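(* Let $\pi: N \to B$ be a smooth real vector bundle of finite rank over a smooth manifold $B$, and let $P$ be a fiberwise algebraic plane field on (the total space) $N$. Then there is an open dense set $U \subset B$ over which $\mathcal{D} = \mathcal{D}^\infty$, that is, $\mathcal{D} \cap \pi^{-1}(U) = \mathcal{D}^\infty \cap \pi^{-1}(U)$. More precisely, $U$ can be chosen so that the involutive distribution $\mathcal{G}$ generated by $P$ is integrable on $\pi^{-1}(U)$.
   Context: Fiberwise algebraic objects. Let $\pi:N\to B$ be a smooth vector bundle with fiber $\mathbb{R}^m$ over a manifold of dimension $n$. Over a coordinate open set $V \subset B$ on which $N$ is trivialized, $\pi^{-1}(V) \cong V \times \mathbb{R}^m$ with $V$ identified with an open subset of $\mathbb{R}^n$ (trivializations being linear in the fibers). A vector field on $N$ is fiberwise algebraic if, in each sufficiently small such local trivialization, it has the form $(x,u)\mapsto (R(x,u),Q(x,u)) \in \mathbb{R}^n\times\mathbb{R}^m$ with all components in the ring $C^\infty(V)[X_1,\dots,X_m]$ (polynomials in the fiber coordinate $u$ with coefficients smooth in $x$). This does not depend on the trivialization. A fiberwise algebraic plane field $P$ of dimension $d$ on $N$ is a smooth plane field (a rank-$d$ subbundle of $TN$) such that each point of $B$ has a neighborhood $V$ for which $P$ is spanned, at each point of $\pi^{-1}(V)$, by fiberwise algebraic vector fields on $\pi^{-1}(V)$ tangent to $P$. Distributions. A $C^\infty$ distribution on a manifold $N$ is a $C^\infty(N)$-submodule $\Delta$ of the Lie algebra of $C^\infty$ vector fields of $N$; its evaluation at $x$ is $\Delta(x)=\{X(x)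 : X\in\Delta\}\subset T_xN$ (whose dimension may depend on $x$). It is involutive if it is a Lie subalgebra. A leaf of $\Delta$ is a submanifold $S$ with $T_xS = \Delta(x)$ for all $x\in S$; $\Delta$ is integrable if every point lies on a leaf. The involutive distribution $\mathcal{G}$ generated by a plane field $P$ is the Lie subalgebra generated by the smooth vector fields everywhere tangent to $P$ (it is a $C^\infty(N)$-submodule); its evaluation is $G(x)=\{X(x): X\in\mathcal{G}\}$. Integrability domains. For a smooth plane field $P$ of dimension $d$, a leaf of $P$ is a $d$-dimensional submanifold everywhere tangent to $P$. The integrability domain $\mathcal{D}$ of $P$ is the set of points of $N$ through which passes a (germ of a) leaf of $P$. The infinitesimal integrability domain is $\mathcal{D}^\infty=\{x\in N : G(x)=P(x)\}$. *)

theory Defs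
  imports "HOL-Analysis.Analysis"
begin

section \<open>Model spaces\<close>

text \<open>
  The model spaces of base and fibre play the role of \<open>\<real>\<^sup>n\<close> and \<open>\<real>\<^sup>m\<close>. The library
  class \<open>euclidean_space\<close> excludes dimension 0, but a base of dimension 0 or a bundle of rank 0
  is allowed here, so we use the class of all finite-dimensional real normed spaces; the
  instance \<open>unit\<close> is the space of dimension 0.
\<close>

class finite_dim_space = real_normed_vector +
  assumes finite_generating_set:
    "\<exists>S :: 'a set. finite S \<and> (\<forall>x. \<exists>r. x = (\<Sum>s\<in>S. r s *\<^sub>R s))"

lemma finite_spanning_set: "\<exists>S :: 'a::finite_dim_space set. finite S \<and> span S = UNIV"
proof -
  obtain S :: "'a set" where S: "finite S" "\<And>x. \<exists>r. x = (\<Sum>s\<in>S. r s *\<^sub>R s)"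
    using finite_generating_set by metis
  have "x \<in> span S" for x
  proof -
    obtain r where "x = (\<Sum>s\<in>S. r s *\<^sub>R s)"
      using S(2) by blast
    then show ?thesis
      by (simp add: span_base span_scale span_sum)
  qed
  then show ?thesis
    using S(1) by blast
qed

lemma finite_dim_spaceI:
  assumes "finite S" and "span S = (UNIV :: 'a::real_vector set)"
  shows "\<exists>S :: 'a set. finite S \<and> (\<forall>x. \<exists>r. x = (\<Sum>s\<in>S. r s *\<^sub>R s))"
  using assms span_finite[OF assms(1)] by (metis (no_types, lifting) UNIV_I imageE)

instance euclidean_space \<subseteq> finite_dim_space
  by standard (rule finite_dim_spaceI[OF finite_Basis span_Basis])

instance prod :: (finite_dim_space, finite_dim_space) finite_dim_space
proof
  obtain S :: "'a set" where S: "finite S" "span S = UNIV"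
    using finite_spanning_set by blast
  obtain T :: "'b set" where T: "finite T" "span T = UNIV"
    using finite_spanning_set by blast
  let ?R = "(\<lambda>x. (x, 0)) ` S \<union> (\<lambda>y. (0, y)) ` T :: ('a \<times> 'b) set"
  have l1: "linear (\<lambda>x::'a. (x, 0::'b))" and l2: "linear (\<lambda>y::'b. (0::'a, y))"
    by (auto intro!: linearI)
  have "(x, y) \<in> span ?R" for x y
  proof -
    have "(x, 0) \<in> span ?R"
      using linear_span_image[OF l1, of S] S span_mono[of "(\<lambda>x. (x, 0)) ` S" ?R] by auto
    moreover have "(0, y) \<in> span ?R"
      using linear_span_image[OF l2, of T] T span_mono[of "(\<lambda>y. (0, y)) ` T" ?R] by auto
    ultimately show ?thesis
      using span_add[of "(x, 0)" ?R "(0, y)"] by simp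
  qed
  then have "span ?R = UNIV"
    by auto
  then show "\<exists>R :: ('a \<times> 'b) set. finite R \<and> (\<forall>x. \<exists>r. x = (\<Sum>s\<in>R. r s *\<^sub>R s))"
    using S T by (intro finite_dim_spaceI[of ?R]) auto
qed

instantiation unit :: finite_dim_space
begin

definition scaleR_unit :: "real \<Rightarrow> unit \<Rightarrow> unit" where "scaleR_unit _ _ = ()"
definition plus_unit :: "unit \<Rightarrow> unit \<Rightarrow> unit" where "plus_unit _ _ = ()"
definition minus_unit :: "unit \<Rightarrow> unit \<Rightarrow> unit" where "minus_unit _ _ = ()"
definition uminus_unit :: "unit \<Rightarrow> unit" where "uminus_unit _ = ()"
definition zero_unit :: unit where "zero_unit = ()"
definition norm_unit :: "unit \<Rightarrow> real" where "norm_unit _ = 0"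
definition dist_unit :: "unit \<Rightarrow> unit \<Rightarrow> real" where "dist_unit _ _ = 0"
definition sgn_unit :: "unit \<Rightarrow> unit" where "sgn_unit _ = ()"
definition uniformity_unit :: "(unit \<times> unit) filter" where
  "uniformity_unit = (INF e\<in>{0 <..}. principal {(x, y). dist x y < e})"
definition open_unit :: "unit set \<Rightarrow> bool" where
  "open_unit U = (\<forall>x\<in>U. eventually (\<lambda>(x', y). x' = x \<longrightarrow> y \<in> U) uniformity)"

instance
  by standard
    (auto simp: norm_unit_def dist_unit_def uniformity_unit_def open_unit_def
      intro!: exI[of _ "{} :: unit set"])

end

section \<open>Smooth maps and smooth manifolds\<close>

text \<open>Intended for open \<open>U\<close>.\<close>

primrec Ck_on :: "nat \<Rightarrow> 'v::real_normed_vector set \<Rightarrow> ('v \<Rightarrow> 'w::real_normed_vector) \<Rightarrow> bool" where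
  "Ck_on 0 U f \<longleftrightarrow> continuous_on U f"
| "Ck_on (Suc k) U f \<longleftrightarrow>
     f differentiable_on U \<and> (\<forall>h. Ck_on k U (\<lambda>x. frechet_derivative f (at x) h))"

definition smooth_on :: "'v::real_normed_vector set \<Rightarrow> ('v \<Rightarrow> 'w::real_normed_vector) \<Rightarrow> bool" where
  "smooth_on U f \<longleftrightarrow> (\<forall>k. Ck_on k U f)"

text \<open>A chart is a pair of its domain and its coordinate map; the values of the coordinate map
  outside the domain are irrelevant.\<close>

type_synonym ('x, 'v) chart = "'x set \<times> ('x \<Rightarrow> 'v)"

definition chart_inv :: "('x, 'v) chart \<Rightarrow> 'v \<Rightarrow> 'x" where
  "chart_inv c = inv_into (fst c) (snd c)"

definition is_chart :: "('x::topological_space, 'v::topological_space) chart \<Rightarrow> bool" where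
  "is_chart c \<longleftrightarrow> open (fst c) \<and> open (snd c ` fst c) \<and>
     homeomorphism (fst c) (snd c ` fst c) (snd c) (chart_inv c)"

definition compatible_charts ::
    "('x, 'v::real_normed_vector) chart \<Rightarrow> ('x, 'v) chart \<Rightarrow> bool" where
  "compatible_charts c d \<longleftrightarrow>
     smooth_on (snd c ` (fst c \<inter> fst d)) (snd d \<circ> chart_inv c) \<and>
     smooth_on (snd d ` (fst c \<inter> fst d)) (snd c \<circ> chart_inv d)"

text \<open>The set \<open>A\<close> is a maximal smooth atlas.\<close>

definition smooth_structure ::
    "('x::{second_countable_topology, t2_space}, 'v::finite_dim_space) chart set \<Rightarrow> bool" where
  "smooth_structure A \<longleftrightarrow>
     (\<forall>c\<in>A. is_chart c) \<and> (\<Union>c\<in>A. fst c) = UNIV \<and>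
     (\<forall>c\<in>A. \<forall>d\<in>A. compatible_charts c d) \<and>
     (\<forall>c. is_chart c \<and> (\<forall>d\<in>A. compatible_charts c d) \<longrightarrow> c \<in> A)"

section \<open>Tangent vectors and vector fields\<close>

text \<open>A tangent vector at \<open>p\<close> is the family of its coordinate vectors in all charts around \<open>p\<close>,
  related by the derivatives of the transition maps. The value at all other arguments is fixed
  to be 0.\<close>

type_synonym ('x, 'v) tvec = "('x, 'v) chart \<Rightarrow> 'v"

definition tangent_space ::
    "('x, 'v::real_normed_vector) chart set \<Rightarrow> 'x \<Rightarrow> ('x, 'v) tvec set" where
  "tangent_space A p = {v.
     (\<forall>c. \<not> (c \<in> A \<and> p \<in> fst c) \<longrightarrow> v c = 0) \<and>
     (\<forall>c\<in>A. \<forall>d\<in>A. p \<in> fst c \<inter> fst d \<longrightarrow>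
        v d = frechet_derivative (snd d \<circ> chart_inv c) (at (snd c p)) (v c))}"

definition lin_comb ::
    "nat \<Rightarrow> (nat \<Rightarrow> ('x, 'v::real_vector) tvec) \<Rightarrow> (nat \<Rightarrow> real) \<Rightarrow> ('x, 'v) tvec" where
  "lin_comb k v a = (\<lambda>c. \<Sum>i<k. a i *\<^sub>R v i c)"

definition tspan :: "('x, 'v::real_vector) tvec set \<Rightarrow> ('x, 'v) tvec set" where
  "tspan S = {lin_comb k v a | k v a. \<forall>i<k. v i \<in> S}"

definition tindependent :: "nat \<Rightarrow> (nat \<Rightarrow> ('x, 'v::real_vector) tvec) \<Rightarrow> bool" where
  "tindependent k v \<longleftrightarrow> (\<forall>a. lin_comb k v a = (\<lambda>_. 0) \<longrightarrow> (\<forall>i<k. a i = 0))"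

type_synonym ('x, 'v) vfield = "'x \<Rightarrow> ('x, 'v) tvec"

definition in_chart :: "('x, 'v) vfield \<Rightarrow> ('x, 'v) chart \<Rightarrow> 'v \<Rightarrow> 'v" where
  "in_chart X c = (\<lambda>y. X (chart_inv c y) c)"

text \<open>Smooth vector fields on an open set \<open>W\<close>; their values outside \<open>W\<close> are irrelevant.\<close>

definition smooth_vfield_on ::
    "('x, 'v::real_normed_vector) chart set \<Rightarrow> 'x set \<Rightarrow> ('x, 'v) vfield \<Rightarrow> bool" where
  "smooth_vfield_on A W X \<longleftrightarrow>
     (\<forall>p\<in>W. X p \<in> tangent_space A p) \<and>
     (\<forall>c\<in>A. smooth_on (snd c ` (fst c \<inter> W)) (in_chart X c))"

definition lie_bracket ::
    "('x, 'v::real_normed_vector) chart set \<Rightarrow>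
     ('x, 'v) vfield \<Rightarrow> ('x, 'v) vfield \<Rightarrow> ('x, 'v) vfield" where
  "lie_bracket A X Y = (\<lambda>p c.
     if c \<in> A \<and> p \<in> fst c
     then frechet_derivative (in_chart Y c) (at (snd c p)) (X p c)
        - frechet_derivative (in_chart X c) (at (snd c p)) (Y p c)
     else 0)"

definition lie_subalgebra ::
    "('x, 'v::real_normed_vector) chart set \<Rightarrow> ('x, 'v) vfield set \<Rightarrow> bool" where
  "lie_subalgebra A L \<longleftrightarrow>
     (\<forall>X\<in>L. smooth_vfield_on A UNIV X) \<and>
     (\<lambda>p c. 0) \<in> L \<and>
     (\<forall>X\<in>L. \<forall>Y\<in>L. (\<lambda>p c. X p c + Y p c) \<in> L) \<and>
     (\<forall>r. \<forall>X\<in>L. (\<lambda>p c. r *\<^sub>R X p c) \<in> L) \<and>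
     (\<forall>X\<in>L. \<forall>Y\<in>L. lie_bracket A X Y \<in> L)"

definition evaluation :: "('x, 'v) vfield set \<Rightarrow> 'x \<Rightarrow> ('x, 'v) tvec set" where
  "evaluation L p = {X p | X. X \<in> L}"

section \<open>Submanifolds, distributions, plane fields\<close>

text \<open>A slice chart for \<open>S\<close> around \<open>p\<close>: in this chart, \<open>S\<close> is the linear subspace \<open>L\<close>.\<close>

definition slice_chart ::
    "('x, 'v::real_vector) chart set \<Rightarrow> 'x set \<Rightarrow> 'x \<Rightarrow> ('x, 'v) chart \<Rightarrow> 'v set \<Rightarrow> bool" where
  "slice_chart A S p c L \<longleftrightarrow> c \<in> A \<and> p \<in> fst c \<and> subspace L \<and>
     snd c ` (S \<inter> fst c) = snd c ` fst c \<inter> L"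

definition submanifold ::
    "('x, 'v::real_vector) chart set \<Rightarrow> nat \<Rightarrow> 'x set \<Rightarrow> bool" where
  "submanifold A k S \<longleftrightarrow> (\<forall>p\<in>S. \<exists>c L. slice_chart A S p c L \<and> dim L = k)"

definition submanifold_tangent_space ::
    "('x, 'v::real_normed_vector) chart set \<Rightarrow> 'x set \<Rightarrow> 'x \<Rightarrow> ('x, 'v) tvec set" where
  "submanifold_tangent_space A S p =
     {v \<in> tangent_space A p. \<exists>c L. slice_chart A S p c L \<and> v c \<in> L}"

definition distribution_leaf ::
    "('x, 'v::real_normed_vector) chart set \<Rightarrow> ('x, 'v) vfield set \<Rightarrow> 'x set \<Rightarrow> bool" where
  "distribution_leaf A \<Delta> S \<longleftrightarrow>
     (\<exists>k. submanifold A k S) \<and>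
     (\<forall>p\<in>S. submanifold_tangent_space A S p = evaluation \<Delta> p)"

text \<open>Integrability of the restriction of \<open>\<Delta>\<close> to an open set \<open>W\<close>.\<close>

definition integrable_distribution_on ::
    "('x, 'v::real_normed_vector) chart set \<Rightarrow> 'x set \<Rightarrow> ('x, 'v) vfield set \<Rightarrow> bool" where
  "integrable_distribution_on A W \<Delta> \<longleftrightarrow>
     (\<forall>p\<in>W. \<exists>S. S \<subseteq> W \<and> p \<in> S \<and> distribution_leaf A \<Delta> S)"

text \<open>A smooth plane field of dimension \<open>d\<close>, i.e. a rank-\<open>d\<close> subbundle of the tangent bundle,
  is described by local smooth frames.\<close>

definition plane_field ::
    "('x::topological_space, 'v::real_normed_vector) chart set \<Rightarrow> nat \<Rightarrow>
     ('x \<Rightarrow> ('x, 'v) tvec set) \<Rightarrow> bool" where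
  "plane_field A d P \<longleftrightarrow>
     (\<forall>p. \<exists>W X. open W \<and> p \<in> W \<and>
        (\<forall>i<d. smooth_vfield_on A W (X i)) \<and>
        (\<forall>q\<in>W. tindependent d (\<lambda>i. X i q) \<and> P q = tspan ((\<lambda>i. X i q) ` {..<d})))"

definition tangent_vfields ::
    "('x, 'v::real_normed_vector) chart set \<Rightarrow> ('x \<Rightarrow> ('x, 'v) tvec set) \<Rightarrow>
     ('x, 'v) vfield set" where
  "tangent_vfields A P = {X. smooth_vfield_on A UNIV X \<and> (\<forall>p. X p \<in> P p)}"

definition generated_distribution ::
    "('x, 'v::real_normed_vector) chart set \<Rightarrow> ('x \<Rightarrow> ('x, 'v) tvec set) \<Rightarrow>
     ('x, 'v) vfield set" where
  "generated_distribution A P = \<Inter> {L. lie_subalgebra A L \<and> tangent_vfields A P \<subseteq> L}"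

definition plane_leaf ::
    "('x, 'v::real_normed_vector) chart set \<Rightarrow> nat \<Rightarrow> ('x \<Rightarrow> ('x, 'v) tvec set) \<Rightarrow>
     'x set \<Rightarrow> bool" where
  "plane_leaf A d P S \<longleftrightarrow>
     submanifold A d S \<and> (\<forall>p\<in>S. submanifold_tangent_space A S p \<subseteq> P p)"

definition integrability_domain ::
    "('x, 'v::real_normed_vector) chart set \<Rightarrow> nat \<Rightarrow> ('x \<Rightarrow> ('x, 'v) tvec set) \<Rightarrow> 'x set" where
  "integrability_domain A d P = {p. \<exists>S. plane_leaf A d P S \<and> p \<in> S}"

definition infinitesimal_integrability_domain ::
    "('x, 'v::real_normed_vector) chart set \<Rightarrow> ('x \<Rightarrow> ('x, 'v) tvec set) \<Rightarrow> 'x set" where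
  "infinitesimal_integrability_domain A P =
     {p. evaluation (generated_distribution A P) p = P p}"

section \<open>Vector bundles\<close>

text \<open>
  \<open>padd\<close> and \<open>pscale\<close> are the vector space operations of the fibres. In a local trivialization,
  \<open>(V, \<phi>)\<close> is a chart of the base and \<open>\<tau>\<close> is the fibre coordinate; since
  \<open>(\<phi> \<circ> \<pi>, \<tau>)\<close> is a chart of the total space onto \<open>\<phi> V \<times> UNIV\<close>, the map \<open>(\<pi>, \<tau>)\<close> is a
  diffeomorphism onto the product of \<open>V\<close> and the model fibre, and \<open>\<tau>\<close> is bijective on each
  fibre over \<open>V\<close>. Linearity of \<open>\<tau>\<close> on the fibres thus includes the vector space axioms for
  the fibres (as well as surjectivity and smoothness of \<open>\<pi>\<close>).
\<close>

definition bundle_chart :: "('b \<Rightarrow> 'a) \<Rightarrow> ('e \<Rightarrow> 'b) \<Rightarrow> ('e \<Rightarrow> 'f) \<Rightarrow> 'e \<Rightarrow> 'a \<times> 'f" where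
  "bundle_chart \<phi> \<pi> \<tau> = (\<lambda>p. (\<phi> (\<pi> p), \<tau> p))"

definition local_trivialization ::
    "('b, 'a) chart set \<Rightarrow> ('e, 'a \<times> 'f::real_vector) chart set \<Rightarrow> ('e \<Rightarrow> 'b) \<Rightarrow>
     ('e \<Rightarrow> 'e \<Rightarrow> 'e) \<Rightarrow> (real \<Rightarrow> 'e \<Rightarrow> 'e) \<Rightarrow> 'b set \<Rightarrow> ('b \<Rightarrow> 'a) \<Rightarrow> ('e \<Rightarrow> 'f) \<Rightarrow> bool" where
  "local_trivialization AB AN \<pi> padd pscale V \<phi> \<tau> \<longleftrightarrow>
     (V, \<phi>) \<in> AB \<and>
     (\<pi> -` V, bundle_chart \<phi> \<pi> \<tau>) \<in> AN \<and>
     bundle_chart \<phi> \<pi> \<tau> ` (\<pi> -` V) = \<phi> ` V \<times> UNIV \<and>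
     (\<forall>p q. \<pi> p \<in> V \<and> \<pi> q = \<pi> p \<longrightarrow> \<tau> (padd p q) = \<tau> p + \<tau> q) \<and>
     (\<forall>r p. \<pi> p \<in> V \<longrightarrow> \<tau> (pscale r p) = r *\<^sub>R \<tau> p)"

definition smooth_vector_bundle ::
    "('b::{second_countable_topology, t2_space}, 'a::finite_dim_space) chart set \<Rightarrow>
     ('e::{second_countable_topology, t2_space}, 'a \<times> 'f::finite_dim_space) chart set \<Rightarrow>
     ('e \<Rightarrow> 'b) \<Rightarrow> ('e \<Rightarrow> 'e \<Rightarrow> 'e) \<Rightarrow> (real \<Rightarrow> 'e \<Rightarrow> 'e) \<Rightarrow> bool" where
  "smooth_vector_bundle AB AN \<pi> padd pscale \<longleftrightarrow>
     smooth_structure AB \<and> smooth_structure AN \<and>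
     (\<forall>p q. \<pi> q = \<pi> p \<longrightarrow> \<pi> (padd p q) = \<pi> p) \<and>
     (\<forall>r p. \<pi> (pscale r p) = \<pi> p) \<and>
     (\<forall>b. \<exists>V \<phi> \<tau>. b \<in> V \<and> local_trivialization AB AN \<pi> padd pscale V \<phi> \<tau>)"

section \<open>Fiberwise algebraic objects\<close>

text \<open>Elements of \<open>C\<^sup>\<infinity>(V)[X\<^sub>1, \<dots>, X\<^sub>m]\<close>, as functions of \<open>(x, u)\<close>: \<open>X\<^sub>1, \<dots>, X\<^sub>m\<close> are the
  coordinates of \<open>u\<close> with respect to a basis \<open>E\<close> of the model fibre, and a monomial is given
  by its exponents \<open>\<alpha> :: 'f \<Rightarrow> nat\<close>, of which only the values on \<open>E\<close> matter.\<close>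

definition fiber_polynomial ::
    "'a::real_normed_vector set \<Rightarrow> ('a \<times> 'f::real_vector \<Rightarrow> real) \<Rightarrow> bool" where
  "fiber_polynomial V g \<longleftrightarrow>
     (\<exists>E M C. finite E \<and> independent E \<and> span E = UNIV \<and> finite M \<and>
        (\<forall>\<alpha>\<in>M. smooth_on V (C \<alpha>)) \<and>
        (\<forall>x\<in>V. \<forall>u. g (x, u) =
           (\<Sum>\<alpha>\<in>M. C \<alpha> x * (\<Prod>e\<in>E. representation E u e ^ \<alpha> e))))"

text \<open>The components of a local expression are its compositions with linear functionals.\<close>

definition fiberwise_algebraic_vfield_on ::
    "('b::topological_space, 'a::real_normed_vector) chart set \<Rightarrow>
     ('e, 'a \<times> 'f::real_normed_vector) chart set \<Rightarrow>
     ('e \<Rightarrow> 'b) \<Rightarrow> ('e \<Rightarrow> 'e \<Rightarrow> 'e) \<Rightarrow> (real \<Rightarrow> 'e \<Rightarrow> 'e) \<Rightarrow> 'b set \<Rightarrow>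
     ('e, 'a \<times> 'f) vfield \<Rightarrow> bool" where
  "fiberwise_algebraic_vfield_on AB AN \<pi> padd pscale V X \<longleftrightarrow>
     smooth_vfield_on AN (\<pi> -` V) X \<and>
     (\<forall>b\<in>V. \<exists>V0. open V0 \<and> b \<in> V0 \<and> V0 \<subseteq> V \<and>
        (\<forall>V' \<phi> \<tau>. local_trivialization AB AN \<pi> padd pscale V' \<phi> \<tau> \<and> V' \<subseteq> V0 \<longrightarrow>
           (\<forall>l. linear l \<longrightarrow>
              fiber_polynomial (\<phi> ` V')
                (\<lambda>z. l (in_chart X (\<pi> -` V', bundle_chart \<phi> \<pi> \<tau>) z)))))"

definition fiberwise_algebraic_plane_field ::
    "('b::topological_space, 'a::real_normed_vector) chart set \<Rightarrow>
     ('e::topological_space, 'a \<times> 'f::real_normed_vector) chart set \<Rightarrow>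
     ('e \<Rightarrow> 'b) \<Rightarrow> ('e \<Rightarrow> 'e \<Rightarrow> 'e) \<Rightarrow> (real \<Rightarrow> 'e \<Rightarrow> 'e) \<Rightarrow> nat \<Rightarrow>
     ('e \<Rightarrow> ('e, 'a \<times> 'f) tvec set) \<Rightarrow> bool" where
  "fiberwise_algebraic_plane_field AB AN \<pi> padd pscale d P \<longleftrightarrow>
     plane_field AN d P \<and>
     (\<forall>b. \<exists>V. open V \<and> b \<in> V \<and>
        (\<forall>p\<in>\<pi> -` V. P p = tspan {X p | X.
           fiberwise_algebraic_vfield_on AB AN \<pi> padd pscale V X \<and> (\<forall>q\<in>\<pi> -` V. X q \<in> P q)}))"

end

theory Submission
  imports Defs
begin

text \<open>
  Over a coordinate open set of the base, the fields tangent to \<open>P\<close> that are polynomial in the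
  fibre coordinate generate, by addition, multiplication with polynomials and brackets, a presheaf
  of modules over the rings \<open>C\<^sup>\<infinity>(W)[X\<^sub>1, \<dots>, X\<^sub>m]\<close>. These rings are not Noetherian, but division with
  respect to a monomial order works over open sets where the relevant leading coefficients do not
  vanish; by Dickson's lemma there is a nonempty open \<open>W\<close> on which the whole presheaf has a finite
  system of generators. Hence over \<open>W\<close> the distribution \<open>\<G>\<close> has locally finitely many generators
  whose brackets are combinations of the generators with smooth coefficients, and Frobenius'
  theorem holds for such a family even though its rank may drop. A leaf of \<open>\<G>\<close> through a point of
  \<open>\<D>\<^sup>\<infinity>\<close> has dimension \<open>d\<close> and is a leaf of \<open>P\<close>; conversely, the fields tangent to a leaf of \<open>P\<close> are
  closed under brackets, so \<open>\<D> \<subseteq> \<D>\<^sup>\<infinity>\<close> everywhere.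
\<close>

section \<open>Finite-dimensional linear algebra and the calculus of smooth maps\<close>

subsection \<open>Finite-dimensional normed spaces\<close>

text \<open>Two obstacles shape the proof. Over smooth functions a leading coefficient may vanish on
  an arbitrary closed set, and no division is possible across its zeros; generators are therefore
  sought only over some nonempty open part of each given open set, which yields an open dense set
  and nothing better. Shrinking the base does not shrink the fibres, so the rank of the generated
  distribution can still jump inside a single fibre; finite generation together with involutivity
  has to replace the constant rank of the classical Frobenius theorem.

  The second obstacle is the gap between polynomial and smooth fields:
  \<open>generated_distribution\<close> is built from all smooth fields on the total space that are
  tangent to the plane field. Products of polynomial brackets with smooth coefficients are germs of
  its members (\<open>extendable\<close>), by means of bump functions. Conversely, a smooth field
  tangent to the plane field locally has smooth coefficients in a frame of polynomial fields
  (\<open>dual_frame\<close>), and the global fields that lie locally in the module form a Lie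
  algebra, which must therefore contain the whole distribution.\<close>

lemma finite_dim_basis_exists:
  "\<exists>B :: 'a::finite_dim_space set. finite B \<and> independent B \<and> span B = UNIV"
proof -
  obtain S :: "'a set" where S: "finite S" "span S = UNIV"
    using finite_spanning_set by blast
  obtain B where B: "B \<subseteq> S" "independent B" "S \<subseteq> span B"
    using maximal_independent_subset[of S] by blast
  then show ?thesis
    using S span_mono[OF B(3)] finite_subset by (metis span_span top.extremum_uniqueI)
qed

definition fd_basis :: "'a::finite_dim_space set" where
  "fd_basis = (SOME B. finite B \<and> independent B \<and> span B = UNIV)"

lemma fd_basis: "finite (fd_basis :: 'a::finite_dim_space set)"
  "independent (fd_basis :: 'a::finite_dim_space set)"
  "span (fd_basis :: 'a::finite_dim_space set) = UNIV"
  using someI_ex[OF finite_dim_basis_exists[where 'a='a]] unfolding fd_basis_def by auto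

text \<open>Dimension theory for the class comes from the locale of finite-dimensional vector
  spaces; the rewrites identify the notions of the locale with \<open>span\<close>,
  \<open>dim\<close> and \<open>subspace\<close> of real vector spaces, so that facts from both
  sides combine.\<close>

interpretation fd: finite_dimensional_vector_space
  "scaleR :: real \<Rightarrow> 'a \<Rightarrow> 'a::finite_dim_space" fd_basis
  rewrites "module.dependent (*\<^sub>R) = dependent"
    and "module.representation (*\<^sub>R) = representation"
    and "module.subspace (*\<^sub>R) = subspace"
    and "module.span (*\<^sub>R) = span"
    and "vector_space.extend_basis (*\<^sub>R) = extend_basis"
    and "vector_space.dim (*\<^sub>R) = dim"
    and "Vector_Spaces.linear (*\<^sub>R) (*\<^sub>R) = linear"
    and "Vector_Spaces.linear (*) (*\<^sub>R) = linear"
proof -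
  show "finite_dimensional_vector_space ((*\<^sub>R) :: real \<Rightarrow> 'a \<Rightarrow> 'a) fd_basis"
    using fd_basis[where 'a='a]
    by unfold_locales (auto simp: dependent_raw_def span_raw_def)
qed (auto simp: dependent_raw_def representation_raw_def
      subspace_raw_def span_raw_def extend_basis_raw_def dim_raw_def linear_def
      real_scaleR_def[abs_def])

text \<open>Coordinates in the fixed basis \<open>fd_basis\<close> take the place of an inner
  product. For \<open>b\<close> outside the basis the function \<open>coord b\<close> is 0, so
  bounds and smoothness hold for every index.\<close>

definition coord :: "'a::finite_dim_space \<Rightarrow> 'a \<Rightarrow> real" where
  "coord b x = representation fd_basis x b"

lemma coord_linear: "linear (coord b)"
  unfolding coord_def
  by (intro linearI) (auto simp: representation_add representation_scale fd_basis)

lemma coord_sum: "(\<Sum>b\<in>fd_basis. coord b x *\<^sub>R b) = x"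
  unfolding coord_def by (rule sum_representation_eq) (auto simp: fd_basis)

lemma coord_basis: "b \<in> fd_basis \<Longrightarrow> coord c b = (if c = b then 1 else 0)"
  unfolding coord_def by (simp add: representation_basis fd_basis)

lemma linear_coord_expand:
  fixes f :: "'a::finite_dim_space \<Rightarrow> 'b::real_vector"
  assumes "linear f"
  shows "f x = (\<Sum>b\<in>fd_basis. coord b x *\<^sub>R f b)"
proof -
  have "f x = f (\<Sum>b\<in>fd_basis. coord b x *\<^sub>R b)"
    by (simp add: coord_sum)
  also have "\<dots> = (\<Sum>b\<in>fd_basis. coord b x *\<^sub>R f b)"
    by (simp add: linear_sum[OF assms] linear_scale[OF assms])
  finally show ?thesis .
qed

text \<open>Induction on the basis. The new vector \<open>b\<close> has positive distance from the
  span of \<open>S\<close>: combinations of \<open>S\<close> approaching \<open>-b\<close> would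
  form a Cauchy sequence, the induction hypothesis makes their coefficients Cauchy, and the limit
  would put \<open>b\<close> into the span. Completeness is used only for real numbers.\<close>

lemma independent_coefficient_bound:
  fixes S :: "'a::real_normed_vector set"
  assumes "finite S" "independent S"
  shows "\<exists>C>0. \<forall>u. \<forall>s\<in>S. \<bar>u s\<bar> \<le> C * norm (\<Sum>s\<in>S. u s *\<^sub>R s)"
  using assms
proof (induction S rule: finite_induct)
  case empty
  then show ?case by (auto intro: exI[of _ 1])
next
  case (insert b S)
  have ind: "independent S" "b \<notin> span S"
    using insert.prems insert.hyps(2) independent_insert[of b S] by auto
  obtain C where C: "C > 0" "\<And>u s. s \<in> S \<Longrightarrow> \<bar>u s\<bar> \<le> C * norm (\<Sum>s\<in>S. u s *\<^sub>R s)"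
    using insert.IH[OF ind(1)] by blast
  have "\<exists>\<delta>>0. \<forall>u. \<delta> \<le> norm (b + (\<Sum>s\<in>S. u s *\<^sub>R s))"
  proof (rule ccontr)
    assume "\<not> ?thesis"
    then have "\<forall>n. \<exists>u. norm (b + (\<Sum>s\<in>S. u s *\<^sub>R s)) < 1 / real (Suc n)"
      by (metis not_le of_nat_0_less_iff zero_less_Suc zero_less_divide_1_iff)
    then obtain u where u: "\<And>n. norm (b + (\<Sum>s\<in>S. u n s *\<^sub>R s)) < 1 / real (Suc n)"
      by metis
    have lim0: "(\<lambda>n. 1 / real (Suc n)) \<longlonglongrightarrow> 0"
      using LIMSEQ_inverse_real_of_nat by (simp add: inverse_eq_divide)
    have lim: "(\<lambda>n. b + (\<Sum>s\<in>S. u n s *\<^sub>R s)) \<longlonglongrightarrow> 0"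
      by (rule Lim_null_comparison[OF _ lim0]) (auto intro!: always_eventually less_imp_le u simp del: of_nat_Suc)
    then have "(\<lambda>n. (b + (\<Sum>s\<in>S. u n s *\<^sub>R s)) - b) \<longlonglongrightarrow> 0 - b"
      by (intro tendsto_intros)
    then have cauchy: "Cauchy (\<lambda>n. \<Sum>s\<in>S. u n s *\<^sub>R s)"
      by (simp add: LIMSEQ_imp_Cauchy)
    have "convergent (\<lambda>n. u n s)" if s: "s \<in> S" for s
    proof -
      have "Cauchy (\<lambda>n. u n s)"
      proof (rule CauchyI)
        fix e :: real assume "0 < e"
        then obtain M where M: "\<And>m n. m \<ge> M \<Longrightarrow> n \<ge> M \<Longrightarrow>
            norm ((\<Sum>s\<in>S. u m s *\<^sub>R s) - (\<Sum>s\<in>S. u n s *\<^sub>R s)) < e / C"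
          using CauchyD[OF cauchy, of "e / C"] C(1) by auto
        show "\<exists>M. \<forall>m\<ge>M. \<forall>n\<ge>M. norm (u m s - u n s) < e"
        proof (intro exI allI impI)
          fix m n assume mn: "M \<le> m" "M \<le> n"
          have "\<bar>u m s - u n s\<bar> \<le> C * norm (\<Sum>s\<in>S. (u m s - u n s) *\<^sub>R s)"
            using C(2)[OF s, of "\<lambda>s. u m s - u n s"] .
          also have "\<dots> = C * norm ((\<Sum>s\<in>S. u m s *\<^sub>R s) - (\<Sum>s\<in>S. u n s *\<^sub>R s))"
            by (simp add: scaleR_diff_left sum_subtractf)
          also have "\<dots> < e"
            using M[OF mn] C(1) by (simp add: field_simps)
          finally show "norm (u m s - u n s) < e" by simp
        qed
      qed
      then show ?thesis by (simp add: Cauchy_convergent)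
    qed
    then obtain v where v: "\<And>s. s \<in> S \<Longrightarrow> (\<lambda>n. u n s) \<longlonglongrightarrow> v s"
      unfolding convergent_def by metis
    have "(\<lambda>n. b + (\<Sum>s\<in>S. u n s *\<^sub>R s)) \<longlonglongrightarrow> b + (\<Sum>s\<in>S. v s *\<^sub>R s)"
      by (intro tendsto_intros v)
    then have "b + (\<Sum>s\<in>S. v s *\<^sub>R s) = 0"
      using lim LIMSEQ_unique by blast
    then have "b = - (\<Sum>s\<in>S. v s *\<^sub>R s)"
      by (simp add: eq_neg_iff_add_eq_0)
    then have "b \<in> span S"
      by (simp add: span_neg span_sum span_scale span_base)
    then show False using ind(2) by simp
  qed
  then obtain \<delta> where \<delta>: "\<delta> > 0" "\<And>u. \<delta> \<le> norm (b + (\<Sum>s\<in>S. u s *\<^sub>R s))"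
    by blast
  have b_bound: "\<bar>u b\<bar> * \<delta> \<le> norm (u b *\<^sub>R b + (\<Sum>s\<in>S. u s *\<^sub>R s))" for u
  proof (cases "u b = 0")
    case False
    have "\<bar>u b\<bar> * \<delta> \<le> \<bar>u b\<bar> * norm (b + (\<Sum>s\<in>S. (u s / u b) *\<^sub>R s))"
      using \<delta>(2)[of "\<lambda>s. u s / u b"] by (simp add: mult_left_mono)
    also have "\<dots> = norm (u b *\<^sub>R (b + (\<Sum>s\<in>S. (u s / u b) *\<^sub>R s)))"
      by simp
    also have "u b *\<^sub>R (b + (\<Sum>s\<in>S. (u s / u b) *\<^sub>R s)) = u b *\<^sub>R b + (\<Sum>s\<in>S. u s *\<^sub>R s)"
      using False by (simp add: scaleR_add_right scaleR_sum_right)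
    finally show ?thesis .
  qed auto
  \<comment> \<open>The coefficient at \<open>b\<close> is at most \<open>1 / \<delta>\<close> times
    the norm; removing the term with \<open>b\<close> costs the factor
    \<open>1 + norm b / \<delta>\<close> for the other coefficients. The sum serves both
    cases.\<close>
  define D where "D = C * (1 + norm b / \<delta>) + 1 / \<delta>"
  have bt: "\<bar>u t\<bar> \<le> D * norm (\<Sum>s\<in>insert b S. u s *\<^sub>R s)" if t: "t \<in> insert b S" for u t
  proof -
    let ?N = "norm (u b *\<^sub>R b + (\<Sum>s\<in>S. u s *\<^sub>R s))"
    have N: "norm (\<Sum>s\<in>insert b S. u s *\<^sub>R s) = ?N"
      using insert.hyps by simp
    have 1: "\<bar>u b\<bar> \<le> 1 / \<delta> * ?N"
      using b_bound[of u] \<delta>(1) by (simp add: field_simps)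
    have 2: "\<bar>u s\<bar> \<le> C * (1 + norm b / \<delta>) * ?N" if "s \<in> S" for s
    proof -
      have "norm (\<Sum>s\<in>S. u s *\<^sub>R s) \<le> ?N + \<bar>u b\<bar> * norm b"
        using norm_triangle_ineq4[of "u b *\<^sub>R b + (\<Sum>s\<in>S. u s *\<^sub>R s)" "u b *\<^sub>R b"] by simp
      also have "\<dots> \<le> ?N + 1 / \<delta> * ?N * norm b"
        using mult_right_mono[OF 1, of "norm b"] by simp
      also have "\<dots> = (1 + norm b / \<delta>) * ?N"
        by (simp add: algebra_simps)
      finally have "C * norm (\<Sum>s\<in>S. u s *\<^sub>R s) \<le> C * ((1 + norm b / \<delta>) * ?N)"
        using C(1) by simp
      then show ?thesis using C(2)[OF that, of u] by simp
    qed
    show ?thesis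
    proof (cases "t = b")
      case True
      have "1 / \<delta> * ?N \<le> D * ?N"
        unfolding D_def using C(1) \<delta>(1) by (intro mult_right_mono) auto
      then show ?thesis using 1 True N by simp
    next
      case False
      have "C * (1 + norm b / \<delta>) * ?N \<le> D * ?N"
        unfolding D_def using C(1) \<delta>(1) by (intro mult_right_mono) auto
      then show ?thesis using 2[of t] False t N by fastforce
    qed
  qed
  have "D > 0"
    unfolding D_def using C(1) \<delta>(1) by (simp add: add_nonneg_pos)
  then show ?case using bt by blast
qed

lemma coord_bounded_linear: "bounded_linear (coord b :: 'a::finite_dim_space \<Rightarrow> real)"
proof (cases "b \<in> fd_basis")
  case True
  obtain C where C: "C > 0" "\<And>u s. s \<in> (fd_basis :: 'a set) \<Longrightarrow>
      \<bar>u s\<bar> \<le> C * norm (\<Sum>s\<in>fd_basis. u s *\<^sub>R s)"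
    using independent_coefficient_bound[OF fd_basis(1,2)[where 'a='a]] by blast
  have "norm (coord b x) \<le> norm x * C" for x
    using C(2)[OF True, of "\<lambda>s. coord s x"] by (simp add: coord_sum mult.commute)
  then show ?thesis
    using coord_linear[of b] by (auto simp: bounded_linear_def bounded_linear_axioms_def)
next
  case False
  then have "coord b = (\<lambda>x::'a. 0)"
    using representation_ne_zero[of fd_basis _ b] unfolding coord_def by blast
  then show ?thesis by simp
qed

lemma linear_bounded_linear:
  fixes f :: "'a::finite_dim_space \<Rightarrow> 'b::real_normed_vector"
  assumes "linear f"
  shows "bounded_linear f"
proof -
  have "bounded_linear (\<lambda>x. \<Sum>b\<in>fd_basis. coord b x *\<^sub>R f b)"
    by (intro bounded_linear_sum bounded_linear_scaleR_const coord_bounded_linear)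
  then show ?thesis
    using linear_coord_expand[OF assms] by (metis (no_types, lifting) ext)
qed

text \<open>A bounded sequence has bounded coordinates, and a common subsequence along which the
  finitely many coordinates converge gives a limit. This supplies compact balls and, next,
  completeness.\<close>

instance finite_dim_space \<subseteq> heine_borel
proof
  fix f :: "nat \<Rightarrow> 'a"
  assume f: "bounded (range f)"
  have "\<forall>d\<subseteq>fd_basis. \<exists>(l::'a) r. strict_mono r \<and>
      (\<forall>e>0. eventually (\<lambda>n. \<forall>i\<in>d. dist (coord i (f (r n))) (coord i l) < e) sequentially)"
  proof (rule compact_lemma_general[where unproj="\<lambda>g. \<Sum>b\<in>fd_basis. g b *\<^sub>R b"])
    show "finite (fd_basis :: 'a set)" by (rule fd_basis)
    show "bounded ((\<lambda>x. coord k x) ` range f)" for k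
      by (rule bounded_linear_image[OF f coord_bounded_linear])
    show "coord k (\<Sum>b\<in>fd_basis. g b *\<^sub>R b) = g k" if "k \<in> fd_basis" for g and k :: 'a
      using that
      by (simp add: fd_basis(1) linear_sum[OF coord_linear] linear_scale[OF coord_linear] coord_basis if_distrib[of "\<lambda>c. g _ * c"] cong: if_cong)
    show "(\<Sum>b\<in>fd_basis. coord b x *\<^sub>R b) = x" for x :: 'a
      by (rule coord_sum)
  qed
  then obtain l :: 'a and r where r: "strict_mono r"
    "\<And>e. e > 0 \<Longrightarrow> eventually (\<lambda>n. \<forall>i\<in>fd_basis. dist (coord i (f (r n))) (coord i l) < e) sequentially"
    by blast
  have "(\<lambda>n. coord i (f (r n))) \<longlonglongrightarrow> coord i l" if "i \<in> fd_basis" for i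
  proof (rule tendstoI)
    fix e :: real assume "0 < e"
    from r(2)[OF this] show "eventually (\<lambda>n. dist (coord i (f (r n))) (coord i l) < e) sequentially"
      by (rule eventually_mono) (use that in blast)
  qed
  then have "(\<lambda>n. \<Sum>i\<in>fd_basis. coord i (f (r n)) *\<^sub>R i) \<longlonglongrightarrow> (\<Sum>i\<in>fd_basis. coord i l *\<^sub>R i)"
    by (intro tendsto_intros) auto
  then have "(f \<circ> r) \<longlonglongrightarrow> l"
    by (simp add: coord_sum o_def)
  then show "\<exists>l r. strict_mono r \<and> (f \<circ> r) \<longlonglongrightarrow> l"
    using r(1) by blast
qed

instance finite_dim_space \<subseteq> banach ..

text \<open>A basis of \<open>S\<close> together with \<open>v\<close> is independent, so
  prescribing 1 at \<open>v\<close> and 0 on the basis defines a functional. It lets membership in a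
  subspace be decided by a scalar argument, as in \<open>span_constant\<close> and
  \<open>dd_in_subspace\<close>.\<close>

lemma separating_functional:
  fixes v :: "'a::real_vector"
  assumes "subspace S" "v \<notin> S"
  shows "\<exists>l :: 'a \<Rightarrow> real. linear l \<and> l v = 1 \<and> (\<forall>x\<in>S. l x = 0)"
proof -
  obtain B where B: "B \<subseteq> S" "independent B" "S \<subseteq> span B"
    using maximal_independent_subset[of S] by blast
  have sB: "span B = S"
    using B span_minimal[OF B(1) assms(1)] by auto
  have ind: "independent (insert v B)"
    using B(2) assms(2) sB by (simp add: independent_insertI)
  obtain l :: "'a \<Rightarrow> real" where l: "linear l" "\<And>x. x \<in> insert v B \<Longrightarrow> l x = (if x = v then 1 else 0)"
    using linear_independent_extend[OF ind, of "\<lambda>x. if x = v then 1 else 0"] by blast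
  have "v \<notin> B" using assms(2) B(1) by auto
  then have "l x = 0" if "x \<in> B" for x using l(2)[of x] that by auto
  then have "l x = 0" if "x \<in> span B" for x
    using that linear_eq_0_on_span[OF l(1)] by blast
  then show ?thesis using l sB by auto
qed

subsection \<open>Calculus of smooth maps\<close>

abbreviation dd :: "('v::real_normed_vector \<Rightarrow> 'w::real_normed_vector) \<Rightarrow> 'v \<Rightarrow> 'v \<Rightarrow> 'w" where
  "dd f x \<equiv> frechet_derivative f (at x)"

lemma dd_eqI: "(f has_derivative f') (at x) \<Longrightarrow> dd f x = f'"
  using frechet_derivative_at by metis

lemma differentiable_dd: "f differentiable (at x) \<Longrightarrow> (f has_derivative dd f x) (at x)"
  using frechet_derivative_works by blast

lemma has_derivative_local:
  assumes "open U" "x \<in> U" "\<And>y. y \<in> U \<Longrightarrow> f y = g y" "(f has_derivative f') (at x)"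
  shows "(g has_derivative f') (at x)"
  using has_derivative_transform_within_open[OF assms(4,1,2)] assms(3) by auto

lemma dd_local:
  assumes "open U" "x \<in> U" "\<And>y. y \<in> U \<Longrightarrow> f y = g y"
  shows "dd f x = dd g x"
proof -
  have "(f has_derivative f') (at x) \<longleftrightarrow> (g has_derivative f') (at x)" for f'
    using has_derivative_local[OF assms(1,2), of f g] has_derivative_local[OF assms(1,2), of g f] assms(3)
    by metis
  then show ?thesis unfolding frechet_derivative_def by simp
qed

lemma Ck_on_cong:
  assumes "open U" "\<And>x. x \<in> U \<Longrightarrow> f x = g x" "Ck_on k U f"
  shows "Ck_on k U g"
  using assms
proof (induction k arbitrary: f g)
  case 0
  then show ?case using continuous_on_cong[of U U f g] by auto
next
  case (Suc k)
  have "g differentiable_on U"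
    unfolding differentiable_on_eq_differentiable_at[OF Suc.prems(1)]
  proof
    fix x assume x: "x \<in> U"
    then have "f differentiable (at x)"
      using Suc.prems differentiable_on_eq_differentiable_at[OF Suc.prems(1)] by auto
    then show "g differentiable (at x)"
      unfolding differentiable_def using has_derivative_local[OF Suc.prems(1) x, of f g] Suc.prems(2) by blast
  qed
  moreover have "Ck_on k U (\<lambda>x. dd g x h)" for h
    by (rule Suc.IH[OF Suc.prems(1), of "\<lambda>x. dd f x h"])
      (use Suc.prems dd_local[OF Suc.prems(1), of _ f g] in auto)
  ultimately show ?case by simp
qed

lemma Ck_on_Suc:
  assumes "open U"
  shows "Ck_on (Suc k) U f \<longleftrightarrow>
    (\<forall>x\<in>U. f differentiable (at x)) \<and> (\<forall>h. Ck_on k U (\<lambda>x. dd f x h))"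
  by (simp add: differentiable_on_eq_differentiable_at[OF assms])

text \<open>The derivative may be given by any formula \<open>D\<close>; inductions on the order
  then need not compute with \<open>frechet_derivative\<close> itself.\<close>

lemma Ck_on_SucI:
  assumes "open U" "\<And>x. x \<in> U \<Longrightarrow> (f has_derivative D x) (at x)"
    "\<And>h. Ck_on k U (\<lambda>x. D x h)"
  shows "Ck_on (Suc k) U f"
proof -
  have "Ck_on k U (\<lambda>x. dd f x h)" for h
    by (rule Ck_on_cong[OF assms(1) _ assms(3)]) (use assms(2) dd_eqI in fastforce)
  then show ?thesis
    unfolding Ck_on_Suc[OF assms(1)] using assms(2) by (auto simp: differentiable_def)
qed

lemma Ck_on_derivative:
  assumes "open U" "Ck_on (Suc k) U f" "x \<in> U"
  shows "(f has_derivative dd f x) (at x)"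
  using assms Ck_on_Suc differentiable_dd by blast

lemma Ck_on_dd: "Ck_on (Suc k) U f \<Longrightarrow> Ck_on k U (\<lambda>x. dd f x h)"
  by simp

lemma Ck_on_continuous:
  assumes "Ck_on k U f"
  shows "continuous_on U f"
  using assms by (cases k) (auto intro: differentiable_imp_continuous_on)

lemma Ck_on_Suc_imp: "Ck_on (Suc k) U f \<Longrightarrow> Ck_on k U f"
proof (induction k arbitrary: f)
  case 0
  then show ?case by (auto intro: differentiable_imp_continuous_on)
qed auto

lemma Ck_on_le: "Ck_on k U f \<Longrightarrow> j \<le> k \<Longrightarrow> Ck_on j U f"
proof (induction k)
  case (Suc k)
  then show ?case using Ck_on_Suc_imp by (metis le_SucE)
qed auto

lemma Ck_on_subset:
  assumes "Ck_on k U f" "W \<subseteq> U"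
  shows "Ck_on k W f"
  using assms
  by (induction k arbitrary: f) (auto intro: continuous_on_subset differentiable_on_subset)

lemma Ck_on_local:
  assumes "\<And>x. x \<in> U \<Longrightarrow> \<exists>W. open W \<and> x \<in> W \<and> Ck_on k W f"
  shows "Ck_on k U f"
  using assms
proof (induction k arbitrary: f)
  case 0
  have "continuous (at x within U) f" if "x \<in> U" for x
    using 0[OF that] by (auto simp: continuous_on_eq_continuous_at continuous_at_imp_continuous_at_within)
  then show ?case by (simp add: continuous_on_eq_continuous_within)
next
  case (Suc k)
  have "f differentiable_on U"
    unfolding differentiable_on_def
  proof
    fix x assume "x \<in> U"
    then obtain W where "open W" "x \<in> W" "Ck_on (Suc k) W f" using Suc.prems by blast
    then show "f differentiable (at x within U)"
      using Ck_on_Suc differentiable_at_withinI by blast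
  qed
  moreover have "Ck_on k U (\<lambda>x. dd f x h)" for h
    by (rule Suc.IH) (use Suc.prems in fastforce)
  ultimately show ?case by simp
qed

lemma Ck_on_const: "open U \<Longrightarrow> Ck_on k U (\<lambda>x. c)"
proof (induction k arbitrary: c)
  case (Suc k)
  then show ?case by (intro Ck_on_SucI[where D="\<lambda>x h. 0"]) auto
qed auto

lemma Ck_on_bounded_linear:
  assumes "open U" "bounded_linear f"
  shows "Ck_on k U f"
proof (cases k)
  case 0
  then show ?thesis using assms linear_continuous_on by auto
next
  case (Suc j)
  then show ?thesis
    unfolding Suc using assms
    by (intro Ck_on_SucI[where D="\<lambda>x. f"] Ck_on_const bounded_linear_imp_has_derivative)
qed

lemma Ck_on_bounded_linear_comp:
  assumes "open U" "bounded_linear l" "Ck_on k U f"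
  shows "Ck_on k U (\<lambda>x. l (f x))"
  using assms(3)
proof (induction k arbitrary: f)
  case 0
  then show ?case using bounded_linear.continuous_on[OF assms(2)] by auto
next
  case (Suc k)
  show ?case
    by (intro Ck_on_SucI[OF assms(1), where D="\<lambda>x h. l (dd f x h)"] bounded_linear.has_derivative[OF assms(2)]
        Ck_on_derivative[OF assms(1) Suc.prems] Suc.IH Ck_on_dd[OF Suc.prems])
qed

lemma Ck_on_add:
  assumes "open U" "Ck_on k U f" "Ck_on k U g"
  shows "Ck_on k U (\<lambda>x. f x + g x)"
  using assms(2,3)
proof (induction k arbitrary: f g)
  case 0
  then show ?case by (auto intro: continuous_on_add)
next
  case (Suc k)
  show ?case
    by (intro Ck_on_SucI[OF assms(1), where D="\<lambda>x h. dd f x h + dd g x h"] has_derivative_add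
        Ck_on_derivative[OF assms(1) Suc.prems(1)] Ck_on_derivative[OF assms(1) Suc.prems(2)]
        Suc.IH Ck_on_dd[OF Suc.prems(1)] Ck_on_dd[OF Suc.prems(2)])
qed

lemma Ck_on_sum:
  assumes "open U" "\<And>i. i \<in> I \<Longrightarrow> Ck_on k U (f i)"
  shows "Ck_on k U (\<lambda>x. \<Sum>i\<in>I. f i x)"
  using assms(2)
  by (induction I rule: infinite_finite_induct) (auto intro: Ck_on_const Ck_on_add assms(1))

lemma Ck_on_bilinear:
  assumes "open U" "bounded_bilinear b" "Ck_on k U f" "Ck_on k U g"
  shows "Ck_on k U (\<lambda>x. b (f x) (g x))"
  using assms(3,4)
proof (induction k arbitrary: f g)
  case 0
  then show ?case using bounded_bilinear.continuous_on[OF assms(2)] by auto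
next
  case (Suc k)
  show ?case
  proof (rule Ck_on_SucI[OF assms(1), where D="\<lambda>x h. b (f x) (dd g x h) + b (dd f x h) (g x)"])
    show "((\<lambda>x. b (f x) (g x)) has_derivative (\<lambda>h. b (f x) (dd g x h) + b (dd f x h) (g x))) (at x)"
      if "x \<in> U" for x
      by (intro bounded_bilinear.FDERIV[OF assms(2)] Ck_on_derivative[OF assms(1) Suc.prems(1) that]
        Ck_on_derivative[OF assms(1) Suc.prems(2) that])
    show "Ck_on k U (\<lambda>x. b (f x) (dd g x h) + b (dd f x h) (g x))" for h
      by (intro Ck_on_add[OF assms(1)] Suc.IH Ck_on_dd[OF Suc.prems(1)] Ck_on_dd[OF Suc.prems(2)]
          Ck_on_Suc_imp[OF Suc.prems(1)] Ck_on_Suc_imp[OF Suc.prems(2)])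
  qed
qed

lemmas Ck_on_scaleR = Ck_on_bilinear[OF _ bounded_bilinear_scaleR]
lemmas Ck_on_mult = Ck_on_bilinear[OF _ bounded_bilinear_mult]

lemma dd_linear: "f differentiable (at x) \<Longrightarrow> linear (dd f x)"
  using differentiable_dd has_derivative_linear by blast

text \<open>The derivative \<open>dd f (g x) (dd g x h)\<close> is taken in a direction depending on
  \<open>x\<close>, to which the induction hypothesis does not apply. Expanding that direction in a
  basis leaves derivatives of \<open>f\<close> in constant directions; this is why the middle space
  is finite-dimensional.\<close>

lemma Ck_on_compose:
  fixes g :: "'u::real_normed_vector \<Rightarrow> 'v::finite_dim_space" and f :: "'v \<Rightarrow> 'w::real_normed_vector"
  assumes "open U" "open W" "Ck_on k U g" "Ck_on k W f" "g ` U \<subseteq> W"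
  shows "Ck_on k U (\<lambda>x. f (g x))"
  using assms(3,4)
proof (induction k arbitrary: f)
  case 0
  then show ?case using assms continuous_on_compose2[of W f U g] by auto
next
  case (Suc k)
  have fd: "f differentiable (at (g x))" if "x \<in> U" for x
    using that assms(5) Suc.prems(2) Ck_on_Suc[OF assms(2)] by auto
  show ?case
  proof (rule Ck_on_SucI[OF assms(1),
        where D="\<lambda>x h. \<Sum>b\<in>fd_basis. coord b (dd g x h) *\<^sub>R dd f (g x) b"])
    fix x assume x: "x \<in> U"
    have "((\<lambda>x. f (g x)) has_derivative (\<lambda>h. dd f (g x) (dd g x h))) (at x)"
      using has_derivative_compose[OF Ck_on_derivative[OF assms(1) Suc.prems(1) x]
          differentiable_dd[OF fd[OF x]]] .
    moreover have "dd f (g x) (dd g x h) = (\<Sum>b\<in>fd_basis. coord b (dd g x h) *\<^sub>R dd f (g x) b)" for h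
      by (rule linear_coord_expand[OF dd_linear[OF fd[OF x]]])
    ultimately show "((\<lambda>x. f (g x)) has_derivative
        (\<lambda>h. \<Sum>b\<in>fd_basis. coord b (dd g x h) *\<^sub>R dd f (g x) b)) (at x)" by simp
  next
    fix h
    show "Ck_on k U (\<lambda>x. \<Sum>b\<in>fd_basis. coord b (dd g x h) *\<^sub>R dd f (g x) b)"
    proof (intro Ck_on_sum Ck_on_scaleR assms(1))
      fix b :: 'v
      show "Ck_on k U (\<lambda>x. coord b (dd g x h))"
        by (intro Ck_on_bounded_linear_comp[OF assms(1) coord_bounded_linear] Ck_on_dd[OF Suc.prems(1)])
      show "Ck_on k U (\<lambda>x. dd f (g x) b)"
        by (rule Suc.IH[of "\<lambda>y. dd f y b"]) (intro Ck_on_Suc_imp[OF Suc.prems(1)] Ck_on_dd[OF Suc.prems(2)])+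
    qed
  qed
qed

lemma Ck_on_inverse:
  fixes f :: "'u::real_normed_vector \<Rightarrow> real"
  assumes "open U" "Ck_on k U f" "\<And>x. x \<in> U \<Longrightarrow> f x \<noteq> 0"
  shows "Ck_on k U (\<lambda>x. inverse (f x))"
  using assms(2)
proof (induction k)
  case 0
  then show ?case using assms(3) by (auto intro: continuous_on_inverse)
next
  case (Suc k)
  show ?case
  proof (rule Ck_on_SucI[OF assms(1), where D="\<lambda>x h. (- dd f x h) * (inverse (f x) * inverse (f x))"])
    show "((\<lambda>x. inverse (f x)) has_derivative (\<lambda>h. (- dd f x h) * (inverse (f x) * inverse (f x)))) (at x)"
      if "x \<in> U" for x
      using has_derivative_compose[OF Ck_on_derivative[OF assms(1) Suc.prems that]
          has_derivative_inverse'[OF assms(3)[OF that]]]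
      by (simp add: algebra_simps)
    show "Ck_on k U (\<lambda>x. (- dd f x h) * (inverse (f x) * inverse (f x)))" for h
      by (intro Ck_on_mult assms(1) Ck_on_bounded_linear_comp[OF assms(1) bounded_linear_minus[OF bounded_linear_ident]]
          Suc.IH[OF Ck_on_Suc_imp[OF Suc.prems]] Ck_on_dd[OF Suc.prems])
  qed
qed

lemma Ck_on_Pair:
  assumes "open U" "Ck_on k U f" "Ck_on k U g"
  shows "Ck_on k U (\<lambda>x. (f x, g x))"
proof -
  have "Ck_on k U (\<lambda>x. (f x, 0) + (0, g x))"
    by (intro Ck_on_add assms Ck_on_bounded_linear_comp[OF assms(1), of "\<lambda>y. (y, 0)"]
        Ck_on_bounded_linear_comp[OF assms(1), of "\<lambda>y. (0, y)"] bounded_linear_intros)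
  then show ?thesis by simp
qed

lemma smooth_on_cong:
  "open U \<Longrightarrow> (\<And>x. x \<in> U \<Longrightarrow> f x = g x) \<Longrightarrow> smooth_on U f \<Longrightarrow> smooth_on U g"
  unfolding smooth_on_def using Ck_on_cong by metis

lemma smooth_on_subset: "smooth_on U f \<Longrightarrow> W \<subseteq> U \<Longrightarrow> smooth_on W f"
  unfolding smooth_on_def using Ck_on_subset by blast

lemma smooth_on_local:
  assumes "\<And>x. x \<in> U \<Longrightarrow> \<exists>W. open W \<and> x \<in> W \<and> smooth_on W f"
  shows "smooth_on U f"
  unfolding smooth_on_def using assms by (auto simp: smooth_on_def intro!: Ck_on_local)

lemma smooth_on_imp_continuous: "smooth_on U f \<Longrightarrow> continuous_on U f"
  unfolding smooth_on_def using Ck_on_continuous by blast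

lemma smooth_on_differentiable: "open U \<Longrightarrow> smooth_on U f \<Longrightarrow> x \<in> U \<Longrightarrow> f differentiable (at x)"
  unfolding smooth_on_def using Ck_on_Suc by blast

lemma smooth_on_derivative: "open U \<Longrightarrow> smooth_on U f \<Longrightarrow> x \<in> U \<Longrightarrow> (f has_derivative dd f x) (at x)"
  by (simp add: smooth_on_differentiable differentiable_dd)

lemma smooth_on_dd_linear: "open U \<Longrightarrow> smooth_on U f \<Longrightarrow> x \<in> U \<Longrightarrow> linear (dd f x)"
  by (simp add: smooth_on_differentiable dd_linear)

lemma smooth_on_dd: "open U \<Longrightarrow> smooth_on U f \<Longrightarrow> smooth_on U (\<lambda>x. dd f x h)"
  unfolding smooth_on_def using Ck_on_dd by blast

lemma smooth_on_const: "open U \<Longrightarrow> smooth_on U (\<lambda>x. c)"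
  by (simp add: smooth_on_def Ck_on_const)

lemma smooth_on_bounded_linear: "open U \<Longrightarrow> bounded_linear f \<Longrightarrow> smooth_on U f"
  by (simp add: smooth_on_def Ck_on_bounded_linear)

lemma smooth_on_linear:
  fixes f :: "'a::finite_dim_space \<Rightarrow> 'b::real_normed_vector"
  shows "open U \<Longrightarrow> linear f \<Longrightarrow> smooth_on U f"
  by (simp add: smooth_on_bounded_linear linear_bounded_linear)

lemma smooth_on_ident: "open U \<Longrightarrow> smooth_on U (\<lambda>x. x)"
  by (simp add: smooth_on_bounded_linear)

lemma smooth_on_bounded_linear_comp:
  "open U \<Longrightarrow> bounded_linear l \<Longrightarrow> smooth_on U f \<Longrightarrow> smooth_on U (\<lambda>x. l (f x))"
  by (simp add: smooth_on_def Ck_on_bounded_linear_comp)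

lemma smooth_on_linear_comp:
  fixes l :: "'a::finite_dim_space \<Rightarrow> 'b::real_normed_vector"
  shows "open U \<Longrightarrow> linear l \<Longrightarrow> smooth_on U f \<Longrightarrow> smooth_on U (\<lambda>x. l (f x))"
  by (simp add: smooth_on_bounded_linear_comp linear_bounded_linear)

lemma smooth_on_add: "open U \<Longrightarrow> smooth_on U f \<Longrightarrow> smooth_on U g \<Longrightarrow> smooth_on U (\<lambda>x. f x + g x)"
  by (simp add: smooth_on_def Ck_on_add)

lemma smooth_on_scaleR:
  "open U \<Longrightarrow> smooth_on U f \<Longrightarrow> smooth_on U g \<Longrightarrow> smooth_on U (\<lambda>x. f x *\<^sub>R g x)"
  by (simp add: smooth_on_def Ck_on_scaleR)

lemma smooth_on_mult:
  fixes f g :: "'a::real_normed_vector \<Rightarrow> real"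
  shows "open U \<Longrightarrow> smooth_on U f \<Longrightarrow> smooth_on U g \<Longrightarrow> smooth_on U (\<lambda>x. f x * g x)"
  by (simp add: smooth_on_def Ck_on_mult)

lemma smooth_on_minus: "open U \<Longrightarrow> smooth_on U f \<Longrightarrow> smooth_on U (\<lambda>x. - f x)"
  by (rule smooth_on_bounded_linear_comp[OF _ bounded_linear_minus[OF bounded_linear_ident]])

lemma smooth_on_diff: "open U \<Longrightarrow> smooth_on U f \<Longrightarrow> smooth_on U g \<Longrightarrow> smooth_on U (\<lambda>x. f x - g x)"
  using smooth_on_add[OF _ _ smooth_on_minus, of U f g] by simp

lemma smooth_on_sum:
  "open U \<Longrightarrow> (\<And>i. i \<in> I \<Longrightarrow> smooth_on U (f i)) \<Longrightarrow> smooth_on U (\<lambda>x. \<Sum>i\<in>I. f i x)"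
  by (simp add: smooth_on_def Ck_on_sum)

lemma smooth_on_inverse:
  fixes f :: "'u::real_normed_vector \<Rightarrow> real"
  shows "open U \<Longrightarrow> smooth_on U f \<Longrightarrow> (\<And>x. x \<in> U \<Longrightarrow> f x \<noteq> 0) \<Longrightarrow> smooth_on U (\<lambda>x. inverse (f x))"
  by (simp add: smooth_on_def Ck_on_inverse)

lemma smooth_on_divide:
  fixes f g :: "'u::real_normed_vector \<Rightarrow> real"
  shows "open U \<Longrightarrow> smooth_on U f \<Longrightarrow> smooth_on U g \<Longrightarrow> (\<And>x. x \<in> U \<Longrightarrow> g x \<noteq> 0) \<Longrightarrow>
    smooth_on U (\<lambda>x. f x / g x)"
  unfolding divide_inverse by (intro smooth_on_mult smooth_on_inverse)

lemma smooth_on_Pair: "open U \<Longrightarrow> smooth_on U f \<Longrightarrow> smooth_on U g \<Longrightarrow> smooth_on U (\<lambda>x. (f x, g x))"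
  by (simp add: smooth_on_def Ck_on_Pair)

lemma smooth_on_compose:
  fixes g :: "'u::real_normed_vector \<Rightarrow> 'v::finite_dim_space" and f :: "'v \<Rightarrow> 'w::real_normed_vector"
  shows "open U \<Longrightarrow> open W \<Longrightarrow> smooth_on U g \<Longrightarrow> smooth_on W f \<Longrightarrow> g ` U \<subseteq> W \<Longrightarrow> smooth_on U (\<lambda>x. f (g x))"
  by (auto simp add: smooth_on_def intro: Ck_on_compose)

lemma smooth_on_fst: "open U \<Longrightarrow> smooth_on U fst"
  and smooth_on_snd: "open U \<Longrightarrow> smooth_on U snd"
  by (auto intro: smooth_on_bounded_linear bounded_linear_fst bounded_linear_snd)

lemma dd_add: "f differentiable (at x) \<Longrightarrow> g differentiable (at x) \<Longrightarrow>
    dd (\<lambda>x. f x + g x) x h = dd f x h + dd g x h"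
  by (subst dd_eqI[OF has_derivative_add[OF differentiable_dd differentiable_dd]]) auto

lemma dd_scaleR: "f differentiable (at x) \<Longrightarrow> g differentiable (at x) \<Longrightarrow>
    dd (\<lambda>x. f x *\<^sub>R g x) x h = f x *\<^sub>R dd g x h + dd f x h *\<^sub>R g x"
  by (subst dd_eqI[OF has_derivative_scaleR[OF differentiable_dd differentiable_dd]]) auto

lemma dd_compose:
  "g differentiable (at x) \<Longrightarrow> f differentiable (at (g x)) \<Longrightarrow>
    dd (\<lambda>x. f (g x)) x h = dd f (g x) (dd g x h)"
  by (subst dd_eqI[OF has_derivative_compose[OF differentiable_dd differentiable_dd]]) auto

lemma dd_linear_comp:
  "bounded_linear l \<Longrightarrow> f differentiable (at x) \<Longrightarrow> dd (\<lambda>x. l (f x)) x h = l (dd f x h)"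
  by (subst dd_eqI[OF bounded_linear.has_derivative[OF _ differentiable_dd]]) auto

lemma smooth_on_dd_apply:
  fixes f :: "'v::finite_dim_space \<Rightarrow> 'w::real_normed_vector" and g :: "'u::real_normed_vector \<Rightarrow> 'v"
  assumes "open U" "open W" "smooth_on W f" "smooth_on U g" "smooth_on U X" "g ` U \<subseteq> W"
  shows "smooth_on U (\<lambda>x. dd f (g x) (X x))"
proof -
  have "smooth_on U (\<lambda>x. \<Sum>b\<in>fd_basis. coord b (X x) *\<^sub>R dd f (g x) b)"
    by (intro smooth_on_sum smooth_on_scaleR assms smooth_on_bounded_linear_comp[OF _ coord_bounded_linear]
        smooth_on_compose[OF assms(1,2) assms(4) smooth_on_dd[OF assms(2,3)] assms(6)])
  then show ?thesis
    by (rule smooth_on_cong[OF assms(1), rotated])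
      (use assms in \<open>auto intro!: linear_coord_expand[symmetric] smooth_on_dd_linear[OF assms(2,3)]\<close>)
qed

subsection \<open>Symmetry of second derivatives\<close>

lemma dd_along_line:
  assumes "f differentiable (at (x + s *\<^sub>R h))"
  shows "((\<lambda>s. f (x + s *\<^sub>R h)) has_vector_derivative dd f (x + s *\<^sub>R h) h) (at s within T)"
proof -
  have "((\<lambda>s. f (x + s *\<^sub>R h)) has_derivative (\<lambda>r. dd f (x + s *\<^sub>R h) (r *\<^sub>R h))) (at s within T)"
    by (rule has_derivative_compose[of "\<lambda>s. x + s *\<^sub>R h" "\<lambda>r. r *\<^sub>R h" s T f, OF _ differentiable_dd[OF assms]])
      (auto intro!: derivative_eq_intros)
  then show ?thesis
    unfolding has_vector_derivative_def
    by (simp add: linear_scale[OF dd_linear[OF assms]])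
qed

text \<open>The mean value theorem is applied twice: to the difference of \<open>f\<close> along two
  opposite sides of the parallelogram, and then to the derivative in direction \<open>h\<close>
  along a segment in direction \<open>k\<close>.\<close>

lemma second_difference_quotient:
  fixes f :: "'v::real_normed_vector \<Rightarrow> real"
  assumes "open U" "Ck_on 2 U f" "s > 0"
    and "\<And>a b. 0 \<le> a \<Longrightarrow> a \<le> s \<Longrightarrow> 0 \<le> b \<Longrightarrow> b \<le> s \<Longrightarrow> x + a *\<^sub>R h + b *\<^sub>R k \<in> U"
  shows "\<exists>a b. 0 \<le> a \<and> a \<le> s \<and> 0 \<le> b \<and> b \<le> s \<and>
    f (x + s *\<^sub>R h + s *\<^sub>R k) - f (x + s *\<^sub>R h) - f (x + s *\<^sub>R k) + f x =
    s * s * dd (\<lambda>y. dd f y h) (x + a *\<^sub>R h + b *\<^sub>R k) k"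
proof -
  have C1: "\<And>y. y \<in> U \<Longrightarrow> f differentiable (at y)"
    "\<And>y. y \<in> U \<Longrightarrow> (\<lambda>y. dd f y h) differentiable (at y)"
    using assms(2) Ck_on_Suc[OF assms(1), of 1 f] Ck_on_Suc[OF assms(1), of 0 "\<lambda>y. dd f y h"]
    by (auto simp: numeral_2_eq_2 simp del: Ck_on.simps)
  define p where "p = (\<lambda>a. f (x + s *\<^sub>R k + a *\<^sub>R h) - f (x + a *\<^sub>R h))"
  define p' where "p' = (\<lambda>a. dd f (x + s *\<^sub>R k + a *\<^sub>R h) h - dd f (x + a *\<^sub>R h) h)"
  have "(p has_real_derivative p' a) (at a)" if "0 \<le> a" "a \<le> s" for a
    unfolding p_def p'_def has_real_derivative_iff_has_vector_derivative
    using assms(4)[OF that, of s] assms(4)[OF that, of 0] assms(3)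
    by (intro has_vector_derivative_diff dd_along_line C1) (auto simp: algebra_simps)
  from MVT2[OF assms(3) this] obtain a where a: "0 < a" "a < s" "p s - p 0 = (s - 0) * p' a"
    by blast
  define q where "q = (\<lambda>b. dd f ((x + a *\<^sub>R h) + b *\<^sub>R k) h)"
  have "(q has_real_derivative dd (\<lambda>y. dd f y h) ((x + a *\<^sub>R h) + b *\<^sub>R k) k) (at b)" if "0 \<le> b" "b \<le> s" for b
    unfolding q_def has_real_derivative_iff_has_vector_derivative
    using assms(4)[of a b] a that
    by (intro dd_along_line[of "\<lambda>y. dd f y h"] C1) (auto simp: algebra_simps)
  from MVT2[OF assms(3) this] obtain b where b: "0 < b" "b < s"
    "q s - q 0 = (s - 0) * dd (\<lambda>y. dd f y h) ((x + a *\<^sub>R h) + b *\<^sub>R k) k"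
    by blast
  have "p' a = q s - q 0"
    unfolding p'_def q_def by (simp add: algebra_simps)
  then have "p s - p 0 = s * s * dd (\<lambda>y. dd f y h) (x + a *\<^sub>R h + b *\<^sub>R k) k"
    using a(3) b(3) by simp
  moreover have "p s - p 0 = f (x + s *\<^sub>R h + s *\<^sub>R k) - f (x + s *\<^sub>R h) - f (x + s *\<^sub>R k) + f x"
    unfolding p_def by (simp add: algebra_simps)
  ultimately show ?thesis using a b less_imp_le by metis
qed

text \<open>The second difference does not change when \<open>h\<close> and \<open>k\<close> are
  exchanged, so \<open>second_difference_quotient\<close> expresses it by both mixed derivatives, at
  two points of the same small parallelogram. Continuity at \<open>x\<close> closes the gap.\<close>

lemma second_derivative_symmetric_real:
  fixes f :: "'v::real_normed_vector \<Rightarrow> real"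
  assumes "open U" "Ck_on 2 U f" "x \<in> U"
  shows "dd (\<lambda>y. dd f y h) x k = dd (\<lambda>y. dd f y k) x h"
proof -
  let ?A = "\<lambda>y. dd (\<lambda>y. dd f y h) y k" and ?B = "\<lambda>y. dd (\<lambda>y. dd f y k) y h"
  have cont: "continuous_on U ?A" "continuous_on U ?B"
    using assms(2) by (auto simp: numeral_2_eq_2)
  have "\<bar>?A x - ?B x\<bar> \<le> e" if e: "e > 0" for e :: real
  proof -
    have "\<exists>r>0. ball x r \<subseteq> U \<and> (\<forall>y\<in>ball x r. \<bar>?A y - ?A x\<bar> < e/2 \<and> \<bar>?B y - ?B x\<bar> < e/2)"
    proof -
      have "isCont ?A x" "isCont ?B x"
        using cont assms(1,3) by (auto simp: continuous_on_eq_continuous_at)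
      then have "(?A \<longlongrightarrow> ?A x) (nhds x)" "(?B \<longlongrightarrow> ?B x) (nhds x)"
        using tendsto_at_iff_tendsto_nhds[of ?A x] tendsto_at_iff_tendsto_nhds[of ?B x] by (auto simp: isCont_def)
      then have "eventually (\<lambda>y. y \<in> U \<and> dist (?A y) (?A x) < e/2 \<and> dist (?B y) (?B x) < e/2) (nhds x)"
        using assms(1,3) e
        by (intro eventually_conj eventually_nhds_in_open tendstoD[of ?A] tendstoD[of ?B]) auto
      then show ?thesis
        unfolding eventually_nhds_metric by (auto simp: dist_real_def dist_commute subset_eq)
    qed
    then obtain r where r: "r > 0" "ball x r \<subseteq> U"
      "\<And>y. y \<in> ball x r \<Longrightarrow> \<bar>?A y - ?A x\<bar> < e/2 \<and> \<bar>?B y - ?B x\<bar> < e/2" by blast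
    \<comment> \<open>The summand 1 keeps \<open>N\<close> positive even for
      \<open>h = k = 0\<close>; with the factor \<open>r / N / 2\<close> the whole parallelogram
      stays in the ball of radius \<open>r\<close>.\<close>
    define N where "N = norm h + norm k + 1"
    have N: "N > 0" unfolding N_def by (simp add: add_nonneg_pos)
    define s where "s = r / N / 2"
    have s: "s > 0" unfolding s_def using r(1) N by simp
    have inb: "x + a *\<^sub>R h + b *\<^sub>R k \<in> ball x r" if "0 \<le> a" "a \<le> s" "0 \<le> b" "b \<le> s" for a b
    proof -
      have "norm (a *\<^sub>R h + b *\<^sub>R k) \<le> s * norm h + s * norm k"
        using that by (intro norm_triangle_le add_mono) (auto intro: mult_right_mono)
      also have "\<dots> < s * N" using s by (simp add: N_def algebra_simps)
      also have "\<dots> = r / 2"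
        unfolding s_def using N by simp
      finally show ?thesis using r(1) by (simp add: dist_norm algebra_simps norm_minus_commute)
    qed
    then have inb': "x + a *\<^sub>R k + b *\<^sub>R h \<in> ball x r" if "0 \<le> a" "a \<le> s" "0 \<le> b" "b \<le> s" for a b
      using that by (metis add.commute add.left_commute)
    obtain a b where ab: "0 \<le> a" "a \<le> s" "0 \<le> b" "b \<le> s"
      "f (x + s *\<^sub>R h + s *\<^sub>R k) - f (x + s *\<^sub>R h) - f (x + s *\<^sub>R k) + f x = s * s * ?A (x + a *\<^sub>R h + b *\<^sub>R k)"
      using second_difference_quotient[OF assms(1,2) s, of x h k] inb r(2) by blast
    obtain a' b' where ab': "0 \<le> a'" "a' \<le> s" "0 \<le> b'" "b' \<le> s"
      "f (x + s *\<^sub>R k + s *\<^sub>R h) - f (x + s *\<^sub>R k) - f (x + s *\<^sub>R h) + f x = s * s * ?B (x + a' *\<^sub>R k + b' *\<^sub>R h)"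
      using second_difference_quotient[OF assms(1,2) s, of x k h] inb' r(2) by blast
    have "s * s * ?A (x + a *\<^sub>R h + b *\<^sub>R k) = s * s * ?B (x + a' *\<^sub>R k + b' *\<^sub>R h)"
      using ab(5) ab'(5) by (simp add: algebra_simps)
    then have "?A (x + a *\<^sub>R h + b *\<^sub>R k) = ?B (x + a' *\<^sub>R k + b' *\<^sub>R h)" using s by simp
    moreover note r(3)[OF inb[OF ab(1-4)]] r(3)[OF inb'[OF ab'(1-4)]]
    ultimately show ?thesis by linarith
  qed
  then have "\<bar>?A x - ?B x\<bar> \<le> 0" by (rule field_le_epsilon) simp
  then show ?thesis by simp
qed

lemma second_derivative_symmetric:
  fixes f :: "'v::real_normed_vector \<Rightarrow> 'w::finite_dim_space"
  assumes "open U" "smooth_on U f" "x \<in> U"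
  shows "dd (\<lambda>y. dd f y h) x k = dd (\<lambda>y. dd f y k) x h"
proof -
  have l: "coord b (dd (\<lambda>y. dd f y h) x k) = dd (\<lambda>y. dd (\<lambda>z. coord b (f z)) y h) x k" for b :: 'w and h k
  proof -
    have "dd (\<lambda>y. dd (\<lambda>z. coord b (f z)) y h) x k = dd (\<lambda>y. coord b (dd f y h)) x k"
      by (rule arg_cong[of _ _ "\<lambda>g. g k"], rule dd_local[OF assms(1,3)])
        (use assms in \<open>simp add: dd_linear_comp[OF coord_bounded_linear] smooth_on_differentiable\<close>)
    also have "\<dots> = coord b (dd (\<lambda>y. dd f y h) x k)"
      using assms by (intro dd_linear_comp coord_bounded_linear smooth_on_differentiable[OF assms(1) smooth_on_dd])
    finally show ?thesis by simp
  qed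
  have "coord b (dd (\<lambda>y. dd f y h) x k) = coord b (dd (\<lambda>y. dd f y k) x h)" for b :: 'w
  proof -
    have "Ck_on 2 U (\<lambda>z. coord b (f z))"
      using assms(2) smooth_on_bounded_linear_comp[OF assms(1) coord_bounded_linear, of f b]
      unfolding smooth_on_def by blast
    then show ?thesis unfolding l using second_derivative_symmetric_real[OF assms(1) _ assms(3)] by blast
  qed
  then have "(\<Sum>b\<in>fd_basis. coord b (dd (\<lambda>y. dd f y h) x k) *\<^sub>R b)
      = (\<Sum>b\<in>fd_basis. coord b (dd (\<lambda>y. dd f y k) x h) *\<^sub>R b)"
    by (intro sum.cong) auto
  then show ?thesis unfolding coord_sum .
qed

subsection \<open>Bump functions\<close>

text \<open>The powers of \<open>1 / x\<close> are carried along so that derivatives stay in the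
  linear span of the family (\<open>flat_has_derivative\<close>); smoothness of all members then
  follows by one induction on the order.\<close>

definition flat :: "nat \<Rightarrow> real \<Rightarrow> real" where
  "flat n x = (if x \<le> 0 then 0 else (1 / x) ^ n * exp (- (1 / x)))"

lemma flat_tendsto_0: "(flat n \<longlongrightarrow> 0) (at 0)"
proof (rule filterlim_split_at)
  show "(flat n \<longlongrightarrow> 0) (at_left 0)"
    by (rule tendsto_eventually) (auto simp: eventually_at_filter flat_def)
  have "((\<lambda>z. z ^ n / exp z) \<longlongrightarrow> 0) (at_top :: real filter)"
    by (rule tendsto_power_div_exp_0)
  then have "((\<lambda>x. (inverse x) ^ n / exp (inverse x)) \<longlongrightarrow> (0::real)) (at_right 0)"
    using filterlim_inverse_at_top_right by (rule filterlim_compose)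
  then show "(flat n \<longlongrightarrow> 0) (at_right 0)"
    by (rule Lim_transform_eventually)
      (auto simp: eventually_at_filter flat_def inverse_eq_divide exp_minus)
qed

lemma flat_has_derivative:
  "(flat n has_real_derivative (flat (n + 2) x - real n * flat (n + 1) x)) (at x)"
proof (cases x "0::real" rule: linorder_cases)
  case less
  have "((\<lambda>x. 0) has_real_derivative (flat (n + 2) x - real n * flat (n + 1) x)) (at x)"
    using less by (simp add: flat_def)
  then show ?thesis
    by (rule has_field_derivative_transform_within_open[of _ _ _ "{..<0}"])
      (use less in \<open>auto simp: flat_def\<close>)
next
  case equal
  \<comment> \<open>At 0 the difference quotient of one member of the family is the next member,
    which tends to 0.\<close>
  have "(\<lambda>y. (flat n y - flat n 0) / (y - 0)) = (\<lambda>y. flat (n + 1) y)"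
    by (auto simp: flat_def fun_eq_iff divide_simps)
  then have "(flat n has_real_derivative 0) (at 0)"
    using flat_tendsto_0[of "n + 1"] unfolding has_field_derivative_iff by simp
  then show ?thesis using equal by (simp add: flat_def)
next
  case greater
  have "((\<lambda>x. (1 / x) ^ n * exp (- (1 / x))) has_real_derivative
      (flat (n + 2) x - real n * flat (n + 1) x)) (at x)"
  proof -
    have H: "((\<lambda>x. 1 / x) has_real_derivative (- ((1 / x)\<^sup>2))) (at x)"
      using DERIV_inverse[of x] greater by (simp add: inverse_eq_divide power2_eq_square)
    have E: "real n * (- ((1 / x)\<^sup>2) * (1 / x) ^ (n - Suc 0)) = - (real n * (1 / x) ^ (n + 1))"
      by (cases n) (simp_all add: power2_eq_square)
    show ?thesis
      by (rule DERIV_cong[OF DERIV_mult[OF DERIV_power[OF H, of n] DERIV_fun_exp[OF DERIV_minus[OF H]]]])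
        (use greater E in \<open>simp add: flat_def power2_eq_square algebra_simps\<close>)
  qed
  then show ?thesis
    by (rule has_field_derivative_transform_within_open[of _ _ _ "{0<..}"])
      (use greater in \<open>auto simp: flat_def\<close>)
qed

lemma flat_smooth: "smooth_on UNIV (flat n)"
proof -
  have "Ck_on k UNIV (flat n)" for k
  proof (induction k arbitrary: n)
    case 0
    have "isCont (flat n) x" for x
      using flat_has_derivative DERIV_isCont by blast
    then show ?case by (simp add: continuous_on_eq_continuous_at)
  next
    case (Suc k)
    show ?case
    proof (rule Ck_on_SucI[where D="\<lambda>x h. h * (flat (n + 2) x + (- real n) * flat (n + 1) x)"])
      show "(flat n has_derivative (\<lambda>h. h * (flat (n + 2) x + (- real n) * flat (n + 1) x))) (at x)" for x
        using flat_has_derivative[of n x] by (simp add: has_field_derivative_def mult.commute[of _ "flat _ _ - _"])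
      show "Ck_on k UNIV (\<lambda>x. h * (flat (n + 2) x + (- real n) * flat (n + 1) x))" for h
        by (intro Ck_on_mult Ck_on_add Ck_on_const Suc.IH open_UNIV)
    qed simp
  qed
  then show ?thesis by (simp add: smooth_on_def)
qed

text \<open>Of the two summands in the denominator, one is nonzero exactly for \<open>r < 1\<close>
  and the other exactly for \<open>r > 1/2\<close>. These half-lines cover the real line, so the
  denominator never vanishes.\<close>

lemma step_function_exists:
  "\<exists>\<sigma> :: real \<Rightarrow> real. smooth_on UNIV \<sigma> \<and> (\<forall>r<1/2. \<sigma> r = 1) \<and> (\<forall>r>1. \<sigma> r = 0)"
proof -
  let ?\<sigma> = "\<lambda>r. flat 0 (1 - r) / (flat 0 (1 - r) + flat 0 (r - 1/2))"
  have c: "smooth_on UNIV (\<lambda>r. flat 0 (f r))" if "smooth_on UNIV f" for f :: "real \<Rightarrow> real"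
    by (rule smooth_on_compose[OF _ _ that flat_smooth]) auto
  have "flat 0 (1 - r) + flat 0 (r - 1/2) \<noteq> 0" for r
  proof (cases "r < 1")
    case True
    then show ?thesis using exp_gt_zero[of "- (1 / (1 - r))"] exp_gt_zero[of "- (1 / (r - 1/2))"]
      by (auto simp: flat_def simp del: exp_gt_zero)
  next
    case False
    then show ?thesis by (auto simp: flat_def)
  qed
  then have "smooth_on UNIV ?\<sigma>"
    by (intro smooth_on_divide smooth_on_add smooth_on_diff smooth_on_const smooth_on_ident c) auto
  then show ?thesis by (intro exI[of _ ?\<sigma>]) (auto simp: flat_def)
qed

text \<open>The norm need not be smooth away from 0, but the sum of the squared coordinates is; this
  comparison lets bump functions be built from the latter.\<close>

lemma norm_le_coord_squares:
  fixes x :: "'v::finite_dim_space"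
  shows "norm x \<le> (\<Sum>b\<in>(fd_basis::'v set). norm b) * sqrt (\<Sum>b\<in>fd_basis. (coord b x)\<^sup>2)"
proof -
  have c: "\<bar>coord b x\<bar> \<le> sqrt (\<Sum>b\<in>fd_basis. (coord b x)\<^sup>2)" if "b \<in> fd_basis" for b
    using member_le_sum[OF that, of "\<lambda>b. (coord b x)\<^sup>2"] fd_basis(1)[where 'a='v]
    by (intro real_le_rsqrt) simp
  have "norm x = norm (\<Sum>b\<in>fd_basis. coord b x *\<^sub>R b)" by (simp add: coord_sum)
  also have "\<dots> \<le> (\<Sum>b\<in>fd_basis. \<bar>coord b x\<bar> * norm b)"
    by (rule sum_norm_le) simp
  also have "\<dots> \<le> (\<Sum>b\<in>(fd_basis::'v set). sqrt (\<Sum>b\<in>fd_basis. (coord b x)\<^sup>2) * norm b)"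
  proof (rule sum_mono)
    fix b :: 'v assume "b \<in> fd_basis"
    from c[OF this] show "\<bar>coord b x\<bar> * norm b \<le> sqrt (\<Sum>b\<in>fd_basis. (coord b x)\<^sup>2) * norm b"
      by (rule mult_right_mono) simp
  qed
  finally show ?thesis by (simp add: sum_distrib_right mult.commute)
qed

lemma bump_exists:
  fixes p :: "'v::finite_dim_space"
  assumes "open W" "p \<in> W"
  shows "\<exists>\<beta> K U. smooth_on UNIV \<beta> \<and> compact K \<and> K \<subseteq> W \<and> open U \<and> p \<in> U \<and> U \<subseteq> K \<and>
    (\<forall>x\<in>U. \<beta> x = (1::real)) \<and> (\<forall>x. x \<notin> K \<longrightarrow> \<beta> x = 0)"
proof -
  obtain r where r: "r > 0" "cball p r \<subseteq> W"
    using assms open_contains_cball by blast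
  obtain \<sigma> :: "real \<Rightarrow> real" where \<sigma>: "smooth_on UNIV \<sigma>" "\<And>r. r < 1/2 \<Longrightarrow> \<sigma> r = 1" "\<And>r. r > 1 \<Longrightarrow> \<sigma> r = 0"
    using step_function_exists by blast
  define M where "M = (\<Sum>b\<in>(fd_basis::'v set). norm b) + 1"
  have M: "M > 0" unfolding M_def by (simp add: add_nonneg_pos sum_nonneg)
  \<comment> \<open>The scaling \<open>M / r\<close> is chosen so that points at distance more than
    \<open>r\<close> from \<open>p\<close> get a value above 1, where the step function
    vanishes.\<close>
  define N where "N = (\<lambda>x::'v. (\<Sum>b\<in>fd_basis. (coord b (x - p))\<^sup>2) * (M / r)\<^sup>2)"
  have N_smooth: "smooth_on UNIV N"
    unfolding N_def power2_eq_square
    by (intro smooth_on_mult smooth_on_sum smooth_on_const smooth_on_linear_comp[OF _ coord_linear]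
        smooth_on_diff smooth_on_ident) auto
  define \<beta> where "\<beta> = (\<lambda>x. \<sigma> (N x))"
  have "smooth_on UNIV \<beta>"
    unfolding \<beta>_def by (rule smooth_on_compose[OF _ _ N_smooth \<sigma>(1)]) auto
  moreover have out: "N x > 1" if "x \<notin> cball p r" for x
  proof -
    let ?q = "\<Sum>b\<in>fd_basis. (coord b (x - p))\<^sup>2"
    have "r < norm (x - p)" using that by (simp add: dist_norm norm_minus_commute)
    also have "\<dots> \<le> (\<Sum>b\<in>(fd_basis::'v set). norm b) * sqrt ?q" by (rule norm_le_coord_squares)
    also have "\<dots> \<le> M * sqrt ?q" unfolding M_def by (intro mult_right_mono) (auto simp: sum_nonneg)
    finally have "1 < (M / r) * sqrt ?q" using r(1) by (simp add: field_simps)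
    then have "1 < ((M / r) * sqrt ?q)\<^sup>2" by (simp add: one_less_power)
    also have "((M / r) * sqrt ?q)\<^sup>2 = (M / r)\<^sup>2 * ?q"
      unfolding power_mult_distrib by (simp add: sum_nonneg)
    finally show ?thesis unfolding N_def by (simp add: mult.commute)
  qed
  moreover have "open (N -` {..<1/2})"
    using smooth_on_imp_continuous[OF N_smooth] by (intro open_vimage) auto
  moreover have "p \<in> N -` {..<1/2}"
    by (simp add: N_def linear_0[OF coord_linear])
  moreover have "N -` {..<1/2} \<subseteq> cball p r"
  proof
    fix x assume "x \<in> N -` {..<1/2}"
    then have "\<not> N x > 1" by simp
    then show "x \<in> cball p r" using out by blast
  qed
  ultimately show ?thesis
    using r(2) by (intro exI[of _ \<beta>] exI[of _ "cball p r"] exI[of _ "N -` {..<1/2}"])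
      (auto simp: \<beta>_def intro!: \<sigma>(2,3) out)
qed

subsection \<open>Uniform estimates on compact sets\<close>

lemma compact_thickening:
  fixes K :: "'a::finite_dim_space set"
  assumes "compact K" "open W" "K \<subseteq> W"
  shows "\<exists>r>0. \<exists>K'. compact K' \<and> K' \<subseteq> W \<and> (\<forall>q\<in>K. cball q r \<subseteq> K')"
proof -
  obtain r where r: "r > 0" "(\<Union>x\<in>K. cball x r) \<subseteq> W"
    using compact_subset_open_imp_cball_epsilon_subset[OF assms] by blast
  have "compact {x + y | x y. x \<in> K \<and> y \<in> cball 0 r}"
    by (rule compact_sums[OF assms(1) compact_cball])
  moreover have "{x + y | x y. x \<in> K \<and> y \<in> cball 0 r} = (\<Union>x\<in>K. cball x r)"
  proof safe
    fix x y assume "x \<in> K" "y \<in> cball (0::'a) r"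
    then show "x + y \<in> (\<Union>x\<in>K. cball x r)" by (auto simp: dist_norm intro!: bexI[of _ x])
  next
    fix x y assume "x \<in> K" "y \<in> cball x r"
    then show "\<exists>x' y'. y = x' + y' \<and> x' \<in> K \<and> y' \<in> cball 0 r"
      by (intro exI[of _ x] exI[of _ "y - x"]) (auto simp: dist_norm norm_minus_commute)
  qed
  ultimately show ?thesis using r by (intro exI[of _ r]) auto
qed

text \<open>The second point \<open>x\<close> may leave \<open>K\<close>, so uniform continuity is
  applied on a compact neighbourhood of \<open>K\<close> inside \<open>W\<close>.\<close>

lemma uniform_continuity_compact:
  fixes G :: "'a::finite_dim_space \<Rightarrow> 'b::metric_space"
  assumes "compact K" "open W" "K \<subseteq> W" "continuous_on W G" "e > 0"
  shows "\<exists>\<delta>>0. \<forall>q\<in>K. \<forall>x. norm (x - q) < \<delta> \<longrightarrow> x \<in> W \<and> dist (G x) (G q) < e"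
proof -
  obtain r K' where r: "r > 0" "compact K'" "K' \<subseteq> W" "\<And>q. q \<in> K \<Longrightarrow> cball q r \<subseteq> K'"
    using compact_thickening[OF assms(1-3)] by blast
  have "uniformly_continuous_on K' G"
    by (rule compact_uniformly_continuous[OF continuous_on_subset[OF assms(4) r(3)] r(2)])
  then obtain d where d: "d > 0" "\<And>x x'. x \<in> K' \<Longrightarrow> x' \<in> K' \<Longrightarrow> dist x' x < d \<Longrightarrow> dist (G x') (G x) < e"
    using assms(5) unfolding uniformly_continuous_on_def by blast
  show ?thesis
  proof (intro exI[of _ "min r d"] conjI ballI allI impI)
    fix q x assume q: "q \<in> K" and x: "norm (x - q) < min r d"
    have 1: "x \<in> cball q r" using x by (simp add: dist_norm norm_minus_commute)
    have 2: "q \<in> K'" using r(4)[OF q] r(1) by auto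
    show "x \<in> W" using 1 r(3) r(4)[OF q] by auto
    show "dist (G x) (G q) < e"
      using d(2)[OF 2, of x] 1 r(4)[OF q] x by (auto simp: dist_norm)
  qed (use r(1) d(1) in auto)
qed

text \<open>The directional derivatives in the finitely many basis directions are uniformly
  continuous near \<open>K\<close>. Hence the derivative varies little on a ball around
  \<open>q\<close> of uniform radius, and the mean value inequality bounds the error of the
  linearisation.\<close>

lemma uniform_differentiability_compact:
  fixes G :: "'a::finite_dim_space \<Rightarrow> 'b::real_normed_vector"
  assumes "compact K" "open W" "K \<subseteq> W" "Ck_on 1 W G" "e > 0"
  shows "\<exists>\<delta>>0. \<forall>q\<in>K. \<forall>x. norm (x - q) < \<delta> \<longrightarrow>
    x \<in> W \<and> norm (G x - G q - dd G q (x - q)) \<le> e * norm (x - q)"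
proof -
  have diff: "\<And>x. x \<in> W \<Longrightarrow> (G has_derivative dd G x) (at x)"
    and cont: "\<And>h. continuous_on W (\<lambda>x. dd G x h)"
    using assms(4) Ck_on_derivative[OF assms(2), of 0 G] by auto
  obtain c where c: "\<And>b x. norm (coord b (x::'a)) \<le> norm x * c b"
    using bounded_linear.bounded[OF coord_bounded_linear] by metis
  \<comment> \<open>\<open>C\<close> turns a bound for the derivatives in the basis directions into
    a bound for the operator norm; the summand 1 keeps it positive.\<close>
  define C where "C = (\<Sum>b\<in>(fd_basis::'a set). \<bar>c b\<bar>) + 1"
  have C: "C > 0" unfolding C_def by (simp add: add_nonneg_pos sum_nonneg)
  have "\<forall>b::'a. \<exists>\<delta>>0. \<forall>q\<in>K. \<forall>x. norm (x - q) < \<delta> \<longrightarrow> x \<in> W \<and> dist (dd G x b) (dd G q b) < e / C"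
    using uniform_continuity_compact[OF assms(1-3) cont, of "e / C"] assms(5) C by simp
  then obtain \<delta> where \<delta>: "\<And>b::'a. \<delta> b > 0"
    "\<And>b q x. q \<in> K \<Longrightarrow> norm (x - q) < \<delta> b \<Longrightarrow> x \<in> W \<and> dist (dd G x b) (dd G q b) < e / C"
    by metis
  define D where "D = Min (insert (\<delta> 0) (\<delta> ` fd_basis))"
  have D: "D > 0" "D \<le> \<delta> 0" "\<And>b. b \<in> fd_basis \<Longrightarrow> D \<le> \<delta> b"
    unfolding D_def using \<delta>(1) fd_basis(1)[where 'a='a] by auto
  show ?thesis
  proof (intro exI[of _ D] conjI ballI allI impI)
    fix q x assume q: "q \<in> K" and x: "norm (x - q) < D"
    have inW: "y \<in> W" if "y \<in> ball q D" for y
      using \<delta>(2)[OF q, of y 0] that D(2) by (simp add: dist_norm norm_minus_commute)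
    then show "x \<in> W" using x by (simp add: dist_norm norm_minus_commute)
    have est: "norm (dd G y v - dd G q v) \<le> e * norm v" if y: "y \<in> ball q D" for y v
    proof -
      have lin: "linear (\<lambda>v. dd G y v - dd G q v)"
        using diff[OF inW[OF y]] diff[of q] q assms(3) has_derivative_linear
        by (intro linear_compose_sub) auto
      have "norm (dd G y v - dd G q v) = norm (\<Sum>b\<in>fd_basis. coord b v *\<^sub>R (dd G y b - dd G q b))"
        using linear_coord_expand[OF lin, of v] by simp
      also have "\<dots> \<le> (\<Sum>b\<in>(fd_basis::'a set). (norm v * \<bar>c b\<bar>) * (e / C))"
      proof (rule sum_norm_le)
        fix b :: 'a assume b: "b \<in> fd_basis"
        have "norm (dd G y b - dd G q b) \<le> e / C"
          using \<delta>(2)[OF q, of y b] y D(3)[OF b] by (simp add: dist_norm norm_minus_commute)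
        moreover have "\<bar>coord b v\<bar> \<le> norm v * \<bar>c b\<bar>"
          using c[of b v] mult_left_mono[OF abs_ge_self[of "c b"], of "norm v"] by simp
        ultimately show "norm (coord b v *\<^sub>R (dd G y b - dd G q b)) \<le> (norm v * \<bar>c b\<bar>) * (e / C)"
          unfolding norm_scaleR by (intro mult_mono) auto
      qed
      also have "\<dots> = (norm v * e / C) * (\<Sum>b\<in>(fd_basis::'a set). \<bar>c b\<bar>)"
        by (simp add: sum_distrib_left sum_divide_distrib mult_ac)
      also have "\<dots> \<le> (norm v * e / C) * C"
        unfolding C_def using assms(5) by (intro mult_left_mono) (auto intro!: divide_nonneg_nonneg add_nonneg_nonneg sum_nonneg)
      also have "\<dots> = e * norm v" using C by simp
      finally show ?thesis .
    qed
    have "norm (G x - G q - dd G q (x - q)) \<le> norm (x - q) * e"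
    proof (rule differentiable_bound_linearization[where S="ball q D"])
      show "q + t *\<^sub>R (x - q) \<in> ball q D" if "t \<in> {0..1}" for t
      proof -
        have "norm (t *\<^sub>R (x - q)) \<le> norm (x - q)" using that by (simp add: mult_left_le_one_le)
        then show ?thesis using x by (simp add: dist_norm)
      qed
      show "(G has_derivative dd G y) (at y within ball q D)" if "y \<in> ball q D" for y
        using diff[OF inW[OF that]] by (rule has_derivative_at_withinI)
      show "onorm (dd G y - dd G q) \<le> e" if "y \<in> ball q D" for y
        unfolding fun_diff_def using est[OF that] assms(5) by (intro onorm_bound) auto
      show "q \<in> ball q D" using D by simp
    qed
    then show "norm (G x - G q - dd G q (x - q)) \<le> e * norm (x - q)" by (simp add: mult.commute)
  qed (use D in auto)
qed

section \<open>Existence, uniqueness and smooth dependence on parameters for differential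
  equations\<close>

subsection \<open>Ordinary differential equations\<close>

lemma Ck_on_fst: "open U \<Longrightarrow> Ck_on k U fst"
  and Ck_on_snd: "open U \<Longrightarrow> Ck_on k U snd"
  and Ck_on_fst_snd: "open W \<Longrightarrow> Ck_on k W (\<lambda>y. fst (snd y))"
  and Ck_on_snd_snd: "open W \<Longrightarrow> Ck_on k W (\<lambda>y. snd (snd y))"
  by (auto intro!: Ck_on_bounded_linear bounded_linear_fst bounded_linear_snd
      bounded_linear_fst_comp bounded_linear_snd_comp simp del: Ck_on.simps)

lemma Ck_on_1_dd: "Ck_on 1 W G \<Longrightarrow> continuous_on W (\<lambda>x. dd G x h)"
  by simp

text \<open>A substitute for Gronwall's inequality on short intervals. At a point where
  \<open>norm (u t)\<close> attains its maximum \<open>M\<close>, the mean value inequality gives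
  \<open>M \<le> S * (L * M + e)\<close>, and \<open>L * S < 1\<close> allows solving for
  \<open>M\<close>.\<close>

lemma integral_inequality_bound:
  fixes u :: "real \<Rightarrow> 'v::real_normed_vector"
  assumes ab: "a \<le> 0" "0 \<le> b" "- S \<le> a" "b \<le> S"
    and L: "0 \<le> L" "L * S < 1" and e: "0 \<le> e"
    and u0: "u 0 = 0"
    and du: "\<And>t. t \<in> {a..b} \<Longrightarrow> (u has_vector_derivative u' t) (at t within {a..b})"
    and bd: "\<And>t. t \<in> {a..b} \<Longrightarrow> norm (u' t) \<le> L * norm (u t) + e"
    and t: "t \<in> {a..b}"
  shows "norm (u t) \<le> S * e / (1 - L * S)"
proof -
  have cont: "continuous_on {a..b} (\<lambda>t. norm (u t))"
    by (intro continuous_on_norm continuous_on_vector_derivative[of _ u u'] du)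
  obtain t0 where t0: "t0 \<in> {a..b}" "\<And>t. t \<in> {a..b} \<Longrightarrow> norm (u t) \<le> norm (u t0)"
    using continuous_attains_sup[OF compact_Icc _ cont] t by blast
  let ?M = "norm (u t0)"
  have "norm (u t0 - u 0) \<le> (L * ?M + e) * norm (t0 - 0)"
  proof (rule differentiable_bound[where S="{a..b}" and f'="\<lambda>t h. h *\<^sub>R u' t"])
    show "(u has_derivative (\<lambda>h. h *\<^sub>R u' t)) (at t within {a..b})" if "t \<in> {a..b}" for t
      using du[OF that] by (simp add: has_vector_derivative_def)
    show "onorm (\<lambda>h. h *\<^sub>R u' t) \<le> L * ?M + e" if "t \<in> {a..b}" for t
    proof (rule onorm_bound)
      have "norm (u' t) \<le> L * ?M + e"
        using bd[OF that] mult_left_mono[OF t0(2)[OF that] L(1)] by linarith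
      then show "norm (h *\<^sub>R u' t) \<le> (L * ?M + e) * norm h" for h
        using mult_left_mono[of "norm (u' t)" "L * ?M + e" "\<bar>h\<bar>"] by (simp add: mult.commute)
      show "0 \<le> L * ?M + e" using L e by simp
    qed
  qed (use t0 ab in auto)
  also have "\<dots> \<le> (L * ?M + e) * S"
    using t0(1) ab L e by (intro mult_left_mono) auto
  finally have "?M * (1 - L * S) \<le> S * e" using u0 by (simp add: algebra_simps)
  then have "?M \<le> S * e / (1 - L * S)" using L by (simp add: field_simps)
  then show ?thesis using t0(2)[OF t] by linarith
qed

lemma ode_unique:
  fixes u v :: "real \<Rightarrow> 'v::real_normed_vector"
  assumes ab: "a \<le> 0" "0 \<le> b" "- S \<le> a" "b \<le> S"
    and L: "0 \<le> L" "L * S < 1"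
    and lip: "\<And>t x y. t \<in> {a..b} \<Longrightarrow> norm (G t x - G t y) \<le> L * norm (x - y)"
    and "u 0 = v 0"
    and u: "\<And>t. t \<in> {a..b} \<Longrightarrow> (u has_vector_derivative G t (u t)) (at t within {a..b})"
    and v: "\<And>t. t \<in> {a..b} \<Longrightarrow> (v has_vector_derivative G t (v t)) (at t within {a..b})"
    and t: "t \<in> {a..b}"
  shows "u t = v t"
proof -
  have "norm (u t - v t) \<le> S * 0 / (1 - L * S)"
    by (rule integral_inequality_bound[OF ab L order_refl, where u'="\<lambda>t. G t (u t) - G t (v t)"])
      (use assms in \<open>auto intro!: has_vector_derivative_diff\<close>)
  then show ?thesis by simp
qed

text \<open>Picard iteration: the integral operator contracts the bounded continuous functions, because
  \<open>L * S < 1\<close>. Outside \<open>[-S, S]\<close> its values are extended as constants.\<close>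

lemma ode_exists:
  fixes G :: "real \<Rightarrow> 'v::banach \<Rightarrow> 'v"
  assumes S: "S \<ge> 0" and L: "0 \<le> L" "L * S < 1"
    and cont: "continuous_on ({-S..S} \<times> UNIV) (\<lambda>(t, x). G t x)"
    and lip: "\<And>t x y. t \<in> {-S..S} \<Longrightarrow> norm (G t x - G t y) \<le> L * norm (x - y)"
  shows "\<exists>u. u 0 = 0 \<and> (\<forall>t\<in>{-S..S}. (u has_vector_derivative G t (u t)) (at t within {-S..S}))"
proof -
  define c where "c = (\<lambda>t. max (-S) (min S t))"
  have c: "c t \<in> {-S..S}" "continuous_on UNIV c" for t
    unfolding c_def using S by (auto intro!: continuous_intros)
  have c_id: "c t = t" if "t \<in> {-S..S}" for t using that by (auto simp: c_def)
  \<comment> \<open>The integral from 0 to \<open>t\<close> is a difference of integrals with common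
    left end \<open>-S\<close>, which covers negative \<open>t\<close> as well.\<close>
  define I where "I = (\<lambda>(u :: real \<Rightarrow> 'v) t. integral {-S..t} (\<lambda>r. G r (u r)) - integral {-S..0} (\<lambda>r. G r (u r)))"
  have Gu: "continuous_on {-S..S} (\<lambda>r. G r (u r))" if "continuous_on {-S..S} u" for u
  proof -
    have "continuous_on {-S..S} (\<lambda>r. case (r, u r) of (t, x) \<Rightarrow> G t x)"
      by (rule continuous_on_compose2[OF cont, of "{-S..S}" "\<lambda>r. (r, u r)"])
        (use that in \<open>auto intro!: continuous_intros\<close>)
    then show ?thesis by simp
  qed
  have dI: "(I u has_vector_derivative G t (u t)) (at t within {-S..S})"
    if "continuous_on {-S..S} u" "t \<in> {-S..S}" for u t
  proof -
    have "((\<lambda>t. integral {-S..t} (\<lambda>r. G r (u r))) has_vector_derivative G t (u t)) (at t within {-S..S})"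
      by (rule integral_has_vector_derivative[OF Gu[OF that(1)] that(2)])
    from has_vector_derivative_diff[OF this has_vector_derivative_const[of "integral {-S..0} (\<lambda>r. G r (u r))"]]
    show ?thesis unfolding I_def diff_zero .
  qed
  have contI: "continuous_on {-S..S} (I u)" if "continuous_on {-S..S} u" for u
    by (rule continuous_on_vector_derivative[OF dI[OF that]])
  define T where "T = (\<lambda>u :: real \<Rightarrow>\<^sub>C 'v. Bcontfun (\<lambda>t. I (apply_bcontfun u) (c t)))"
  have T: "apply_bcontfun (T u) t = I (apply_bcontfun u) (c t)" for u t
  proof -
    have cI: "continuous_on {-S..S} (I (apply_bcontfun u))" by (rule contI) simp
    have "continuous_on UNIV (\<lambda>t. I (apply_bcontfun u) (c t))"
      by (rule continuous_on_compose2[OF cI c(2)]) (use c(1) in auto)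
    moreover have "bounded (range (\<lambda>t. I (apply_bcontfun u) (c t)))"
    proof (rule bounded_subset)
      show "bounded (I (apply_bcontfun u) ` {-S..S})"
        by (intro compact_imp_bounded compact_continuous_image cI compact_Icc)
    qed (use c(1) in auto)
    ultimately have "(\<lambda>t. I (apply_bcontfun u) (c t)) \<in> bcontfun"
      by (simp add: bcontfun_def)
    then show ?thesis by (simp add: T_def Bcontfun_inverse)
  qed
  have "dist (T u) (T v) \<le> (L * S) * dist u v" for u v
  proof (rule dist_bound)
    fix t
    let ?d = "\<lambda>t. I (apply_bcontfun u) t - I (apply_bcontfun v) t"
    have "norm (?d (c t) - ?d 0) \<le> (L * dist u v) * norm (c t - 0)"
    proof (rule differentiable_bound[where S="{-S..S}" and
          f'="\<lambda>t h. h *\<^sub>R (G t (apply_bcontfun u t) - G t (apply_bcontfun v t))"])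
      show "(?d has_derivative (\<lambda>h. h *\<^sub>R (G t (apply_bcontfun u t) - G t (apply_bcontfun v t))))
          (at t within {-S..S})" if "t \<in> {-S..S}" for t
        using has_vector_derivative_diff[OF dI[OF _ that] dI[OF _ that], of "apply_bcontfun u" "apply_bcontfun v"]
        by (simp add: has_vector_derivative_def)
      show "onorm (\<lambda>h. h *\<^sub>R (G t (apply_bcontfun u t) - G t (apply_bcontfun v t))) \<le> L * dist u v"
        if "t \<in> {-S..S}" for t
      proof (rule onorm_bound)
        have "norm (apply_bcontfun u t - apply_bcontfun v t) \<le> dist u v"
          using dist_bounded[of u t v] by (simp add: dist_norm)
        then have 1: "norm (G t (apply_bcontfun u t) - G t (apply_bcontfun v t)) \<le> L * dist u v"
          using lip[OF that, of "apply_bcontfun u t" "apply_bcontfun v t"] mult_left_mono[OF _ L(1)]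
          by (meson order_trans)
        show "norm (h *\<^sub>R (G t (apply_bcontfun u t) - G t (apply_bcontfun v t))) \<le> (L * dist u v) * norm h" for h
          using mult_left_mono[OF 1 abs_ge_zero[of h]] by (simp add: mult.commute)
        show "0 \<le> L * dist u v" using L by simp
      qed
    qed (use c(1) S in auto)
    moreover have "?d 0 = 0" by (simp add: I_def)
    moreover have "(L * dist u v) * norm (c t - 0) \<le> (L * dist u v) * S"
      using c(1)[of t] L S by (intro mult_left_mono) auto
    ultimately show "dist (apply_bcontfun (T u) t) (apply_bcontfun (T v) t) \<le> (L * S) * dist u v"
      unfolding T dist_norm by (simp add: mult_ac)
  qed
  then obtain u where u: "T u = u"
    using banach_fix_type[of "L * S" T] L S by auto
  then have ueq: "apply_bcontfun u t = I (apply_bcontfun u) t" if "t \<in> {-S..S}" for t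
    using T[of u t] c_id[OF that] by simp
  show ?thesis
  proof (intro exI[of _ "apply_bcontfun u"] conjI ballI)
    show "apply_bcontfun u 0 = 0" using ueq[of 0] S by (simp add: I_def)
    show "(apply_bcontfun u has_vector_derivative G t (apply_bcontfun u t)) (at t within {-S..S})"
      if t: "t \<in> {-S..S}" for t
      by (rule has_vector_derivative_transform[OF t _ dI[OF _ t]]) (use ueq in auto)
  qed
qed

text \<open>The Lipschitz bound is assumed only along the line through \<open>x\<close> in direction
  \<open>v\<close>. This suits right-hand sides for which a Lipschitz constant is given in the
  unknown alone.\<close>

lemma derivative_norm_le_Lipschitz:
  fixes f :: "'a::real_normed_vector \<Rightarrow> 'b::real_normed_vector"
  assumes df: "(f has_derivative f') (at x)" and B: "\<And>r. norm (f (x + r *\<^sub>R v) - f x) \<le> B * norm (r *\<^sub>R v)"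
  shows "norm (f' v) \<le> B * norm v"
proof -
  interpret f': bounded_linear f' using df by (rule has_derivative_bounded_linear)
  show ?thesis
  proof (cases "v = 0")
    case False
    have *: "norm (f' v) \<le> B * norm v + e * norm v" if e: "e > 0" for e
    proof -
      obtain d where d: "d > 0" "\<And>y. norm (y - x) < d \<Longrightarrow> norm (f y - f x - f' (y - x)) \<le> e * norm (y - x)"
        using df e unfolding has_derivative_at_alt by blast
      define r where "r = d / 2 / norm v"
      have r: "r > 0" "norm (r *\<^sub>R v) < d" unfolding r_def using d(1) False by auto
      have "norm (f' (r *\<^sub>R v)) \<le> norm (f (x + r *\<^sub>R v) - f x) + norm (f (x + r *\<^sub>R v) - f x - f' (r *\<^sub>R v))"
        using norm_triangle_ineq4[of "f (x + r *\<^sub>R v) - f x" "f (x + r *\<^sub>R v) - f x - f' (r *\<^sub>R v)"] by simp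
      also have "\<dots> \<le> B * norm (r *\<^sub>R v) + e * norm (r *\<^sub>R v)"
        using d(2)[of "x + r *\<^sub>R v"] B[of r] r by (intro add_mono) auto
      finally have "r * norm (f' v) \<le> r * (B * norm v + e * norm v)"
        using r(1) by (simp add: f'.scaleR algebra_simps)
      then show ?thesis using r(1) by simp
    qed
    have "norm (f' v) \<le> B * norm v + e" if "e > 0" for e
      using *[of "e / norm v"] False that by simp
    then show ?thesis by (rule field_le_epsilon)
  qed (simp add: f'.zero)
qed

lemma cancel_constants:
  fixes a c m e x :: real
  assumes "m > 0" "c > 0" "a > 0"
  shows "a * (e * m / a / c * (c * x)) / m = e * x"
  using assms by simp

text \<open>Solutions start at 0 for every parameter; an initial point is handled by letting the
  right-hand side depend on it, as in \<open>flow_box\<close>. The smallness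
  \<open>L * S < 1\<close> makes \<open>integral_inequality_bound\<close> available on every compact
  interval \<open>{-S1..S1}\<close> with \<open>S1 < S\<close>.\<close>

locale lipschitz_ode =
  fixes F :: "real \<times> 'p::finite_dim_space \<times> 'v::finite_dim_space \<Rightarrow> 'v" and S L :: real and U :: "'p set"
  assumes U: "open U" and S: "S > 0" and L: "0 \<le> L" "L * S < 1"
    and lip: "\<And>t p x y. \<bar>t\<bar> < S \<Longrightarrow> p \<in> U \<Longrightarrow> norm (F (t, p, x) - F (t, p, y)) \<le> L * norm (x - y)"
    and F_cont: "continuous_on ({-S<..<S} \<times> U \<times> UNIV) F"
begin

abbreviation "D \<equiv> {-S<..<S} \<times> U \<times> (UNIV :: 'v set)"

definition solution :: "(real \<times> 'p \<Rightarrow> 'v) \<Rightarrow> bool" where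
  "solution z \<longleftrightarrow> (\<forall>p\<in>U. z (0, p) = 0 \<and>
     (\<forall>t\<in>{-S<..<S}. ((\<lambda>t. z (t, p)) has_vector_derivative F (t, p, z (t, p))) (at t)))"

lemma open_D: "open D"
  using U by (intro open_Times) auto

lemma LS1: "S1 \<le> S \<Longrightarrow> L * S1 < 1"
  using mult_left_mono[OF _ L(1), of S1 S] L(2) by linarith

lemma solution_within:
  assumes "solution z" "p \<in> U" "S1 < S" "t \<in> {-S1..S1}"
  shows "((\<lambda>t. z (t, p)) has_vector_derivative F (t, p, z (t, p))) (at t within {-S1..S1})"
proof -
  have "t \<in> {-S<..<S}" using assms(3,4) by auto
  then have "((\<lambda>t. z (t, p)) has_vector_derivative F (t, p, z (t, p))) (at t)"
    using assms(1,2) unfolding solution_def by blast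
  then show ?thesis by (rule has_vector_derivative_at_within)
qed

lemma solution_curve_compact:
  assumes "solution z" "p \<in> U" "S1 < S"
  shows "compact ((\<lambda>t. (t, p, z (t, p))) ` {-S1..S1})" "(\<lambda>t. (t, p, z (t, p))) ` {-S1..S1} \<subseteq> D"
proof -
  have "continuous_on {-S1..S1} (\<lambda>t. z (t, p))"
    by (rule continuous_on_vector_derivative[OF solution_within[OF assms]])
  then show "compact ((\<lambda>t. (t, p, z (t, p))) ` {-S1..S1})"
    by (intro compact_continuous_image continuous_intros) auto
qed (use assms in auto)

text \<open>The curve of the solution at \<open>p0\<close> over a compact time interval is compact,
  so replacing \<open>p0\<close> by a nearby \<open>p\<close> changes \<open>F\<close> uniformly
  little along it. The integral inequality turns this into closeness of the two solutions;
  continuity in time at \<open>p0\<close> does the rest.\<close>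

lemma solution_continuous:
  assumes z: "solution z"
  shows "continuous_on ({-S<..<S} \<times> U) z"
proof -
  have "isCont z (t0, p0)" if t0: "t0 \<in> {-S<..<S}" and p0: "p0 \<in> U" for t0 p0
  proof -
    \<comment> \<open>Halfway between \<open>\<bar>t0\<bar>\<close> and \<open>S\<close>: the closed
      interval lies inside the domain and contains a neighbourhood of \<open>t0\<close>.\<close>
    define S1 where "S1 = (\<bar>t0\<bar> + S) / 2"
    have S1: "\<bar>t0\<bar> < S1" "S1 < S" "S1 > 0" using t0 by (auto simp: S1_def)
    have c0: "isCont (\<lambda>t. z (t, p0)) t0"
      using z t0 p0 unfolding solution_def
      by (meson differentiable_imp_continuous_within has_vector_derivative_def differentiable_def)
    show ?thesis
      unfolding continuous_at_eps_delta
    proof (intro allI impI)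
      fix e :: real assume e: "e > 0"
      define m where "m = 1 - L * S1"
      have m: "m > 0" unfolding m_def using S1 LS1[of S1] by simp
      \<comment> \<open>Chosen so that the bound \<open>S1 * e' / (1 - L * S1)\<close> of the
        integral inequality equals \<open>e / 4\<close>.\<close>
      define e' where "e' = e / 4 * m / S1"
      have e': "e' > 0" unfolding e'_def using e S1 m by simp
      obtain d where d: "d > 0" "\<And>q x. q \<in> (\<lambda>t. (t, p0, z (t, p0))) ` {-S1..S1} \<Longrightarrow> norm (x - q) < d \<Longrightarrow>
          x \<in> D \<and> dist (F x) (F q) < e'"
        using uniform_continuity_compact[OF solution_curve_compact(1)[OF z p0 S1(2)] open_D
            solution_curve_compact(2)[OF z p0 S1(2)] F_cont e'] by blast
      obtain d2 where d2: "d2 > 0" "\<And>t. dist t t0 < d2 \<Longrightarrow> dist (z (t, p0)) (z (t0, p0)) < e / 2"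
        using c0 e unfolding continuous_at_eps_delta by (metis half_gt_zero)
      have close: "norm (z (t, p) - z (t, p0)) \<le> e / 4" if p: "norm (p - p0) < d" and t: "t \<in> {-S1..S1}" for p t
      proof -
        have pD: "(t, p, z (t, p0)) \<in> D \<and> dist (F (t, p, z (t, p0))) (F (t, p0, z (t, p0))) < e'"
          if "t \<in> {-S1..S1}" for t
          by (rule d(2)) (use that p in \<open>auto simp: norm_prod_def\<close>)
        then have pU: "p \<in> U" using t by blast
        have "norm (z (t, p) - z (t, p0)) \<le> S1 * e' / (1 - L * S1)"
        proof (rule integral_inequality_bound[where a="-S1" and b=S1 and
              u'="\<lambda>t. F (t, p, z (t, p)) - F (t, p0, z (t, p0))"])
          show "z (0, p) - z (0, p0) = 0" using z pU p0 by (simp add: solution_def)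
          show "((\<lambda>t. z (t, p) - z (t, p0)) has_vector_derivative F (t, p, z (t, p)) - F (t, p0, z (t, p0)))
              (at t within {-S1..S1})" if "t \<in> {-S1..S1}" for t
            by (intro has_vector_derivative_diff solution_within[OF z] pU p0 S1(2) that)
          show "norm (F (t, p, z (t, p)) - F (t, p0, z (t, p0))) \<le> L * norm (z (t, p) - z (t, p0)) + e'"
            if "t \<in> {-S1..S1}" for t
          proof -
            have "norm (F (t, p, z (t, p)) - F (t, p, z (t, p0))) \<le> L * norm (z (t, p) - z (t, p0))"
              by (rule lip) (use that S1 pU in auto)
            moreover have "norm (F (t, p, z (t, p0)) - F (t, p0, z (t, p0))) \<le> e'"
              using pD[OF that] by (simp add: dist_norm less_imp_le)
            ultimately show ?thesis
              using norm_triangle_ineq[of "F (t, p, z (t, p)) - F (t, p, z (t, p0))" "F (t, p, z (t, p0)) - F (t, p0, z (t, p0))"]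
              by simp
          qed
        qed (use S1 L LS1[of S1] e' t in auto)
        also have "\<dots> = e / 4" unfolding e'_def m_def[symmetric] using S1 m by simp
        finally show ?thesis .
      qed
      show "\<exists>d>0. \<forall>x'. dist x' (t0, p0) < d \<longrightarrow> dist (z x') (z (t0, p0)) < e"
      proof (intro exI[of _ "min d (min d2 (S1 - \<bar>t0\<bar>))"] conjI allI impI)
        fix x' assume x': "dist x' (t0, p0) < min d (min d2 (S1 - \<bar>t0\<bar>))"
        obtain t p where tp: "x' = (t, p)" by (cases x')
        have t: "dist t t0 < min d2 (S1 - \<bar>t0\<bar>)" and p: "norm (p - p0) < d"
          using x' dist_fst_le[of x' "(t0, p0)"] dist_snd_le[of x' "(t0, p0)"]
          by (auto simp: tp dist_norm)
        have "t \<in> {-S1..S1}" using t by (auto simp: dist_real_def)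
        then have "dist (z (t, p)) (z (t, p0)) \<le> e / 4" using close[OF p] by (simp add: dist_norm)
        moreover have "dist (z (t, p0)) (z (t0, p0)) < e / 2" using d2(2) t by simp
        ultimately show "dist (z x') (z (t0, p0)) < e"
          using dist_triangle[of "z (t, p)" "z (t0, p0)" "z (t, p0)"] e unfolding tp by linarith
      qed (use d d2 S1 in auto)
    qed
  qed
  then show ?thesis
    by (intro continuous_at_imp_continuous_on) auto
qed

text \<open>The equation linearised along the solution \<open>z\<close>. Its solution
  \<open>w\<close> is the candidate for the derivative of \<open>z\<close> in the parameter
  direction \<open>h\<close>, and the equation inherits the Lipschitz constant \<open>L\<close>,
  since \<open>L\<close> bounds the derivative of \<open>F\<close> in the last variable.\<close>

lemma variation_exists:
  assumes C1: "Ck_on 1 D F" and z: "solution z" and S1: "0 < S1" "S1 < S" and p: "p \<in> U"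
  shows "\<exists>w. w 0 = 0 \<and> (\<forall>t\<in>{-S1..S1}.
    (w has_vector_derivative dd F (t, p, z (t, p)) (0, h, w t)) (at t within {-S1..S1}))"
    and "\<And>t x. \<bar>t\<bar> < S \<Longrightarrow> norm (dd F (t, p, z (t, p)) (0, 0, x)) \<le> L * norm x"
    and "\<And>t. \<bar>t\<bar> < S \<Longrightarrow> linear (dd F (t, p, z (t, p)))"
proof -
  have dF: "\<And>q. q \<in> D \<Longrightarrow> (F has_derivative dd F q) (at q)"
    using C1 Ck_on_derivative[OF open_D, of 0 F] by auto
  show bd: "norm (dd F (t, p, z (t, p)) (0, 0, x)) \<le> L * norm x" if "\<bar>t\<bar> < S" for t x
  proof -
    have "norm (dd F (t, p, z (t, p)) (0, 0, x)) \<le> L * norm ((0, 0, x) :: real \<times> 'p \<times> 'v)"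
    proof (rule derivative_norm_le_Lipschitz)
      show "(F has_derivative dd F (t, p, z (t, p))) (at (t, p, z (t, p)))"
        using that p by (intro dF) auto
      show "norm (F ((t, p, z (t, p)) + r *\<^sub>R (0, 0, x)) - F (t, p, z (t, p))) \<le> L * norm (r *\<^sub>R (0::real, 0::'p, x))" for r
        using lip[OF that p, of "z (t, p) + r *\<^sub>R x" "z (t, p)"] by (simp add: norm_prod_def)
    qed
    then show ?thesis by (simp add: norm_prod_def)
  qed
  show lin: "linear (dd F (t, p, z (t, p)))" if "\<bar>t\<bar> < S" for t
  proof -
    have "(t, p, z (t, p)) \<in> D" using that p by auto
    from has_derivative_linear[OF dF[OF this]] show ?thesis .
  qed
  show "\<exists>w. w 0 = 0 \<and> (\<forall>t\<in>{-S1..S1}.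
    (w has_vector_derivative dd F (t, p, z (t, p)) (0, h, w t)) (at t within {-S1..S1}))"
  proof (rule ode_exists)
    have "continuous_on ({-S1..S1} \<times> UNIV) (\<lambda>(t, x).
        \<Sum>b\<in>fd_basis. coord b (0::real, h, x::'v) *\<^sub>R dd F (t, p, z (t, p)) b)"
    proof -
      have c: "continuous_on D (\<lambda>q. dd F q b)" for b by (rule Ck_on_1_dd[OF C1])
      have "continuous_on {-S1..S1} (\<lambda>t. z (t, p))"
        by (rule continuous_on_vector_derivative[OF solution_within[OF z p S1(2)]])
      then have "continuous_on {-S1..S1} (\<lambda>t. dd F (t, p, z (t, p)) b)" for b
        by (intro continuous_on_compose2[OF c, of _ "\<lambda>t. (t, p, z (t, p))"] continuous_intros)
          (use S1 p in auto)
      then have c1: "continuous_on ({-S1..S1} \<times> UNIV) (\<lambda>y. dd F (fst y, p, z (fst y, p)) b)" for b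
        by (rule continuous_on_compose2[of _ _ _ fst]) (auto intro!: continuous_intros)
      have c2: "continuous_on ({-S1..S1} \<times> UNIV) (\<lambda>y::real \<times> 'v. coord b (0::real, h, snd y))" for b :: "real \<times> 'p \<times> 'v"
        by (rule bounded_linear.continuous_on[OF coord_bounded_linear]) (intro continuous_intros)
      show ?thesis
        unfolding case_prod_unfold by (intro continuous_on_sum continuous_on_scaleR c1 c2)
    qed
    then show "continuous_on ({-S1..S1} \<times> UNIV) (\<lambda>(t, x). dd F (t, p, z (t, p)) (0, h, x))"
    proof (rule continuous_on_eq)
      fix y :: "real \<times> 'v" assume "y \<in> {-S1..S1} \<times> UNIV"
      then have "\<bar>fst y\<bar> < S" using S1 by auto
      from linear_coord_expand[OF lin[OF this], of "(0, h, snd y)"]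
      show "(case y of (t, x) \<Rightarrow> \<Sum>b\<in>fd_basis. coord b (0::real, h, x::'v) *\<^sub>R dd F (t, p, z (t, p)) b)
        = (case y of (t, x) \<Rightarrow> dd F (t, p, z (t, p)) (0, h, x))"
        by (simp add: case_prod_unfold)
    qed
    fix t x y assume "t \<in> {-S1..S1}"
    then have t: "\<bar>t\<bar> < S" using S1 by auto
    have "dd F (t, p, z (t, p)) (0, h, x) - dd F (t, p, z (t, p)) (0, h, y) = dd F (t, p, z (t, p)) (0, 0, x - y)"
      using linear_diff[OF lin[OF t], of "(0, h, x)" "(0, h, y)"] by simp
    then show "norm (dd F (t, p, z (t, p)) (0, h, x) - dd F (t, p, z (t, p)) (0, h, y)) \<le> L * norm (x - y)"
      using bd[OF t] by simp
  qed (use S1 L LS1[of S1] in auto)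
qed

text \<open>The error \<open>z (t, p + h) - z (t, p) - w h t\<close> satisfies a differential
  inequality whose inhomogeneous part is the linearisation error of \<open>F\<close>. That error is
  small compared with \<open>norm h\<close> once the increments of \<open>z\<close> are known to be
  of order \<open>norm h\<close>, and the integral inequality passes this on to the
  solutions.\<close>

lemma solution_has_derivative_parameter:
  assumes C1: "Ck_on 1 D F" and z: "solution z" and S1: "0 < S1" "S1 < S" and p: "p \<in> U"
    and w: "\<And>h. w h 0 = 0" "\<And>h t. t \<in> {-S1..S1} \<Longrightarrow>
      (w h has_vector_derivative dd F (t, p, z (t, p)) (0, h, w h t)) (at t within {-S1..S1})"
    and t0: "t0 \<in> {-S1..S1}"
  shows "((\<lambda>p. z (t0, p)) has_derivative (\<lambda>h. w h t0)) (at p)"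
proof -
  let ?A = "\<lambda>t. dd F (t, p, z (t, p))"
  note bd = variation_exists(2)[OF C1 z S1 p] and lin = variation_exists(3)[OF C1 z S1 p]
  have LS: "0 < 1 - L * S1" using LS1[of S1] S1 by simp
  have tS: "\<bar>t\<bar> < S" if "t \<in> {-S1..S1}" for t using that S1 by auto
  \<comment> \<open>Uniqueness for the linearised equation; it is what makes \<open>w h t0\<close>
    linear in \<open>h\<close>.\<close>
  have uniq: "u t0 = v t0" if "u 0 = v 0"
    "\<And>t. t \<in> {-S1..S1} \<Longrightarrow> (u has_vector_derivative ?A t (0, h, u t)) (at t within {-S1..S1})"
    "\<And>t. t \<in> {-S1..S1} \<Longrightarrow> (v has_vector_derivative ?A t (0, h, v t)) (at t within {-S1..S1})" for u v h
  proof (rule ode_unique[of "-S1" S1 S1 L "\<lambda>t x. ?A t (0, h, x)"])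
    fix t x y assume "t \<in> {-S1..S1}"
    then have t: "\<bar>t\<bar> < S" using S1 by auto
    have "?A t (0, h, x) - ?A t (0, h, y) = ?A t (0, 0, x - y)"
      using linear_diff[OF lin[OF t], of "(0, h, x)" "(0, h, y)"] by simp
    then show "norm (?A t (0, h, x) - ?A t (0, h, y)) \<le> L * norm (x - y)" using bd[OF t] by simp
  qed (use that S1 L LS t0 in auto)
  have lw: "linear (\<lambda>h. w h t0)"
  proof (rule linearI)
    fix h k
    show "w (h + k) t0 = w h t0 + w k t0"
    proof (rule uniq[where h="h + k" and v="\<lambda>t. w h t + w k t"])
      fix t assume t: "t \<in> {-S1..S1}"
      have "?A t (0, h + k, w h t + w k t) = ?A t (0, h, w h t) + ?A t (0, k, w k t)"
        using linear_add[OF lin[OF tS[OF t]], of "(0, h, w h t)" "(0, k, w k t)"] by simp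
      then show "((\<lambda>t. w h t + w k t) has_vector_derivative ?A t (0, h + k, w h t + w k t)) (at t within {-S1..S1})"
        using has_vector_derivative_add[OF w(2)[OF t, of h] w(2)[OF t, of k]] by simp
    qed (use w in auto)
  next
    fix r h
    show "w (r *\<^sub>R h) t0 = r *\<^sub>R w h t0"
    proof (rule uniq[where h="r *\<^sub>R h" and v="\<lambda>t. r *\<^sub>R w h t"])
      fix t assume t: "t \<in> {-S1..S1}"
      have "?A t (0, r *\<^sub>R h, r *\<^sub>R w h t) = r *\<^sub>R ?A t (0, h, w h t)"
        using linear_scale[OF lin[OF tS[OF t]], of r "(0, h, w h t)"] by simp
      then show "((\<lambda>t. r *\<^sub>R w h t) has_vector_derivative ?A t (0, r *\<^sub>R h, r *\<^sub>R w h t)) (at t within {-S1..S1})"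
        using bounded_linear.has_vector_derivative[OF bounded_linear_scaleR_right w(2)[OF t], of r h] by metis
    qed (use w in auto)
  qed
  let ?K = "(\<lambda>t. (t, p, z (t, p))) ` {-S1..S1}"
  note K = solution_curve_compact[OF z p S1(2)]
  have cA: "continuous_on ?K (\<lambda>q. dd F q b)" for b
    by (rule continuous_on_subset[OF Ck_on_1_dd[OF C1] K(2)])
  have "\<exists>B\<ge>0. \<forall>t\<in>{-S1..S1}. \<forall>h. norm (?A t (0, h, 0)) \<le> B * norm h"
  proof -
    have "\<exists>B. \<forall>q\<in>?K. norm (dd F q b) \<le> B" for b
    proof -
      have "bounded ((\<lambda>q. dd F q b) ` ?K)"
        by (rule compact_imp_bounded[OF compact_continuous_image[OF cA K(1)]])
      then obtain a where "\<forall>x\<in>(\<lambda>q. dd F q b) ` ?K. norm x \<le> a" unfolding bounded_iff by blast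
      then show ?thesis by blast
    qed
    then have "\<exists>B. \<forall>b. \<forall>q\<in>?K. norm (dd F q b) \<le> B b" by (intro choice allI)
    then obtain B where B: "\<And>b q. q \<in> ?K \<Longrightarrow> norm (dd F q b) \<le> B b" by blast
    obtain c where c: "\<And>b x. norm (coord b (x::'p)) \<le> norm x * c b"
      using bounded_linear.bounded[OF coord_bounded_linear] by metis
    show ?thesis
    proof (intro exI[of _ "\<Sum>b\<in>(fd_basis::'p set). \<bar>c b\<bar> * \<bar>B (0, b, 0)\<bar>"] conjI ballI allI)
      fix t h assume t: "t \<in> {-S1..S1}"
      have "linear (\<lambda>h. ?A t (0, h, 0))"
      proof (rule linearI)
        fix h k r
        show "?A t (0, h + k, 0) = ?A t (0, h, 0) + ?A t (0, k, 0)"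
          using linear_add[OF lin[OF tS[OF t]], of "(0, h, 0)" "(0, k, 0)"] by simp
        show "?A t (0, r *\<^sub>R h, 0) = r *\<^sub>R ?A t (0, h, 0)"
          using linear_scale[OF lin[OF tS[OF t]], of r "(0, h, 0)"] by simp
      qed
      from linear_coord_expand[OF this, of h]
      have "norm (?A t (0, h, 0)) = norm (\<Sum>b\<in>fd_basis. coord b h *\<^sub>R ?A t (0, b, 0))" by simp
      also have "\<dots> \<le> (\<Sum>b\<in>(fd_basis::'p set). (norm h * \<bar>c b\<bar>) * \<bar>B (0, b, 0)\<bar>)"
      proof (rule sum_norm_le)
        fix b :: 'p
        have "norm (?A t (0, b, 0)) \<le> \<bar>B (0, b, 0)\<bar>" using B[of "(t, p, z (t, p))" "(0, b, 0)"] t by force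
        moreover have "\<bar>coord b h\<bar> \<le> norm h * \<bar>c b\<bar>"
          using c[of b h] mult_left_mono[OF abs_ge_self[of "c b"], of "norm h"] by simp
        ultimately show "norm (coord b h *\<^sub>R ?A t (0, b, 0)) \<le> (norm h * \<bar>c b\<bar>) * \<bar>B (0, b, 0)\<bar>"
          unfolding norm_scaleR by (intro mult_mono) auto
      qed
      also have "\<dots> = (\<Sum>b\<in>(fd_basis::'p set). \<bar>c b\<bar> * \<bar>B (0, b, 0)\<bar>) * norm h"
        by (simp add: sum_distrib_left sum_distrib_right mult_ac)
      finally show "norm (?A t (0, h, 0)) \<le> (\<Sum>b\<in>(fd_basis::'p set). \<bar>c b\<bar> * \<bar>B (0, b, 0)\<bar>) * norm h" .
    qed (auto intro: sum_nonneg)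
  qed
  then obtain B where B: "B \<ge> 0" "\<And>t h. t \<in> {-S1..S1} \<Longrightarrow> norm (?A t (0, h, 0)) \<le> B * norm h" by blast
  \<comment> \<open>A Lipschitz constant of the solution in the parameter: \<open>B + 1\<close>
    bounds the increment of \<open>F\<close> by its derivative in the parameter direction plus a
    linearisation error taken with tolerance 1.\<close>
  define C where "C = S1 * (B + 1) / (1 - L * S1)"
  have C: "C \<ge> 0" unfolding C_def using S1 B LS by simp
  have UD: "\<exists>d>0. \<forall>q\<in>?K. \<forall>x. norm (x - q) < d \<longrightarrow>
      x \<in> D \<and> norm (F x - F q - dd F q (x - q)) \<le> e * norm (x - q)" if "e > 0" for e
    by (rule uniform_differentiability_compact[OF K(1) open_D K(2) C1 that])
  have zp: "\<exists>d>0. \<forall>h. norm h < d \<longrightarrow> p + h \<in> U \<and> (\<forall>t\<in>{-S1..S1}. norm (z (t, p + h) - z (t, p)) \<le> C * norm h)"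
  proof -
    obtain d where d: "d > 0" "\<And>q x. q \<in> ?K \<Longrightarrow> norm (x - q) < d \<Longrightarrow>
      x \<in> D \<and> norm (F x - F q - dd F q (x - q)) \<le> 1 * norm (x - q)" using UD[OF zero_less_one] by blast
    show ?thesis
    proof (intro exI[of _ d] conjI allI impI ballI)
      fix h :: 'p assume h: "norm h < d"
      have e: "(t, p + h, z (t, p)) \<in> D \<and> norm (F (t, p + h, z (t, p)) - F (t, p, z (t, p))) \<le> (B + 1) * norm h"
        if t: "t \<in> {-S1..S1}" for t
      proof -
        have n: "norm ((t, p + h, z (t, p)) - (t, p, z (t, p))) = norm h" by (simp add: norm_prod_def)
        from d(2)[of "(t, p, z (t, p))" "(t, p + h, z (t, p))"] n h t
        have 1: "(t, p + h, z (t, p)) \<in> D" "norm (F (t, p + h, z (t, p)) - F (t, p, z (t, p)) - ?A t (0, h, 0)) \<le> norm h"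
          by auto
        from norm_triangle_ineq[of "F (t, p + h, z (t, p)) - F (t, p, z (t, p)) - ?A t (0, h, 0)" "?A t (0, h, 0)"]
        show ?thesis using 1 B(2)[OF t, of h] by (simp add: algebra_simps)
      qed
      show pU: "p + h \<in> U" using e[OF t0] by blast
      fix t assume t: "t \<in> {-S1..S1}"
      have "norm (z (t, p + h) - z (t, p)) \<le> S1 * ((B + 1) * norm h) / (1 - L * S1)"
      proof (rule integral_inequality_bound[where a="-S1" and b=S1 and
            u'="\<lambda>t. F (t, p + h, z (t, p + h)) - F (t, p, z (t, p))"])
        show "z (0, p + h) - z (0, p) = 0" using z pU p by (simp add: solution_def)
        fix t assume t: "t \<in> {-S1..S1}"
        show "((\<lambda>t. z (t, p + h) - z (t, p)) has_vector_derivative F (t, p + h, z (t, p + h)) - F (t, p, z (t, p)))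
            (at t within {-S1..S1})"
          by (intro has_vector_derivative_diff solution_within[OF z] pU p S1(2) t)
        have "norm (F (t, p + h, z (t, p + h)) - F (t, p + h, z (t, p))) \<le> L * norm (z (t, p + h) - z (t, p))"
          by (rule lip[OF tS[OF t] pU])
        then show "norm (F (t, p + h, z (t, p + h)) - F (t, p, z (t, p)))
            \<le> L * norm (z (t, p + h) - z (t, p)) + (B + 1) * norm h"
          using e[OF t] norm_triangle_ineq[of "F (t, p + h, z (t, p + h)) - F (t, p + h, z (t, p))"
              "F (t, p + h, z (t, p)) - F (t, p, z (t, p))"] by simp
      qed (use S1 L LS t B in auto)
      then show "norm (z (t, p + h) - z (t, p)) \<le> C * norm h" by (simp add: C_def mult_ac)
    qed (use d in auto)
  qed
  then obtain d0 where d0: "d0 > 0" "\<And>h. norm h < d0 \<Longrightarrow> p + h \<in> U"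
    "\<And>h t. norm h < d0 \<Longrightarrow> t \<in> {-S1..S1} \<Longrightarrow> norm (z (t, p + h) - z (t, p)) \<le> C * norm h" by blast
  show ?thesis
    unfolding has_derivative_at_alt
  proof (intro conjI allI impI)
    show "bounded_linear (\<lambda>h. w h t0)" by (rule linear_bounded_linear[OF lw])
    fix e :: real assume e: "0 < e"
    define m where "m = 1 - L * S1"
    define c where "c = 1 + C"
    have mc: "m > 0" "c > 0" using LS C by (simp_all add: m_def c_def)
    \<comment> \<open>Chosen so that the factors \<open>1 + C\<close> and
      \<open>S1 / (1 - L * S1)\<close> met below cancel, leaving exactly
      \<open>e * norm h\<close>.\<close>
    define e' where "e' = e * m / S1 / c"
    have e': "e' > 0" unfolding e'_def using e mc S1 by simp
    obtain d where d: "d > 0" "\<And>q x. q \<in> ?K \<Longrightarrow> norm (x - q) < d \<Longrightarrow>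
      x \<in> D \<and> norm (F x - F q - dd F q (x - q)) \<le> e' * norm (x - q)" using UD[OF e'] by blast
    show "\<exists>d>0. \<forall>y. norm (y - p) < d \<longrightarrow> norm (z (t0, y) - z (t0, p) - w (y - p) t0) \<le> e * norm (y - p)"
    proof (intro exI[of _ "min d0 (d / (1 + C))"] conjI allI impI)
      fix y assume y: "norm (y - p) < min d0 (d / (1 + C))"
      define h where "h = y - p"
      have yp: "y = p + h" and h: "norm h < d0" "norm h < d / (1 + C)" using y by (auto simp: h_def)
      have hd: "(1 + C) * norm h < d" using h(2) C by (simp add: field_simps)
      have "norm (z (t0, p + h) - z (t0, p) - w h t0) \<le> S1 * (e' * ((1 + C) * norm h)) / (1 - L * S1)"
      proof (rule integral_inequality_bound[where a="-S1" and b=S1 and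
            u'="\<lambda>t. F (t, p + h, z (t, p + h)) - F (t, p, z (t, p)) - ?A t (0, h, w h t)"])
        show "z (0, p + h) - z (0, p) - w h 0 = 0" using z d0(2)[OF h(1)] p w by (simp add: solution_def)
        fix t assume t: "t \<in> {-S1..S1}"
        show "((\<lambda>t. z (t, p + h) - z (t, p) - w h t) has_vector_derivative
            F (t, p + h, z (t, p + h)) - F (t, p, z (t, p)) - ?A t (0, h, w h t)) (at t within {-S1..S1})"
          by (intro has_vector_derivative_diff solution_within[OF z] d0(2)[OF h(1)] p S1(2) t w)
        let ?dz = "z (t, p + h) - z (t, p)"
        have "norm ((0::real), h, ?dz) \<le> norm h + norm ?dz"
          using norm_Pair_le[of "0::real" "(h, ?dz)"] norm_Pair_le[of h ?dz] by simp
        also have "\<dots> \<le> (1 + C) * norm h" using d0(3)[OF h(1) t] by (simp add: algebra_simps)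
        finally have n: "norm ((0::real), h, ?dz) \<le> (1 + C) * norm h" .
        have eq: "(t, p + h, z (t, p + h)) - (t, p, z (t, p)) = (0, h, ?dz)" by simp
        have "norm (F (t, p + h, z (t, p + h)) - F (t, p, z (t, p)) - ?A t (0, h, ?dz)) \<le> e' * norm ((0::real), h, ?dz)"
          using d(2)[of "(t, p, z (t, p))" "(t, p + h, z (t, p + h))"] n hd t unfolding eq by auto
        also have "\<dots> \<le> e' * ((1 + C) * norm h)" using n e' by simp
        finally have 1: "norm (F (t, p + h, z (t, p + h)) - F (t, p, z (t, p)) - ?A t (0, h, ?dz)) \<le> e' * ((1 + C) * norm h)" .
        have "?A t (0, h, ?dz) - ?A t (0, h, w h t) = ?A t (0, 0, ?dz - w h t)"
          using linear_diff[OF lin[OF tS[OF t]], of "(0, h, ?dz)" "(0, h, w h t)"] by simp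
        then have 2: "norm (?A t (0, h, ?dz) - ?A t (0, h, w h t)) \<le> L * norm (?dz - w h t)"
          using bd[OF tS[OF t]] by simp
        show "norm (F (t, p + h, z (t, p + h)) - F (t, p, z (t, p)) - ?A t (0, h, w h t))
            \<le> L * norm (z (t, p + h) - z (t, p) - w h t) + e' * ((1 + C) * norm h)"
          using 1 2 norm_triangle_ineq[of "F (t, p + h, z (t, p + h)) - F (t, p, z (t, p)) - ?A t (0, h, ?dz)"
              "?A t (0, h, ?dz) - ?A t (0, h, w h t)"] by simp
      qed (use S1 L LS t0 C e' in auto)
      also have "\<dots> = e * norm h"
        unfolding e'_def m_def[symmetric] c_def[symmetric] using mc S1(1) by (intro cancel_constants)
      finally show "norm (z (t0, y) - z (t0, p) - w (y - p) t0) \<le> e * norm (y - p)"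
        by (simp add: yp)
    qed (use d d0 C in auto)
  qed
qed

end

text \<open>Induction on the order, for all equations simultaneously. The partial derivative in time
  is \<open>F\<close> along the solution, and the one in the parameter solves the linearised
  equation, which is again a \<open>lipschitz_ode\<close>. The induction hypothesis gives
  \<open>Ck_on k\<close> for \<open>z\<close>, hence for the linearised right-hand side, and so it
  applies to the linearised equation too.\<close>

theorem ode_solution_Ck:
  fixes F :: "real \<times> 'p::finite_dim_space \<times> 'v::finite_dim_space \<Rightarrow> 'v"
  assumes "lipschitz_ode F S L U" "Ck_on k ({-S<..<S} \<times> U \<times> UNIV) F" "lipschitz_ode.solution F S U z"
  shows "Ck_on k ({-S<..<S} \<times> U) z"
  using assms
proof (induction k arbitrary: F S z)
  case 0
  then show ?case using lipschitz_ode.solution_continuous by auto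
next
  case (Suc k)
  interpret lipschitz_ode F S L U by (rule Suc.prems(1))
  note z = Suc.prems(3)
  note FS = Suc.prems(2)
  have zk: "Ck_on k ({-S<..<S} \<times> U) z"
    by (rule Suc.IH[OF Suc.prems(1) Ck_on_Suc_imp[OF FS] z])
  have C1: "Ck_on 1 D F" by (rule Ck_on_le[OF FS]) simp
  have oDU: "open ({-S<..<S} \<times> U)" using U by (intro open_Times) auto
  show ?case
  proof (rule Ck_on_local)
    fix y assume y: "y \<in> {-S<..<S} \<times> U"
    define S1 where "S1 = (\<bar>fst y\<bar> + S) / 2"
    have S1: "\<bar>fst y\<bar> < S1" "S1 < S" "S1 > 0" using y by (auto simp: S1_def)
    let ?O = "{-S1<..<S1} \<times> U"
    have oO: "open ?O" using U by (intro open_Times) auto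
    have OS: "?O \<subseteq> {-S<..<S} \<times> U" using S1 by auto
    have "\<forall>p h. \<exists>w. p \<in> U \<longrightarrow> w 0 = 0 \<and> (\<forall>t\<in>{-S1..S1}.
        (w has_vector_derivative dd F (t, p, z (t, p)) (0, h, w t)) (at t within {-S1..S1}))"
      using variation_exists(1)[OF C1 z S1(3,2)] by blast
    then obtain w where w: "\<And>p h. p \<in> U \<Longrightarrow> w p h 0 = 0"
      "\<And>p h t. p \<in> U \<Longrightarrow> t \<in> {-S1..S1} \<Longrightarrow>
        (w p h has_vector_derivative dd F (t, p, z (t, p)) (0, h, w p h t)) (at t within {-S1..S1})"
      unfolding choice_iff by blast
    have w_at: "(w p h has_vector_derivative dd F (t, p, z (t, p)) (0, h, w p h t)) (at t)"
      if "p \<in> U" "t \<in> {-S1<..<S1}" for p h t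
    proof -
      have "at t within {-S1..S1} = at t" using that by (intro at_within_Icc_at) auto
      then show ?thesis using w(2)[OF that(1), of t h] that(2) by simp
    qed
    have z_at: "((\<lambda>t. z (t, p)) has_vector_derivative F (t, p, z (t, p))) (at t)"
      if "p \<in> U" "t \<in> {-S<..<S}" for p t
      using z that unfolding solution_def by blast
    have "Ck_on (Suc k) ?O z"
    proof (rule Ck_on_SucI[OF oO, where D="\<lambda>q h. fst h *\<^sub>R F (fst q, snd q, z q) + w (snd q) (snd h) (fst q)"])
      fix q assume q: "q \<in> ?O"
      obtain t0 p0 where q_eq: "q = (t0, p0)" by (cases q)
      have t0: "t0 \<in> {-S1<..<S1}" and p0: "p0 \<in> U" using q q_eq by auto
      \<comment> \<open>The arguments are exchanged because the criterion for total
        differentiability asks for continuity of the partial derivative in the second argument only.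
        In time it is \<open>F\<close> along the solution, known to be continuous; continuity of
        \<open>w\<close> is not yet available.\<close>
      have swap: "((\<lambda>(p, t). z (t, p)) has_derivative
          (\<lambda>(h, s). w p0 h t0 + blinfun_apply (blinfun_scaleR_left (F (t0, p0, z (t0, p0)))) s))
          (at (p0, t0) within U \<times> {-S1<..<S1})"
      proof (rule has_derivative_partialsI[where fy="\<lambda>p t. blinfun_scaleR_left (F (t, p, z (t, p)))"])
        show "((\<lambda>p. z (t0, p)) has_derivative (\<lambda>h. w p0 h t0)) (at p0 within U)"
          by (rule has_derivative_at_withinI[OF solution_has_derivative_parameter[OF C1 z S1(3,2) p0 w(1)[OF p0] w(2)[OF p0]]])
            (use t0 in auto)
        show "((\<lambda>t. z (t, p)) has_derivative blinfun_apply (blinfun_scaleR_left (F (t, p, z (t, p)))))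
            (at t within {-S1<..<S1})" if "p \<in> U" "t \<in> {-S1<..<S1}" for p t
          using z_at[OF that(1), of t] that(2) S1(2)
          by (auto simp: has_vector_derivative_def intro: has_derivative_at_withinI)
        have "continuous_on (U \<times> {-S1<..<S1}) (\<lambda>x. F (snd x, fst x, z (snd x, fst x)))"
        proof (rule continuous_on_compose2[OF F_cont])
          have "continuous_on (U \<times> {-S1<..<S1}) (\<lambda>x. z (snd x, fst x))"
            by (rule continuous_on_compose2[OF Ck_on_continuous[OF zk]])
              (use S1 in \<open>auto intro!: continuous_intros\<close>)
          then show "continuous_on (U \<times> {-S1<..<S1}) (\<lambda>x. (snd x, fst x, z (snd x, fst x)))"
            by (intro continuous_intros)
        qed (use S1 in auto)
        then have "continuous_on (U \<times> {-S1<..<S1}) (\<lambda>x. blinfun_scaleR_left (F (snd x, fst x, z (snd x, fst x))))"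
          by (rule bounded_linear.continuous_on[OF bounded_linear_blinfun_scaleR_left])
        then show "continuous (at (p0, t0) within U \<times> {-S1<..<S1}) (\<lambda>(p, t). blinfun_scaleR_left (F (t, p, z (t, p))))"
          using p0 t0 by (auto simp: continuous_on_eq_continuous_within case_prod_unfold)
      qed (use t0 in auto)
      have oU: "open (U \<times> {-S1<..<S1})" using U by (intro open_Times) auto
      have A: "((\<lambda>q. (snd q, fst q)) has_derivative (\<lambda>q. (snd q, fst q))) (at (t0, p0))"
        by (intro has_derivative_Pair has_derivative_fst has_derivative_snd has_derivative_ident)
      have B: "((\<lambda>(p, t). z (t, p)) has_derivative (\<lambda>(h, s). w p0 h t0 + s *\<^sub>R F (t0, p0, z (t0, p0))))
          (at (snd (t0, p0), fst (t0, p0)))"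
        using swap at_within_open[OF _ oU, of "(p0, t0)"] p0 t0 by simp
      from has_derivative_compose[OF A B]
      show "(z has_derivative (\<lambda>h. fst h *\<^sub>R F (fst q, snd q, z q) + w (snd q) (snd h) (fst q))) (at q)"
        unfolding q_eq by (simp add: case_prod_unfold add.commute)
    next
      fix h :: "real \<times> 'p"
      have zO: "Ck_on k ?O z" by (rule Ck_on_subset[OF zk OS])
      have 1: "Ck_on k ?O (\<lambda>q. F (fst q, snd q, z q))"
        by (rule Ck_on_compose[OF oO open_D _ Ck_on_Suc_imp[OF FS]])
          ((intro Ck_on_Pair zO oO Ck_on_fst Ck_on_snd)+, use S1 in auto)
      let ?G = "\<lambda>y::real \<times> 'p \<times> 'v. dd F (fst y, fst (snd y), z (fst y, fst (snd y))) (0, snd h, snd (snd y))"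
      let ?D1 = "{-S1<..<S1} \<times> U \<times> (UNIV :: 'v set)"
      have oD1: "open ?D1" using U by (intro open_Times) auto
      have tri: "Ck_on k ?D1 (\<lambda>y. (fst y, fst (snd y), z (fst y, fst (snd y))))"
      proof -
        have "Ck_on k ?D1 (\<lambda>y. z (fst y, fst (snd y)))"
          by (rule Ck_on_compose[OF oD1 oO _ zO])
            ((intro Ck_on_Pair oD1 Ck_on_fst Ck_on_fst_snd)+, auto)
        then show ?thesis
          by (intro Ck_on_Pair oD1 Ck_on_fst Ck_on_fst_snd)
      qed
      have "Ck_on k ?D1 (\<lambda>y. dd F (fst y, fst (snd y), z (fst y, fst (snd y))) b)" for b
        by (rule Ck_on_compose[OF oD1 open_D tri Ck_on_dd[OF FS]]) (use S1 in auto)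
      then have "Ck_on k ?D1 (\<lambda>y. \<Sum>b\<in>fd_basis. coord b (0::real, snd h, snd (snd y)) *\<^sub>R
          dd F (fst y, fst (snd y), z (fst y, fst (snd y))) b)"
        by (intro Ck_on_sum Ck_on_scaleR oD1 Ck_on_bounded_linear_comp[OF oD1 coord_bounded_linear]
            Ck_on_Pair Ck_on_const Ck_on_snd_snd) blast+
      then have Gk: "Ck_on k ?D1 ?G"
      proof (rule Ck_on_cong[OF oD1, rotated])
        fix y assume "y \<in> ?D1"
        then have "fst (snd y) \<in> U" "\<bar>fst y\<bar> < S" using S1 by auto
        from linear_coord_expand[OF variation_exists(3)[OF C1 z S1(3,2) this], of "(0, snd h, snd (snd y))"]
        show "(\<Sum>b\<in>fd_basis. coord b (0::real, snd h, snd (snd y)) *\<^sub>R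
          dd F (fst y, fst (snd y), z (fst y, fst (snd y))) b) = ?G y" by simp
      qed
      have lipG: "norm (?G (t, p, x) - ?G (t, p, y)) \<le> L * norm (x - y)" if "\<bar>t\<bar> < S1" "p \<in> U" for t p x y
      proof -
        have t: "\<bar>t\<bar> < S" using that S1 by simp
        have "?G (t, p, x) - ?G (t, p, y) = dd F (t, p, z (t, p)) (0, 0, x - y)"
          using linear_diff[OF variation_exists(3)[OF C1 z S1(3,2) that(2) t], of "(0, snd h, x)" "(0, snd h, y)"] by simp
        then show ?thesis using variation_exists(2)[OF C1 z S1(3,2) that(2) t, of "x - y"] by simp
      qed
      have lo: "lipschitz_ode ?G S1 L U"
        by (unfold_locales) (use U S1 L LS1[of S1] lipG Ck_on_continuous[OF Gk] in auto)
      have "Ck_on k ?O (\<lambda>q. w (snd q) (snd h) (fst q))"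
      proof (rule Suc.IH[OF lo Gk])
        show "lipschitz_ode.solution ?G S1 U (\<lambda>q. w (snd q) (snd h) (fst q))"
          unfolding lipschitz_ode.solution_def[OF lo] using w(1) w_at by auto
      qed
      then show "Ck_on k ?O (\<lambda>q. fst h *\<^sub>R F (fst q, snd q, z q) + w (snd q) (snd h) (fst q))"
        by (intro Ck_on_add Ck_on_scaleR Ck_on_const oO 1)
    qed
    then show "\<exists>W. open W \<and> y \<in> W \<and> Ck_on (Suc k) W z"
      using oO y S1 by (intro exI[of _ ?O]) auto
  qed
qed

section \<open>Vector fields in coordinates, up to Frobenius' theorem without constant rank\<close>

subsection \<open>Lie brackets in coordinates\<close>

definition brk :: "('v::real_normed_vector \<Rightarrow> 'v) \<Rightarrow> ('v \<Rightarrow> 'v) \<Rightarrow> 'v \<Rightarrow> 'v" where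
  "brk X Y x = dd Y x (X x) - dd X x (Y x)"

lemma brk_antisym: "brk X Y x = - brk Y X x"
  by (simp add: brk_def)

lemma brk_local:
  assumes "open W" "x \<in> W" "\<And>y. y \<in> W \<Longrightarrow> X y = X' y" "\<And>y. y \<in> W \<Longrightarrow> Y y = Y' y"
  shows "brk X Y x = brk X' Y' x"
  using dd_local[OF assms(1,2), of X X'] dd_local[OF assms(1,2), of Y Y'] assms by (simp add: brk_def)

lemma brk_smooth:
  fixes X Y :: "'v::finite_dim_space \<Rightarrow> 'v"
  assumes "open W" "smooth_on W X" "smooth_on W Y"
  shows "smooth_on W (brk X Y)"
proof -
  have "smooth_on W (\<lambda>x. dd Y x (X x) - dd X x (Y x))"
    by (intro smooth_on_diff smooth_on_dd_apply[where g="\<lambda>x. x" and W=W] smooth_on_ident assms) auto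
  then show ?thesis by (simp add: brk_def[abs_def])
qed

text \<open>Product rule for the pairing of \<open>dd T\<close> with the field \<open>Y\<close>; the
  basis expansion replaces operator-valued differentiation by derivatives in constant
  directions.\<close>

lemma dd_apply_has_derivative:
  fixes T :: "'v::finite_dim_space \<Rightarrow> 'w::real_normed_vector"
  assumes "open A" "smooth_on A T" "smooth_on A Y" "x \<in> A"
  shows "((\<lambda>z. dd T z (Y z)) has_derivative
    (\<lambda>v. dd (\<lambda>z. dd T z (Y x)) x v + dd T x (dd Y x v))) (at x)"
proof -
  have lin: "linear (dd T z)" if "z \<in> A" for z by (rule smooth_on_dd_linear[OF assms(1,2) that])
  have dT: "((\<lambda>z. dd T z b) has_derivative dd (\<lambda>z. dd T z b) x) (at x)" for b
    by (rule smooth_on_derivative[OF assms(1) smooth_on_dd[OF assms(1,2)] assms(4)])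
  have dY: "(Y has_derivative dd Y x) (at x)" by (rule smooth_on_derivative[OF assms(1,3,4)])
  have "((\<lambda>z. \<Sum>b\<in>fd_basis. coord b (Y z) *\<^sub>R dd T z b) has_derivative
      (\<lambda>v. \<Sum>b\<in>fd_basis. coord b (Y x) *\<^sub>R dd (\<lambda>z. dd T z b) x v + coord b (dd Y x v) *\<^sub>R dd T x b)) (at x)"
    by (intro has_derivative_sum has_derivative_scaleR dT bounded_linear.has_derivative[OF coord_bounded_linear] dY)
  then have "((\<lambda>z. dd T z (Y z)) has_derivative
      (\<lambda>v. \<Sum>b\<in>fd_basis. coord b (Y x) *\<^sub>R dd (\<lambda>z. dd T z b) x v + coord b (dd Y x v) *\<^sub>R dd T x b)) (at x)"
    by (rule has_derivative_local[OF assms(1,4), rotated]) (rule linear_coord_expand[OF lin, symmetric])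
  moreover have "(\<Sum>b\<in>fd_basis. coord b (dd Y x v) *\<^sub>R dd T x b) = dd T x (dd Y x v)" for v
    by (rule linear_coord_expand[OF lin[OF assms(4)], symmetric])
  moreover have "(\<Sum>b\<in>fd_basis. coord b (Y x) *\<^sub>R dd (\<lambda>z. dd T z b) x v) = dd (\<lambda>z. dd T z (Y x)) x v" for v
  proof -
    have "((\<lambda>z. \<Sum>b\<in>fd_basis. coord b (Y x) *\<^sub>R dd T z b) has_derivative
        (\<lambda>v. \<Sum>b\<in>fd_basis. coord b (Y x) *\<^sub>R dd (\<lambda>z. dd T z b) x v)) (at x)"
      by (intro has_derivative_sum has_derivative_scaleR_right dT)
    then have "((\<lambda>z. dd T z (Y x)) has_derivative
        (\<lambda>v. \<Sum>b\<in>fd_basis. coord b (Y x) *\<^sub>R dd (\<lambda>z. dd T z b) x v)) (at x)"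
      by (rule has_derivative_local[OF assms(1,4), rotated]) (rule linear_coord_expand[OF lin, symmetric])
    from dd_eqI[OF this] show ?thesis by simp
  qed
  ultimately show ?thesis by (simp add: sum.distrib)
qed

text \<open>Differentiating the relation between \<open>Y\<close> and \<open>Y'\<close> produces a
  second derivative of \<open>T\<close>. In the difference that forms the bracket, the two
  second-derivative terms are equal by symmetry and cancel.\<close>

lemma brk_related:
  fixes T :: "'v::finite_dim_space \<Rightarrow> 'w::finite_dim_space"
  assumes "open A" "open B" "smooth_on A T" "T ` A \<subseteq> B"
    and X: "smooth_on A X" "smooth_on A Y" and X': "smooth_on B X'" "smooth_on B Y'"
    and rel: "\<And>x. x \<in> A \<Longrightarrow> X' (T x) = dd T x (X x)" "\<And>x. x \<in> A \<Longrightarrow> Y' (T x) = dd T x (Y x)"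
    and x: "x \<in> A"
  shows "brk X' Y' (T x) = dd T x (brk X Y x)"
proof -
  have key: "dd Y' (T x) (dd T x v) = dd (\<lambda>z. dd T z (Y x)) x v + dd T x (dd Y x v)"
    if "smooth_on A Y" "smooth_on B Y'" "\<And>x. x \<in> A \<Longrightarrow> Y' (T x) = dd T x (Y x)" for Y Y' v
  proof -
    have Tx: "T x \<in> B" using assms(4) x by auto
    have "((\<lambda>z. Y' (T z)) has_derivative (\<lambda>v. dd Y' (T x) (dd T x v))) (at x)"
      by (rule has_derivative_compose[OF smooth_on_derivative[OF assms(1,3) x] smooth_on_derivative[OF assms(2) that(2) Tx]])
    then have "((\<lambda>z. dd T z (Y z)) has_derivative (\<lambda>v. dd Y' (T x) (dd T x v))) (at x)"
      by (rule has_derivative_local[OF assms(1) x that(3), rotated])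
    from has_derivative_unique[OF this dd_apply_has_derivative[OF assms(1,3) that(1) x]]
    show ?thesis by meson
  qed
  have "brk X' Y' (T x) = dd Y' (T x) (dd T x (X x)) - dd X' (T x) (dd T x (Y x))"
    using rel[OF x] by (simp add: brk_def)
  also have "\<dots> = dd T x (dd Y x (X x)) - dd T x (dd X x (Y x))"
    using key[OF X(2) X'(2) rel(2)] key[OF X(1) X'(1) rel(1)]
      second_derivative_symmetric[OF assms(1,3) x, of "Y x" "X x"] by simp
  also have "\<dots> = dd T x (brk X Y x)"
    by (simp add: brk_def linear_diff[OF smooth_on_dd_linear[OF assms(1,3) x]])
  finally show ?thesis .
qed

definition diffeo :: "'v::real_normed_vector set \<Rightarrow> 'w::real_normed_vector set \<Rightarrow> ('v \<Rightarrow> 'w) \<Rightarrow> ('w \<Rightarrow> 'v) \<Rightarrow> bool" where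
  "diffeo A B \<Theta> \<Psi> \<longleftrightarrow> open A \<and> open B \<and> smooth_on A \<Theta> \<and> smooth_on B \<Psi> \<and> \<Theta> ` A \<subseteq> B \<and> \<Psi> ` B \<subseteq> A \<and>
    (\<forall>x\<in>A. \<Psi> (\<Theta> x) = x) \<and> (\<forall>y\<in>B. \<Theta> (\<Psi> y) = y)"

lemma diffeo_inverse: "diffeo A B \<Theta> \<Psi> \<Longrightarrow> diffeo B A \<Psi> \<Theta>"
  by (auto simp: diffeo_def)

lemma diffeo_dd_inverse:
  assumes "diffeo A B \<Theta> \<Psi>" "x \<in> A"
  shows "dd \<Psi> (\<Theta> x) (dd \<Theta> x v) = v"
proof -
  have "((\<lambda>x. \<Psi> (\<Theta> x)) has_derivative (\<lambda>v. dd \<Psi> (\<Theta> x) (dd \<Theta> x v))) (at x)"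
    by (rule has_derivative_compose[OF smooth_on_derivative smooth_on_derivative])
      (use assms in \<open>auto simp: diffeo_def\<close>)
  then have "((\<lambda>x. x) has_derivative (\<lambda>v. dd \<Psi> (\<Theta> x) (dd \<Theta> x v))) (at x)"
    by (rule has_derivative_local[of A, rotated 3]) (use assms in \<open>auto simp: diffeo_def\<close>)
  from has_derivative_unique[OF this has_derivative_ident] show ?thesis by meson
qed

lemma diffeo_restrict:
  assumes "diffeo A B \<Theta> \<Psi>" "open W"
  shows "diffeo (A \<inter> W) {y \<in> B. \<Psi> y \<in> W} \<Theta> \<Psi>"
proof -
  have "{y \<in> B. \<Psi> y \<in> W} = B \<inter> \<Psi> -` W" by auto
  moreover have "open (B \<inter> \<Psi> -` W)"
    using assms by (intro continuous_open_preimage) (auto simp: diffeo_def intro: smooth_on_imp_continuous)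
  ultimately show ?thesis
    using assms by (auto simp: diffeo_def intro: smooth_on_subset)
qed

lemma diffeo_compose:
  fixes \<Theta> :: "'u::finite_dim_space \<Rightarrow> 'v::finite_dim_space" and \<Theta>' :: "'v \<Rightarrow> 'w::finite_dim_space"
  assumes "diffeo A B \<Theta> \<Psi>" "diffeo A' B' \<Theta>' \<Psi>'"
  shows "diffeo {x \<in> A. \<Theta> x \<in> A'} {y \<in> B'. \<Psi>' y \<in> B} (\<lambda>x. \<Theta>' (\<Theta> x)) (\<lambda>y. \<Psi> (\<Psi>' y))"
proof -
  let ?A = "{x \<in> A. \<Theta> x \<in> A'}" and ?B = "{y \<in> B'. \<Psi>' y \<in> B}"
  note d = assms(1)[unfolded diffeo_def] and d' = assms(2)[unfolded diffeo_def]
  have oA: "open ?A"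
    using continuous_open_preimage[of A \<Theta> A'] d d' smooth_on_imp_continuous[of A \<Theta>]
    by (simp add: vimage_def Int_def)
  have oB: "open ?B"
    using continuous_open_preimage[of B' \<Psi>' B] d d' smooth_on_imp_continuous[of B' \<Psi>']
    by (simp add: vimage_def Int_def)
  have "smooth_on ?A (\<lambda>x. \<Theta>' (\<Theta> x))"
    by (rule smooth_on_compose[OF oA, of A']) (use d d' in \<open>auto intro: smooth_on_subset\<close>)
  moreover have "smooth_on ?B (\<lambda>y. \<Psi> (\<Psi>' y))"
    by (rule smooth_on_compose[OF oB, of B]) (use d d' in \<open>auto intro: smooth_on_subset\<close>)
  ultimately show ?thesis
    unfolding diffeo_def using oA oB d d' by auto
qed

subsection \<open>Flow boxes\<close>

text \<open>The derivative vanishes off \<open>K\<close> and is bounded on it, hence bounded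
  everywhere. A global constant is needed to solve the cut-off equation for a time independent of
  the starting point.\<close>

lemma compact_support_Lipschitz:
  fixes G :: "'v::finite_dim_space \<Rightarrow> 'w::real_normed_vector"
  assumes "smooth_on UNIV G" "compact K" "\<And>x. x \<notin> K \<Longrightarrow> G x = 0"
  shows "\<exists>L\<ge>0. \<forall>x y. norm (G x - G y) \<le> L * norm (x - y)"
proof -
  have dG: "(G has_derivative dd G x) (at x)" for x
    by (rule smooth_on_derivative[OF open_UNIV assms(1)]) simp
  have out: "dd G x v = 0" if "x \<notin> K" for x v
  proof -
    have "dd G x = dd (\<lambda>x. 0) x"
      by (rule dd_local[of "- K"]) (use assms that compact_imp_closed in auto)
    then show ?thesis by simp
  qed
  have "\<exists>B. \<forall>x. norm (dd G x b) \<le> B" for b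
  proof -
    have "continuous_on K (\<lambda>x. dd G x b)"
      by (rule continuous_on_subset[OF smooth_on_imp_continuous[OF smooth_on_dd[OF open_UNIV assms(1)]]]) simp
    then have "bounded ((\<lambda>x. dd G x b) ` K)"
      by (rule compact_imp_bounded[OF compact_continuous_image[OF _ assms(2)]])
    then obtain B where B: "\<forall>x\<in>(\<lambda>x. dd G x b) ` K. norm x \<le> B" unfolding bounded_iff by blast
    have "norm (dd G x b) \<le> \<bar>B\<bar>" for x
      using B out[of x b] by (cases "x \<in> K") force+
    then show ?thesis by blast
  qed
  then have "\<exists>B. \<forall>b x. norm (dd G x b) \<le> B b" by (intro choice allI)
  then obtain B where B: "\<And>b x. norm (dd G x b) \<le> B b" by blast
  have "\<exists>c. \<forall>b x. norm (coord b (x::'v)) \<le> norm x * c b"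
    by (intro choice allI) (rule bounded_linear.bounded[OF coord_bounded_linear])
  then obtain c where c: "\<And>b x. norm (coord b (x::'v)) \<le> norm x * c b" by blast
  define L where "L = (\<Sum>b\<in>(fd_basis::'v set). \<bar>c b\<bar> * \<bar>B b\<bar>)"
  have L: "L \<ge> 0" unfolding L_def by (auto intro: sum_nonneg)
  have est: "norm (dd G x v) \<le> L * norm v" for x v
  proof -
    have "norm (dd G x v) = norm (\<Sum>b\<in>fd_basis. coord b v *\<^sub>R dd G x b)"
      using linear_coord_expand[OF has_derivative_linear[OF dG], of x v] by simp
    also have "\<dots> \<le> (\<Sum>b\<in>(fd_basis::'v set). (norm v * \<bar>c b\<bar>) * \<bar>B b\<bar>)"
    proof (rule sum_norm_le)
      fix b :: 'v
      have "norm (dd G x b) \<le> \<bar>B b\<bar>" using B[of x b] by linarith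
      moreover have "\<bar>coord b v\<bar> \<le> norm v * \<bar>c b\<bar>"
        using c[of b v] mult_left_mono[OF abs_ge_self[of "c b"], of "norm v"] by simp
      ultimately show "norm (coord b v *\<^sub>R dd G x b) \<le> (norm v * \<bar>c b\<bar>) * \<bar>B b\<bar>"
        unfolding norm_scaleR by (intro mult_mono) auto
    qed
    also have "\<dots> = L * norm v" by (simp add: L_def sum_distrib_left mult_ac)
    finally show ?thesis .
  qed
  have "norm (G x - G y) \<le> L * norm (x - y)" for x y
    by (rule differentiable_bound[where S=UNIV and f'="dd G"]) (use dG est L in \<open>auto intro!: onorm_bound\<close>)
  then show ?thesis using L by blast
qed

text \<open>After normalizing \<open>lam X = 1\<close>, the flow of \<open>X\<close> raises the coordinate \<open>lam\<close> with unit speed.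
  So both the straightening map (follow the flow for the time \<open>- lam x\<close>) and its inverse are
  explicit, and no inverse function theorem is needed.\<close>

lemma flow_box:
  fixes X Q :: "'v::finite_dim_space \<Rightarrow> 'v" and lam :: "'v \<Rightarrow> real"
  assumes Q: "linear Q" "\<And>x. Q (Q x) = Q x"
    and lam: "linear lam" "\<And>x. lam (Q x) = lam x" "lam e = 1" "Q e = e"
    and W: "open W" "0 \<in> W" "\<And>x. x \<in> W \<longleftrightarrow> Q x \<in> W"
    and X: "smooth_on W X" "\<And>x. x \<in> W \<Longrightarrow> X (Q x) = X x" "\<And>x. x \<in> W \<Longrightarrow> Q (X x) = X x"
      "\<And>x. x \<in> W \<Longrightarrow> lam (X x) = 1"
  shows "\<exists>\<Theta> \<Psi> A B. diffeo A B \<Theta> \<Psi> \<and> 0 \<in> A \<and> A \<subseteq> W \<and> \<Theta> 0 = 0 \<and>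
    (\<forall>y\<in>B. dd \<Psi> y e = X (\<Psi> y)) \<and> (\<forall>x\<in>A. lam (\<Theta> x) = lam x) \<and>
    (\<forall>x\<in>A. Q (\<Theta> x - x) = \<Theta> x - x) \<and> (\<forall>x\<in>A. \<forall>l. Q l = 0 \<longrightarrow> x + l \<in> A \<and> \<Theta> (x + l) = \<Theta> x + l)"
proof -
  obtain \<beta> K U where b: "smooth_on UNIV \<beta>" "compact K" "K \<subseteq> W" "open U" "0 \<in> U" "U \<subseteq> K"
    "\<And>x. x \<in> U \<Longrightarrow> \<beta> x = (1::real)" "\<And>x. x \<notin> K \<Longrightarrow> \<beta> x = 0"
    using bump_exists[OF W(1,2)] by blast
  \<comment> \<open>The difference \<open>X - e\<close> is cut off, so that \<open>e\<close> plus
    the result is smooth everywhere and agrees with \<open>X\<close> where the bump is 1.\<close>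
  define G0 where "G0 = (\<lambda>v. \<beta> v *\<^sub>R (X v - e))"
  have G0_smooth: "smooth_on UNIV G0"
  proof (rule smooth_on_local)
    fix x
    show "\<exists>O'. open O' \<and> x \<in> O' \<and> smooth_on O' G0"
    proof (cases "x \<in> W")
      case True
      have "smooth_on W G0"
        unfolding G0_def
        by (intro smooth_on_scaleR smooth_on_diff smooth_on_const W(1) X(1) smooth_on_subset[OF b(1)]) auto
      then show ?thesis using True W(1) by blast
    next
      case False
      have "smooth_on (- K) G0"
        by (rule smooth_on_cong[of _ "\<lambda>x. 0"]) (use b(8) compact_imp_closed[OF b(2)] in \<open>auto simp: G0_def intro: smooth_on_const\<close>)
      then show ?thesis using False b(2,3) compact_imp_closed by (intro exI[of _ "- K"]) auto
    qed
  qed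
  obtain L0 where L0: "L0 \<ge> 0" "\<And>x y. norm (G0 x - G0 y) \<le> L0 * norm (x - y)"
    using compact_support_Lipschitz[OF G0_smooth b(2)] b(8) by (auto simp: G0_def)
  obtain NQ where NQ: "NQ \<ge> 0" "\<And>x. norm (Q x) \<le> norm x * NQ"
    using bounded_linear.nonneg_bounded[OF linear_bounded_linear[OF Q(1)]] by blast
  \<comment> \<open>The bump need not be constant along the kernel of \<open>Q\<close>; composing
    with \<open>Q\<close> restores this invariance.\<close>
  define g where "g = (\<lambda>x. G0 (Q x))"
  define L where "L = L0 * NQ"
  have L: "L \<ge> 0" using L0 NQ by (simp add: L_def)
  have g_lip: "norm (g x - g y) \<le> L * norm (x - y)" for x y
  proof -
    have "norm (g x - g y) \<le> L0 * norm (Q x - Q y)" unfolding g_def by (rule L0)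
    also have "\<dots> \<le> L0 * (norm (x - y) * NQ)"
      using NQ(2)[of "x - y"] L0(1) by (intro mult_left_mono) (simp_all add: linear_diff[OF Q(1)])
    finally show ?thesis by (simp add: L_def mult_ac)
  qed
  have g_smooth: "smooth_on UNIV g"
    unfolding g_def by (rule smooth_on_compose[OF _ _ smooth_on_linear[OF _ Q(1)] G0_smooth]) auto
  have lam_g: "lam (g x) = 0" for x
    using b(3,8) X(4)[of "Q x"] lam
    by (cases "Q x \<in> K") (auto simp: g_def G0_def linear_scale[OF lam(1)] linear_diff[OF lam(1)] linear_0[OF lam(1)])
  have Q_g: "Q (g x) = g x" for x
    using b(3,8) X(3)[of "Q x"] lam
    by (cases "Q x \<in> K") (auto simp: g_def G0_def linear_scale[OF Q(1)] linear_diff[OF Q(1)] linear_0[OF Q(1)])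
  have g_l: "g (x + l) = g x" if "Q l = 0" for x l
    using that by (simp add: g_def linear_add[OF Q(1)])
  define T where "T = 1 / (2 * (L + 1))"
  have T: "T > 0" "L * T < 1" unfolding T_def using L by (auto simp: field_simps)
  \<comment> \<open>The unknown is the deviation of an integral curve of \<open>e + g\<close> from
    the straight line \<open>p + t *\<^sub>R e\<close>, so it starts at 0.\<close>
  have ex: "\<exists>u. u 0 = 0 \<and> (\<forall>t\<in>{-T..T}. (u has_vector_derivative g (p + t *\<^sub>R e + u t)) (at t within {-T..T}))" for p
  proof (rule ode_exists)
    show "continuous_on ({- T..T} \<times> UNIV) (\<lambda>(t, x). g (p + t *\<^sub>R e + x))"
      unfolding case_prod_unfold
      by (rule continuous_on_compose2[OF smooth_on_imp_continuous[OF g_smooth]]) (auto intro!: continuous_intros)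
    show "norm (g (p + t *\<^sub>R e + x) - g (p + t *\<^sub>R e + y)) \<le> L * norm (x - y)" for t x y
      using g_lip[of "p + t *\<^sub>R e + x" "p + t *\<^sub>R e + y"] by simp
  qed (use T L in auto)
  have "\<exists>z. \<forall>p. z p 0 = 0 \<and> (\<forall>t\<in>{-T..T}. (z p has_vector_derivative g (p + t *\<^sub>R e + z p t)) (at t within {-T..T}))"
    by (intro choice allI ex)
  then obtain \<zeta> where \<zeta>: "\<And>p. \<zeta> p 0 = 0"
    "\<And>p t. t \<in> {-T..T} \<Longrightarrow> (\<zeta> p has_vector_derivative g (p + t *\<^sub>R e + \<zeta> p t)) (at t within {-T..T})" by blast
  have \<zeta>_at: "(\<zeta> p has_vector_derivative g (p + t *\<^sub>R e + \<zeta> p t)) (at t)" if "\<bar>t\<bar> < T" for p t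
  proof -
    have "at t within {-T..T} = at t" using that by (intro at_within_Icc_at) auto
    moreover have "t \<in> {-T..T}" using that by auto
    ultimately show ?thesis using \<zeta>(2)[of t p] by simp
  qed
  define z where "z = (\<lambda>(t, p). \<zeta> p t)"
  have z_smooth: "smooth_on ({-T<..<T} \<times> UNIV) z"
    unfolding smooth_on_def
  proof
    fix k
    let ?F = "\<lambda>y::real \<times> 'v \<times> 'v. g (fst (snd y) + fst y *\<^sub>R e + snd (snd y))"
    have Fs: "smooth_on UNIV ?F"
      by (rule smooth_on_compose[OF _ _ _ g_smooth])
        (auto intro!: smooth_on_add smooth_on_scaleR smooth_on_const smooth_on_bounded_linear bounded_linear_intros
          bounded_linear_fst bounded_linear_fst_comp bounded_linear_snd_comp)
    have lo: "lipschitz_ode ?F T L UNIV"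
    proof
      show "continuous_on ({- T<..<T} \<times> UNIV \<times> UNIV) ?F"
        by (rule continuous_on_subset[OF smooth_on_imp_continuous[OF Fs]]) simp
      show "norm (?F (t, p, x) - ?F (t, p, y)) \<le> L * norm (x - y)" for t p x y
        using g_lip[of "p + t *\<^sub>R e + x" "p + t *\<^sub>R e + y"] by simp
    qed (use T L in auto)
    show "Ck_on k ({-T<..<T} \<times> UNIV) z"
    proof (rule ode_solution_Ck[OF lo])
      show "Ck_on k ({- T<..<T} \<times> UNIV \<times> UNIV) ?F"
        using Ck_on_subset Fs unfolding smooth_on_def by blast
      show "lipschitz_ode.solution ?F T UNIV z"
        unfolding lipschitz_ode.solution_def[OF lo] z_def using \<zeta>(1) \<zeta>_at by auto
    qed
  qed
  \<comment> \<open>\<open>lam\<close> of the deviation has derivative 0, so it is 0 by the integral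
    inequality with Lipschitz and error constant both 0. The same device shows next that the
    deviation lies in the image of \<open>Q\<close>.\<close>
  have lam_z: "lam (\<zeta> p t) = 0" if "t \<in> {-T..T}" for p t
  proof -
    have "norm (lam (\<zeta> p t)) \<le> T * 0 / (1 - 0 * T)"
    proof (rule integral_inequality_bound[where u="\<lambda>t. lam (\<zeta> p t)" and a="-T" and b=T and u'="\<lambda>t. lam (g (p + t *\<^sub>R e + \<zeta> p t))"])
      show "((\<lambda>t. lam (\<zeta> p t)) has_vector_derivative lam (g (p + t *\<^sub>R e + \<zeta> p t))) (at t within {-T..T})"
        if "t \<in> {-T..T}" for t
        by (rule bounded_linear.has_vector_derivative[OF linear_bounded_linear[OF lam(1)] \<zeta>(2)[OF that]])
    qed (use T that \<zeta>(1) lam_g in \<open>auto simp: linear_0[OF lam(1)]\<close>)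
    then show ?thesis by simp
  qed
  have Q_z: "Q (\<zeta> p t) = \<zeta> p t" if "t \<in> {-T..T}" for p t
  proof -
    have "norm (Q (\<zeta> p t) - \<zeta> p t) \<le> T * 0 / (1 - 0 * T)"
    proof (rule integral_inequality_bound[where u="\<lambda>t. Q (\<zeta> p t) - \<zeta> p t" and a="-T" and b=T and
          u'="\<lambda>t. Q (g (p + t *\<^sub>R e + \<zeta> p t)) - g (p + t *\<^sub>R e + \<zeta> p t)"])
      show "((\<lambda>t. Q (\<zeta> p t) - \<zeta> p t) has_vector_derivative
          Q (g (p + t *\<^sub>R e + \<zeta> p t)) - g (p + t *\<^sub>R e + \<zeta> p t)) (at t within {-T..T})"
        if "t \<in> {-T..T}" for t
        by (intro has_vector_derivative_diff \<zeta>(2)[OF that]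
            bounded_linear.has_vector_derivative[OF linear_bounded_linear[OF Q(1)] \<zeta>(2)[OF that]])
    qed (use T that \<zeta>(1) Q_g in \<open>auto simp: linear_0[OF Q(1)]\<close>)
    then show ?thesis by simp
  qed
  have z_l: "\<zeta> (p + l) t = \<zeta> p t" if l: "Q l = 0" and t: "t \<in> {-T..T}" for p l t
  proof (rule ode_unique[where u="\<zeta> (p + l)" and v="\<zeta> p" and a="-T" and b=T and S=T and L=L and G="\<lambda>t x. g (p + t *\<^sub>R e + x)"])
    show "(\<zeta> (p + l) has_vector_derivative g (p + t *\<^sub>R e + \<zeta> (p + l) t)) (at t within {-T..T})"
      if "t \<in> {-T..T}" for t
      using \<zeta>(2)[OF that, of "p + l"] g_l[OF l, of "p + t *\<^sub>R e + \<zeta> (p + l) t"] by (simp add: algebra_simps)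
    show "norm (g (p + t *\<^sub>R e + x) - g (p + t *\<^sub>R e + y)) \<le> L * norm (x - y)" for t x y
      using g_lip[of "p + t *\<^sub>R e + x" "p + t *\<^sub>R e + y"] by simp
  qed (use T L t \<zeta> in auto)
  define Fl where "Fl = (\<lambda>t x. x + t *\<^sub>R e + \<zeta> x t)"
  have lam_Fl: "lam (Fl t x) = lam x + t" if "t \<in> {-T..T}" for t x
    using lam_z[OF that] lam(3) by (simp add: Fl_def linear_add[OF lam(1)] linear_scale[OF lam(1)])
  \<comment> \<open>The flow law, by uniqueness: as functions of \<open>s\<close>, the deviation
    restarted at \<open>Fl t x\<close> and the shifted original one solve the same equation.\<close>
  have inv: "Fl (- t) (Fl t x) = x" if t: "\<bar>t\<bar> < T" for t x
  proof -
    let ?x' = "Fl t x"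
    have "\<zeta> ?x' (- t) = \<zeta> x (t + (- t)) - \<zeta> x t"
    proof (rule ode_unique[where u="\<zeta> ?x'" and v="\<lambda>s. \<zeta> x (t + s) - \<zeta> x t" and t="-t" and a="min 0 (-t)" and b="max 0 (-t)" and S=T and L=L and G="\<lambda>s y. g (?x' + s *\<^sub>R e + y)"])
      fix s assume s: "s \<in> {min 0 (- t)..max 0 (- t)}"
      have s1: "\<bar>s\<bar> < T" "\<bar>t + s\<bar> < T" using s t by (auto simp: min_def max_def split: if_splits)
      show "(\<zeta> ?x' has_vector_derivative g (?x' + s *\<^sub>R e + \<zeta> ?x' s)) (at s within {min 0 (- t)..max 0 (- t)})"
        by (rule has_vector_derivative_at_within[OF \<zeta>_at[OF s1(1)]])
      have "((\<zeta> x \<circ> (\<lambda>s. t + s)) has_vector_derivative (1 *\<^sub>R g (x + (t + s) *\<^sub>R e + \<zeta> x (t + s)))) (at s)"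
        by (rule vector_diff_chain_at[of "\<lambda>s. t + s" 1 s "\<zeta> x", OF _ \<zeta>_at[OF s1(2)]])
          (auto intro!: derivative_eq_intros)
      then have "((\<lambda>s. \<zeta> x (t + s)) has_vector_derivative g (x + (t + s) *\<^sub>R e + \<zeta> x (t + s))) (at s)"
        unfolding o_def scaleR_one .
      from has_vector_derivative_diff[OF this has_vector_derivative_const[of "\<zeta> x t"]]
      have "((\<lambda>s. \<zeta> x (t + s) - \<zeta> x t) has_vector_derivative g (x + (t + s) *\<^sub>R e + \<zeta> x (t + s))) (at s)"
        unfolding diff_zero .
      moreover have "x + (t + s) *\<^sub>R e + \<zeta> x (t + s) = ?x' + s *\<^sub>R e + (\<zeta> x (t + s) - \<zeta> x t)"
        by (simp add: Fl_def algebra_simps)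
      ultimately have "((\<lambda>s. \<zeta> x (t + s) - \<zeta> x t) has_vector_derivative
          g (?x' + s *\<^sub>R e + (\<zeta> x (t + s) - \<zeta> x t))) (at s)"
        by (simp only:)
      then show "((\<lambda>s. \<zeta> x (t + s) - \<zeta> x t) has_vector_derivative
          g (?x' + s *\<^sub>R e + (\<zeta> x (t + s) - \<zeta> x t))) (at s within {min 0 (- t)..max 0 (- t)})"
        by (rule has_vector_derivative_at_within)
    next
      show "norm (g (?x' + s *\<^sub>R e + y) - g (?x' + s *\<^sub>R e + y')) \<le> L * norm (y - y')" for s y y'
        using g_lip[of "?x' + s *\<^sub>R e + y" "?x' + s *\<^sub>R e + y'"] by simp
    qed (use T L t \<zeta> in auto)
    then show ?thesis by (simp add: Fl_def \<zeta>(1))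
  qed
  define \<Theta> where "\<Theta> = (\<lambda>x. x + \<zeta> x (- lam x))"
  define \<Psi> where "\<Psi> = (\<lambda>y. y + \<zeta> (y - lam y *\<^sub>R e) (lam y))"
  have \<Theta>_Fl: "\<Theta> x = Fl (- lam x) x + lam x *\<^sub>R e" for x by (simp add: \<Theta>_def Fl_def)
  have \<Psi>_Fl: "\<Psi> y = Fl (lam y) (y - lam y *\<^sub>R e)" for y by (simp add: \<Psi>_def Fl_def)
  have lam_\<Theta>: "lam (\<Theta> x) = lam x" if "\<bar>lam x\<bar> < T" for x
    using that lam_z[of "- lam x" x] by (simp add: \<Theta>_def linear_add[OF lam(1)] abs_less_iff less_imp_le)
  have lam_\<Psi>: "lam (\<Psi> y) = lam y" if "\<bar>lam y\<bar> < T" for y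
    using that lam_z[of "lam y" "y - lam y *\<^sub>R e"]
    by (simp add: \<Psi>_def linear_add[OF lam(1)] abs_less_iff minus_le_iff less_imp_le)
  have \<Psi>\<Theta>: "\<Psi> (\<Theta> x) = x" if "\<bar>lam x\<bar> < T" for x
    using inv[of "- lam x" x] that lam_\<Theta>[OF that] by (simp add: \<Psi>_Fl) (simp add: \<Theta>_Fl)
  have \<Theta>\<Psi>: "\<Theta> (\<Psi> y) = y" if "\<bar>lam y\<bar> < T" for y
    using inv[of "lam y" "y - lam y *\<^sub>R e"] that lam_\<Psi>[OF that] by (simp add: \<Theta>_Fl) (simp add: \<Psi>_Fl)
  define St where "St = {x. \<bar>lam x\<bar> < T}"
  have lam_cont: "continuous_on UNIV lam"
    using linear_continuous_on[OF linear_bounded_linear[OF lam(1)]] .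
  have St: "open St" unfolding St_def by (intro open_Collect_less continuous_intros lam_cont)
  have oTU: "open ({-T<..<T} \<times> (UNIV :: 'v set))" by (intro open_Times) auto
  have \<Theta>_smooth: "smooth_on St \<Theta>"
  proof -
    have "smooth_on St (\<lambda>x. x + z (- lam x, x))"
      by (intro smooth_on_add St smooth_on_ident smooth_on_compose[OF St oTU _ z_smooth] smooth_on_Pair
          smooth_on_minus smooth_on_linear lam(1)) (auto simp: St_def)
    then show ?thesis by (simp add: \<Theta>_def z_def)
  qed
  have \<Psi>_smooth: "smooth_on St \<Psi>"
  proof -
    have "smooth_on St (\<lambda>y. y + z (lam y, y - lam y *\<^sub>R e))"
      by (intro smooth_on_add St smooth_on_ident smooth_on_compose[OF St oTU _ z_smooth] smooth_on_Pair
          smooth_on_diff smooth_on_scaleR smooth_on_const smooth_on_linear lam(1)) (auto simp: St_def)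
    then show ?thesis by (simp add: \<Psi>_def z_def)
  qed
  \<comment> \<open>On the preimage of \<open>U\<close> under \<open>Q\<close> the cut-off is
    inactive, and \<open>e + g\<close> coincides with \<open>X\<close>.\<close>
  define A where "A = St \<inter> Q -` U"
  define B where "B = St \<inter> (\<lambda>y. Q (\<Psi> y)) -` U"
  have oA: "open A"
    unfolding A_def
    by (rule continuous_open_preimage[OF linear_continuous_on[OF linear_bounded_linear[OF Q(1)]] St b(4)])
  have oB: "open B"
    unfolding B_def
    by (rule continuous_open_preimage[OF smooth_on_imp_continuous[OF smooth_on_linear_comp[OF St Q(1) \<Psi>_smooth]] St b(4)])
  have AW: "A \<subseteq> W" using W(3) b(3,6) by (auto simp: A_def)
  have dif: "diffeo A B \<Theta> \<Psi>"
    unfolding diffeo_def using oA oB smooth_on_subset[OF \<Theta>_smooth, of A] smooth_on_subset[OF \<Psi>_smooth, of B]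
    by (auto simp: A_def B_def St_def lam_\<Theta> lam_\<Psi> \<Psi>\<Theta> \<Theta>\<Psi>)
  moreover have "0 \<in> A"
    using b(5) T by (simp add: A_def St_def linear_0[OF lam(1)] linear_0[OF Q(1)])
  moreover have "\<Theta> 0 = 0" by (simp add: \<Theta>_def linear_0[OF lam(1)] \<zeta>)
  moreover have "dd \<Psi> y e = X (\<Psi> y)" if y: "y \<in> B" for y
  proof -
    define w where "w = y - lam y *\<^sub>R e"
    have yS: "\<bar>lam y\<bar> < T" using y by (simp add: B_def St_def)
    have "((\<lambda>h. \<Psi> (y + h *\<^sub>R e)) has_vector_derivative dd \<Psi> (y + 0 *\<^sub>R e) e) (at 0)"
      using smooth_on_differentiable[OF St \<Psi>_smooth, of y] y by (intro dd_along_line) (simp add: B_def)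
    moreover have "\<Psi> (y + h *\<^sub>R e) = w + (lam y + h) *\<^sub>R e + \<zeta> w (lam y + h)" for h
      by (simp add: \<Psi>_def w_def linear_add[OF lam(1)] linear_scale[OF lam(1)] lam(3) algebra_simps)
    moreover have "((\<lambda>h. w + (lam y + h) *\<^sub>R e + \<zeta> w (lam y + h)) has_vector_derivative
        e + g (w + (lam y + 0) *\<^sub>R e + \<zeta> w (lam y + 0))) (at 0)"
    proof -
      have 1: "((\<zeta> w \<circ> (\<lambda>h. lam y + h)) has_vector_derivative (1 *\<^sub>R g (w + (lam y + 0) *\<^sub>R e + \<zeta> w (lam y + 0)))) (at 0)"
        by (rule vector_diff_chain_at[OF _ \<zeta>_at]) (use yS in \<open>auto intro!: derivative_eq_intros\<close>)
      have 2: "((\<lambda>h. w + (lam y + h) *\<^sub>R e) has_vector_derivative e) (at 0)"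
        by (auto intro!: derivative_eq_intros simp: has_vector_derivative_def)
      show ?thesis
        using has_vector_derivative_add[OF 2 1] by (simp add: o_def)
    qed
    ultimately have "dd \<Psi> (y + 0 *\<^sub>R e) e = e + g (w + (lam y + 0) *\<^sub>R e + \<zeta> w (lam y + 0))"
      by (simp only: vector_derivative_unique_at)
    then have "dd \<Psi> y e = e + g (w + lam y *\<^sub>R e + \<zeta> w (lam y))" by simp
    also have "w + lam y *\<^sub>R e + \<zeta> w (lam y) = \<Psi> y" by (simp add: \<Psi>_def w_def)
    also have "e + g (\<Psi> y) = X (\<Psi> y)"
    proof -
      have "\<Psi> y \<in> A" using dif y by (auto simp: diffeo_def)
      then have "Q (\<Psi> y) \<in> U" "\<Psi> y \<in> W" using AW by (auto simp: A_def)
      then show ?thesis using b(7) X(2) by (simp add: g_def G0_def)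
    qed
    finally show ?thesis .
  qed
  moreover have "lam (\<Theta> x) = lam x" if "x \<in> A" for x using that lam_\<Theta> by (simp add: A_def St_def)
  moreover have "Q (\<Theta> x - x) = \<Theta> x - x" if "x \<in> A" for x
    using that Q_z[of "- lam x" x] by (simp add: \<Theta>_def A_def St_def abs_less_iff less_imp_le)
  moreover have "x + l \<in> A \<and> \<Theta> (x + l) = \<Theta> x + l" if "x \<in> A" "Q l = 0" for x l
  proof -
    have "lam l = 0" using lam(2)[of l] that(2) by (simp add: linear_0[OF lam(1)])
    then show ?thesis
      using that z_l[OF that(2), of "- lam x" x]
      by (simp add: A_def St_def \<Theta>_def linear_add[OF lam(1)] linear_add[OF Q(1)] abs_less_iff less_imp_le)
  qed
  ultimately show ?thesis using AW by (intro exI[of _ \<Theta>] exI[of _ \<Psi>] exI[of _ A] exI[of _ B]) blast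
qed

subsection \<open>Finitely generated modules of vector fields\<close>

definition in_mod :: "'v::real_normed_vector set \<Rightarrow> 'i set \<Rightarrow> ('i \<Rightarrow> 'v \<Rightarrow> 'w::real_normed_vector) \<Rightarrow> ('v \<Rightarrow> 'w) \<Rightarrow> bool" where
  "in_mod W I Y f \<longleftrightarrow> (\<exists>a. (\<forall>i\<in>I. smooth_on W (a i)) \<and> (\<forall>x\<in>W. f x = (\<Sum>i\<in>I. a i x *\<^sub>R Y i x)))"

lemma in_modI:
  "(\<And>i. i \<in> I \<Longrightarrow> smooth_on W (a i)) \<Longrightarrow> (\<And>x. x \<in> W \<Longrightarrow> f x = (\<Sum>i\<in>I. a i x *\<^sub>R Y i x)) \<Longrightarrow> in_mod W I Y f"
  unfolding in_mod_def by blast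

lemma in_mod_base:
  assumes "finite I" "i \<in> I" "open W"
  shows "in_mod W I Y (Y i)"
proof (rule in_modI[where a="\<lambda>j x. if j = i then 1 else 0"])
  show "Y i x = (\<Sum>j\<in>I. (if j = i then 1 else 0) *\<^sub>R Y j x)" for x
    using assms by (simp add: if_distrib[of "\<lambda>c. c *\<^sub>R _"] cong: if_cong)
qed (use assms in \<open>auto intro: smooth_on_const\<close>)

lemma in_mod_cong: "(\<And>x. x \<in> W \<Longrightarrow> f x = g x) \<Longrightarrow> in_mod W I Y f \<Longrightarrow> in_mod W I Y g"
  unfolding in_mod_def by auto

lemma in_mod_subset: "in_mod W I Y f \<Longrightarrow> W' \<subseteq> W \<Longrightarrow> in_mod W' I Y f"
  unfolding in_mod_def by (meson smooth_on_subset subsetD)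

lemma in_mod_scale:
  assumes "open W" "smooth_on W c" "in_mod W I Y f"
  shows "in_mod W I Y (\<lambda>x. c x *\<^sub>R f x)"
proof -
  obtain a where a: "\<And>i. i \<in> I \<Longrightarrow> smooth_on W (a i)" "\<And>x. x \<in> W \<Longrightarrow> f x = (\<Sum>i\<in>I. a i x *\<^sub>R Y i x)"
    using assms(3) unfolding in_mod_def by blast
  show ?thesis
    by (rule in_modI[where a="\<lambda>i x. c x * a i x"]) (auto simp: a scaleR_sum_right intro!: smooth_on_mult assms)
qed

lemma in_mod_add:
  assumes "open W" "in_mod W I Y f" "in_mod W I Y g"
  shows "in_mod W I Y (\<lambda>x. f x + g x)"
proof -
  obtain a where a: "\<And>i. i \<in> I \<Longrightarrow> smooth_on W (a i)" "\<And>x. x \<in> W \<Longrightarrow> f x = (\<Sum>i\<in>I. a i x *\<^sub>R Y i x)"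
    using assms(2) unfolding in_mod_def by blast
  obtain b where b: "\<And>i. i \<in> I \<Longrightarrow> smooth_on W (b i)" "\<And>x. x \<in> W \<Longrightarrow> g x = (\<Sum>i\<in>I. b i x *\<^sub>R Y i x)"
    using assms(3) unfolding in_mod_def by blast
  show ?thesis
    by (rule in_modI[where a="\<lambda>i x. a i x + b i x"])
      (auto simp: a b scaleR_add_left sum.distrib intro!: smooth_on_add assms)
qed

lemma in_mod_minus:
  assumes "open W" "in_mod W I Y f"
  shows "in_mod W I Y (\<lambda>x. - f x)"
  using in_mod_scale[OF assms(1) smooth_on_const[OF assms(1)] assms(2), of "-1"] by simp

lemma in_mod_diff:
  assumes "open W" "in_mod W I Y f" "in_mod W I Y g"
  shows "in_mod W I Y (\<lambda>x. f x - g x)"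
  using in_mod_add[OF assms(1,2) in_mod_minus[OF assms(1,3)]] by simp

lemma in_mod_zero: "open W \<Longrightarrow> in_mod W I Y (\<lambda>x. 0)"
  by (rule in_modI[where a="\<lambda>i x. 0"]) (auto intro: smooth_on_const)

lemma in_mod_sum:
  assumes "open W" "\<And>j. j \<in> J \<Longrightarrow> in_mod W I Y (f j)"
  shows "in_mod W I Y (\<lambda>x. \<Sum>j\<in>J. f j x)"
  using assms(2)
  by (induction J rule: infinite_finite_induct) (auto intro: in_mod_zero in_mod_add assms(1))

lemma in_mod_trans:
  assumes "open W" "\<And>j. j \<in> J \<Longrightarrow> in_mod W I Y (Z j)" "in_mod W J Z f"
  shows "in_mod W I Y f"
proof -
  obtain a where a: "\<And>i. i \<in> J \<Longrightarrow> smooth_on W (a i)" "\<And>x. x \<in> W \<Longrightarrow> f x = (\<Sum>i\<in>J. a i x *\<^sub>R Z i x)"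
    using assms(3) unfolding in_mod_def by blast
  have "in_mod W I Y (\<lambda>x. \<Sum>i\<in>J. a i x *\<^sub>R Z i x)"
    by (intro in_mod_sum in_mod_scale assms a)
  then show ?thesis by (rule in_mod_cong[rotated]) (simp add: a)
qed

lemma in_mod_smooth:
  assumes "open W" "\<And>i. i \<in> I \<Longrightarrow> smooth_on W (Y i)" "in_mod W I Y f"
  shows "smooth_on W f"
proof -
  obtain a where a: "\<And>i. i \<in> I \<Longrightarrow> smooth_on W (a i)" "\<And>x. x \<in> W \<Longrightarrow> f x = (\<Sum>i\<in>I. a i x *\<^sub>R Y i x)"
    using assms(3) unfolding in_mod_def by blast
  have "smooth_on W (\<lambda>x. \<Sum>i\<in>I. a i x *\<^sub>R Y i x)"
    by (intro smooth_on_sum smooth_on_scaleR assms a)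
  then show ?thesis by (rule smooth_on_cong[OF assms(1), rotated]) (simp add: a)
qed

lemma in_mod_span: "in_mod W I Y f \<Longrightarrow> x \<in> W \<Longrightarrow> f x \<in> span ((\<lambda>i. Y i x) ` I)"
  unfolding in_mod_def by (elim exE conjE) (simp, intro span_sum span_scale span_base imageI)

lemma brk_sum_left:
  assumes "open W" "x \<in> W" "\<And>i. i \<in> I \<Longrightarrow> smooth_on W (a i)" "\<And>i. i \<in> I \<Longrightarrow> smooth_on W (Y i)"
    "h differentiable (at x)"
  shows "brk (\<lambda>x. \<Sum>i\<in>I. a i x *\<^sub>R Y i x) h x =
    (\<Sum>i\<in>I. a i x *\<^sub>R brk (Y i) h x - dd (a i) x (h x) *\<^sub>R Y i x)"
proof -
  have "((\<lambda>x. \<Sum>i\<in>I. a i x *\<^sub>R Y i x) has_derivative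
      (\<lambda>v. \<Sum>i\<in>I. a i x *\<^sub>R dd (Y i) x v + dd (a i) x v *\<^sub>R Y i x)) (at x)"
    by (intro has_derivative_sum has_derivative_scaleR smooth_on_derivative[OF assms(1) _ assms(2)] assms)
  from dd_eqI[OF this] show ?thesis
    using dd_linear[OF assms(5)]
    by (simp add: brk_def linear_sum linear_scale scaleR_diff_right sum.distrib sum_subtractf algebra_simps)
qed

text \<open>The Leibniz rule in each argument: derivatives of the coefficients only multiply
  generators. Antisymmetry reduces the second argument to the first.\<close>

lemma in_mod_brk:
  fixes Y :: "'i \<Rightarrow> 'v::finite_dim_space \<Rightarrow> 'v"
  assumes W: "open W" and Y: "\<And>i. i \<in> I \<Longrightarrow> smooth_on W (Y i)" and I: "finite I"
    and inv: "\<And>i j. i \<in> I \<Longrightarrow> j \<in> I \<Longrightarrow> in_mod W I Y (brk (Y i) (Y j))"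
    and f: "in_mod W I Y f" and g: "in_mod W I Y g"
  shows "in_mod W I Y (brk f g)"
proof -
  have left: "in_mod W I Y (brk f h)"
    if f: "in_mod W I Y f" and h: "smooth_on W h" and b: "\<And>i. i \<in> I \<Longrightarrow> in_mod W I Y (brk (Y i) h)" for f h
  proof -
    obtain a where a: "\<And>i. i \<in> I \<Longrightarrow> smooth_on W (a i)" "\<And>x. x \<in> W \<Longrightarrow> f x = (\<Sum>i\<in>I. a i x *\<^sub>R Y i x)"
      using f unfolding in_mod_def by blast
    have "in_mod W I Y (\<lambda>x. \<Sum>i\<in>I. a i x *\<^sub>R brk (Y i) h x - dd (a i) x (h x) *\<^sub>R Y i x)"
      by (intro in_mod_sum in_mod_diff in_mod_scale W a b in_mod_base I
          smooth_on_dd_apply[where g="\<lambda>x. x" and W=W] smooth_on_ident h) auto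
    then show ?thesis
    proof (rule in_mod_cong[rotated])
      fix x assume x: "x \<in> W"
      have "brk f h x = brk (\<lambda>x. \<Sum>i\<in>I. a i x *\<^sub>R Y i x) h x"
        by (rule brk_local[OF W x]) (use a in auto)
      also have "\<dots> = (\<Sum>i\<in>I. a i x *\<^sub>R brk (Y i) h x - dd (a i) x (h x) *\<^sub>R Y i x)"
        by (rule brk_sum_left[OF W x a(1) Y smooth_on_differentiable[OF W h x]])
      finally show "(\<Sum>i\<in>I. a i x *\<^sub>R brk (Y i) h x - dd (a i) x (h x) *\<^sub>R Y i x) = brk f h x" by simp
    qed
  qed
  have "in_mod W I Y (brk (Y i) g)" if i: "i \<in> I" for i
  proof -
    have "in_mod W I Y (brk g (Y i))" by (rule left[OF g Y[OF i]]) (rule inv[OF _ i])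
    from in_mod_minus[OF W this] show ?thesis by (rule in_mod_cong[rotated]) (simp add: brk_antisym[of "Y i"])
  qed
  from left[OF f in_mod_smooth[OF W Y g] this] show ?thesis .
qed

subsection \<open>Linear differential equations preserve spans\<close>

text \<open>\<open>N r * exp (- K * r)\<close> is nonincreasing, so the zero at \<open>s\<close>
  bounds \<open>N\<close> forwards; for \<open>t < s\<close> the factor \<open>exp (K * r)\<close>
  does the same backwards.\<close>

lemma gronwall_zero:
  fixes N :: "real \<Rightarrow> real"
  assumes N: "\<And>r. r \<in> {min s t..max s t} \<Longrightarrow> (N has_real_derivative N' r) (at r)"
    and bound: "\<And>r. r \<in> {min s t..max s t} \<Longrightarrow> \<bar>N' r\<bar> \<le> K * N r"
    and "N s = 0"
  shows "N t \<le> 0"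
proof (cases "s \<le> t")
  case True
  have "N t * exp (- K * t) \<le> N s * exp (- K * s)"
  proof (rule DERIV_nonpos_imp_nonincreasing[OF True])
    fix r assume r: "s \<le> r" "r \<le> t"
    have "((\<lambda>r. N r * exp (- K * r)) has_real_derivative (N' r - K * N r) * exp (- K * r)) (at r)"
      by (rule derivative_eq_intros N | use r True in \<open>force simp: algebra_simps\<close>)+
    moreover have "(N' r - K * N r) * exp (- K * r) \<le> 0"
      using bound[of r] r True by (intro mult_nonpos_nonneg) auto
    ultimately show "\<exists>y. ((\<lambda>r. N r * exp (- K * r)) has_real_derivative y) (at r) \<and> y \<le> 0" by blast
  qed
  then have "N t * exp (- K * t) \<le> 0" using assms(3) by simp
  then show ?thesis by (simp add: mult_le_0_iff)
next
  case False
  have "N t * exp (K * t) \<le> N s * exp (K * s)"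
  proof (rule DERIV_nonneg_imp_nondecreasing[where f="\<lambda>r. N r * exp (K * r)"])
    show "t \<le> s" using False by simp
    fix r assume r: "t \<le> r" "r \<le> s"
    have "((\<lambda>r. N r * exp (K * r)) has_real_derivative (N' r + K * N r) * exp (K * r)) (at r)"
      by (rule derivative_eq_intros N | use r False in \<open>force simp: algebra_simps\<close>)+
    moreover have "(N' r + K * N r) * exp (K * r) \<ge> 0"
      using bound[of r] r False by (intro mult_nonneg_nonneg) auto
    ultimately show "\<exists>y. ((\<lambda>r. N r * exp (K * r)) has_real_derivative y) (at r) \<and> 0 \<le> y" by blast
  qed
  then have "N t * exp (K * t) \<le> 0" using assms(3) by simp
  then show ?thesis by (simp add: mult_le_0_iff)
qed

text \<open>A functional \<open>l\<close> that kills the span at time \<open>s\<close> yields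
  functions \<open>l (Y i r)\<close> satisfying a homogeneous linear system with zero values at
  \<open>s\<close>. They stay 0, so no \<open>Y i t\<close> can leave the span.\<close>

lemma span_constant:
  fixes Y :: "'i \<Rightarrow> real \<Rightarrow> 'v::finite_dim_space"
  assumes I: "finite I"
    and Y: "\<And>i r. i \<in> I \<Longrightarrow> r \<in> {min s t..max s t} \<Longrightarrow>
      (Y i has_vector_derivative (\<Sum>j\<in>I. c i j r *\<^sub>R Y j r)) (at r)"
    and c: "\<And>i j. i \<in> I \<Longrightarrow> j \<in> I \<Longrightarrow> continuous_on {min s t..max s t} (c i j)"
  shows "span ((\<lambda>i. Y i t) ` I) \<subseteq> span ((\<lambda>i. Y i s) ` I)"
proof (rule span_minimal)
  show "(\<lambda>i. Y i t) ` I \<subseteq> span ((\<lambda>i. Y i s) ` I)"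
  proof (rule ccontr)
    assume "\<not> ?thesis"
    then obtain i0 where i0: "i0 \<in> I" "Y i0 t \<notin> span ((\<lambda>i. Y i s) ` I)" by blast
    obtain l :: "'v \<Rightarrow> real" where l: "linear l" "l (Y i0 t) = 1" "\<And>x. x \<in> span ((\<lambda>i. Y i s) ` I) \<Longrightarrow> l x = 0"
      using separating_functional[OF subspace_span i0(2)] by blast
    have "\<exists>B. \<forall>r\<in>{min s t..max s t}. \<bar>c i j r\<bar> \<le> B" if "i \<in> I" "j \<in> I" for i j
    proof -
      have "bounded (c i j ` {min s t..max s t})"
        by (rule compact_imp_bounded[OF compact_continuous_image[OF c[OF that] compact_Icc]])
      then obtain B where "\<forall>x\<in>c i j ` {min s t..max s t}. norm x \<le> B" unfolding bounded_iff by blast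
      then show ?thesis by auto
    qed
    then have "\<forall>i j. \<exists>B. i \<in> I \<longrightarrow> j \<in> I \<longrightarrow> (\<forall>r\<in>{min s t..max s t}. \<bar>c i j r\<bar> \<le> B)" by blast
    then obtain B where B: "\<And>i j r. i \<in> I \<Longrightarrow> j \<in> I \<Longrightarrow> r \<in> {min s t..max s t} \<Longrightarrow> \<bar>c i j r\<bar> \<le> B i j"
      unfolding choice_iff by blast
    define w where "w = (\<lambda>i r. l (Y i r))"
    \<comment> \<open>The squared length of the vector of the \<open>w i\<close>. Twice the product
      of two components is bounded in absolute value by the sum of their squares, hence by
      \<open>2 * N r\<close>; this is the origin of \<open>K\<close>.\<close>
    define N where "N = (\<lambda>r. \<Sum>i\<in>I. w i r * w i r)"
    define N' where "N' = (\<lambda>r. \<Sum>i\<in>I. w i r * (\<Sum>j\<in>I. c i j r * w j r) + (\<Sum>j\<in>I. c i j r * w j r) * w i r)"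
    define K where "K = (\<Sum>i\<in>I. \<Sum>j\<in>I. 2 * B i j)"
    have w: "(w i has_real_derivative (\<Sum>j\<in>I. c i j r * w j r)) (at r)"
      if "i \<in> I" "r \<in> {min s t..max s t}" for i r
      using bounded_linear.has_vector_derivative[OF linear_bounded_linear[OF l(1)] Y[OF that]]
      unfolding has_real_derivative_iff_has_vector_derivative w_def
      by (simp add: linear_sum[OF l(1)] linear_scale[OF l(1)])
    have "N t \<le> 0"
    proof (rule gronwall_zero[where N=N and N'=N' and K=K])
      fix r assume r: "r \<in> {min s t..max s t}"
      have "((\<lambda>r. w i r * w i r) has_real_derivative
          w i r * (\<Sum>j\<in>I. c i j r * w j r) + (\<Sum>j\<in>I. c i j r * w j r) * w i r) (at r)" if "i \<in> I" for i
        using DERIV_mult[OF w[OF that r] w[OF that r]] by (simp add: add.commute mult.commute)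
      then show "(N has_real_derivative N' r) (at r)"
        unfolding N_def N'_def by (rule DERIV_sum)
      have "\<bar>N' r\<bar> \<le> (\<Sum>i\<in>I. \<Sum>j\<in>I. 2 * B i j * N r)"
        unfolding N'_def
      proof (rule order_trans[OF sum_abs], rule sum_mono)
        fix i assume i: "i \<in> I"
        have "\<bar>w i r * (\<Sum>j\<in>I. c i j r * w j r) + (\<Sum>j\<in>I. c i j r * w j r) * w i r\<bar>
            = \<bar>\<Sum>j\<in>I. c i j r * (2 * (w i r * w j r))\<bar>"
          by (simp add: sum_distrib_left sum_distrib_right sum.distrib[symmetric] algebra_simps)
        also have "\<dots> \<le> (\<Sum>j\<in>I. 2 * B i j * N r)"
        proof (rule order_trans[OF sum_abs], rule sum_mono)
          fix j assume j: "j \<in> I"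
          have n: "w k r * w k r \<le> N r" if "k \<in> I" for k
            unfolding N_def by (rule member_le_sum[OF that _ I, of "\<lambda>i. w i r * w i r"]) simp
          have "2 * \<bar>w i r * w j r\<bar> \<le> w i r * w i r + w j r * w j r"
            using sum_squares_bound[of "\<bar>w i r\<bar>" "\<bar>w j r\<bar>"] by (simp add: abs_mult power2_eq_square)
          then have "\<bar>2 * (w i r * w j r)\<bar> \<le> 2 * N r" using n[OF i] n[OF j] by (simp add: abs_mult)
          then have "\<bar>c i j r\<bar> * \<bar>2 * (w i r * w j r)\<bar> \<le> B i j * (2 * N r)"
            using B[OF i j r] by (intro mult_mono) auto
          then show "\<bar>c i j r * (2 * (w i r * w j r))\<bar> \<le> 2 * B i j * N r"
            by (simp only: abs_mult mult_ac)
        qed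
        finally show "\<bar>w i r * (\<Sum>j\<in>I. c i j r * w j r) + (\<Sum>j\<in>I. c i j r * w j r) * w i r\<bar>
            \<le> (\<Sum>j\<in>I. 2 * B i j * N r)" .
      qed
      then show "\<bar>N' r\<bar> \<le> K * N r" unfolding K_def by (simp add: sum_distrib_right)
    next
      show "N s = 0" unfolding N_def w_def using l(3)[OF span_base[OF imageI]] by (intro sum.neutral ballI) simp
    qed
    moreover have "w i0 t * w i0 t \<le> N t"
      unfolding N_def by (rule member_le_sum[OF i0(1) _ I, of "\<lambda>i. w i t * w i t"]) simp
    ultimately show False using l(2) by (simp add: w_def)
  qed
qed (rule subspace_span)

subsection \<open>Singular Frobenius theorem\<close>

lemma span_image_subset_eq:
  "S \<subseteq> span T \<Longrightarrow> T \<subseteq> span S \<Longrightarrow> span S = span T"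
  by (metis span_minimal span_eq subspace_span subset_antisym)

lemma Un_image_subset_span:
  assumes "\<And>i. i \<in> I \<Longrightarrow> f i \<in> span (g ` J)"
  shows "K \<union> f ` I \<subseteq> span (K \<union> g ` J)"
proof -
  have "span (g ` J) \<subseteq> span (K \<union> g ` J)" by (rule span_mono) blast
  moreover have "K \<subseteq> span (K \<union> g ` J)" by (auto intro: span_base)
  ultimately show ?thesis using assms by blast
qed

text \<open>The evaluation of the module at \<open>x\<close> is \<open>ker Q + span {Y i x}\<close>. As long as some generator
  does not vanish at 0, it is straightened to a constant field \<open>e\<close>, the other generators are made
  tangent to \<open>ker lam\<close>, and \<open>e\<close> is moved into the kernel of the projection. The remaining generators
  satisfy a linear differential equation along \<open>e\<close>, so their span does not change along \<open>e\<close>.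
  When all generators vanish at 0, they vanish on \<open>ker Q\<close>, which is the leaf.\<close>

theorem singular_frobenius_aux:
  fixes Q :: "'v::finite_dim_space \<Rightarrow> 'v" and Y :: "'i \<Rightarrow> 'v \<Rightarrow> 'v"
  assumes "finite I" "card I = n"
    and "linear Q" "\<And>x. Q (Q x) = Q x"
    and "open W" "0 \<in> W" "\<And>x. x \<in> W \<longleftrightarrow> Q x \<in> W"
    and "\<And>i. i \<in> I \<Longrightarrow> smooth_on W (Y i)"
    and "\<And>i x. i \<in> I \<Longrightarrow> x \<in> W \<Longrightarrow> Y i (Q x) = Y i x"
    and "\<And>i x. i \<in> I \<Longrightarrow> x \<in> W \<Longrightarrow> Q (Y i x) = Y i x"
    and "\<And>i j. i \<in> I \<Longrightarrow> j \<in> I \<Longrightarrow> in_mod W I Y (brk (Y i) (Y j))"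
  shows "\<exists>(\<Theta> :: 'v \<Rightarrow> 'v) \<Psi> A B L. diffeo A B \<Theta> \<Psi> \<and> 0 \<in> A \<and> A \<subseteq> W \<and> \<Theta> 0 = 0 \<and> subspace L \<and>
    (\<forall>x\<in>A. \<Theta> x \<in> L \<longrightarrow> span ({l. Q l = 0} \<union> (\<lambda>i. Y i x) ` I) = dd \<Psi> (\<Theta> x) ` L)"
  using assms
proof (induction n arbitrary: I Q Y W)
  case (0 I Q Y W)
  then have I: "I = {}" by simp
  have k: "subspace {l. Q l = 0}" using linear_subspace_kernel[OF 0(3)] .
  have d: "diffeo W W (\<lambda>x. x) (\<lambda>x. x)" using 0 smooth_on_ident by (auto simp: diffeo_def)
  have dd: "dd (\<lambda>x. x) y = (\<lambda>h. h)" for y :: 'v by (rule dd_eqI) simp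
  show ?case
    using k 0 by (intro exI[of _ "\<lambda>x. x"] exI[of _ W] exI[of _ "{l. Q l = 0}"] conjI d)
      (auto simp: I dd span_eq_iff[THEN iffD2])
next
  case (Suc n I Q Y W)
  note fI = Suc.prems(1) and cI = Suc.prems(2) and Q = Suc.prems(3,4) and W = Suc.prems(5,6,7)
    and Ys = Suc.prems(8) and YQ = Suc.prems(9) and QY = Suc.prems(10) and inv = Suc.prems(11)
  note linQ = linear_add[OF Q(1)] linear_diff[OF Q(1)] linear_scale[OF Q(1)] linear_0[OF Q(1)]
  show ?case
  proof (cases "\<forall>i\<in>I. Y i 0 = 0")
    case True
    have k: "subspace {l. Q l = 0}" using linear_subspace_kernel[OF Q(1)] .
    have d: "diffeo W W (\<lambda>x. x) (\<lambda>x. x)" using W smooth_on_ident by (auto simp: diffeo_def)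
    have dd: "dd (\<lambda>x. x) y = (\<lambda>h. h)" for y :: 'v by (rule dd_eqI) simp
    have sp: "span ({l. Q l = 0} \<union> (\<lambda>i. Y i x) ` I) = {l. Q l = 0}" if "x \<in> W" "Q x = 0" for x
    proof -
      have "Y i x = 0" if "i \<in> I" for i using YQ[OF that \<open>x \<in> W\<close>] \<open>Q x = 0\<close> True that by simp
      then have "{l. Q l = 0} \<union> (\<lambda>i. Y i x) ` I = {l. Q l = 0}" by (auto simp: linQ)
      then show ?thesis using k by (simp add: span_eq_iff[THEN iffD2])
    qed
    show ?thesis
      using k W(2) by (intro exI[of _ "\<lambda>x. x"] exI[of _ W] exI[of _ "{l. Q l = 0}"] conjI d) (auto simp: dd sp)
  next
    case False
    then obtain i0 where i0: "i0 \<in> I" "Y i0 0 \<noteq> 0" by blast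
    define e where "e = Y i0 0"
    have e: "e \<noteq> 0" "Q e = e" using i0 QY[OF i0(1) W(2)] by (auto simp: e_def)
    obtain l0 :: "'v \<Rightarrow> real" where l0: "linear l0" "l0 e = 1"
      using separating_functional[OF subspace_single_0, of e] e(1) by auto
    \<comment> \<open>Composing with \<open>Q\<close> makes \<open>lam\<close> vanish on the kernel
      of \<open>Q\<close>, so the directions already straightened do not interfere with the new
      one.\<close>
    define lam where "lam = (\<lambda>x. l0 (Q x))"
    have lam: "linear lam" "\<And>x. lam (Q x) = lam x" "lam e = 1"
      using linear_compose[OF Q(1) l0(1)] l0(2) Q(2) e(2) by (simp_all add: lam_def o_def)
    note linlam = linear_add[OF lam(1)] linear_diff[OF lam(1)] linear_scale[OF lam(1)] linear_0[OF lam(1)]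
    have bl: "bounded_linear lam" "bounded_linear Q" by (rule linear_bounded_linear, fact)+
    have lamker: "lam l = 0" if "Q l = 0" for l using lam(2)[of l] that by (simp add: linlam)
    define W1 where "W1 = {x \<in> W. lam (Y i0 x) \<noteq> 0}"
    have s0: "smooth_on W (\<lambda>x. lam (Y i0 x))" by (rule smooth_on_linear_comp[OF W(1) lam(1) Ys[OF i0(1)]])
    have "W1 = W \<inter> (\<lambda>x. lam (Y i0 x)) -` (- {0})" by (auto simp: W1_def)
    then have oW1: "open W1"
      using continuous_open_preimage[OF smooth_on_imp_continuous[OF s0] W(1), of "- {0}"] by auto
    have W1W: "W1 \<subseteq> W" by (auto simp: W1_def)
    have W10: "0 \<in> W1" using W(2) lam(3) by (simp add: W1_def e_def)
    have W1Q: "x \<in> W1 \<longleftrightarrow> Q x \<in> W1" for x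
      using W(3)[of x] YQ[OF i0(1), of x] by (auto simp: W1_def)
    define X where "X = (\<lambda>x. inverse (lam (Y i0 x)) *\<^sub>R Y i0 x)"
    have Ys1: "smooth_on W1 (Y i)" if "i \<in> I" for i by (rule smooth_on_subset[OF Ys[OF that] W1W])
    have s1: "smooth_on W1 (\<lambda>x. lam (Y i x))" if "i \<in> I" for i
      by (rule smooth_on_linear_comp[OF oW1 lam(1) Ys1[OF that]])
    have Xs: "smooth_on W1 X"
      unfolding X_def
      by (intro smooth_on_scaleR oW1 smooth_on_inverse s1 i0 Ys1) (auto simp: W1_def)
    have lamX: "lam (X x) = 1" if "x \<in> W1" for x using that by (simp add: X_def linlam W1_def)
    have QX: "Q (X x) = X x" "X (Q x) = X x" if "x \<in> W1" for x
      using that W1W QY[OF i0(1)] YQ[OF i0(1)] by (auto simp: X_def linQ)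
    define Y1 where "Y1 = (\<lambda>i x. if i = i0 then X x else Y i x - lam (Y i x) *\<^sub>R X x)"
    have Y1s: "smooth_on W1 (Y1 i)" if "i \<in> I" for i
      using Xs Ys1[OF that] s1[OF that] oW1
      by (cases "i = i0") (auto simp: Y1_def intro!: smooth_on_diff smooth_on_scaleR)
    have Y1Q: "Y1 i (Q x) = Y1 i x" "Q (Y1 i x) = Y1 i x" if "i \<in> I" "x \<in> W1" for i x
      using that QX[OF that(2)] YQ[OF that(1), of x] QY[OF that(1), of x] W1W
      by (auto simp: Y1_def linQ)
    have lamY1: "lam (Y1 i x) = 0" if "i \<noteq> i0" "x \<in> W1" for i x
      using that lamX by (simp add: Y1_def linlam)
    have mX: "in_mod W1 I Y X"
      unfolding X_def
      by (intro in_mod_scale oW1 smooth_on_inverse s1 i0 in_mod_base fI) (auto simp: W1_def)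
    \<comment> \<open>\<open>Y\<close> and \<open>Y1\<close> generate the same module over
      \<open>W1\<close>, so involutivity passes to \<open>Y1\<close> and the spans at points agree
      up to the common kernel.\<close>
    have m1: "in_mod W1 I Y (Y1 i)" if "i \<in> I" for i
    proof (cases "i = i0")
      case True
      then show ?thesis using mX by (simp add: Y1_def)
    next
      case False
      have "in_mod W1 I Y (\<lambda>x. Y i x - lam (Y i x) *\<^sub>R X x)"
        by (intro in_mod_diff in_mod_scale oW1 in_mod_base fI that s1 mX)
      then show ?thesis using False by (simp add: Y1_def)
    qed
    have m2: "in_mod W1 I Y1 (Y i)" if "i \<in> I" for i
    proof (cases "i = i0")
      case True
      have "in_mod W1 I Y1 (\<lambda>x. lam (Y i0 x) *\<^sub>R Y1 i0 x)"
        by (intro in_mod_scale oW1 s1 i0 in_mod_base fI)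
      then show ?thesis
        by (rule in_mod_cong[rotated]) (simp add: True Y1_def X_def W1_def)
    next
      case False
      have "in_mod W1 I Y1 (\<lambda>x. Y1 i x + lam (Y i x) *\<^sub>R Y1 i0 x)"
        by (intro in_mod_add in_mod_scale oW1 s1 i0 in_mod_base fI that)
      then show ?thesis
        by (rule in_mod_cong[rotated]) (simp add: False Y1_def)
    qed
    have inv1: "in_mod W1 I Y1 (brk (Y1 i) (Y1 j))" if "i \<in> I" "j \<in> I" for i j
    proof (rule in_mod_trans[OF oW1 m2])
      show "in_mod W1 I Y (brk (Y1 i) (Y1 j))"
        by (rule in_mod_brk[OF oW1 Ys1 fI in_mod_subset[OF inv W1W] m1[OF that(1)] m1[OF that(2)]])
    qed
    obtain \<Theta>1 \<Psi>1 A1 B1 where D1: "diffeo A1 B1 \<Theta>1 \<Psi>1" and A1: "0 \<in> A1" "A1 \<subseteq> W1" "\<Theta>1 0 = 0"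
      and \<Psi>1e: "\<And>y. y \<in> B1 \<Longrightarrow> dd \<Psi>1 y e = X (\<Psi>1 y)"
      and lam\<Theta>: "\<And>x. x \<in> A1 \<Longrightarrow> lam (\<Theta>1 x) = lam x"
      and Q\<Theta>: "\<And>x. x \<in> A1 \<Longrightarrow> Q (\<Theta>1 x - x) = \<Theta>1 x - x"
      and \<Theta>l: "\<And>x l. x \<in> A1 \<Longrightarrow> Q l = 0 \<Longrightarrow> x + l \<in> A1 \<and> \<Theta>1 (x + l) = \<Theta>1 x + l"
      using flow_box[OF Q lam e(2) oW1 W10 W1Q Xs QX(2) QX(1) lamX] by blast
    note d1 = D1[unfolded diffeo_def]
    have oA1: "open A1" and oB1: "open B1" and s\<Theta>: "smooth_on A1 \<Theta>1" and s\<Psi>: "smooth_on B1 \<Psi>1"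
      and \<Theta>B: "\<And>x. x \<in> A1 \<Longrightarrow> \<Theta>1 x \<in> B1" and \<Psi>A: "\<And>y. y \<in> B1 \<Longrightarrow> \<Psi>1 y \<in> A1"
      and \<Psi>\<Theta>: "\<And>x. x \<in> A1 \<Longrightarrow> \<Psi>1 (\<Theta>1 x) = x" and \<Theta>\<Psi>: "\<And>y. y \<in> B1 \<Longrightarrow> \<Theta>1 (\<Psi>1 y) = y"
      using d1 by auto
    have \<Psi>W: "\<Psi>1 y \<in> W1" if "y \<in> B1" for y using \<Psi>A[OF that] A1(2) by auto
    have \<Psi>\<Theta>d: "dd \<Psi>1 (\<Theta>1 x) (dd \<Theta>1 x v) = v" if "x \<in> A1" for x v by (rule diffeo_dd_inverse[OF D1 that])
    have \<Theta>\<Psi>d: "dd \<Theta>1 (\<Psi>1 y) (dd \<Psi>1 y v) = v" if "y \<in> B1" for y v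
      by (rule diffeo_dd_inverse[OF diffeo_inverse[OF D1] that])
    have d\<Theta>: "(\<Theta>1 has_derivative dd \<Theta>1 x) (at x)" if "x \<in> A1" for x by (rule smooth_on_derivative[OF oA1 s\<Theta> that])
    have lamd: "lam (dd \<Theta>1 x v) = lam v" if x: "x \<in> A1" for x v
    proof -
      have "((\<lambda>x. lam (\<Theta>1 x)) has_derivative (\<lambda>v. lam (dd \<Theta>1 x v))) (at x)"
        by (rule bounded_linear.has_derivative[OF bl(1) d\<Theta>[OF x]])
      then have "(lam has_derivative (\<lambda>v. lam (dd \<Theta>1 x v))) (at x)"
        by (rule has_derivative_local[OF oA1 x lam\<Theta>, rotated])
      from fun_cong[OF has_derivative_unique[OF this bounded_linear_imp_has_derivative[OF bl(1)]], of v]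
      show ?thesis .
    qed
    have Qd: "Q (dd \<Theta>1 x v) = dd \<Theta>1 x v" if x: "x \<in> A1" and v: "Q v = v" for x v
    proof -
      have d: "((\<lambda>x. \<Theta>1 x - x) has_derivative (\<lambda>v. dd \<Theta>1 x v - v)) (at x)"
        by (intro has_derivative_diff d\<Theta>[OF x] has_derivative_ident)
      have "((\<lambda>x. Q (\<Theta>1 x - x)) has_derivative (\<lambda>v. Q (dd \<Theta>1 x v - v))) (at x)"
        by (rule bounded_linear.has_derivative[OF bl(2) d])
      then have "((\<lambda>x. \<Theta>1 x - x) has_derivative (\<lambda>v. Q (dd \<Theta>1 x v - v))) (at x)"
        by (rule has_derivative_local[OF oA1 x Q\<Theta>, rotated])
      from has_derivative_unique[OF this d] have "Q (dd \<Theta>1 x v - v) = dd \<Theta>1 x v - v" by meson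
      then show ?thesis using v by (simp add: linQ)
    qed
    have dl: "dd \<Theta>1 (x + l) = dd \<Theta>1 x" "dd \<Theta>1 x l = l" if x: "x \<in> A1" and l: "Q l = 0" for x l
    proof -
      have sh: "((\<lambda>z. z + l) has_derivative (\<lambda>h. h)) (at x)" by (auto intro!: derivative_eq_intros)
      have "((\<lambda>z. \<Theta>1 (z + l)) has_derivative (\<lambda>h. dd \<Theta>1 (x + l) h)) (at x)"
        by (rule has_derivative_compose[OF sh]) (use d\<Theta> \<Theta>l[OF x l] in blast)
      then have "((\<lambda>z. \<Theta>1 z + l) has_derivative dd \<Theta>1 (x + l)) (at x)"
        by (rule has_derivative_local[OF oA1 x, rotated]) (use \<Theta>l[OF _ l] in blast)
      moreover have "((\<lambda>z. \<Theta>1 z + l) has_derivative dd \<Theta>1 x) (at x)"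
        using has_derivative_add[OF d\<Theta>[OF x] has_derivative_const[of l]] by simp
      ultimately show "dd \<Theta>1 (x + l) = dd \<Theta>1 x" by (rule has_derivative_unique)
      have "\<Theta>1 (x + s *\<^sub>R l) = \<Theta>1 x + s *\<^sub>R l" for s using \<Theta>l[OF x, of "s *\<^sub>R l"] l by (simp add: linQ)
      then have "((\<lambda>s. \<Theta>1 x + s *\<^sub>R l) has_vector_derivative dd \<Theta>1 (x + 0 *\<^sub>R l) l) (at 0)"
        using dd_along_line[of \<Theta>1 x 0 l UNIV] d\<Theta>[OF x] by (simp add: differentiable_def) blast
      moreover have "((\<lambda>s. \<Theta>1 x + s *\<^sub>R l) has_vector_derivative l) (at 0)"
        by (auto intro!: derivative_eq_intros simp: has_vector_derivative_def)
      ultimately show "dd \<Theta>1 x l = l" using vector_derivative_unique_at by fastforce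
    qed
    \<comment> \<open>The fields \<open>Y1\<close> pushed forward by the straightening map;
      \<open>Z i0\<close> becomes the constant field \<open>e\<close>.\<close>
    define Z where "Z = (\<lambda>i y. dd \<Theta>1 (\<Psi>1 y) (Y1 i (\<Psi>1 y)))"
    have Zs: "smooth_on B1 (Z i)" if "i \<in> I" for i
      unfolding Z_def
    proof (rule smooth_on_dd_apply[OF oB1 oA1 s\<Theta> s\<Psi>])
      show "smooth_on B1 (\<lambda>y. Y1 i (\<Psi>1 y))"
        by (rule smooth_on_compose[OF oB1 oW1 s\<Psi> Y1s[OF that]]) (use \<Psi>W in auto)
    qed (use \<Psi>A in auto)
    have Z0: "Z i0 y = e" if "y \<in> B1" for y
      using \<Theta>\<Psi>d[OF that, of e] \<Psi>1e[OF that] by (simp add: Z_def Y1_def)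
    have lamZ: "lam (Z i y) = 0" if "i \<noteq> i0" "y \<in> B1" for i y
      using lamd[OF \<Psi>A[OF that(2)]] lamY1[OF that(1) \<Psi>W[OF that(2)]] by (simp add: Z_def)
    have QZ: "Q (Z i y) = Z i y" if "i \<in> I" "y \<in> B1" for i y
      unfolding Z_def by (rule Qd[OF \<Psi>A[OF that(2)] Y1Q(2)[OF that(1) \<Psi>W[OF that(2)]]])
    have Bl: "y + l \<in> B1" "Z i (y + l) = Z i y" if "i \<in> I" "y \<in> B1" "Q l = 0" for i y l
    proof -
      let ?x = "\<Psi>1 y"
      have x: "?x \<in> A1" "\<Theta>1 ?x = y" using \<Psi>A \<Theta>\<Psi> that by auto
      have xl: "?x + l \<in> A1" "\<Theta>1 (?x + l) = y + l" using \<Theta>l[OF x(1) that(3)] x by auto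
      show "y + l \<in> B1" using \<Theta>B[OF xl(1)] xl(2) by simp
      have \<Psi>l: "\<Psi>1 (y + l) = ?x + l" using \<Psi>\<Theta>[OF xl(1)] xl(2) by simp
      have "Y1 i (?x + l) = Y1 i (Q (?x + l))" using Y1Q(1)[OF that(1), of "?x + l"] xl A1(2) by auto
      also have "\<dots> = Y1 i ?x" using Y1Q(1)[OF that(1), of ?x] x A1(2) that(3) by (auto simp: linQ)
      finally show "Z i (y + l) = Z i y" by (simp add: Z_def \<Psi>l dl(1)[OF x(1) that(3)])
    qed
    \<comment> \<open>Each \<open>lam (Z k y)\<close> is constant in \<open>y\<close>, so
      \<open>lam\<close> kills the bracket. On the right-hand side \<open>lam\<close> is 1 on
      \<open>e\<close> and 0 on the other fields, so it isolates the coefficient of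
      \<open>Z i0\<close>, which must be 0.\<close>
    have invZ: "\<exists>a. (\<forall>k\<in>I. smooth_on B1 (a k)) \<and> (\<forall>y\<in>B1. brk (Z i) (Z j) y = (\<Sum>k\<in>I - {i0}. a k y *\<^sub>R Z k y))"
      if i: "i \<in> I" and j: "j \<in> I" "j \<noteq> i0" for i j
    proof -
      obtain a where a: "\<And>k. k \<in> I \<Longrightarrow> smooth_on W1 (a k)"
        "\<And>x. x \<in> W1 \<Longrightarrow> brk (Y1 i) (Y1 j) x = (\<Sum>k\<in>I. a k x *\<^sub>R Y1 k x)"
        using inv1[OF i j(1)] unfolding in_mod_def by blast
      show ?thesis
      proof (intro exI[of _ "\<lambda>k y. a k (\<Psi>1 y)"] conjI ballI)
        show "smooth_on B1 (\<lambda>y. a k (\<Psi>1 y))" if "k \<in> I" for k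
          by (rule smooth_on_compose[OF oB1 oW1 s\<Psi> a(1)[OF that]]) (use \<Psi>W in auto)
        fix y assume y: "y \<in> B1"
        have lin: "linear (dd \<Theta>1 (\<Psi>1 y))" by (rule smooth_on_dd_linear[OF oA1 s\<Theta> \<Psi>A[OF y]])
        have Zrel: "Z i (\<Theta>1 x) = dd \<Theta>1 x (Y1 i x)" if "x \<in> A1" for x i using \<Psi>\<Theta>[OF that] by (simp add: Z_def)
        have "brk (Z i) (Z j) (\<Theta>1 (\<Psi>1 y)) = dd \<Theta>1 (\<Psi>1 y) (brk (Y1 i) (Y1 j) (\<Psi>1 y))"
          by (rule brk_related[OF oA1 oB1 s\<Theta> _ smooth_on_subset[OF Y1s[OF i] A1(2)] smooth_on_subset[OF Y1s[OF j(1)] A1(2)]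
              Zs[OF i] Zs[OF j(1)] Zrel Zrel \<Psi>A[OF y]]) (use \<Theta>B in auto)
        then have b: "brk (Z i) (Z j) y = (\<Sum>k\<in>I. a k (\<Psi>1 y) *\<^sub>R Z k y)"
          using a(2)[OF \<Psi>W[OF y]] \<Theta>\<Psi>[OF y] by (simp add: linear_sum[OF lin] linear_scale[OF lin] Z_def)
        have ld: "lam (dd (Z k) y v) = 0" if "k \<in> I" "k \<noteq> i0" for k v
        proof -
          have "lam (dd (Z k) y v) = dd (\<lambda>y. lam (Z k y)) y v"
            by (rule dd_linear_comp[OF bl(1) smooth_on_differentiable[OF oB1 Zs[OF that(1)] y], symmetric])
          also have "dd (\<lambda>y. lam (Z k y)) y = dd (\<lambda>y. 0) y"
            by (rule dd_local[OF oB1 y]) (rule lamZ[OF that(2)])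
          finally show ?thesis by simp
        qed
        have di0: "dd (Z i0) y v = 0" for v
        proof -
          have "dd (Z i0) y = dd (\<lambda>y. e) y" by (rule dd_local[OF oB1 y Z0])
          then show ?thesis by simp
        qed
        have "lam (brk (Z i) (Z j) y) = 0"
          using ld[OF j] ld[OF i] di0 by (cases "i = i0") (simp_all add: brk_def linlam)
        moreover have "lam (\<Sum>k\<in>I. a k (\<Psi>1 y) *\<^sub>R Z k y) = a i0 (\<Psi>1 y)"
        proof -
          have "lam (\<Sum>k\<in>I. a k (\<Psi>1 y) *\<^sub>R Z k y) = (\<Sum>k\<in>I. a k (\<Psi>1 y) * lam (Z k y))"
            by (simp add: linear_sum[OF lam(1)] linlam)
          also have "\<dots> = a i0 (\<Psi>1 y) * lam (Z i0 y) + (\<Sum>k\<in>I - {i0}. a k (\<Psi>1 y) * lam (Z k y))"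
            by (rule sum.remove[OF fI i0(1)])
          also have "(\<Sum>k\<in>I - {i0}. a k (\<Psi>1 y) * lam (Z k y)) = 0"
            by (rule sum.neutral) (use lamZ[OF _ y] in auto)
          finally show ?thesis using Z0[OF y] lam(3) by simp
        qed
        ultimately have "a i0 (\<Psi>1 y) = 0" using b by simp
        then show "brk (Z i) (Z j) y = (\<Sum>k\<in>I - {i0}. a k (\<Psi>1 y) *\<^sub>R Z k y)"
          using b sum.remove[OF fI i0(1), of "\<lambda>k. a k (\<Psi>1 y) *\<^sub>R Z k y"] by simp
      qed
    qed
    define I' where "I' = I - {i0}"
    have I'I: "\<And>i. i \<in> I' \<Longrightarrow> i \<in> I" "\<And>i. i \<in> I' \<Longrightarrow> i \<noteq> i0" by (auto simp: I'_def)
    define Q' where "Q' = (\<lambda>x. Q x - lam x *\<^sub>R e)"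
    have Q'lin: "linear Q'"
      unfolding Q'_def by (rule linearI) (simp_all add: linQ linlam algebra_simps)
    have bQ': "bounded_linear Q'" by (rule linear_bounded_linear[OF Q'lin])
    have Q'Q': "Q' (Q' x) = Q' x" for x
      by (simp add: Q'_def linQ linlam Q(2) lam e(2))
    have Q'fix: "Q' v = v" if "Q v = v" "lam v = 0" for v using that by (simp add: Q'_def)
    define W' where "W' = {y. Q' y \<in> B1}"
    have B10: "0 \<in> B1" using \<Theta>B[OF A1(1)] A1(3) by simp
    have oW': "open W'"
      using open_vimage[OF oB1 linear_continuous_on[OF bQ']] by (simp add: W'_def vimage_def)
    \<comment> \<open>Freezing the coordinate along \<open>e\<close> gives fields invariant under
      \<open>Q'\<close>. They still satisfy the bracket relations, since their values lie in the
      image of \<open>Q'\<close> and the brackets see only derivatives in these directions.\<close>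
    define Y' where "Y' = (\<lambda>i y. Z i (Q' y))"
    have Y's: "smooth_on W' (Y' i)" if "i \<in> I'" for i
      unfolding Y'_def
      by (rule smooth_on_compose[OF oW' oB1 smooth_on_linear[OF oW' Q'lin] Zs[OF I'I(1)[OF that]]]) (auto simp: W'_def)
    have inv': "in_mod W' I' Y' (brk (Y' i) (Y' j))" if i: "i \<in> I'" and j: "j \<in> I'" for i j
    proof -
      obtain a where a: "\<And>k. k \<in> I \<Longrightarrow> smooth_on B1 (a k)"
        "\<And>y. y \<in> B1 \<Longrightarrow> brk (Z i) (Z j) y = (\<Sum>k\<in>I'. a k y *\<^sub>R Z k y)"
        using invZ[of i j] i j unfolding I'_def by auto
      show ?thesis
      proof (rule in_modI[where a="\<lambda>k y. a k (Q' y)"])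
        show "smooth_on W' (\<lambda>y. a k (Q' y))" if "k \<in> I'" for k
          by (rule smooth_on_compose[OF oW' oB1 smooth_on_linear[OF oW' Q'lin] a(1)[OF I'I(1)[OF that]]]) (auto simp: W'_def)
        fix y assume "y \<in> W'"
        then have y: "Q' y \<in> B1" by (simp add: W'_def)
        have dY: "dd (Y' k) y v = dd (Z k) (Q' y) v" if "k \<in> I'" "Q' v = v" for k v
        proof -
          have "(Y' k has_derivative (\<lambda>v. dd (Z k) (Q' y) (Q' v))) (at y)"
            unfolding Y'_def
            by (rule has_derivative_compose[OF bounded_linear_imp_has_derivative[OF bQ']
                  smooth_on_derivative[OF oB1 Zs[OF I'I(1)[OF that(1)]] y]])
          from dd_eqI[OF this] that(2) show ?thesis by simp
        qed
        have fixZ: "Q' (Z k (Q' y)) = Z k (Q' y)" if "k \<in> I'" for k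
          by (rule Q'fix[OF QZ[OF I'I(1)[OF that] y] lamZ[OF I'I(2)[OF that] y]])
        have "brk (Y' i) (Y' j) y = brk (Z i) (Z j) (Q' y)"
          using dY[OF i fixZ[OF j]] dY[OF j fixZ[OF i]] by (simp add: brk_def Y'_def)
        then show "brk (Y' i) (Y' j) y = (\<Sum>k\<in>I'. a k (Q' y) *\<^sub>R Y' k y)"
          using a(2)[OF y] by (simp add: Y'_def)
      qed
    qed
    have "\<exists>(\<Theta> :: 'v \<Rightarrow> 'v) \<Psi> A B L. diffeo A B \<Theta> \<Psi> \<and> 0 \<in> A \<and> A \<subseteq> W' \<and> \<Theta> 0 = 0 \<and> subspace L \<and>
        (\<forall>x\<in>A. \<Theta> x \<in> L \<longrightarrow> span ({l. Q' l = 0} \<union> (\<lambda>i. Y' i x) ` I') = dd \<Psi> (\<Theta> x) ` L)"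
    proof (rule Suc.IH)
      show "finite I'" "card I' = n" using fI cI i0(1) by (auto simp: I'_def)
      show "0 \<in> W'" using B10 linear_0[OF Q'lin] by (simp add: W'_def)
      show "x \<in> W' \<longleftrightarrow> Q' x \<in> W'" for x by (simp add: W'_def Q'Q')
      show "Y' i (Q' x) = Y' i x" for i x by (simp add: Y'_def Q'Q')
      show "Q' (Y' i x) = Y' i x" if "i \<in> I'" "x \<in> W'" for i x
      proof -
        have x: "Q' x \<in> B1" using that(2) by (simp add: W'_def)
        show ?thesis
          unfolding Y'_def by (rule Q'fix[OF QZ[OF I'I(1)[OF that(1)] x] lamZ[OF I'I(2)[OF that(1)] x]])
      qed
    qed (fact Q'lin Q'Q' oW' Y's inv')+
    then obtain \<Theta>2 :: "'v \<Rightarrow> 'v" and \<Psi>2 A2 B2 L where H2: "diffeo A2 B2 \<Theta>2 \<Psi>2 \<and> 0 \<in> A2 \<and> A2 \<subseteq> W' \<and>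
        \<Theta>2 0 = 0 \<and> subspace L \<and>
        (\<forall>x\<in>A2. \<Theta>2 x \<in> L \<longrightarrow> span ({l. Q' l = 0} \<union> (\<lambda>i. Y' i x) ` I') = dd \<Psi>2 (\<Theta>2 x) ` L)"
      by (elim exE)
    then have D2: "diffeo A2 B2 \<Theta>2 \<Psi>2" and A2: "0 \<in> A2" "A2 \<subseteq> W'" "\<Theta>2 0 = 0" "subspace L"
      by simp_all
    have sp2: "span ({l. Q' l = 0} \<union> (\<lambda>i. Y' i x) ` I') = dd \<Psi>2 (\<Theta>2 x) ` L" if "x \<in> A2" "\<Theta>2 x \<in> L" for x
      using H2 that by simp
    obtain \<rho> where \<rho>: "\<rho> > 0" "ball 0 \<rho> \<subseteq> B1" using oB1 B10 open_contains_ball by blast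
    \<comment> \<open>For \<open>y\<close> in \<open>N\<close> the segment from \<open>Q y\<close>
      to \<open>Q' y\<close> along \<open>e\<close> stays in the ball around 0 inside
      \<open>B1\<close>.\<close>
    define N where "N = {y. norm (Q y) + \<bar>lam y\<bar> * norm e < \<rho>}"
    have oN: "open N"
      unfolding N_def
      by (intro open_Collect_less continuous_intros linear_continuous_on[OF bl(1)] linear_continuous_on[OF bl(2)])
    have N0: "0 \<in> N" using \<rho> by (simp add: N_def linQ linlam)
    \<comment> \<open>\<open>Z\<close> and its frozen version \<open>Y'\<close> differ, but
      bracketing with the constant field \<open>e\<close> differentiates \<open>Z\<close> along
      \<open>e\<close>. The relations \<open>invZ\<close> thus become a linear differential equation
      on the segment, and \<open>span_constant\<close> in both directions equates the spans.\<close>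
    have spanZ: "span ((\<lambda>i. Z i y) ` I') = span ((\<lambda>i. Y' i y) ` I')" if y: "y \<in> B1" "y \<in> N" for y
    proof -
      let ?y = "Q y"
      have "?y = y + (?y - y)" "Q (?y - y) = 0" by (simp_all add: linQ Q(2))
      then have ZQ: "Z i ?y = Z i y" if "i \<in> I" for i using Bl(2)[OF that y(1)] by metis
      define G where "G = (\<lambda>s. ?y - s *\<^sub>R e)"
      have inB: "G s \<in> B1" if "\<bar>s\<bar> \<le> \<bar>lam y\<bar>" for s
      proof -
        have "norm (G s) \<le> norm ?y + \<bar>s\<bar> * norm e" unfolding G_def using norm_triangle_ineq4[of ?y "s *\<^sub>R e"] by simp
        also have "\<dots> \<le> norm ?y + \<bar>lam y\<bar> * norm e" using that by (simp add: mult_right_mono)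
        also have "\<dots> < \<rho>" using y(2) by (simp add: N_def)
        finally show ?thesis using \<rho>(2) by (auto simp: dist_norm)
      qed
      have "\<exists>a. \<forall>i\<in>I'. \<forall>k\<in>I. smooth_on B1 (a i k)" by (intro exI[of _ "\<lambda>i k x. 0"]) (auto intro: smooth_on_const oB1)
      have "\<forall>i. \<exists>a. i \<in> I' \<longrightarrow> (\<forall>k\<in>I. smooth_on B1 (a k)) \<and> (\<forall>y\<in>B1. brk (Z i0) (Z i) y = (\<Sum>k\<in>I'. a k y *\<^sub>R Z k y))"
        using invZ[OF i0(1)] unfolding I'_def by blast
      then obtain a where a: "\<And>i k. i \<in> I' \<Longrightarrow> k \<in> I \<Longrightarrow> smooth_on B1 (a i k)"
        "\<And>i y. i \<in> I' \<Longrightarrow> y \<in> B1 \<Longrightarrow> brk (Z i0) (Z i) y = (\<Sum>k\<in>I'. a i k y *\<^sub>R Z k y)"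
        unfolding choice_iff by blast
      have der: "((\<lambda>s. Z i (G s)) has_vector_derivative (\<Sum>k\<in>I'. (- a i k (G s)) *\<^sub>R Z k (G s))) (at s)"
        if i: "i \<in> I'" and s: "\<bar>s\<bar> \<le> \<bar>lam y\<bar>" for i s
      proof -
        have di0: "dd (Z i0) (G s) v = 0" for v
        proof -
          have "dd (Z i0) (G s) = dd (\<lambda>y. e) (G s)" by (rule dd_local[OF oB1 inB[OF s] Z0])
          then show ?thesis by simp
        qed
        have "brk (Z i0) (Z i) (G s) = dd (Z i) (G s) e"
          using di0 Z0[OF inB[OF s]] by (simp add: brk_def)
        then have de: "dd (Z i) (G s) e = (\<Sum>k\<in>I'. a i k (G s) *\<^sub>R Z k (G s))" using a(2)[OF i inB[OF s]] by simp
        have Geq: "G s = ?y + s *\<^sub>R (- e)" for s by (simp add: G_def)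
        have dif: "Z i differentiable (at (G s))"
          by (rule smooth_on_differentiable[OF oB1 Zs[OF I'I(1)[OF i]] inB[OF s]])
        have "((\<lambda>s. Z i (?y + s *\<^sub>R (- e))) has_vector_derivative dd (Z i) (?y + s *\<^sub>R (- e)) (- e)) (at s)"
          by (rule dd_along_line) (use dif Geq in simp)
        moreover have "dd (Z i) (G s) (- e) = (\<Sum>k\<in>I'. (- a i k (G s)) *\<^sub>R Z k (G s))"
          using de by (simp add: linear_neg[OF dd_linear[OF dif]] sum_negf)
        ultimately show ?thesis unfolding Geq by simp
      qed
      have cont: "continuous_on {min s t..max s t} (\<lambda>r. - a i k (G r))"
        if "i \<in> I'" "k \<in> I'" "\<bar>s\<bar> \<le> \<bar>lam y\<bar>" "\<bar>t\<bar> \<le> \<bar>lam y\<bar>" for i k s t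
      proof (intro continuous_on_minus continuous_on_compose2[OF smooth_on_imp_continuous[OF a(1)[OF that(1) I'I(1)[OF that(2)]]]])
        show "continuous_on {min s t..max s t} G" unfolding G_def by (intro continuous_intros)
        show "G ` {min s t..max s t} \<subseteq> B1"
        proof
          fix z assume "z \<in> G ` {min s t..max s t}"
          then obtain r where r: "z = G r" "min s t \<le> r" "r \<le> max s t" by auto
          then have "\<bar>r\<bar> \<le> \<bar>lam y\<bar>" using that(3,4) by linarith
          then show "z \<in> B1" using inB r(1) by simp
        qed
      qed
      have sub: "span ((\<lambda>i. Z i (G t)) ` I') \<subseteq> span ((\<lambda>i. Z i (G s)) ` I')"
        if "\<bar>s\<bar> \<le> \<bar>lam y\<bar>" "\<bar>t\<bar> \<le> \<bar>lam y\<bar>" for s t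
      proof (rule span_constant[where c="\<lambda>i k r. - a i k (G r)"])
        show "finite I'" using fI by (simp add: I'_def)
        fix i r assume i: "i \<in> I'" and "r \<in> {min s t..max s t}"
        then have "\<bar>r\<bar> \<le> \<bar>lam y\<bar>" using that by auto
        from der[OF i this] show "((\<lambda>s. Z i (G s)) has_vector_derivative (\<Sum>k\<in>I'. (- a i k (G r)) *\<^sub>R Z k (G r))) (at r)" .
      qed (use cont that in blast)
      have "span ((\<lambda>i. Z i (G 0)) ` I') = span ((\<lambda>i. Z i (G (lam y))) ` I')"
        using sub[of 0 "lam y"] sub[of "lam y" 0] by auto
      moreover have "(\<lambda>i. Z i (G 0)) ` I' = (\<lambda>i. Z i y) ` I'"
        using ZQ I'I(1) by (intro image_cong) (auto simp: G_def)
      moreover have "(\<lambda>i. Z i (G (lam y))) ` I' = (\<lambda>i. Y' i y) ` I'"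
        by (simp add: Y'_def G_def Q'_def)
      ultimately show ?thesis by simp
    qed
    let ?A = "{x \<in> A1. \<Theta>1 x \<in> A2 \<inter> N}"
    define B where "B = {w \<in> {y \<in> B2. \<Psi>2 y \<in> N}. \<Psi>2 w \<in> B1}"
    have dif: "diffeo ?A B (\<lambda>x. \<Theta>2 (\<Theta>1 x)) (\<lambda>w. \<Psi>1 (\<Psi>2 w))"
      unfolding B_def by (rule diffeo_compose[OF D1 diffeo_restrict[OF D2 oN]])
    note d2 = D2[unfolded diffeo_def]
    have fin: "span ({l. Q l = 0} \<union> (\<lambda>i. Y i x) ` I) = dd (\<lambda>w. \<Psi>1 (\<Psi>2 w)) (\<Theta>2 (\<Theta>1 x)) ` L"
      if x: "x \<in> ?A" and xL: "\<Theta>2 (\<Theta>1 x) \<in> L" for x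
    proof -
      define y where "y = \<Theta>1 x"
      have xA: "x \<in> A1" and yB: "y \<in> B1" and yA: "y \<in> A2" and yN: "y \<in> N" and \<Psi>y: "\<Psi>1 y = x"
        using x \<Theta>B \<Psi>\<Theta> by (auto simp: y_def)
      have xW: "x \<in> W1" using xA A1(2) by auto
      let ?w = "\<Theta>2 y"
      have w: "?w \<in> B2" "\<Psi>2 ?w = y" using d2 yA by auto
      have comp: "dd (\<lambda>w. \<Psi>1 (\<Psi>2 w)) ?w v = dd \<Psi>1 y (dd \<Psi>2 ?w v)" for v
        using dd_compose[of \<Psi>2 ?w \<Psi>1 v] smooth_on_differentiable[of B2 \<Psi>2 ?w] smooth_on_differentiable[OF oB1 s\<Psi> yB] d2 w
        by simp
      let ?M = "dd \<Psi>1 y" and ?M' = "dd \<Theta>1 x"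
      have M'M: "?M' (?M v) = v" and MM': "?M (?M' v) = v" for v
        using \<Theta>\<Psi>d[OF yB, of v] \<Psi>\<Theta>d[OF xA, of v] unfolding \<Psi>y y_def[symmetric] .
      have linM: "linear ?M" by (rule smooth_on_dd_linear[OF oB1 s\<Psi> yB])
      have linM': "linear ?M'" by (rule smooth_on_dd_linear[OF oA1 s\<Theta> xA])
      let ?K = "{l. Q l = 0}" and ?K' = "{l. Q' l = 0}"
      \<comment> \<open>The span is carried over in stages: from \<open>Y\<close> to
        \<open>Y1\<close>, through the derivative of the straightening map to \<open>Z\<close>, and
        from there to \<open>Y'\<close>, with \<open>e\<close> now absorbed by the larger
        kernel.\<close>
      have 1: "span (?K \<union> (\<lambda>i. Y i x) ` I) = span (?K \<union> (\<lambda>i. Y1 i x) ` I)"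
      proof (rule span_image_subset_eq)
        show "?K \<union> (\<lambda>i. Y i x) ` I \<subseteq> span (?K \<union> (\<lambda>i. Y1 i x) ` I)"
          by (rule Un_image_subset_span[OF in_mod_span[OF m2 xW]])
        show "?K \<union> (\<lambda>i. Y1 i x) ` I \<subseteq> span (?K \<union> (\<lambda>i. Y i x) ` I)"
          by (rule Un_image_subset_span[OF in_mod_span[OF m1 xW]])
      qed
      have "?M' ` span (?K \<union> (\<lambda>i. Y1 i x) ` I) = span (?M' ` (?K \<union> (\<lambda>i. Y1 i x) ` I))"
        by (rule linear_span_image[OF linM', symmetric])
      also have "?M' ` (?K \<union> (\<lambda>i. Y1 i x) ` I) = ?K \<union> (\<lambda>i. Z i y) ` I"
      proof -
        have "?M' ` ?K = ?K" using dl(2)[OF xA] by (auto simp: image_iff)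
        moreover have "?M' ` (\<lambda>i. Y1 i x) ` I = (\<lambda>i. Z i y) ` I" by (simp add: image_image Z_def \<Psi>y)
        ultimately show ?thesis by (simp add: image_Un)
      qed
      also have "span (?K \<union> (\<lambda>i. Z i y) ` I) = span (?K' \<union> (\<lambda>i. Y' i y) ` I')"
      proof (rule span_image_subset_eq)
        have K'e: "e \<in> ?K'" using e lam by (simp add: Q'_def)
        have KK': "?K \<subseteq> ?K'" using lamker by (auto simp: Q'_def)
        have ZI': "Z i y \<in> span (?K' \<union> (\<lambda>i. Y' i y) ` I')" if "i \<in> I'" for i
          using spanZ[OF yB yN] span_base[of "Z i y" "(\<lambda>i. Z i y) ` I'"] that
            span_mono[of "(\<lambda>i. Y' i y) ` I'" "?K' \<union> (\<lambda>i. Y' i y) ` I'"] by auto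
        have ZI: "Z i y \<in> span (?K' \<union> (\<lambda>i. Y' i y) ` I')" if "i \<in> I" for i
        proof (cases "i = i0")
          case True
          then show ?thesis using Z0[OF yB] K'e by (auto intro: span_base)
        next
          case False
          then show ?thesis using ZI' that by (simp add: I'_def)
        qed
        show "?K \<union> (\<lambda>i. Z i y) ` I \<subseteq> span (?K' \<union> (\<lambda>i. Y' i y) ` I')"
          using ZI KK' span_superset[of "?K' \<union> (\<lambda>i. Y' i y) ` I'"] by blast
        have eS: "e \<in> span (?K \<union> (\<lambda>i. Z i y) ` I)"
          using Z0[OF yB] i0(1) by (intro span_base) (auto simp: image_iff)
        have "l \<in> span (?K \<union> (\<lambda>i. Z i y) ` I)" if "l \<in> ?K'" for l
        proof -
          have eq: "(l - Q l) + lam l *\<^sub>R e = l" using that by (simp add: Q'_def)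
          have "l - Q l \<in> span (?K \<union> (\<lambda>i. Z i y) ` I)" by (rule span_base) (simp add: linQ Q(2))
          from span_add[OF this span_scale[OF eS, of "lam l"]] show ?thesis unfolding eq .
        qed
        moreover have "Y' i y \<in> span (?K \<union> (\<lambda>i. Z i y) ` I)" if "i \<in> I'" for i
        proof -
          have "Y' i y \<in> span ((\<lambda>i. Z i y) ` I')"
            unfolding spanZ[OF yB yN] using that by (intro span_base imageI)
          moreover have "span ((\<lambda>i. Z i y) ` I') \<subseteq> span (?K \<union> (\<lambda>i. Z i y) ` I)"
            by (rule span_mono) (auto simp: I'_def)
          ultimately show ?thesis by blast
        qed
        ultimately show "?K' \<union> (\<lambda>i. Y' i y) ` I' \<subseteq> span (?K \<union> (\<lambda>i. Z i y) ` I)" by blast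
      qed
      also have "\<dots> = dd \<Psi>2 ?w ` L" using sp2[OF yA] xL by (simp add: y_def)
      finally have eq: "?M' ` span (?K \<union> (\<lambda>i. Y1 i x) ` I) = dd \<Psi>2 ?w ` L" .
      have "span (?K \<union> (\<lambda>i. Y1 i x) ` I) = ?M ` (?M' ` span (?K \<union> (\<lambda>i. Y1 i x) ` I))"
        by (simp add: image_image MM')
      also have "\<dots> = dd (\<lambda>w. \<Psi>1 (\<Psi>2 w)) ?w ` L" unfolding eq by (simp add: image_image comp)
      finally show ?thesis using 1 by (simp add: y_def)
    qed
    show ?thesis
    proof (intro exI conjI)
      show "diffeo ?A B (\<lambda>x. \<Theta>2 (\<Theta>1 x)) (\<lambda>w. \<Psi>1 (\<Psi>2 w))" by (rule dif)
      show "0 \<in> ?A" "\<Theta>2 (\<Theta>1 0) = 0" using A1 A2 N0 by auto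
      show "?A \<subseteq> W" using A1(2) W1W by auto
      show "subspace L" by (rule A2(4))
      show "\<forall>x\<in>?A. \<Theta>2 (\<Theta>1 x) \<in> L \<longrightarrow> span ({l. Q l = 0} \<union> (\<lambda>i. Y i x) ` I) = dd (\<lambda>w. \<Psi>1 (\<Psi>2 w)) (\<Theta>2 (\<Theta>1 x)) ` L"
        using fin by blast
    qed
  qed
qed

text \<open>After a translation moving \<open>x0\<close> to 0, the inductive version starts with
  \<open>Q\<close> equal to the identity, whose kernel is trivial.\<close>

theorem singular_frobenius:
  fixes Y :: "'i \<Rightarrow> 'v::finite_dim_space \<Rightarrow> 'v"
  assumes I: "finite I" and W: "open W" "x0 \<in> W" and Y: "\<And>i. i \<in> I \<Longrightarrow> smooth_on W (Y i)"
    and inv: "\<And>i j. i \<in> I \<Longrightarrow> j \<in> I \<Longrightarrow> in_mod W I Y (brk (Y i) (Y j))"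
  shows "\<exists>(\<Theta> :: 'v \<Rightarrow> 'v) \<Psi> A B L. diffeo A B \<Theta> \<Psi> \<and> x0 \<in> A \<and> A \<subseteq> W \<and> subspace L \<and> \<Theta> x0 \<in> L \<and>
    (\<forall>x\<in>A. \<Theta> x \<in> L \<longrightarrow> span ((\<lambda>i. Y i x) ` I) = dd \<Psi> (\<Theta> x) ` L)"
proof -
  define W0 where "W0 = {x. x + x0 \<in> W}"
  define Y0 where "Y0 = (\<lambda>i x. Y i (x + x0))"
  have oW0: "open W0"
    using open_vimage[OF W(1), of "\<lambda>x. x + x0"] by (simp add: W0_def vimage_def continuous_intros)
  have sh: "smooth_on U (\<lambda>x. x + c)" if "open U" for U and c :: 'v
    by (intro smooth_on_add smooth_on_ident smooth_on_const that)
  have dsh: "((\<lambda>x. x + c) has_derivative (\<lambda>h. h)) (at x)" for x c :: 'v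
    by (auto intro!: derivative_eq_intros)
  have Y0s: "smooth_on W0 (Y0 i)" if "i \<in> I" for i
    unfolding Y0_def by (rule smooth_on_compose[OF oW0 W(1) sh[OF oW0] Y[OF that]]) (auto simp: W0_def)
  have inv0: "in_mod W0 I Y0 (brk (Y0 i) (Y0 j))" if i: "i \<in> I" and j: "j \<in> I" for i j
  proof -
    obtain a where a: "\<And>k. k \<in> I \<Longrightarrow> smooth_on W (a k)"
      "\<And>x. x \<in> W \<Longrightarrow> brk (Y i) (Y j) x = (\<Sum>k\<in>I. a k x *\<^sub>R Y k x)"
      using inv[OF i j] unfolding in_mod_def by blast
    show ?thesis
    proof (rule in_modI[where a="\<lambda>k x. a k (x + x0)"])
      show "smooth_on W0 (\<lambda>x. a k (x + x0))" if "k \<in> I" for k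
        by (rule smooth_on_compose[OF oW0 W(1) sh[OF oW0] a(1)[OF that]]) (auto simp: W0_def)
      fix x assume "x \<in> W0"
      then have x: "x + x0 \<in> W" by (simp add: W0_def)
      have "dd (Y0 k) x = dd (Y k) (x + x0)" if "k \<in> I" for k
        unfolding Y0_def
        by (rule dd_eqI[OF has_derivative_compose[OF dsh smooth_on_derivative[OF W(1) Y[OF that] x]]])
      then show "brk (Y0 i) (Y0 j) x = (\<Sum>k\<in>I. a k (x + x0) *\<^sub>R Y0 k x)"
        using a(2)[OF x] i j by (simp add: brk_def Y0_def)
    qed
  qed
  obtain \<Theta> :: "'v \<Rightarrow> 'v" and \<Psi> A B L where D: "diffeo A B \<Theta> \<Psi>" and A: "0 \<in> A" "A \<subseteq> W0" "\<Theta> 0 = 0" "subspace L"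
    and sp: "\<And>x. x \<in> A \<Longrightarrow> \<Theta> x \<in> L \<Longrightarrow> span ({l::'v. l = 0} \<union> (\<lambda>i. Y0 i x) ` I) = dd \<Psi> (\<Theta> x) ` L"
    using singular_frobenius_aux[OF I refl linear_ident, of W0 Y0] oW0 W(2) Y0s inv0 unfolding W0_def by auto
  have D0: "diffeo UNIV UNIV (\<lambda>x. x + (- x0)) (\<lambda>x. x + x0)"
    unfolding diffeo_def using sh[OF open_UNIV, of "- x0"] sh[OF open_UNIV, of x0] by simp
  have D': "diffeo {x. x + (- x0) \<in> A} B (\<lambda>x. \<Theta> (x + (- x0))) (\<lambda>y. \<Psi> y + x0)"
    using diffeo_compose[OF D0 D] by simp
  show ?thesis
  proof (intro exI conjI ballI impI)
    show "diffeo {x. x + (- x0) \<in> A} B (\<lambda>x. \<Theta> (x + (- x0))) (\<lambda>y. \<Psi> y + x0)" by (rule D')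
    show "x0 \<in> {x. x + (- x0) \<in> A}" "\<Theta> (x0 + (- x0)) \<in> L" using A subspace_0 by auto
    show "{x. x + (- x0) \<in> A} \<subseteq> W" using A(2) by (auto simp: W0_def)
    show "subspace L" by (rule A(4))
    fix x assume x: "x \<in> {x. x + (- x0) \<in> A}" and xL: "\<Theta> (x + (- x0)) \<in> L"
    let ?y = "x + (- x0)"
    have "span ({l::'v. l = 0} \<union> (\<lambda>i. Y0 i ?y) ` I) = span ((\<lambda>i. Y i x) ` I)"
    proof (rule span_image_subset_eq)
      show "{l. l = 0} \<union> (\<lambda>i. Y0 i ?y) ` I \<subseteq> span ((\<lambda>i. Y i x) ` I)"
        by (auto simp: Y0_def span_zero intro: span_base)
      show "(\<lambda>i. Y i x) ` I \<subseteq> span ({l. l = 0} \<union> (\<lambda>i. Y0 i ?y) ` I)"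
        by (auto simp: Y0_def intro: span_base)
    qed
    moreover have "dd (\<lambda>y. \<Psi> y + x0) (\<Theta> ?y) = dd \<Psi> (\<Theta> ?y)"
    proof -
      have "(\<Psi> has_derivative dd \<Psi> (\<Theta> ?y)) (at (\<Theta> ?y))"
        by (rule smooth_on_derivative[of B]) (use D x in \<open>auto simp: diffeo_def\<close>)
      from dd_eqI[OF has_derivative_add[OF this has_derivative_const[of x0]]] show ?thesis by simp
    qed
    ultimately show "span ((\<lambda>i. Y i x) ` I) = dd (\<lambda>y. \<Psi> y + x0) (\<Theta> ?y) ` L"
      using sp[of ?y] x xL by simp
  qed
qed

section \<open>Smooth manifolds: vector fields, plane fields, submanifolds and leaves\<close>

subsection \<open>Charts\<close>

locale smooth_manifold =
  fixes A :: "('x::{second_countable_topology, t2_space}, 'v::finite_dim_space) chart set"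
  assumes smooth_structure: "smooth_structure A"
begin

definition trans :: "('x, 'v) chart \<Rightarrow> ('x, 'v) chart \<Rightarrow> 'v \<Rightarrow> 'v" where
  "trans c d = snd d \<circ> chart_inv c"

lemma chart:
  assumes "c \<in> A"
  shows "open (fst c)" "open (snd c ` fst c)" "homeomorphism (fst c) (snd c ` fst c) (snd c) (chart_inv c)"
  using assms smooth_structure unfolding smooth_structure_def is_chart_def by blast+

lemma chart_at: "\<exists>c\<in>A. p \<in> fst c"
  using smooth_structure unfolding smooth_structure_def by blast

lemma chart_inv_left: "c \<in> A \<Longrightarrow> p \<in> fst c \<Longrightarrow> chart_inv c (snd c p) = p"
  using chart(3) homeomorphism_apply1 by blast

lemma chart_inv_right: "c \<in> A \<Longrightarrow> y \<in> snd c ` fst c \<Longrightarrow> snd c (chart_inv c y) = y"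
  using chart(3) homeomorphism_apply2 by blast

lemma chart_inv_image: "c \<in> A \<Longrightarrow> O' \<subseteq> fst c \<Longrightarrow> y \<in> snd c ` O' \<Longrightarrow> chart_inv c y \<in> O'"
  using chart_inv_left by fastforce

lemma chart_image_open: "c \<in> A \<Longrightarrow> open W \<Longrightarrow> W \<subseteq> fst c \<Longrightarrow> open (snd c ` W)"
  using homeomorphism_imp_open_map[OF chart(3), of c W] chart(1,2)[of c]
  by (metis openin_open_eq open_subset openin_open_trans)

lemma chart_image_open_Int: "c \<in> A \<Longrightarrow> open W \<Longrightarrow> open (snd c ` (fst c \<inter> W))"
  using chart_image_open[of c "fst c \<inter> W"] chart(1)[of c] by (simp add: open_Int)

lemma chart_preimage_open:
  assumes "c \<in> A" "open O'"
  shows "open {p \<in> fst c. snd c p \<in> O'}"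
proof -
  have "continuous_on (fst c) (snd c)" using chart(3)[OF assms(1)] homeomorphism_cont1 by blast
  from continuous_open_preimage[OF this chart(1)[OF assms(1)] assms(2)]
  show ?thesis by (simp add: vimage_def Int_def)
qed

lemma trans_at: "c \<in> A \<Longrightarrow> p \<in> fst c \<Longrightarrow> trans c d (snd c p) = snd d p"
  by (simp add: trans_def chart_inv_left)

lemma trans_open:
  "c \<in> A \<Longrightarrow> d \<in> A \<Longrightarrow> open (snd c ` (fst c \<inter> fst d))"
  by (rule chart_image_open_Int[OF _ chart(1)])

lemma trans_smooth:
  "c \<in> A \<Longrightarrow> d \<in> A \<Longrightarrow> smooth_on (snd c ` (fst c \<inter> fst d)) (trans c d)"
  using smooth_structure unfolding smooth_structure_def compatible_charts_def trans_def by blast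

text \<open>Maximality of the atlas admits the composite as a chart. This is how a straightening
  diffeomorphism becomes a slice chart.\<close>

lemma chart_compose_in_atlas:
  assumes c: "c \<in> A" and dif: "diffeo O' B \<Theta> \<Psi>"
  defines "c' \<equiv> ({p \<in> fst c. snd c p \<in> O'}, \<lambda>p. \<Theta> (snd c p))"
  shows "c' \<in> A" "\<And>y. y \<in> snd c' ` fst c' \<Longrightarrow> chart_inv c' y = chart_inv c (\<Psi> y)"
    "snd c' ` fst c' = {y \<in> B. \<Psi> y \<in> snd c ` fst c}"
proof -
  note d = dif[unfolded diffeo_def]
  have f: "fst c' = {p \<in> fst c. snd c p \<in> O'}" "snd c' = (\<lambda>p. \<Theta> (snd c p))" by (simp_all add: c'_def)
  have fsub: "fst c' \<subseteq> fst c" by (auto simp: f)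
  have o1: "open (fst c')" unfolding f(1) by (rule chart_preimage_open[OF c]) (use d in auto)
  show im: "snd c' ` fst c' = {y \<in> B. \<Psi> y \<in> snd c ` fst c}"
  proof (intro equalityI subsetI)
    fix y assume "y \<in> {y \<in> B. \<Psi> y \<in> snd c ` fst c}"
    then obtain p where p: "p \<in> fst c" "\<Psi> y = snd c p" "y \<in> B" by auto
    then have "p \<in> fst c'" "snd c' p = y" using d by (auto simp: f simp flip: p(2))
    then show "y \<in> snd c' ` fst c'" by blast
  qed (use d in \<open>auto simp: f\<close>)
  have "{y \<in> B. \<Psi> y \<in> snd c ` fst c} = B \<inter> \<Psi> -` (snd c ` fst c)" by auto
  then have o2: "open (snd c' ` fst c')"
    unfolding im using d smooth_on_imp_continuous[of B \<Psi>] chart(2)[OF c]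
    by (simp add: continuous_open_preimage)
  have hom: "homeomorphism (fst c') (snd c' ` fst c') (snd c') (\<lambda>y. chart_inv c (\<Psi> y))"
  proof (rule homeomorphismI)
    have "continuous_on (fst c') (snd c)"
      using chart(3)[OF c] homeomorphism_cont1 continuous_on_subset fsub by blast
    from continuous_on_compose2[OF smooth_on_imp_continuous[of O' \<Theta>] this] d
    show "continuous_on (fst c') (snd c')" unfolding f by auto
    have "continuous_on (snd c ` fst c) (chart_inv c)"
      using chart(3)[OF c] homeomorphism_cont2 by blast
    moreover have "continuous_on (snd c' ` fst c') \<Psi>"
      by (rule continuous_on_subset[OF smooth_on_imp_continuous[of B \<Psi>]]) (use d im in auto)
    ultimately show "continuous_on (snd c' ` fst c') (\<lambda>y. chart_inv c (\<Psi> y))"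
      by (rule continuous_on_compose2) (auto simp: im)
    show "(\<lambda>y. chart_inv c (\<Psi> y)) ` (snd c' ` fst c') \<subseteq> fst c'"
      using d by (auto simp: f chart_inv_left[OF c])
    show "chart_inv c (\<Psi> (snd c' x)) = x" if "x \<in> fst c'" for x
      using that d by (auto simp: f chart_inv_left[OF c])
    show "snd c' (chart_inv c (\<Psi> y)) = y" if "y \<in> snd c' ` fst c'" for y
      using that d by (auto simp: f chart_inv_left[OF c])
  qed simp
  have inj: "inj_on (snd c') (fst c')"
    by (rule inj_on_inverseI[where g="\<lambda>y. chart_inv c (\<Psi> y)"]) (rule homeomorphism_apply1[OF hom])
  show inv: "chart_inv c' y = chart_inv c (\<Psi> y)" if "y \<in> snd c' ` fst c'" for y
  proof -
    obtain p where p: "p \<in> fst c'" "y = snd c' p" using \<open>y \<in> snd c' ` fst c'\<close> by blast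
    then show ?thesis
      unfolding chart_inv_def[of c'] using inj homeomorphism_apply1[OF hom p(1)] by (simp add: inv_into_f_f)
  qed
  have ic: "is_chart c'"
    unfolding is_chart_def using o1 o2 homeomorphism_cong[OF hom refl refl refl, of "chart_inv c'"] inv
    by (metis (no_types, lifting) hom homeomorphism_cong)
  have op: "open (snd c' ` W)" if "open W" "W \<subseteq> fst c'" for W
    using homeomorphism_imp_open_map[OF hom, of W] o1 o2 that
    by (metis openin_open_eq open_subset openin_open_trans)
  have "compatible_charts c' e" if e: "e \<in> A" for e
    unfolding compatible_charts_def
  proof
    let ?W = "fst c' \<inter> fst e"
    have oW: "open (snd c' ` ?W)" by (rule op) (use o1 chart(1)[OF e] in auto)
    have s\<Psi>: "smooth_on (snd c' ` ?W) \<Psi>" by (rule smooth_on_subset[of B]) (use d im in auto)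
    have i\<Psi>: "\<Psi> ` (snd c' ` ?W) \<subseteq> snd c ` (fst c \<inter> fst e)" using d by (auto simp: f)
    have 1: "smooth_on (snd c' ` ?W) (\<lambda>y. trans c e (\<Psi> y))"
      by (rule smooth_on_compose[OF oW trans_open[OF c e] s\<Psi> trans_smooth[OF c e] i\<Psi>])
    have 2: "trans c e (\<Psi> y) = (snd e \<circ> chart_inv c') y" if "y \<in> snd c' ` ?W" for y
      using inv[of y] that by (auto simp: trans_def)
    show "smooth_on (snd c' ` ?W) (snd e \<circ> chart_inv c')"
      by (rule smooth_on_cong[OF oW 2 1])
    have oW': "open (snd e ` ?W)"
      by (rule chart_image_open[OF e]) (use o1 chart(1)[OF e] in auto)
    have st: "smooth_on (snd e ` ?W) (trans e c)"
      by (rule smooth_on_subset[OF trans_smooth[OF e c]]) (use fsub in auto)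
    have it: "trans e c ` (snd e ` ?W) \<subseteq> O'" by (auto simp: f trans_at[OF e])
    have "smooth_on (snd e ` ?W) (\<lambda>y. \<Theta> (trans e c y))"
      by (rule smooth_on_compose[OF oW' _ st _ it]) (use d in simp_all)
    then show "smooth_on (snd e ` ?W) (snd c' \<circ> chart_inv e)"
      by (simp add: f(2) o_def trans_def)
  qed
  then show "c' \<in> A" using smooth_structure ic unfolding smooth_structure_def by blast
qed

lemma chart_restrict_in_atlas:
  assumes "c \<in> A" "open W" "W \<subseteq> fst c"
  shows "(W, snd c) \<in> A" "\<And>y. y \<in> snd c ` W \<Longrightarrow> chart_inv (W, snd c) y = chart_inv c y"
proof -
  have oW: "open (snd c ` W)" by (rule chart_image_open[OF assms])
  have dif: "diffeo (snd c ` W) (snd c ` W) (\<lambda>x. x) (\<lambda>x. x)"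
    unfolding diffeo_def using oW smooth_on_ident by auto
  have "p \<in> W" if "p \<in> fst c" "snd c p \<in> snd c ` W" for p
    using chart_inv_image[OF assms(1,3) that(2)] chart_inv_left[OF assms(1) that(1)] by simp
  then have "{p \<in> fst c. snd c p \<in> snd c ` W} = W" using assms(3) by auto
  then show "(W, snd c) \<in> A" "\<And>y. y \<in> snd c ` W \<Longrightarrow> chart_inv (W, snd c) y = chart_inv c y"
    using chart_compose_in_atlas[OF assms(1) dif] by auto
qed

subsection \<open>Tangent vectors and vector fields\<close>

lemma tangent_change:
  "v \<in> tangent_space A p \<Longrightarrow> c \<in> A \<Longrightarrow> d \<in> A \<Longrightarrow> p \<in> fst c \<Longrightarrow> p \<in> fst d \<Longrightarrow>
    v d = dd (trans c d) (snd c p) (v c)"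
  unfolding tangent_space_def trans_def by blast

lemma tangent_outside: "v \<in> tangent_space A p \<Longrightarrow> \<not> (c \<in> A \<and> p \<in> fst c) \<Longrightarrow> v c = 0"
  unfolding tangent_space_def by blast

lemma tangent_eqI:
  assumes "v \<in> tangent_space A p" "w \<in> tangent_space A p" "c \<in> A" "p \<in> fst c" "v c = w c"
  shows "v = w"
proof
  fix d
  show "v d = w d"
    using tangent_change[OF assms(1,3), of d] tangent_change[OF assms(2,3), of d]
      tangent_outside[OF assms(1), of d] tangent_outside[OF assms(2), of d] assms(4,5) by metis
qed

lemma trans_linear: "c \<in> A \<Longrightarrow> d \<in> A \<Longrightarrow> p \<in> fst c \<Longrightarrow> p \<in> fst d \<Longrightarrow> linear (dd (trans c d) (snd c p))"
  by (rule smooth_on_dd_linear[OF trans_open trans_smooth]) auto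

lemma tangentI:
  assumes "\<And>c. \<not> (c \<in> A \<and> p \<in> fst c) \<Longrightarrow> v c = 0"
    and "\<And>c d. c \<in> A \<Longrightarrow> d \<in> A \<Longrightarrow> p \<in> fst c \<Longrightarrow> p \<in> fst d \<Longrightarrow> v d = dd (trans c d) (snd c p) (v c)"
  shows "v \<in> tangent_space A p"
  unfolding tangent_space_def trans_def[symmetric]
  by (intro CollectI conjI allI ballI impI assms) auto

lemma tangent_add:
  assumes "v \<in> tangent_space A p" "w \<in> tangent_space A p"
  shows "(\<lambda>c. v c + w c) \<in> tangent_space A p"
proof (rule tangentI)
  fix c d assume cd: "c \<in> A" "d \<in> A" "p \<in> fst c" "p \<in> fst d"
  then have "linear (dd (trans c d) (snd c p))" using trans_linear by simp
  from linear_add[OF this, of "v c" "w c"] show "v d + w d = dd (trans c d) (snd c p) (v c + w c)"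
    using tangent_change[OF assms(1), of c d] tangent_change[OF assms(2), of c d] cd by simp
qed (simp add: tangent_outside[OF assms(1)] tangent_outside[OF assms(2)])

lemma tangent_scale:
  assumes "v \<in> tangent_space A p"
  shows "(\<lambda>c. r *\<^sub>R v c) \<in> tangent_space A p"
proof (rule tangentI)
  fix c d assume cd: "c \<in> A" "d \<in> A" "p \<in> fst c" "p \<in> fst d"
  then have "linear (dd (trans c d) (snd c p))" using trans_linear by simp
  from linear_scale[OF this, of r "v c"] show "r *\<^sub>R v d = dd (trans c d) (snd c p) (r *\<^sub>R v c)"
    using tangent_change[OF assms(1), of c d] cd by simp
qed (simp add: tangent_outside[OF assms])

lemma tangent_zero: "(\<lambda>c. 0) \<in> tangent_space A p"
  by (rule tangentI) (simp_all add: linear_0[OF trans_linear])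

text \<open>Transporting the component in \<open>c\<close> by the derivatives of the transition maps
  is consistent by the chain rule. Together with \<open>tangent_eqI\<close>, a tangent vector is the
  same as its component in one chart.\<close>

lemma tangent_exists:
  assumes c: "c \<in> A" "p \<in> fst c"
  shows "\<exists>v\<in>tangent_space A p. v c = h"
proof -
  define v where "v = (\<lambda>d. if d \<in> A \<and> p \<in> fst d then dd (trans c d) (snd c p) h else 0)"
  have cp: "snd c p \<in> snd c ` fst c" using c by simp
  have "v \<in> tangent_space A p"
  proof (rule tangentI)
    fix e d assume ed: "e \<in> A" "d \<in> A" "p \<in> fst e" "p \<in> fst d"
    let ?W = "snd c ` (fst c \<inter> (fst e \<inter> fst d))"
    have oW: "open ?W" by (rule chart_image_open_Int[OF c(1)]) (use chart(1)[OF ed(1)] chart(1)[OF ed(2)] in auto)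
    have cW: "snd c p \<in> ?W" using c ed by blast
    have D1: "(trans c e has_derivative dd (trans c e) (snd c p)) (at (snd c p))"
      by (rule smooth_on_derivative[OF trans_open trans_smooth]) (use c ed in auto)
    have D2: "(trans e d has_derivative dd (trans e d) (snd e p)) (at (trans c e (snd c p)))"
      unfolding trans_at[OF c] by (rule smooth_on_derivative[OF trans_open trans_smooth]) (use c ed in auto)
    have "(trans c d has_derivative (\<lambda>h. dd (trans e d) (snd e p) (dd (trans c e) (snd c p) h))) (at (snd c p))"
      by (rule has_derivative_local[OF oW cW _ has_derivative_compose[OF D1 D2]])
        (auto simp: trans_at[OF c(1)] trans_at[OF ed(1)])
    from dd_eqI[OF this] show "v d = dd (trans e d) (snd e p) (v e)"
      using ed by (simp add: v_def)
  qed (auto simp: v_def)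
  moreover have "v c = h"
  proof -
    have "((\<lambda>y. y) has_derivative (\<lambda>h. h)) (at (snd c p))" by simp
    then have "(trans c c has_derivative (\<lambda>h. h)) (at (snd c p))"
      by (rule has_derivative_local[OF chart(2)[OF c(1)] cp, rotated]) (auto simp: trans_at[OF c(1)])
    from dd_eqI[OF this] show ?thesis using c by (simp add: v_def)
  qed
  ultimately show ?thesis by blast
qed

lemma in_chart_at: "c \<in> A \<Longrightarrow> p \<in> fst c \<Longrightarrow> in_chart X c (snd c p) = X p c"
  by (simp add: in_chart_def chart_inv_left)

lemma smooth_vfield_in_chart: "smooth_vfield_on A W X \<Longrightarrow> c \<in> A \<Longrightarrow> smooth_on (snd c ` (fst c \<inter> W)) (in_chart X c)"
  unfolding smooth_vfield_on_def by blast

lemma smooth_vfield_tangent: "smooth_vfield_on A W X \<Longrightarrow> p \<in> W \<Longrightarrow> X p \<in> tangent_space A p"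
  unfolding smooth_vfield_on_def by blast

lemma smooth_vfield_subset: "smooth_vfield_on A W X \<Longrightarrow> W' \<subseteq> W \<Longrightarrow> smooth_vfield_on A W' X"
  unfolding smooth_vfield_on_def by (meson smooth_on_subset image_mono Int_mono order_refl subsetD)

lemma in_chart_related:
  assumes "\<And>q. q \<in> W \<Longrightarrow> X q \<in> tangent_space A q" "c \<in> A" "d \<in> A" "x \<in> snd c ` (fst c \<inter> fst d \<inter> W)"
  shows "in_chart X d (trans c d x) = dd (trans c d) x (in_chart X c x)"
proof -
  obtain q where q: "q \<in> fst c" "q \<in> fst d" "q \<in> W" "x = snd c q" using assms(4) by auto
  show ?thesis
    using tangent_change[OF assms(1)[OF q(3)] assms(2,3) q(1,2)] q
    by (simp add: trans_at[OF assms(2)] in_chart_at assms(2,3))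
qed

text \<open>The transformation rule for components carries smoothness from one chart to all
  overlapping ones, so a single chart near each point suffices.\<close>

lemma smooth_vfieldI_local:
  assumes tan: "\<And>p. p \<in> W \<Longrightarrow> X p \<in> tangent_space A p"
    and loc: "\<And>p. p \<in> W \<Longrightarrow> \<exists>c\<in>A. \<exists>O'. open O' \<and> p \<in> O' \<and> O' \<subseteq> fst c \<inter> W \<and> smooth_on (snd c ` O') (in_chart X c)"
  shows "smooth_vfield_on A W X"
  unfolding smooth_vfield_on_def
proof (intro conjI ballI tan)
  fix d assume d: "d \<in> A"
  show "smooth_on (snd d ` (fst d \<inter> W)) (in_chart X d)"
  proof (rule smooth_on_local)
    fix y assume "y \<in> snd d ` (fst d \<inter> W)"
    then obtain p where p: "p \<in> fst d" "p \<in> W" "y = snd d p" by auto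
    obtain c O' where c: "c \<in> A" "open O'" "p \<in> O'" "O' \<subseteq> fst c" "O' \<subseteq> W" "smooth_on (snd c ` O') (in_chart X c)"
      using loc[OF p(2)] by auto
    let ?O = "snd d ` (fst d \<inter> O')"
    have oO: "open ?O" by (rule chart_image_open_Int[OF d c(2)])
    have oc: "open (snd c ` O')" by (rule chart_image_open[OF c(1,2,4)])
    have st: "smooth_on ?O (trans d c)" by (rule smooth_on_subset[OF trans_smooth[OF d c(1)]]) (use c in auto)
    have "smooth_on ?O (\<lambda>z. in_chart X c (trans d c z))"
      by (rule smooth_on_compose[OF oO oc st c(6)]) (auto simp: trans_at[OF d])
    moreover have "trans d c ` ?O \<subseteq> snd c ` (fst c \<inter> fst d)" using c(4) by (auto simp: trans_at[OF d])
    ultimately have "smooth_on ?O (\<lambda>z. dd (trans c d) (trans d c z) (in_chart X c (trans d c z)))"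
      by (intro smooth_on_dd_apply[OF oO trans_open[OF c(1) d] trans_smooth[OF c(1) d] st])
    then have "smooth_on ?O (in_chart X d)"
    proof (rule smooth_on_cong[OF oO, rotated])
      fix z assume "z \<in> ?O"
      then obtain q where q: "q \<in> fst d" "q \<in> O'" "z = snd d q" by auto
      have qc: "q \<in> fst c" "q \<in> W" using q c by auto
      have "in_chart X d (trans c d (snd c q)) = dd (trans c d) (snd c q) (in_chart X c (snd c q))"
        by (rule in_chart_related[where W=W, OF tan c(1) d]) (use q qc in auto)
      then show "dd (trans c d) (trans d c z) (in_chart X c (trans d c z)) = in_chart X d z"
        unfolding q(3) trans_at[OF c(1) qc(1)] trans_at[OF d q(1)] by simp
    qed
    then show "\<exists>W. open W \<and> y \<in> W \<and> smooth_on W (in_chart X d)"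
      using oO p c by (intro exI[of _ ?O]) auto
  qed
qed

lemma smooth_vfieldI:
  assumes "\<And>p. X p \<in> tangent_space A p" "\<And>c. c \<in> A \<Longrightarrow> smooth_on (snd c ` fst c) (in_chart X c)"
  shows "smooth_vfield_on A UNIV X"
  unfolding smooth_vfield_on_def using assms by simp

lemma smooth_vfield_UNIV_in_chart:
  "smooth_vfield_on A UNIV X \<Longrightarrow> c \<in> A \<Longrightarrow> smooth_on (snd c ` fst c) (in_chart X c)"
  using smooth_vfield_in_chart[of UNIV X c] by simp

lemma smooth_vfield_add:
  assumes "smooth_vfield_on A UNIV X" "smooth_vfield_on A UNIV Y"
  shows "smooth_vfield_on A UNIV (\<lambda>p c. X p c + Y p c)"
proof (rule smooth_vfieldI)
  fix c assume c: "c \<in> A"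
  from smooth_on_add[OF chart(2)[OF c] smooth_vfield_UNIV_in_chart[OF assms(1) c] smooth_vfield_UNIV_in_chart[OF assms(2) c]]
  show "smooth_on (snd c ` fst c) (in_chart (\<lambda>p c. X p c + Y p c) c)" by (simp add: in_chart_def)
qed (intro tangent_add smooth_vfield_tangent[OF assms(1)] smooth_vfield_tangent[OF assms(2)] UNIV_I)

lemma smooth_vfield_scale:
  assumes "smooth_vfield_on A UNIV X"
  shows "smooth_vfield_on A UNIV (\<lambda>p c. r *\<^sub>R X p c)"
proof (rule smooth_vfieldI)
  fix c assume c: "c \<in> A"
  from smooth_on_scaleR[OF chart(2)[OF c] smooth_on_const[OF chart(2)[OF c]] smooth_vfield_UNIV_in_chart[OF assms(1) c]]
  show "smooth_on (snd c ` fst c) (in_chart (\<lambda>p c. r *\<^sub>R X p c) c)" by (simp add: in_chart_def)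
qed (intro tangent_scale smooth_vfield_tangent[OF assms(1)] UNIV_I)

lemma smooth_vfield_zero: "smooth_vfield_on A UNIV (\<lambda>p c. 0)"
  by (rule smooth_vfieldI) (simp_all add: tangent_zero in_chart_def smooth_on_const chart(2))

lemma lie_bracket_at:
  "c \<in> A \<Longrightarrow> p \<in> fst c \<Longrightarrow> lie_bracket A X Y p c = brk (in_chart X c) (in_chart Y c) (snd c p)"
  by (simp add: lie_bracket_def brk_def in_chart_at)

lemma lie_bracket_smooth:
  assumes "smooth_vfield_on A UNIV X" "smooth_vfield_on A UNIV Y"
  shows "smooth_vfield_on A UNIV (lie_bracket A X Y)"
proof (rule smooth_vfieldI)
  fix p
  show "lie_bracket A X Y p \<in> tangent_space A p"
  proof (rule tangentI)
    fix c d assume cd: "c \<in> A" "d \<in> A" "p \<in> fst c" "p \<in> fst d"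
    let ?U = "snd c ` (fst c \<inter> fst d)" and ?V = "snd d ` (fst c \<inter> fst d)"
    have oV: "open ?V" using trans_open[OF cd(2,1)] by (simp add: Int_commute)
    have im: "trans c d ` ?U \<subseteq> ?V" by (auto simp: trans_at[OF cd(1)])
    have s: "smooth_on ?U (in_chart Z c)" "smooth_on ?V (in_chart Z d)" if "smooth_vfield_on A UNIV Z" for Z
      by (rule smooth_on_subset[OF smooth_vfield_UNIV_in_chart[OF that cd(1)]], blast)
        (rule smooth_on_subset[OF smooth_vfield_UNIV_in_chart[OF that cd(2)]], blast)
    have r: "in_chart Z d (trans c d x) = dd (trans c d) x (in_chart Z c x)"
      if "smooth_vfield_on A UNIV Z" "x \<in> ?U" for Z x
      by (rule in_chart_related[where W=UNIV, OF smooth_vfield_tangent[OF that(1)] cd(1,2)]) (use that in auto)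
    have "brk (in_chart X d) (in_chart Y d) (trans c d (snd c p)) =
        dd (trans c d) (snd c p) (brk (in_chart X c) (in_chart Y c) (snd c p))"
      by (rule brk_related[OF trans_open[OF cd(1,2)] oV trans_smooth[OF cd(1,2)] im s(1)[OF assms(1)] s(1)[OF assms(2)]
            s(2)[OF assms(1)] s(2)[OF assms(2)] r[OF assms(1)] r[OF assms(2)]]) (use cd in blast)+
    then show "lie_bracket A X Y p d = dd (trans c d) (snd c p) (lie_bracket A X Y p c)"
      unfolding lie_bracket_at[OF cd(1,3)] lie_bracket_at[OF cd(2,4)] trans_at[OF cd(1,3)] .
  qed (auto simp: lie_bracket_def)
next
  fix c assume c: "c \<in> A"
  have "smooth_on (snd c ` fst c) (brk (in_chart X c) (in_chart Y c))"
    by (intro brk_smooth chart(2)[OF c] smooth_vfield_UNIV_in_chart assms c)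
  then show "smooth_on (snd c ` fst c) (in_chart (lie_bracket A X Y) c)"
    by (rule smooth_on_cong[OF chart(2)[OF c], rotated]) (use c in \<open>auto simp: in_chart_at lie_bracket_at\<close>)
qed

lemma smooth_vfields_subalgebra: "lie_subalgebra A {X. smooth_vfield_on A UNIV X}"
  unfolding lie_subalgebra_def
  using smooth_vfield_zero smooth_vfield_add smooth_vfield_scale lie_bracket_smooth by auto

text \<open>The image of \<open>K\<close> in the manifold is compact, hence closed because the
  manifold is Hausdorff. Off that image the field is 0, and on \<open>W\<close> it is a smooth
  multiple of \<open>X\<close>; these two open sets cover the manifold.\<close>

lemma smooth_vfield_extend_by_zero:
  assumes c: "c \<in> A" and W: "open W" "W \<subseteq> fst c" and X: "smooth_vfield_on A W X"
    and f: "smooth_on UNIV f" "compact K" "K \<subseteq> snd c ` W" "\<And>y. y \<notin> K \<Longrightarrow> f y = (0::real)"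
  shows "smooth_vfield_on A UNIV (\<lambda>p d. (if p \<in> W then f (snd c p) else 0) *\<^sub>R X p d)" (is "smooth_vfield_on A UNIV ?Y")
proof (rule smooth_vfieldI_local)
  fix p
  show "?Y p \<in> tangent_space A p"
    using tangent_scale[OF smooth_vfield_tangent[OF X]] tangent_zero by (cases "p \<in> W") auto
  show "\<exists>c\<in>A. \<exists>O'. open O' \<and> p \<in> O' \<and> O' \<subseteq> fst c \<inter> UNIV \<and> smooth_on (snd c ` O') (in_chart ?Y c)"
  proof (cases "p \<in> W")
    case True
    have o: "open (snd c ` W)" by (rule chart_image_open[OF c W])
    have "smooth_on (snd c ` W) (in_chart X c)"
      using smooth_vfield_in_chart[OF X c] W(2) by (simp add: Int_absorb1)
    then have "smooth_on (snd c ` W) (\<lambda>y. f y *\<^sub>R in_chart X c y)"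
      by (intro smooth_on_scaleR o smooth_on_subset[OF f(1)]) auto
    then have "smooth_on (snd c ` W) (in_chart ?Y c)"
      by (rule smooth_on_cong[OF o, rotated]) (use W c in \<open>auto simp: in_chart_def chart_inv_left\<close>)
    then show ?thesis using True W c by (intro bexI[of _ c] exI[of _ W]) auto
  next
    case False
    have "continuous_on K (chart_inv c)"
      using chart(3)[OF c] homeomorphism_cont2 f(3) W(2) by (meson continuous_on_subset image_mono subset_trans)
    then have cl: "closed (chart_inv c ` K)"
      by (intro compact_imp_closed compact_continuous_image f(2))
    have KW: "chart_inv c ` K \<subseteq> W" using chart_inv_image[OF c W(2)] f(3) by blast
    obtain d where d: "d \<in> A" "p \<in> fst d" using chart_at by blast
    let ?O = "fst d \<inter> - (chart_inv c ` K)"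
    have oO: "open ?O" using chart(1)[OF d(1)] cl by auto
    have od: "open (snd d ` ?O)" by (rule chart_image_open[OF d(1) oO]) auto
    have "smooth_on (snd d ` ?O) (in_chart ?Y d)"
    proof (rule smooth_on_cong[OF od _ smooth_on_const[OF od, of 0]])
      fix y assume "y \<in> snd d ` ?O"
      then obtain q where q: "q \<in> fst d" "q \<notin> chart_inv c ` K" "y = snd d q" by auto
      have "(if q \<in> W then f (snd c q) else 0) = 0"
      proof (cases "q \<in> W")
        case True
        then have "snd c q \<notin> K" using q(2) chart_inv_left[OF c, of q] W(2) by (metis image_eqI subsetD)
        then show ?thesis using f(4) by simp
      qed simp
      then show "0 = in_chart ?Y d y" using q d by (simp add: in_chart_at)
    qed
    then show ?thesis using d oO False KW by (intro bexI[of _ d] exI[of _ ?O]) auto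
  qed
qed

subsection \<open>The generated distribution\<close>

text \<open>The smooth fields form a subalgebra containing the tangent ones, so the intersected
  family is nonempty and members of the intersection are smooth. The other closure properties pass
  to intersections.\<close>

lemma lie_subalgebra_generated: "lie_subalgebra A (generated_distribution A P)"
proof -
  have "{X. smooth_vfield_on A UNIV X} \<in> {L. lie_subalgebra A L \<and> tangent_vfields A P \<subseteq> L}"
    using smooth_vfields_subalgebra by (auto simp: tangent_vfields_def)
  then have sm: "X \<in> generated_distribution A P \<Longrightarrow> smooth_vfield_on A UNIV X" for X
    unfolding generated_distribution_def by blast
  have mem: "X \<in> generated_distribution A P \<longleftrightarrow> (\<forall>L. lie_subalgebra A L \<and> tangent_vfields A P \<subseteq> L \<longrightarrow> X \<in> L)" for X
    unfolding generated_distribution_def by blast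
  show ?thesis
    unfolding lie_subalgebra_def[of A "generated_distribution A P"]
    by (intro conjI ballI allI; (rule sm, assumption)?) (simp_all add: mem lie_subalgebra_def)
qed

lemma generated_subset: "lie_subalgebra A L \<Longrightarrow> tangent_vfields A P \<subseteq> L \<Longrightarrow> generated_distribution A P \<subseteq> L"
  unfolding generated_distribution_def by blast

lemma tangent_vfields_generated: "tangent_vfields A P \<subseteq> generated_distribution A P"
  unfolding generated_distribution_def by blast

lemma generated_smooth: "X \<in> generated_distribution A P \<Longrightarrow> smooth_vfield_on A UNIV X"
  using lie_subalgebra_generated unfolding lie_subalgebra_def by blast

end

subsection \<open>Smooth frames\<close>

lemma independent_family_dim:
  fixes f :: "nat \<Rightarrow> 'v::finite_dim_space"
  assumes "\<And>a. (\<Sum>i<d. a i *\<^sub>R f i) = 0 \<Longrightarrow> \<forall>i<d. a i = 0"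
  shows "dim (span (f ` {..<d})) = d"
proof -
  have inj: "inj_on f {..<d}"
  proof (rule inj_onI, rule ccontr)
    fix i j assume ij: "i \<in> {..<d}" "j \<in> {..<d}" "f i = f j" "i \<noteq> j"
    let ?a = "\<lambda>k. if k = i then 1 else if k = j then -1 else (0::real)"
    have "(\<Sum>k<d. ?a k *\<^sub>R f k) = (\<Sum>k\<in>{i, j}. ?a k *\<^sub>R f k)"
      by (rule sum.mono_neutral_right) (use ij in auto)
    also have "\<dots> = 0" using ij by simp
    finally show False using assms[of ?a] ij by auto
  qed
  have "independent (f ` {..<d})"
    unfolding independent_explicit_module
  proof (intro allI impI)
    fix t u v assume t: "finite t" "t \<subseteq> f ` {..<d}" "(\<Sum>v\<in>t. u v *\<^sub>R v) = 0" "v \<in> t"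
    define a where "a = (\<lambda>i. if f i \<in> t then u (f i) else 0)"
    have "(\<Sum>i<d. a i *\<^sub>R f i) = (\<Sum>w\<in>f ` {..<d}. (if w \<in> t then u w else 0) *\<^sub>R w)"
      unfolding a_def by (simp add: sum.reindex[OF inj])
    also have "\<dots> = (\<Sum>w\<in>t. u w *\<^sub>R w)"
      by (rule sum.mono_neutral_cong_right) (use t in auto)
    finally have "\<forall>i<d. a i = 0" using assms[of a] t(3) by simp
    moreover obtain i where "i < d" "v = f i" using t(2,4) by auto
    ultimately show "u v = 0" using t(4) by (auto simp: a_def)
  qed
  then show ?thesis
    using dim_span_eq_card_independent card_image[OF inj] by (metis card_lessThan)
qed

lemma linear_scaleR_const:
  fixes l :: "'a::real_vector \<Rightarrow> real"
  shows "linear l \<Longrightarrow> linear (\<lambda>v. l v *\<^sub>R c)"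
  by (rule linearI) (simp_all add: linear_add linear_scale scaleR_add_left)

text \<open>An elimination without inner product. \<open>R\<close> subtracts the components along
  the first \<open>d\<close> fields; independence at \<open>x0\<close> makes the remainder of
  \<open>X d\<close> nonzero there, and a functional detecting it stays nonzero near
  \<open>x0\<close>. The smooth dual forms later yield smooth coefficients of fields tangent to a
  plane field.\<close>

lemma dual_frame:
  fixes X :: "nat \<Rightarrow> 'v::finite_dim_space \<Rightarrow> 'v"
  assumes "open W" "x0 \<in> W" "\<And>i. i < d \<Longrightarrow> smooth_on W (X i)"
    and "\<And>a. (\<Sum>i<d. a i *\<^sub>R X i x0) = 0 \<Longrightarrow> \<forall>i<d. a i = 0"
  shows "\<exists>W' \<mu>. open W' \<and> x0 \<in> W' \<and> W' \<subseteq> W \<and>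
    (\<forall>i<d. \<forall>x\<in>W'. linear (\<mu> i x :: 'v \<Rightarrow> real)) \<and> (\<forall>i<d. \<forall>v. smooth_on W' (\<lambda>x. \<mu> i x v)) \<and>
    (\<forall>i<d. \<forall>j<d. \<forall>x\<in>W'. \<mu> i x (X j x) = (if i = j then 1 else 0))"
  using assms(3,4)
proof (induction d)
  case 0
  then show ?case using assms(1,2) by auto
next
  case (Suc d)
  have ind: "\<forall>i<d. a i = 0" if "(\<Sum>i<d. a i *\<^sub>R X i x0) = 0" for a
  proof -
    have "\<forall>i<Suc d. (if i < d then a i else 0) = 0" by (rule Suc.prems(2)) (use that in simp)
    then show ?thesis by (metis less_SucI)
  qed
  obtain W1 and \<mu> :: "nat \<Rightarrow> 'v \<Rightarrow> 'v \<Rightarrow> real" where H: "open W1 \<and> x0 \<in> W1 \<and> W1 \<subseteq> W \<and>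
    (\<forall>i<d. \<forall>x\<in>W1. linear (\<mu> i x)) \<and> (\<forall>i<d. \<forall>v. smooth_on W1 (\<lambda>x. \<mu> i x v)) \<and>
    (\<forall>i<d. \<forall>j<d. \<forall>x\<in>W1. \<mu> i x (X j x) = (if i = j then 1 else 0))"
    using Suc.IH[OF Suc.prems(1)[OF less_SucI] ind] by blast
  then have W1: "open W1" "x0 \<in> W1" "W1 \<subseteq> W" by simp_all
  have lin: "linear (\<mu> i x)" if "i < d" "x \<in> W1" for i x using H that by blast
  have sm: "smooth_on W1 (\<lambda>x. \<mu> i x v)" if "i < d" for i v using H that by blast
  have dual: "\<mu> i x (X j x) = (if i = j then 1 else 0)" if "i < d" "j < d" "x \<in> W1" for i j x using H that by blast
  have Xs: "smooth_on W1 (X i)" if "i < Suc d" for i by (rule smooth_on_subset[OF Suc.prems(1)[OF that] W1(3)])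
  have sm_app: "smooth_on W1 (\<lambda>x. \<mu> i x (Y x))" if i: "i < d" and Y: "smooth_on W1 Y" for i Y
  proof -
    have "smooth_on W1 (\<lambda>x. \<Sum>b\<in>fd_basis. coord b (Y x) * \<mu> i x b)"
      by (intro smooth_on_sum smooth_on_mult smooth_on_linear_comp[OF _ coord_linear] W1(1) Y sm i)
    then show ?thesis
      by (rule smooth_on_cong[OF W1(1), rotated])
        (use linear_coord_expand[OF lin[OF i]] in \<open>simp add: real_scaleR_def\<close>)
  qed
  define R where "R = (\<lambda>x v. v - (\<Sum>j<d. \<mu> j x v *\<^sub>R X j x))"
  have Rlin: "linear (R x)" if x: "x \<in> W1" for x
    unfolding R_def
    by (intro linear_compose_sub linear_ident linear_compose_sum ballI linear_scaleR_const[OF lin[OF _ x]]) auto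
  have RX: "R x (X j x) = 0" if "j < d" "x \<in> W1" for j x
  proof -
    have "(\<Sum>k<d. \<mu> k x (X j x) *\<^sub>R X k x) = (\<Sum>k<d. if k = j then X k x else 0)"
      using dual that by (intro sum.cong) auto
    then show ?thesis using that by (simp add: R_def)
  qed
  have Rs: "smooth_on W1 (\<lambda>x. R x v)" for v
    unfolding R_def by (intro smooth_on_diff smooth_on_sum smooth_on_scaleR smooth_on_const W1(1) sm Xs) auto
  have Rsd: "smooth_on W1 (\<lambda>x. R x (X d x))"
    unfolding R_def by (intro smooth_on_diff smooth_on_sum smooth_on_scaleR W1(1) sm_app Xs) auto
  have "R x0 (X d x0) \<noteq> 0"
  proof
    assume "R x0 (X d x0) = 0"
    then have "(\<Sum>i<Suc d. (if i = d then 1 else - \<mu> i x0 (X d x0)) *\<^sub>R X i x0) = 0"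
      by (simp add: R_def sum_negf)
    from Suc.prems(2)[OF this] show False by auto
  qed
  then obtain l :: "'v \<Rightarrow> real" where l: "linear l" "l (R x0 (X d x0)) = 1"
    using separating_functional[OF subspace_single_0] by (metis singletonD)
  define D where "D = (\<lambda>x. l (R x (X d x)))"
  have Ds: "smooth_on W1 D" unfolding D_def by (rule smooth_on_linear_comp[OF W1(1) l(1) Rsd])
  define W2 where "W2 = W1 \<inter> D -` (- {0})"
  have W2: "open W2" "x0 \<in> W2" "W2 \<subseteq> W1" "\<And>x. x \<in> W2 \<Longrightarrow> D x \<noteq> 0"
    using continuous_open_preimage[OF smooth_on_imp_continuous[OF Ds] W1(1), of "- {0}"] W1(2) l(2)
    by (auto simp: W2_def D_def)
  define \<nu> where "\<nu> = (\<lambda>x v. inverse (D x) * l (R x v))"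
  \<comment> \<open>The old functionals are corrected by a multiple of \<open>\<nu>\<close>, so that
    they also vanish on \<open>X d\<close>.\<close>
  define \<mu>' where "\<mu>' = (\<lambda>i x v. if i < d then \<mu> i x v - \<mu> i x (X d x) * \<nu> x v else \<nu> x v)"
  have \<nu>lin: "linear (\<nu> x)" if "x \<in> W2" for x
  proof -
    have "linear (\<lambda>v. inverse (D x) *\<^sub>R l (R x v))"
      by (rule linear_compose_scale_right) (use linear_compose[OF Rlin l(1), of x] that W2(3) in \<open>auto simp: o_def\<close>)
    then show ?thesis by (simp add: \<nu>_def)
  qed
  have \<nu>s: "smooth_on W2 (\<lambda>x. \<nu> x v)" for v
    unfolding \<nu>_def
    by (intro smooth_on_mult smooth_on_inverse smooth_on_linear_comp[OF _ l(1)] W2(1,4)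
        smooth_on_subset[OF Ds W2(3)] smooth_on_subset[OF Rs W2(3)])
  have \<nu>X: "\<nu> x (X j x) = (if j = d then 1 else 0)" if "j < Suc d" "x \<in> W2" for j x
  proof (cases "j = d")
    case True
    then show ?thesis using W2(4)[OF that(2)] by (simp add: \<nu>_def D_def)
  next
    case False
    then show ?thesis using RX[of j x] that W2(3) by (auto simp: \<nu>_def linear_0[OF l(1)])
  qed
  have "linear (\<mu>' i x)" if "i < Suc d" "x \<in> W2" for i x
  proof (cases "i < d")
    case True
    have "linear (\<lambda>v. \<mu> i x v - \<mu> i x (X d x) *\<^sub>R \<nu> x v)"
      using W2(3) that by (intro linear_compose_sub lin True linear_compose_scale_right \<nu>lin) auto
    then show ?thesis using True by (simp add: \<mu>'_def)
  qed (use \<nu>lin that in \<open>simp add: \<mu>'_def\<close>)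
  moreover have "smooth_on W2 (\<lambda>x. \<mu>' i x v)" if "i < Suc d" for i v
  proof (cases "i < d")
    case True
    have "smooth_on W2 (\<lambda>x. \<mu> i x v - \<mu> i x (X d x) * \<nu> x v)"
      by (intro smooth_on_diff smooth_on_mult W2(1) \<nu>s smooth_on_subset[OF sm[OF True] W2(3)]
          smooth_on_subset[OF sm_app[OF True Xs] W2(3)]) simp
    then show ?thesis using True by (simp add: \<mu>'_def)
  qed (use \<nu>s in \<open>simp add: \<mu>'_def\<close>)
  moreover have "\<mu>' i x (X j x) = (if i = j then 1 else 0)" if "i < Suc d" "j < Suc d" "x \<in> W2" for i j x
    using \<nu>X[OF that(2,3)] dual[of i j x] that W2(3) by (auto simp: \<mu>'_def less_Suc_eq)
  ultimately show ?case
    using W2 W1(3) by (intro exI[of _ W2] exI[of _ \<mu>']) auto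
qed

lemma dual_frame_coefficients_smooth:
  fixes \<mu> :: "'v::finite_dim_space \<Rightarrow> 'v \<Rightarrow> real"
  assumes "open W" "\<And>x. x \<in> W \<Longrightarrow> linear (\<mu> x)" "\<And>v. smooth_on W (\<lambda>x. \<mu> x v)" "smooth_on W Y"
  shows "smooth_on W (\<lambda>x. \<mu> x (Y x))"
proof -
  have "smooth_on W (\<lambda>x. \<Sum>b\<in>fd_basis. coord b (Y x) * \<mu> x b)"
    by (intro smooth_on_sum smooth_on_mult smooth_on_linear_comp[OF _ coord_linear] assms)
  then show ?thesis
    by (rule smooth_on_cong[OF assms(1), rotated])
      (use linear_coord_expand[OF assms(2)] in \<open>simp add: real_scaleR_def\<close>)
qed

lemma span_independent_family:
  fixes f :: "nat \<Rightarrow> 'v::finite_dim_space"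
  assumes S: "subspace S" "dim S = d" and f: "\<And>i. i < d \<Longrightarrow> f i \<in> S"
    and ind: "\<And>a. (\<Sum>i<d. a i *\<^sub>R f i) = 0 \<Longrightarrow> \<forall>i<d. a i = 0"
  shows "span (f ` {..<d}) = S"
proof (rule fd.subspace_dim_equal)
  show "subspace (span (f ` {..<d}))" by (rule subspace_span)
  show "span (f ` {..<d}) \<subseteq> S" by (rule span_minimal[OF _ S(1)]) (use f in auto)
  have "dim (span (f ` {..<d})) = d" by (rule independent_family_dim[OF ind])
  then show "dim (span (f ` {..<d})) \<ge> dim S" using S(2) by simp
qed (rule S(1))

text \<open>Duality makes the vectors \<open>f i\<close> independent, so they span \<open>S\<close>
  for reasons of dimension; on these vectors themselves the formula is immediate.\<close>

lemma dual_frame_expand: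
  fixes f :: "nat \<Rightarrow> 'v::finite_dim_space"
  assumes S: "subspace S" "dim S = d" and f: "\<And>i. i < d \<Longrightarrow> f i \<in> S"
    and \<mu>: "\<And>i. i < d \<Longrightarrow> linear (\<mu> i)" "\<And>i j. i < d \<Longrightarrow> j < d \<Longrightarrow> \<mu> i (f j) = (if i = j then 1 else (0::real))"
    and x: "x \<in> S"
  shows "x = (\<Sum>i<d. \<mu> i x *\<^sub>R f i)"
proof -
  have "\<forall>j<d. a j = 0" if a: "(\<Sum>i<d. a i *\<^sub>R f i) = 0" for a
  proof (intro allI impI)
    fix j assume j: "j < d"
    have "\<mu> j (\<Sum>i<d. a i *\<^sub>R f i) = (\<Sum>i<d. a i * \<mu> j (f i))"
      by (simp add: linear_sum[OF \<mu>(1)[OF j]] linear_scale[OF \<mu>(1)[OF j]])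
    also have "\<dots> = (\<Sum>i<d. if j = i then a i else 0)" by (rule sum.cong) (use \<mu>(2)[OF j] in auto)
    also have "\<dots> = a j" using j by simp
    finally show "a j = 0" using a linear_0[OF \<mu>(1)[OF j]] by simp
  qed
  from span_independent_family[OF S f this] have sp: "span (f ` {..<d}) = S" by simp
  let ?T = "{x. x = (\<Sum>i<d. \<mu> i x *\<^sub>R f i)}"
  have "subspace ?T"
  proof (rule subspaceI)
    have "\<mu> i 0 = 0" if "i < d" for i using linear_0[OF \<mu>(1)[OF that]] .
    then show "0 \<in> ?T" by simp
  next
    fix x y assume "x \<in> ?T" "y \<in> ?T"
    moreover have "\<mu> i (x + y) = \<mu> i x + \<mu> i y" if "i < d" for i by (rule linear_add[OF \<mu>(1)[OF that]])
    then have "(\<Sum>i<d. \<mu> i (x + y) *\<^sub>R f i) = (\<Sum>i<d. \<mu> i x *\<^sub>R f i) + (\<Sum>i<d. \<mu> i y *\<^sub>R f i)"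
      by (simp add: scaleR_add_left sum.distrib)
    ultimately show "x + y \<in> ?T" by simp
  next
    fix r x assume "x \<in> ?T"
    moreover have "\<mu> i (r *\<^sub>R x) = r * \<mu> i x" if "i < d" for i using linear_scale[OF \<mu>(1)[OF that]] by simp
    then have "(\<Sum>i<d. \<mu> i (r *\<^sub>R x) *\<^sub>R f i) = r *\<^sub>R (\<Sum>i<d. \<mu> i x *\<^sub>R f i)"
      by (simp add: scaleR_sum_right)
    ultimately show "r *\<^sub>R x \<in> ?T" by simp
  qed
  moreover have "f j \<in> ?T" if j: "j < d" for j
  proof -
    have "(\<Sum>i<d. \<mu> i (f j) *\<^sub>R f i) = (\<Sum>i<d. if i = j then f i else 0)" by (rule sum.cong) (use \<mu>(2) j in auto)
    then show ?thesis using j by simp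
  qed
  ultimately have "span (f ` {..<d}) \<subseteq> ?T" by (intro span_minimal) auto
  then show ?thesis using sp x by blast
qed

text \<open>A functional vanishing on \<open>L\<close> but not on the derivative would, composed
  with \<open>f\<close>, be 0 along the line through \<open>y\<close> in direction \<open>h\<close>
  near \<open>y\<close>, and yet have nonzero derivative there.\<close>

lemma dd_in_subspace:
  fixes f :: "'u::real_normed_vector \<Rightarrow> 'v::finite_dim_space"
  assumes "f differentiable (at y)" "subspace L" "open W" "y \<in> W"
    and "\<And>s. y + s *\<^sub>R h \<in> W \<Longrightarrow> f (y + s *\<^sub>R h) \<in> L"
  shows "dd f y h \<in> L"
proof (rule ccontr)
  assume "dd f y h \<notin> L"
  from separating_functional[OF assms(2) this] obtain l :: "'v \<Rightarrow> real"
    where l: "linear l" "l (dd f y h) = 1" "\<And>x. x \<in> L \<Longrightarrow> l x = 0" by blast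
  have "((\<lambda>s. f (y + s *\<^sub>R h)) has_vector_derivative dd f (y + 0 *\<^sub>R h) h) (at 0)"
    by (rule dd_along_line) (use assms(1) in simp)
  from bounded_linear.has_vector_derivative[OF linear_bounded_linear[OF l(1)] this]
  have "((\<lambda>s. l (f (y + s *\<^sub>R h))) has_vector_derivative 1) (at 0)" using l(2) by simp
  moreover have "((\<lambda>s. l (f (y + s *\<^sub>R h))) has_vector_derivative 0) (at 0)"
  proof (rule has_vector_derivative_transform_within_open[of "\<lambda>s. 0" 0 0 "(\<lambda>s. y + s *\<^sub>R h) -` W"])
    show "open ((\<lambda>s. y + s *\<^sub>R h) -` W)" by (intro open_vimage assms(3) continuous_intros)
    show "0 = l (f (y + s *\<^sub>R h))" if "s \<in> (\<lambda>s. y + s *\<^sub>R h) -` W" for s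
      using l(3)[OF assms(5)] that by simp
  qed (use assms(4) in auto)
  ultimately show False using vector_derivative_unique_at by fastforce
qed

subsection \<open>Spans of tangent vectors\<close>

lemma sum_lessThan_add: "(\<Sum>i<k + l. f i) = (\<Sum>i<k. f i) + (\<Sum>i<(l::nat). f (k + i) :: 'a::comm_monoid_add)"
  by (induction l) (simp_all add: add.assoc)

lemma tspan_base: "v \<in> V \<Longrightarrow> v \<in> tspan V"
  unfolding tspan_def lin_comb_def
  by (intro CollectI exI[of _ 1] exI[of _ "\<lambda>_. v"] exI[of _ "\<lambda>_. 1"]) auto

lemma tspan_zero: "(\<lambda>c. 0) \<in> tspan V"
  unfolding tspan_def lin_comb_def by (intro CollectI exI[of _ 0]) auto

lemma tspan_add:
  assumes "v \<in> tspan V" "w \<in> tspan V"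
  shows "(\<lambda>c. v c + w c) \<in> tspan V"
proof -
  obtain k f a where v: "v = lin_comb k f a" "\<forall>i<k. f i \<in> V" using assms(1) unfolding tspan_def by blast
  obtain l g b where w: "w = lin_comb l g b" "\<forall>i<l. g i \<in> V" using assms(2) unfolding tspan_def by blast
  let ?f = "\<lambda>i. if i < k then f i else g (i - k)" and ?a = "\<lambda>i. if i < k then a i else b (i - k)"
  have "(\<lambda>c. v c + w c) = lin_comb (k + l) ?f ?a"
    unfolding v(1) w(1) lin_comb_def sum_lessThan_add by simp
  moreover have "\<forall>i<k + l. ?f i \<in> V" using v(2) w(2) by auto
  ultimately show ?thesis unfolding tspan_def by blast
qed

lemma tspan_scale:
  assumes "v \<in> tspan V"
  shows "(\<lambda>c. r *\<^sub>R v c) \<in> tspan V"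
proof -
  obtain k f a where v: "v = lin_comb k f a" "\<forall>i<k. f i \<in> V" using assms(1) unfolding tspan_def by blast
  have "(\<lambda>c. r *\<^sub>R v c) = lin_comb k f (\<lambda>i. r * a i)"
    unfolding v(1) lin_comb_def by (simp add: scaleR_sum_right)
  then show ?thesis using v(2) unfolding tspan_def by blast
qed

text \<open>Evaluation in a chart translates combinations of tangent vectors into linear algebra of
  the model space, where dimension arguments are available.\<close>

lemma tspan_image: "(\<lambda>v. v c) ` tspan V = span ((\<lambda>v. v c) ` V)"
proof
  show "(\<lambda>v. v c) ` tspan V \<subseteq> span ((\<lambda>v. v c) ` V)"
    unfolding tspan_def lin_comb_def by (auto intro!: span_sum span_scale intro: span_base)
  have "subspace ((\<lambda>v. v c) ` tspan V)"
  proof (rule subspaceI)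
    show "0 \<in> (\<lambda>v. v c) ` tspan V" using image_eqI[OF _ tspan_zero, of 0 "\<lambda>v. v c"] by simp
    fix x y r assume x: "x \<in> (\<lambda>v. v c) ` tspan V"
    then obtain v where v: "v \<in> tspan V" "x = v c" by blast
    show "r *\<^sub>R x \<in> (\<lambda>v. v c) ` tspan V" using image_eqI[OF _ tspan_scale[OF v(1), of r], of _ "\<lambda>v. v c"] v by simp
    assume "y \<in> (\<lambda>v. v c) ` tspan V"
    then obtain w where w: "w \<in> tspan V" "y = w c" by blast
    show "x + y \<in> (\<lambda>v. v c) ` tspan V" using image_eqI[OF _ tspan_add[OF v(1) w(1)], of _ "\<lambda>v. v c"] v w by simp
  qed
  moreover have "(\<lambda>v. v c) ` V \<subseteq> (\<lambda>v. v c) ` tspan V" using tspan_base by blast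
  ultimately show "span ((\<lambda>v. v c) ` V) \<subseteq> (\<lambda>v. v c) ` tspan V" by (rule span_minimal[rotated])
qed

context smooth_manifold
begin

lemma lin_comb_tangent: "(\<And>i. i < k \<Longrightarrow> v i \<in> tangent_space A p) \<Longrightarrow> lin_comb k v a \<in> tangent_space A p"
proof (induction k)
  case 0
  then show ?case using tangent_zero by (simp add: lin_comb_def)
next
  case (Suc k)
  have "lin_comb (Suc k) v a = (\<lambda>c. lin_comb k v a c + (\<lambda>c. a k *\<^sub>R v k c) c)" by (simp add: lin_comb_def)
  then show ?case using tangent_add[OF Suc.IH tangent_scale[of "v k" p "a k"]] Suc.prems by simp
qed

lemma tspan_tangent: "V \<subseteq> tangent_space A p \<Longrightarrow> tspan V \<subseteq> tangent_space A p"
  unfolding tspan_def by (auto intro!: lin_comb_tangent)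

lemma tangent_set_eqI:
  assumes "V \<subseteq> tangent_space A p" "c \<in> A" "p \<in> fst c"
  shows "V = {v \<in> tangent_space A p. v c \<in> (\<lambda>v. v c) ` V}"
  using assms tangent_eqI[OF _ _ assms(2,3)] by blast

lemma tangent_image_Collect:
  assumes "c \<in> A" "p \<in> fst c"
  shows "(\<lambda>v. v c) ` {v \<in> tangent_space A p. v c \<in> L} = L"
proof
  show "L \<subseteq> (\<lambda>v. v c) ` {v \<in> tangent_space A p. v c \<in> L}"
  proof
    fix x assume x: "x \<in> L"
    obtain v where "v \<in> tangent_space A p" "v c = x" using tangent_exists[OF assms] by blast
    then show "x \<in> (\<lambda>v. v c) ` {v \<in> tangent_space A p. v c \<in> L}" using x by blast
  qed
qed blast

subsection \<open>Submanifolds\<close>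

lemma slice_chart_mem:
  assumes "slice_chart A S p c L" "q \<in> fst c"
  shows "q \<in> S \<longleftrightarrow> snd c q \<in> L"
proof -
  have c: "c \<in> A" and eq: "snd c ` (S \<inter> fst c) = snd c ` fst c \<inter> L" using assms(1) by (auto simp: slice_chart_def)
  show ?thesis
  proof
    assume "q \<in> S"
    then show "snd c q \<in> L" using eq assms(2) by blast
  next
    assume "snd c q \<in> L"
    then have "snd c q \<in> snd c ` (S \<inter> fst c)" unfolding eq using assms(2) by blast
    then obtain q' where q': "q' \<in> S" "q' \<in> fst c" "snd c q = snd c q'" by blast
    then have "q = q'" using chart_inv_left[OF c q'(2)] chart_inv_left[OF c assms(2)] by simp
    then show "q \<in> S" using q'(1) by simp
  qed
qed

text \<open>The transition map sends points of \<open>L\<close> into \<open>M\<close>, because both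
  describe \<open>S\<close>; hence its derivative maps \<open>L\<close> into \<open>M\<close>. This
  makes the tangent space of a submanifold independent of the slice chart.\<close>

lemma slice_chart_tangent_change:
  assumes sc: "slice_chart A S p c L" and sd: "slice_chart A S p d M" and p: "p \<in> S"
    and v: "v \<in> tangent_space A p" "v c \<in> L"
  shows "v d \<in> M"
proof -
  have c: "c \<in> A" "p \<in> fst c" "subspace L" and d: "d \<in> A" "p \<in> fst d" "subspace M"
    using sc sd by (auto simp: slice_chart_def)
  have "dd (trans c d) (snd c p) (v c) \<in> M"
  proof (rule dd_in_subspace[OF _ d(3) trans_open[OF c(1) d(1)]])
    show "trans c d differentiable (at (snd c p))"
      by (rule smooth_on_differentiable[OF trans_open trans_smooth]) (use c d in auto)
    show "snd c p \<in> snd c ` (fst c \<inter> fst d)" using c d by blast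
    fix s assume "snd c p + s *\<^sub>R v c \<in> snd c ` (fst c \<inter> fst d)"
    then obtain q where q: "q \<in> fst c" "q \<in> fst d" "snd c p + s *\<^sub>R v c = snd c q" by blast
    have "snd c q \<in> L"
      using slice_chart_mem[OF sc c(2)] p v(2) c(3) q(3)[symmetric] by (simp add: subspace_add subspace_scale)
    then have "snd d q \<in> M" using slice_chart_mem[OF sc q(1)] slice_chart_mem[OF sd q(2)] by simp
    then show "trans c d (snd c p + s *\<^sub>R v c) \<in> M" unfolding q(3) trans_at[OF c(1) q(1)] .
  qed
  then show ?thesis using tangent_change[OF v(1) c(1) d(1) c(2) d(2)] by simp
qed

lemma submanifold_tangent_space_slice:
  assumes "slice_chart A S p c L" "p \<in> S"
  shows "submanifold_tangent_space A S p = {v \<in> tangent_space A p. v c \<in> L}"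
  unfolding submanifold_tangent_space_def
  using slice_chart_tangent_change[OF _ assms(1,2)] assms(1) by blast

text \<open>In a slice chart both fields take values in \<open>L\<close> along \<open>L\<close>.
  Their derivatives in directions of \<open>L\<close> therefore lie in \<open>L\<close>, and so does
  the bracket.\<close>

lemma tangent_to_submanifold_bracket:
  assumes X: "smooth_vfield_on A UNIV X" "\<And>q. q \<in> S \<Longrightarrow> X q \<in> submanifold_tangent_space A S q"
    and Y: "smooth_vfield_on A UNIV Y" "\<And>q. q \<in> S \<Longrightarrow> Y q \<in> submanifold_tangent_space A S q"
    and sc: "slice_chart A S p c L" and p: "p \<in> S"
  shows "lie_bracket A X Y p \<in> submanifold_tangent_space A S p"
proof -
  have c: "c \<in> A" "p \<in> fst c" "subspace L" using sc by (auto simp: slice_chart_def)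
  have sq: "slice_chart A S q c L" if "q \<in> fst c" for q using sc that by (simp add: slice_chart_def)
  have Zc: "in_chart Z c (snd c q) \<in> L" if "\<And>q. q \<in> S \<Longrightarrow> Z q \<in> submanifold_tangent_space A S q" "q \<in> S" "q \<in> fst c" for Z q
    using that(1)[OF that(2)] submanifold_tangent_space_slice[OF sq[OF that(3)] that(2)]
    by (simp add: in_chart_at[OF c(1) that(3)])
  have key: "dd (in_chart Z c) (snd c p) h \<in> L"
    if Z: "smooth_vfield_on A UNIV Z" "\<And>q. q \<in> S \<Longrightarrow> Z q \<in> submanifold_tangent_space A S q" and h: "h \<in> L" for Z h
  proof (rule dd_in_subspace[OF _ c(3) chart(2)[OF c(1)]])
    show "in_chart Z c differentiable (at (snd c p))"
      by (rule smooth_on_differentiable[OF chart(2)[OF c(1)] smooth_vfield_UNIV_in_chart[OF Z(1) c(1)]]) (use c in blast)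
    fix s assume "snd c p + s *\<^sub>R h \<in> snd c ` fst c"
    then obtain q where q: "q \<in> fst c" "snd c p + s *\<^sub>R h = snd c q" by blast
    have "snd c q \<in> L"
      using slice_chart_mem[OF sc c(2)] p h c(3) q(2)[symmetric] by (simp add: subspace_add subspace_scale)
    then have "q \<in> S" using slice_chart_mem[OF sc q(1)] by simp
    from Zc[OF Z(2) this q(1)] show "in_chart Z c (snd c p + s *\<^sub>R h) \<in> L" unfolding q(2) .
  qed (use c in blast)
  have "lie_bracket A X Y p c \<in> L"
    unfolding lie_bracket_at[OF c(1,2)] brk_def
    by (intro subspace_diff c(3) key X Y Zc p c(2))
  then show ?thesis
    unfolding submanifold_tangent_space_slice[OF sc p]
    using smooth_vfield_tangent[OF lie_bracket_smooth[OF X(1) Y(1)], of p] by simp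
qed

subsection \<open>Plane fields and their leaves\<close>

lemma plane_field_facts:
  assumes "plane_field A d P"
  shows "P p \<subseteq> tangent_space A p"
    and "(\<lambda>c. 0) \<in> P p"
    and "v \<in> P p \<Longrightarrow> w \<in> P p \<Longrightarrow> (\<lambda>c. v c + w c) \<in> P p"
    and "v \<in> P p \<Longrightarrow> (\<lambda>c. r *\<^sub>R v c) \<in> P p"
    and "c \<in> A \<Longrightarrow> p \<in> fst c \<Longrightarrow> subspace ((\<lambda>v. v c) ` P p) \<and> dim ((\<lambda>v. v c) ` P p) = d"
proof -
  obtain W X where W: "open W" "p \<in> W" "\<And>i. i < d \<Longrightarrow> smooth_vfield_on A W (X i)"
    "tindependent d (\<lambda>i. X i p)" "P p = tspan ((\<lambda>i. X i p) ` {..<d})"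
    using assms unfolding plane_field_def by metis
  have X: "X i p \<in> tangent_space A p" if "i < d" for i by (rule smooth_vfield_tangent[OF W(3)[OF that] W(2)])
  show "P p \<subseteq> tangent_space A p" unfolding W(5) by (rule tspan_tangent) (use X in auto)
  show "(\<lambda>c. 0) \<in> P p" unfolding W(5) by (rule tspan_zero)
  show "v \<in> P p \<Longrightarrow> w \<in> P p \<Longrightarrow> (\<lambda>c. v c + w c) \<in> P p" unfolding W(5) by (rule tspan_add)
  show "v \<in> P p \<Longrightarrow> (\<lambda>c. r *\<^sub>R v c) \<in> P p" unfolding W(5) by (rule tspan_scale)
  assume c: "c \<in> A" "p \<in> fst c"
  have im: "(\<lambda>v. v c) ` P p = span ((\<lambda>i. X i p c) ` {..<d})"
    unfolding W(5) tspan_image by (simp add: image_image)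
  have "dim (span ((\<lambda>i. X i p c) ` {..<d})) = d"
  proof (rule independent_family_dim)
    fix a assume "(\<Sum>i<d. a i *\<^sub>R X i p c) = 0"
    then have "lin_comb d (\<lambda>i. X i p) a c = (\<lambda>_. 0) c" by (simp add: lin_comb_def)
    from tangent_eqI[OF lin_comb_tangent tangent_zero c this]
    have "lin_comb d (\<lambda>i. X i p) a = (\<lambda>_. 0)" using X by simp
    then show "\<forall>i<d. a i = 0" using W(4) unfolding tindependent_def by blast
  qed
  then show "subspace ((\<lambda>v. v c) ` P p) \<and> dim ((\<lambda>v. v c) ` P p) = d" unfolding im by simp
qed

text \<open>The field is multiplied by \<open>h\<close> and a bump function and extended by 0; near
  \<open>p\<close> only the factor \<open>h\<close> remains. With \<open>h\<close> equal to 1 this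
  realises local tangent fields as germs of global ones.\<close>

lemma tangent_vfield_localize:
  assumes P: "plane_field A d P" and W: "open W" "p \<in> W" and X: "smooth_vfield_on A W X" "\<And>q. q \<in> W \<Longrightarrow> X q \<in> P q"
    and c: "c \<in> A" "p \<in> fst c" and h: "open B" "snd c p \<in> B" "smooth_on B h"
  shows "\<exists>Y\<in>tangent_vfields A P. \<exists>B'. open B' \<and> snd c p \<in> B' \<and> B' \<subseteq> B \<inter> snd c ` (fst c \<inter> W) \<and>
    (\<forall>y\<in>B'. in_chart Y c y = h y *\<^sub>R in_chart X c y)"
proof -
  let ?W = "fst c \<inter> W"
  have oW: "open ?W" using chart(1)[OF c(1)] W by auto
  have o: "open (snd c ` ?W \<inter> B)" using chart_image_open_Int[OF c(1) W(1)] h(1) by auto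
  have "snd c p \<in> snd c ` ?W \<inter> B" using c W h by blast
  from bump_exists[OF o this] obtain \<beta> K U where b: "smooth_on UNIV \<beta>" "compact K" "K \<subseteq> snd c ` ?W \<inter> B"
    "open U" "snd c p \<in> U" "U \<subseteq> K" "\<And>x. x \<in> U \<Longrightarrow> \<beta> x = (1::real)" "\<And>x. x \<notin> K \<Longrightarrow> \<beta> x = 0" by metis
  \<comment> \<open>\<open>h\<close> is under control only on \<open>B\<close>; setting the product
    to 0 elsewhere is harmless, since the bump is supported inside \<open>B\<close>.\<close>
  define f where "f = (\<lambda>y. if y \<in> B then \<beta> y * h y else 0)"
  have fs: "smooth_on UNIV f"
  proof (rule smooth_on_local)
    fix x
    show "\<exists>V. open V \<and> x \<in> V \<and> smooth_on V f"
    proof (cases "x \<in> B")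
      case True
      have "smooth_on B (\<lambda>y. \<beta> y * h y)" by (intro smooth_on_mult h smooth_on_subset[OF b(1)]) auto
      then have "smooth_on B f" by (rule smooth_on_cong[OF h(1), rotated]) (simp add: f_def)
      then show ?thesis using True h(1) by blast
    next
      case False
      have oK: "open (- K)" using compact_imp_closed[OF b(2)] by auto
      have "smooth_on (- K) f"
        by (rule smooth_on_cong[OF oK _ smooth_on_const[OF oK, of 0]]) (simp add: f_def b(8))
      then show ?thesis using False b(3) oK by (intro exI[of _ "- K"]) auto
    qed
  qed
  define Y where "Y = (\<lambda>p d. (if p \<in> ?W then f (snd c p) else 0) *\<^sub>R X p d)"
  have Ys: "smooth_vfield_on A UNIV Y"
    unfolding Y_def
    by (rule smooth_vfield_extend_by_zero[OF c(1) oW _ smooth_vfield_subset[OF X(1)] fs b(2)])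
      (use b in \<open>auto simp: f_def\<close>)
  have YP: "Y q \<in> P q" for q
    using plane_field_facts(4)[OF P X(2), of q] plane_field_facts(2)[OF P, of q]
    by (cases "q \<in> ?W") (auto simp: Y_def)
  have "in_chart Y c y = h y *\<^sub>R in_chart X c y" if "y \<in> U" for y
  proof -
    have "y \<in> snd c ` ?W" "y \<in> B" using that b by auto
    then obtain q where "q \<in> ?W" "y = snd c q" "y \<in> B" by blast
    then show ?thesis using b(7)[OF that] by (simp add: in_chart_at[OF c(1)] Y_def f_def)
  qed
  then show ?thesis
    using Ys YP b by (intro bexI[of _ Y] exI[of _ U]) (auto simp: tangent_vfields_def)
qed

lemma tangent_vfields_add:
  assumes "plane_field A d P" "X \<in> tangent_vfields A P" "Y \<in> tangent_vfields A P"
  shows "(\<lambda>p c. X p c + Y p c) \<in> tangent_vfields A P"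
  using assms smooth_vfield_add plane_field_facts(3)[OF assms(1)] unfolding tangent_vfields_def by simp

lemma tangent_vfields_scale:
  assumes "plane_field A d P" "X \<in> tangent_vfields A P"
  shows "(\<lambda>p c. r *\<^sub>R X p c) \<in> tangent_vfields A P"
  using assms smooth_vfield_scale plane_field_facts(4)[OF assms(1)] unfolding tangent_vfields_def by simp

lemma tangent_vfields_eval:
  assumes P: "plane_field A d P" and v: "v \<in> P p"
  shows "\<exists>X\<in>tangent_vfields A P. X p = v"
proof -
  obtain W X where W: "open W" "p \<in> W" "\<And>i. i < d \<Longrightarrow> smooth_vfield_on A W (X i)"
    "\<And>q. q \<in> W \<Longrightarrow> P q = tspan ((\<lambda>i. X i q) ` {..<d})"
    using P unfolding plane_field_def by metis
  obtain c where c: "c \<in> A" "p \<in> fst c" using chart_at by blast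
  have ex: "\<exists>Y\<in>tangent_vfields A P. Y p = X i p" if i: "i < d" for i
  proof -
    have XP: "X i q \<in> P q" if "q \<in> W" for q unfolding W(4)[OF that] using i by (intro tspan_base) auto
    obtain Y B' where Y: "Y \<in> tangent_vfields A P" "snd c p \<in> B'" "\<And>y. y \<in> B' \<Longrightarrow> in_chart Y c y = 1 *\<^sub>R in_chart (X i) c y"
      using tangent_vfield_localize[OF P W(1,2) W(3)[OF i] XP c open_UNIV UNIV_I smooth_on_const[OF open_UNIV, of 1]] by blast
    have "Y p c = X i p c" using Y(3)[OF Y(2)] by (simp add: in_chart_at[OF c])
    moreover have "Y p \<in> tangent_space A p" using Y(1) smooth_vfield_tangent unfolding tangent_vfields_def by blast
    ultimately have "Y p = X i p" using tangent_eqI[OF _ smooth_vfield_tangent[OF W(3)[OF i] W(2)] c] by blast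
    then show ?thesis using Y(1) by blast
  qed
  have lc: "\<exists>Y\<in>tangent_vfields A P. Y p = lin_comb k w a"
    if "\<And>i. i < k \<Longrightarrow> w i \<in> (\<lambda>i. X i p) ` {..<d}" for k w a
    using that
  proof (induction k)
    case 0
    have "(\<lambda>p c. 0) \<in> tangent_vfields A P"
      using smooth_vfield_zero plane_field_facts(2)[OF P] by (simp add: tangent_vfields_def)
    then show ?case by (intro bexI[of _ "\<lambda>p c. 0"]) (auto simp: lin_comb_def)
  next
    case (Suc k)
    obtain Y where Y: "Y \<in> tangent_vfields A P" "Y p = lin_comb k w a" using Suc by auto
    obtain i where i: "i < d" "w k = X i p" using Suc.prems[of k] by auto
    obtain Z where Z: "Z \<in> tangent_vfields A P" "Z p = w k" using ex[OF i(1)] i(2) by auto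
    show ?case
      using tangent_vfields_add[OF P Y(1) tangent_vfields_scale[OF P Z(1), of "a k"]]
      by (rule bexI[rotated]) (simp add: Y Z lin_comb_def)
  qed
  obtain k w a where "v = lin_comb k w a" "\<And>i. i < k \<Longrightarrow> w i \<in> (\<lambda>i. X i p) ` {..<d}"
    using v unfolding W(4)[OF W(2)] tspan_def by blast
  then show ?thesis using lc by blast
qed

lemma plane_subset_generated:
  assumes "plane_field A d P"
  shows "P p \<subseteq> evaluation (generated_distribution A P) p"
proof
  fix v assume "v \<in> P p"
  then obtain X where "X \<in> tangent_vfields A P" "X p = v" using tangent_vfields_eval[OF assms] by blast
  then show "v \<in> evaluation (generated_distribution A P) p"
    unfolding evaluation_def using tangent_vfields_generated by blast
qed

text \<open>The smooth fields tangent to a given leaf form a Lie algebra, so all of the generated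
  distribution is tangent to the leaf.\<close>

lemma integrability_domain_subset:
  assumes P: "plane_field A d P"
  shows "integrability_domain A d P \<subseteq> infinitesimal_integrability_domain A P"
proof
  fix p assume "p \<in> integrability_domain A d P"
  then obtain S where S: "submanifold A d S" "\<And>q. q \<in> S \<Longrightarrow> submanifold_tangent_space A S q \<subseteq> P q" "p \<in> S"
    unfolding integrability_domain_def plane_leaf_def by blast
  have slice: "\<exists>c L. slice_chart A S q c L \<and> dim L = d" if "q \<in> S" for q
    using S(1) that unfolding submanifold_def by blast
  \<comment> \<open>Equal dimensions turn the inclusion in the definition of a leaf into an
    equality, so that fields tangent to \<open>P\<close> are tangent to \<open>S\<close>.\<close>
  have TP: "submanifold_tangent_space A S q = P q" if q: "q \<in> S" for q
  proof -
    obtain c L where c: "slice_chart A S q c L" "dim L = d" using slice[OF q] by blast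
    have cA: "c \<in> A" "q \<in> fst c" "subspace L" using c(1) by (auto simp: slice_chart_def)
    note T = submanifold_tangent_space_slice[OF c(1) q]
    note Pf = plane_field_facts(5)[OF P cA(1,2)]
    have "L \<subseteq> (\<lambda>v. v c) ` P q"
      using S(2)[OF q] tangent_image_Collect[OF cA(1,2), of L] unfolding T by blast
    then have "L = (\<lambda>v. v c) ` P q" using fd.subspace_dim_equal[of L] Pf c(2) cA(3) by simp
    then show ?thesis
      using tangent_set_eqI[OF plane_field_facts(1)[OF P, of q] cA(1,2)] T by simp
  qed
  define Lie where "Lie = {X. smooth_vfield_on A UNIV X \<and> (\<forall>q\<in>S. X q \<in> submanifold_tangent_space A S q)}"
  have "lie_subalgebra A Lie"
    unfolding lie_subalgebra_def
  proof (intro conjI ballI allI)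
    show "(\<lambda>p c. 0) \<in> Lie"
      using smooth_vfield_zero TP plane_field_facts(2)[OF P] by (simp add: Lie_def)
    fix X assume X: "X \<in> Lie"
    show "smooth_vfield_on A UNIV X" using X by (simp add: Lie_def)
    show "(\<lambda>p c. r *\<^sub>R X p c) \<in> Lie" for r
      using X smooth_vfield_scale TP plane_field_facts(4)[OF P] by (simp add: Lie_def)
    fix Y assume Y: "Y \<in> Lie"
    show "(\<lambda>p c. X p c + Y p c) \<in> Lie"
      using X Y smooth_vfield_add TP plane_field_facts(3)[OF P] by (simp add: Lie_def)
    have "lie_bracket A X Y q \<in> submanifold_tangent_space A S q" if "q \<in> S" for q
    proof -
      obtain c L where c: "slice_chart A S q c L" using slice[OF \<open>q \<in> S\<close>] by blast
      show ?thesis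
        by (rule tangent_to_submanifold_bracket[OF _ _ _ _ c \<open>q \<in> S\<close>]) (use X Y in \<open>auto simp: Lie_def\<close>)
    qed
    then show "lie_bracket A X Y \<in> Lie" using X Y lie_bracket_smooth by (simp add: Lie_def)
  qed
  moreover have "tangent_vfields A P \<subseteq> Lie" using TP by (auto simp: tangent_vfields_def Lie_def)
  ultimately have "generated_distribution A P \<subseteq> Lie" by (rule generated_subset)
  then have "evaluation (generated_distribution A P) p \<subseteq> P p"
    using TP[OF S(3)] S(3) by (auto simp: evaluation_def Lie_def)
  then show "p \<in> infinitesimal_integrability_domain A P"
    unfolding infinitesimal_integrability_domain_def using plane_subset_generated[OF P, of p] by blast
qed

text \<open>The leaf has constant dimension \<open>k\<close>, and the hypothesis at \<open>p\<close>
  gives \<open>k = d\<close>. At every other point of the leaf \<open>P\<close> is a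
  \<open>d\<close>-dimensional subspace of a tangent space of the same dimension, hence equal to
  it.\<close>

lemma distribution_leaf_plane_leaf:
  assumes P: "plane_field A d P" and leaf: "distribution_leaf A (generated_distribution A P) S"
    and p: "p \<in> S" "p \<in> infinitesimal_integrability_domain A P"
  shows "p \<in> integrability_domain A d P"
proof -
  let ?G = "generated_distribution A P"
  obtain k where k: "submanifold A k S" and T: "\<And>q. q \<in> S \<Longrightarrow> submanifold_tangent_space A S q = evaluation ?G q"
    using leaf unfolding distribution_leaf_def by blast
  have slice: "\<exists>c L. slice_chart A S q c L \<and> dim L = k \<and> (\<lambda>v. v c) ` evaluation ?G q = L" if q: "q \<in> S" for q
  proof -
    obtain c L where c: "slice_chart A S q c L" "dim L = k" using k q unfolding submanifold_def by blast
    have cA: "c \<in> A" "q \<in> fst c" using c(1) by (auto simp: slice_chart_def)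
    have "(\<lambda>v. v c) ` evaluation ?G q = L"
      unfolding T[OF q, symmetric] submanifold_tangent_space_slice[OF c(1) q] by (rule tangent_image_Collect[OF cA])
    then show ?thesis using c by blast
  qed
  obtain c L where c: "slice_chart A S p c L" "dim L = k" "(\<lambda>v. v c) ` evaluation ?G p = L" using slice[OF p(1)] by blast
  have "evaluation ?G p = P p" using p(2) by (simp add: infinitesimal_integrability_domain_def)
  then have kd: "k = d"
    using plane_field_facts(5)[OF P, of c p] c by (auto simp: slice_chart_def)
  have "submanifold_tangent_space A S q \<subseteq> P q" if q: "q \<in> S" for q
  proof -
    obtain c L where c: "slice_chart A S q c L" "dim L = k" "(\<lambda>v. v c) ` evaluation ?G q = L" using slice[OF q] by blast
    have cA: "c \<in> A" "q \<in> fst c" "subspace L" using c(1) by (auto simp: slice_chart_def)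
    note Pf = plane_field_facts(5)[OF P cA(1,2)]
    have "(\<lambda>v. v c) ` P q \<subseteq> L" using plane_subset_generated[OF P, of q] c(3) by blast
    then have "(\<lambda>v. v c) ` P q = L" using fd.subspace_dim_equal[of "(\<lambda>v. v c) ` P q" L] Pf c(2) cA(3) kd by simp
    then show ?thesis
      using tangent_set_eqI[OF plane_field_facts(1)[OF P, of q] cA(1,2)] submanifold_tangent_space_slice[OF c(1) q] by simp
  qed
  then show ?thesis
    using k p(1) unfolding kd integrability_domain_def plane_leaf_def by blast
qed

text \<open>Composing the chart with the diffeomorphism from \<open>singular_frobenius\<close> gives
  a slice chart whose slice is the leaf. The equality of spans along the slice says exactly that its
  tangent spaces are the values of \<open>\<Delta>\<close>.\<close>

lemma distribution_leaf_exists: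
  fixes g :: "'i \<Rightarrow> 'v \<Rightarrow> 'v"
  assumes c: "c \<in> A" and W: "open W" "W \<subseteq> fst c" "p \<in> W" and I: "finite I"
    and g: "\<And>i. i \<in> I \<Longrightarrow> smooth_on (snd c ` W) (g i)"
    and inv: "\<And>i j. i \<in> I \<Longrightarrow> j \<in> I \<Longrightarrow> in_mod (snd c ` W) I g (brk (g i) (g j))"
    and ev: "\<And>q. q \<in> W \<Longrightarrow> evaluation \<Delta> q = {v \<in> tangent_space A q. v c \<in> span ((\<lambda>i. g i (snd c q)) ` I)}"
  shows "\<exists>S. S \<subseteq> W \<and> p \<in> S \<and> distribution_leaf A \<Delta> S"
proof -
  have o: "open (snd c ` W)" by (rule chart_image_open[OF c W(1,2)])
  have "\<exists>(\<Theta> :: 'v \<Rightarrow> 'v) \<Psi> D B L. diffeo D B \<Theta> \<Psi> \<and> snd c p \<in> D \<and> D \<subseteq> snd c ` W \<and> subspace L \<and> \<Theta> (snd c p) \<in> L \<and>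
    (\<forall>x\<in>D. \<Theta> x \<in> L \<longrightarrow> span ((\<lambda>i. g i x) ` I) = dd \<Psi> (\<Theta> x) ` L)"
    by (rule singular_frobenius[OF I o imageI[OF W(3)]]) (fact g inv)+
  then obtain \<Theta> :: "'v \<Rightarrow> 'v" and \<Psi> D B L where H: "diffeo D B \<Theta> \<Psi> \<and> snd c p \<in> D \<and> D \<subseteq> snd c ` W \<and> subspace L \<and> \<Theta> (snd c p) \<in> L \<and>
    (\<forall>x\<in>D. \<Theta> x \<in> L \<longrightarrow> span ((\<lambda>i. g i x) ` I) = dd \<Psi> (\<Theta> x) ` L)"
    by (elim exE)
  then have dif: "diffeo D B \<Theta> \<Psi>" and D: "snd c p \<in> D" "D \<subseteq> snd c ` W" "subspace L" "\<Theta> (snd c p) \<in> L"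
    by simp_all
  have sp: "span ((\<lambda>i. g i x) ` I) = dd \<Psi> (\<Theta> x) ` L" if "x \<in> D" "\<Theta> x \<in> L" for x using H that by simp
  note d = dif[unfolded diffeo_def]
  define c' where "c' = ({p \<in> fst c. snd c p \<in> D}, \<lambda>p. \<Theta> (snd c p))"
  have c'A: "c' \<in> A" unfolding c'_def by (rule chart_compose_in_atlas(1)[OF c dif])
  have mem: "q \<in> fst c' \<longleftrightarrow> q \<in> fst c \<and> snd c q \<in> D" and snd': "snd c' q = \<Theta> (snd c q)" for q
    by (auto simp: c'_def)
  have c'W: "q \<in> W" if "q \<in> fst c'" for q
  proof -
    have "snd c q \<in> snd c ` W" "q \<in> fst c" using that mem D(2) by auto
    then show ?thesis using chart_inv_image[OF c W(2)] chart_inv_left[OF c] by metis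
  qed
  define S where "S = {q \<in> fst c'. snd c' q \<in> L}"
  have sl: "slice_chart A S q c' L" if "q \<in> S" for q
    using that c'A D(3) by (auto simp: slice_chart_def S_def)
  have "submanifold_tangent_space A S q = evaluation \<Delta> q" if q: "q \<in> S" for q
  proof -
    have qc: "q \<in> fst c'" "q \<in> fst c" "snd c q \<in> D" "\<Theta> (snd c q) \<in> L" "q \<in> W"
      using q mem snd' c'W by (auto simp: S_def)
    have oD: "open D" using d by simp
    have "dd (trans c c') (snd c q) = dd \<Theta> (snd c q)"
    proof (rule dd_local[of D])
      fix y assume "y \<in> D"
      then obtain r where r: "r \<in> W" "y = snd c r" using D(2) by blast
      have "r \<in> fst c" using r W(2) by blast
      show "trans c c' y = \<Theta> y" unfolding r(2) trans_at[OF c \<open>r \<in> fst c\<close>] snd' by (rule refl)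
    qed (use oD qc in auto)
    then have vc: "v c' = dd \<Theta> (snd c q) (v c)" if "v \<in> tangent_space A q" for v
      using tangent_change[OF that c c'A qc(2,1)] by simp
    have inv1: "dd \<Psi> (\<Theta> (snd c q)) (dd \<Theta> (snd c q) w) = w" for w by (rule diffeo_dd_inverse[OF dif qc(3)])
    have inv2: "dd \<Theta> (snd c q) (dd \<Psi> (\<Theta> (snd c q)) w) = w" for w
      using diffeo_dd_inverse[OF diffeo_inverse[OF dif], of "\<Theta> (snd c q)" w] d qc(3) by auto
    have "v c' \<in> L \<longleftrightarrow> v c \<in> span ((\<lambda>i. g i (snd c q)) ` I)" if "v \<in> tangent_space A q" for v
      unfolding sp[OF qc(3,4)] vc[OF that] using inv1 inv2 by (metis image_iff)
    then show ?thesis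
      unfolding submanifold_tangent_space_slice[OF sl[OF q] q] ev[OF qc(5)] by blast
  qed
  moreover have "submanifold A (dim L) S" unfolding submanifold_def using sl by blast
  moreover have "p \<in> S" using D W by (auto simp: S_def mem snd')
  moreover have "S \<subseteq> W" using c'W by (auto simp: S_def)
  ultimately show ?thesis unfolding distribution_leaf_def by blast
qed

end

section \<open>Polynomial vector fields and division over open subsets of the base\<close>

subsection \<open>Polynomials in the fibre coordinate\<close>

text \<open>Hiding the exponents makes closure under derivatives and restriction a simple induction;
  explicit coefficients reappear in \<open>FP_srep\<close>. The rule \<open>FP_cong\<close> makes
  values outside \<open>W \<times> UNIV\<close> irrelevant.\<close>

inductive FP :: "'a::finite_dim_space set \<Rightarrow> ('a \<times> 'f::finite_dim_space \<Rightarrow> real) \<Rightarrow> bool" for W where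
  FP_base: "smooth_on W C \<Longrightarrow> FP W (\<lambda>z. C (fst z))"
| FP_lin: "linear l \<Longrightarrow> FP W (\<lambda>z. l (snd z))"
| FP_add: "FP W f \<Longrightarrow> FP W g \<Longrightarrow> FP W (\<lambda>z. f z + g z)"
| FP_mult: "FP W f \<Longrightarrow> FP W g \<Longrightarrow> FP W (\<lambda>z. f z * g z)"
| FP_cong: "FP W f \<Longrightarrow> (\<And>z. z \<in> W \<times> UNIV \<Longrightarrow> f z = g z) \<Longrightarrow> FP W g"

lemma FP_const: "open W \<Longrightarrow> FP W (\<lambda>z. c)"
  using FP_base[OF smooth_on_const[of W c]] by simp

lemma FP_minus: "open W \<Longrightarrow> FP W f \<Longrightarrow> FP W (\<lambda>z. - f z)"
  using FP_mult[OF FP_const[of W "-1"], of f] by simp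

lemma FP_sum: "open W \<Longrightarrow> (\<And>i. i \<in> I \<Longrightarrow> FP W (f i)) \<Longrightarrow> FP W (\<lambda>z. \<Sum>i\<in>I. f i z)"
  by (induction I rule: infinite_finite_induct) (auto intro: FP_const FP_add)

lemma FP_power: "open W \<Longrightarrow> FP W f \<Longrightarrow> FP W (\<lambda>z. f z ^ n)"
  by (induction n) (auto intro: FP_const FP_mult)

lemma FP_prod: "open W \<Longrightarrow> (\<And>i. i \<in> I \<Longrightarrow> FP W (f i)) \<Longrightarrow> FP W (\<lambda>z. \<Prod>i\<in>I. f i z)"
  by (induction I rule: infinite_finite_induct) (auto intro: FP_const FP_mult)

lemma FP_subset: "FP W f \<Longrightarrow> W' \<subseteq> W \<Longrightarrow> FP W' f"
proof (induction rule: FP.induct)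
  case (FP_base C)
  show ?case by (rule FP.FP_base[OF smooth_on_subset[OF FP_base]])
next
  case (FP_cong f g)
  then show ?case by (intro FP.FP_cong[of W' f g]) auto
next
  case (FP_lin l)
  then show ?case by (intro FP.FP_lin)
next
  case (FP_add f g)
  then show ?case by (intro FP.FP_add)
next
  case (FP_mult f g)
  then show ?case by (intro FP.FP_mult)
qed

lemma open_times_UNIV: "open W \<Longrightarrow> open (W \<times> (UNIV :: 'f::topological_space set))"
  by (intro open_Times) auto

lemma FP_smooth:
  fixes f :: "'a::finite_dim_space \<times> 'f::finite_dim_space \<Rightarrow> real"
  assumes W: "open W" and "FP W f"
  shows "smooth_on (W \<times> UNIV) f"
  using assms(2)
proof (induction rule: FP.induct)
  case (FP_base C)
  show ?case
    by (rule smooth_on_compose[OF open_times_UNIV[OF W] W smooth_on_fst[OF open_times_UNIV[OF W]] FP_base]) auto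
next
  case (FP_lin l)
  show ?case by (rule smooth_on_linear_comp[OF open_times_UNIV[OF W] FP_lin smooth_on_snd[OF open_times_UNIV[OF W]]])
next
  case (FP_add f g)
  show ?case by (rule smooth_on_add[OF open_times_UNIV[OF W] FP_add(3,4)])
next
  case (FP_mult f g)
  show ?case by (rule smooth_on_mult[OF open_times_UNIV[OF W] FP_mult(3,4)])
next
  case (FP_cong f g)
  show ?case by (rule smooth_on_cong[OF open_times_UNIV[OF W] FP_cong(2,3)])
qed

lemma FP_dd:
  fixes f :: "'a::finite_dim_space \<times> 'f::finite_dim_space \<Rightarrow> real"
  assumes W: "open W" and "FP W f"
  shows "FP W (\<lambda>z. dd f z h)"
  using assms(2)
proof (induction rule: FP.induct)
  case (FP_base C)
  have "FP W (\<lambda>z. dd C (fst z) (fst h))" by (rule FP.FP_base[OF smooth_on_dd[OF W FP_base]])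
  then show ?case
  proof (rule FP.FP_cong)
    fix z :: "'a \<times> 'f" assume "z \<in> W \<times> UNIV"
    then have "(C has_derivative dd C (fst z)) (at (fst z))" by (intro smooth_on_derivative[OF W FP_base]) auto
    from dd_eqI[OF has_derivative_compose[OF has_derivative_fst[OF has_derivative_ident] this]]
    show "dd C (fst z) (fst h) = dd (\<lambda>z. C (fst z)) z h" by simp
  qed
next
  case (FP_lin l)
  have "(l has_derivative l) (at (snd z))" for z :: "'a \<times> 'f"
    by (rule bounded_linear_imp_has_derivative[OF linear_bounded_linear[OF FP_lin]])
  from dd_eqI[OF has_derivative_compose[OF has_derivative_snd[OF has_derivative_ident] this]]
  have "(\<lambda>z. dd (\<lambda>z::'a \<times> 'f. l (snd z)) z h) = (\<lambda>z. l (snd h))" by auto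
  then show ?case using FP_const[OF W] by simp
next
  case (FP_add f g)
  note sm = smooth_on_differentiable[OF open_times_UNIV[OF W] FP_smooth[OF W FP_add(1)]]
    smooth_on_differentiable[OF open_times_UNIV[OF W] FP_smooth[OF W FP_add(2)]]
  show ?case
    by (rule FP.FP_cong[OF FP.FP_add[OF FP_add(3,4)]]) (use sm in \<open>simp add: dd_add\<close>)
next
  case (FP_mult f g)
  note sm = smooth_on_differentiable[OF open_times_UNIV[OF W] FP_smooth[OF W FP_mult(1)]]
    smooth_on_differentiable[OF open_times_UNIV[OF W] FP_smooth[OF W FP_mult(2)]]
  show ?case
    by (rule FP.FP_cong[OF FP.FP_add[OF FP.FP_mult[OF FP_mult(1,4)] FP.FP_mult[OF FP_mult(3,2)]]])
      (use sm dd_scaleR[of f _ g h] in \<open>simp add: real_scaleR_def\<close>)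
next
  case (FP_cong f g)
  show ?case
    by (rule FP.FP_cong[OF FP_cong(3)]) (use dd_local[OF open_times_UNIV[OF W], of _ f g] FP_cong(2) in metis)
qed

text \<open>The coordinates with respect to the arbitrary basis \<open>E\<close> are linear
  functionals, so the choice of basis is absorbed by \<open>FP_lin\<close>.\<close>

lemma fiber_polynomial_FP:
  fixes g :: "'a::finite_dim_space \<times> 'f::finite_dim_space \<Rightarrow> real"
  assumes V: "open V" and g: "fiber_polynomial V g"
  shows "FP V g"
proof -
  obtain E :: "'f set" and M and C :: "('f \<Rightarrow> nat) \<Rightarrow> 'a \<Rightarrow> real" where
    E: "independent E" "span E = UNIV" and C: "\<And>\<alpha>. \<alpha> \<in> M \<Longrightarrow> smooth_on V (C \<alpha>)"
    and g: "\<And>x u. x \<in> V \<Longrightarrow> g (x, u) = (\<Sum>\<alpha>\<in>M. C \<alpha> x * (\<Prod>e\<in>E. representation E u e ^ \<alpha> e))"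
    using g unfolding fiber_polynomial_def by blast
  have lin: "linear (\<lambda>u. representation E u e)" for e
    using E by (intro linearI) (auto simp: representation_add representation_scale)
  have "FP V (\<lambda>z. \<Sum>\<alpha>\<in>M. C \<alpha> (fst z) * (\<Prod>e\<in>E. representation E (snd z) e ^ \<alpha> e))"
    by (intro FP_sum V FP_mult FP_base C FP_prod FP_power FP_lin lin)
  then show ?thesis by (rule FP_cong) (auto simp: g)
qed

definition FPV :: "'a::finite_dim_space set \<Rightarrow> ('a \<times> 'f::finite_dim_space \<Rightarrow> 'w::finite_dim_space) \<Rightarrow> bool" where
  "FPV W f \<longleftrightarrow> (\<forall>l :: 'w \<Rightarrow> real. linear l \<longrightarrow> FP W (\<lambda>z. l (f z)))"

lemma FPV_coord: "FPV W f \<Longrightarrow> FP W (\<lambda>z. coord b (f z))"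
  unfolding FPV_def using coord_linear by blast

lemma FPV_smooth:
  fixes f :: "'a::finite_dim_space \<times> 'f::finite_dim_space \<Rightarrow> 'w::finite_dim_space"
  assumes W: "open W" and f: "FPV W f"
  shows "smooth_on (W \<times> UNIV) f"
proof -
  have "smooth_on (W \<times> UNIV) (\<lambda>z. \<Sum>b\<in>fd_basis. coord b (f z) *\<^sub>R b)"
    by (intro smooth_on_sum smooth_on_scaleR smooth_on_const open_times_UNIV W FP_smooth FPV_coord f)
  then show ?thesis by (simp add: coord_sum)
qed

lemma FPV_add: "FPV W f \<Longrightarrow> FPV W g \<Longrightarrow> FPV W (\<lambda>z. f z + g z)"
  unfolding FPV_def by (auto simp: linear_add intro!: FP_add)

lemma FPV_scale: "FP W q \<Longrightarrow> FPV W f \<Longrightarrow> FPV W (\<lambda>z. q z *\<^sub>R f z)"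
  unfolding FPV_def by (auto simp: linear_scale intro!: FP_mult)

lemma FPV_subset: "FPV W f \<Longrightarrow> W' \<subseteq> W \<Longrightarrow> FPV W' f"
  unfolding FPV_def using FP_subset by blast

lemma FPV_cong: "FPV W f \<Longrightarrow> (\<And>z. z \<in> W \<times> UNIV \<Longrightarrow> f z = g z) \<Longrightarrow> FPV W g"
  unfolding FPV_def by (metis FP_cong)

lemma FPV_dd:
  fixes f :: "'a::finite_dim_space \<times> 'f::finite_dim_space \<Rightarrow> 'w::finite_dim_space"
  assumes W: "open W" and f: "FPV W f" and X: "FPV W X"
  shows "FPV W (\<lambda>z. dd f z (X z))"
  unfolding FPV_def
proof (intro allI impI)
  fix l :: "'w \<Rightarrow> real" assume l: "linear l"
  note W' = open_times_UNIV[OF W, where 'f='f]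
  note sf = FPV_smooth[OF W f]
  have "FP W (\<lambda>z. \<Sum>b\<in>fd_basis. coord b (X z) * dd (\<lambda>z. l (f z)) z b)"
    using f l by (intro FP_sum W FP_mult FPV_coord X FP_dd) (auto simp: FPV_def)
  then show "FP W (\<lambda>z. l (dd f z (X z)))"
  proof (rule FP_cong)
    fix z :: "'a \<times> 'f" assume z: "z \<in> W \<times> UNIV"
    have "dd f z (X z) = (\<Sum>b\<in>fd_basis. coord b (X z) *\<^sub>R dd f z b)"
      by (rule linear_coord_expand[OF smooth_on_dd_linear[OF W' sf z]])
    moreover have "dd (\<lambda>z. l (f z)) z b = l (dd f z b)" for b
      by (rule dd_linear_comp[OF linear_bounded_linear[OF l] smooth_on_differentiable[OF W' sf z]])
    ultimately show "(\<Sum>b\<in>fd_basis. coord b (X z) * dd (\<lambda>z. l (f z)) z b) = l (dd f z (X z))"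
      by (simp add: linear_sum[OF l] linear_scale[OF l])
  qed
qed

lemma FPV_brk:
  fixes X Y :: "'a::finite_dim_space \<times> 'f::finite_dim_space \<Rightarrow> 'a \<times> 'f"
  assumes W: "open W" and X: "FPV W X" and Y: "FPV W Y"
  shows "FPV W (brk X Y)"
proof -
  have "FPV W (\<lambda>z. dd Y z (X z) + (-1) *\<^sub>R dd X z (Y z))"
    by (intro FPV_add FPV_scale FP_const W FPV_dd X Y)
  then show ?thesis by (simp add: brk_def[abs_def])
qed

subsection \<open>Monomials\<close>

text \<open>Monomials are encoded by natural numbers: the exponents are the multiplicities of distinct
  primes attached to the coordinates, and the component of a vector monomial is one more prime
  factor. So multiplication and divisibility of monomials become those of numbers, and the usual
  order of the natural numbers is a monomial order.\<close>

locale monomials =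
  fixes pe :: "'f::finite_dim_space \<Rightarrow> nat" and pk :: "'w::finite_dim_space \<Rightarrow> nat"
  assumes pe: "inj_on pe fd_basis" "\<And>e. e \<in> fd_basis \<Longrightarrow> prime (pe e)"
    and pk: "inj_on pk fd_basis" "\<And>k. k \<in> fd_basis \<Longrightarrow> prime (pk k)"
    and pe_pk: "\<And>e k. e \<in> fd_basis \<Longrightarrow> k \<in> fd_basis \<Longrightarrow> pe e \<noteq> pk k"

lemma monomials_exist:
  "\<exists>(pe :: 'f::finite_dim_space \<Rightarrow> nat) (pk :: 'w::finite_dim_space \<Rightarrow> nat). monomials pe pk"
proof -
  let ?S = "fd_basis <+> fd_basis :: ('f + 'w) set"
  have fin: "finite ?S"
    using fd_basis(1)[where 'a='f] fd_basis(1)[where 'a='w] by auto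
  obtain B where B: "finite B" "card B = card ?S" "B \<subseteq> {p::nat. prime p}"
    using infinite_arbitrarily_large[OF primes_infinite] by blast
  obtain h where h: "bij_betw h ?S B"
    using finite_same_card_bij[OF fin B(1)] B(2) by auto
  have inj: "inj_on h ?S" and im: "\<And>s. s \<in> ?S \<Longrightarrow> prime (h s)"
    using h B(3) by (auto simp: bij_betw_def)
  have "monomials (\<lambda>e. h (Inl e)) (\<lambda>k. h (Inr k))"
  proof
    show "inj_on (\<lambda>e. h (Inl e)) fd_basis" "inj_on (\<lambda>k. h (Inr k)) fd_basis"
      using inj by (auto simp: inj_on_def)
    show "h (Inl e) \<noteq> h (Inr k)" if "e \<in> fd_basis" "k \<in> fd_basis" for e k
      using inj_onD[OF inj, of "Inl e" "Inr k"] that by auto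
  qed (use im in auto)
  then show ?thesis by blast
qed

text \<open>Subsequences are extracted prime by prime. A monotone subsequence of natural numbers is
  either increasing already or, being decreasing, becomes constant once its least value is
  reached.\<close>

lemma Dickson_subsequence:
  fixes f :: "nat \<Rightarrow> nat"
  assumes "finite P"
  shows "\<exists>r. strict_mono r \<and> (\<forall>p\<in>P. incseq (\<lambda>i. multiplicity p (f (r i))))"
  using assms
proof (induction P rule: finite_induct)
  case empty
  then show ?case using strict_mono_id by (auto simp: id_def)
next
  case (insert q P)
  obtain r where r: "strict_mono r" "\<And>p. p \<in> P \<Longrightarrow> incseq (\<lambda>i. multiplicity p (f (r i)))" using insert.IH by blast
  let ?s = "\<lambda>i. multiplicity q (f (r i))"
  have "\<exists>t. strict_mono t \<and> incseq (\<lambda>i. ?s (t i))"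
  proof -
    obtain t where t: "strict_mono (t :: nat \<Rightarrow> nat)" "monoseq (\<lambda>i. ?s (t i))" using seq_monosub[of ?s] by blast
    then consider "incseq (\<lambda>i. ?s (t i))" | "decseq (\<lambda>i. ?s (t i))" unfolding monoseq_iff by blast
    then show ?thesis
    proof cases
      case 1
      then show ?thesis using t by blast
    next
      case 2
      define m where "m = (LEAST v. \<exists>n. v = ?s (t n))"
      have "\<exists>n. m = ?s (t n)" unfolding m_def by (rule LeastI_ex) blast
      then obtain N where N: "m = ?s (t N)" by blast
      have "?s (t (N + i)) = m" for i
        using decseqD[OF 2, of N "N + i"] N Least_le[of "\<lambda>v. \<exists>n. v = ?s (t n)" "?s (t (N + i))"]
        unfolding m_def[symmetric] by force
      then have "incseq (\<lambda>i. ?s (t (N + i)))" by (simp add: incseq_def)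
      moreover have "strict_mono (\<lambda>i. t (N + i))" using t(1) by (simp add: strict_mono_def)
      ultimately show ?thesis by blast
    qed
  qed
  then obtain t where t: "strict_mono t" "incseq (\<lambda>i. ?s (t i))" by blast
  have "strict_mono (\<lambda>i. r (t i))" using strict_mono_o[OF r(1) t(1)] by (simp add: o_def)
  moreover have "incseq (\<lambda>i. multiplicity p (f (r (t i))))" if "p \<in> insert q P" for p
  proof (cases "p = q")
    case True
    then show ?thesis using t(2) by simp
  next
    case False
    then have "incseq (\<lambda>i. multiplicity p (f (r i)))" using r(2) that by simp
    then show ?thesis using t(1) by (simp add: incseq_def strict_mono_less_eq)
  qed
  ultimately show ?case by blast
qed

lemma Dickson:
  fixes f :: "nat \<Rightarrow> nat"
  assumes "finite P" "\<And>i. f i \<noteq> 0" "\<And>i. prime_factors (f i) \<subseteq> P"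
  shows "\<exists>i j. i < j \<and> f i dvd f j"
proof -
  obtain r where r: "strict_mono r" "\<And>p. p \<in> P \<Longrightarrow> incseq (\<lambda>i. multiplicity p (f (r i)))"
    using Dickson_subsequence[OF assms(1)] by blast
  have "f (r 0) dvd f (r 1)"
  proof (rule multiplicity_le_imp_dvd)
    fix p :: nat assume p: "prime p"
    show "multiplicity p (f (r 0)) \<le> multiplicity p (f (r 1))"
    proof (cases "p \<in> P")
      case True
      then show ?thesis using incseqD[OF r(2), of p 0 1] by simp
    next
      case False
      then have "p \<notin> prime_factors (f (r 0))" using assms(3) by blast
      then have "\<not> p dvd f (r 0)" using p assms(2) by (simp add: prime_factors_dvd)
      then show ?thesis by (simp add: not_dvd_imp_multiplicity_0)
    qed
  qed (use assms in auto)
  moreover have "r 0 < r 1" using strict_monoD[OF r(1), of 0 1] by simp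
  ultimately show ?thesis by blast
qed

context monomials
begin

definition Mon :: "nat set" where
  "Mon = {m. m \<noteq> 0 \<and> prime_factors m \<subseteq> pe ` fd_basis}"

definition mon :: "nat \<Rightarrow> 'f \<Rightarrow> real" where
  "mon n u = (\<Prod>e\<in>fd_basis. coord e u ^ multiplicity (pe e) n)"

definition Idx :: "nat set" where
  "Idx = {pk k * m | k m. k \<in> fd_basis \<and> m \<in> Mon}"

text \<open>For \<open>n\<close> in \<open>Idx\<close> exactly one \<open>pk k\<close> with
  \<open>k\<close> in the basis divides \<open>n\<close>, so the sum picks out the basis vector
  \<open>k\<close>; see \<open>vmon_eq\<close>.\<close>

definition vmon :: "nat \<Rightarrow> 'f \<Rightarrow> 'w" where
  "vmon n u = mon n u *\<^sub>R (\<Sum>k\<in>fd_basis. if pk k dvd n then k else 0)"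

lemma Mon_nonzero: "m \<in> Mon \<Longrightarrow> m \<noteq> 0"
  by (simp add: Mon_def)

lemma Mon_one: "1 \<in> Mon"
  by (simp add: Mon_def)

lemma Mon_mult: "m \<in> Mon \<Longrightarrow> n \<in> Mon \<Longrightarrow> m * n \<in> Mon"
  by (auto simp: Mon_def prime_factors_product)

lemma Mon_pe: "e \<in> fd_basis \<Longrightarrow> pe e \<in> Mon"
  using pe(2)[of e] prime_gt_0_nat[of "pe e"] by (auto simp: Mon_def prime_factorization_prime)

lemma Mon_factor: "m * n \<in> Mon \<Longrightarrow> n \<in> Mon"
  by (auto simp: Mon_def prime_factors_product)

lemma pk_not_dvd_Mon: "k \<in> fd_basis \<Longrightarrow> m \<in> Mon \<Longrightarrow> \<not> pk k dvd m"
proof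
  assume k: "k \<in> fd_basis" and m: "m \<in> Mon" and d: "pk k dvd m"
  have "pk k \<in> prime_factors m" using d pk(2)[OF k] m by (auto simp: Mon_def prime_factors_dvd)
  then obtain e where "e \<in> fd_basis" "pk k = pe e" using m by (auto simp: Mon_def)
  then show False using pe_pk k by metis
qed

lemma mon_mult: "m \<noteq> 0 \<Longrightarrow> n \<noteq> 0 \<Longrightarrow> mon (m * n) u = mon m u * mon n u"
  unfolding mon_def prod.distrib[symmetric]
  by (intro prod.cong refl) (simp add: prime_elem_multiplicity_mult_distrib pe(2) power_add)

lemma mon_one: "mon (Suc 0) u = 1"
  by (simp add: mon_def)

lemma mon_pe:
  assumes "e \<in> fd_basis"
  shows "mon (pe e) u = coord e u"
proof -
  have "multiplicity (pe e') (pe e) = (if e' = e then 1 else 0)" if "e' \<in> fd_basis" for e'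
  proof (cases "e' = e")
    case True
    then show ?thesis using pe(2)[OF assms] by (simp add: prime_gt_1_nat multiplicity_self)
  next
    case False
    then have "pe e' \<noteq> pe e" using inj_onD[OF pe(1)] that assms by blast
    then have "\<not> pe e' dvd pe e" using primes_dvd_imp_eq[OF pe(2)[OF that] pe(2)[OF assms]] by blast
    then show ?thesis using False by (simp add: not_dvd_imp_multiplicity_0)
  qed
  then have "mon (pe e) u = (\<Prod>e'\<in>fd_basis. if e' = e then coord e' u else 1)"
    unfolding mon_def by (intro prod.cong) auto
  then show ?thesis using assms fd_basis(1)[where 'a='f] by simp
qed

lemma mon_pk:
  assumes "k \<in> fd_basis"
  shows "mon (pk k) u = 1"
proof -
  have "multiplicity (pe e) (pk k) = 0" if "e \<in> fd_basis" for e
    using primes_dvd_imp_eq[OF pe(2)[OF that] pk(2)[OF assms]] pe_pk[OF that assms]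
    by (intro not_dvd_imp_multiplicity_0) blast
  then show ?thesis by (simp add: mon_def)
qed

lemma pk_nonzero: "k \<in> fd_basis \<Longrightarrow> pk k \<noteq> 0"
  using pk(2) not_prime_0 by metis

lemma vmon_eq:
  assumes k: "k \<in> fd_basis" and m: "m \<in> Mon"
  shows "vmon (pk k * m) u = mon m u *\<^sub>R k"
proof -
  have "pk k' dvd pk k * m \<longleftrightarrow> k' = k" if "k' \<in> fd_basis" for k'
    using prime_dvd_mult_iff[OF pk(2)[OF that]] pk_not_dvd_Mon[OF that m]
      primes_dvd_imp_eq[OF pk(2)[OF that] pk(2)[OF k]] inj_onD[OF pk(1) _ that k] by auto
  then have "(\<Sum>k'\<in>fd_basis. if pk k' dvd pk k * m then k' else 0) = (\<Sum>k'\<in>fd_basis. if k' = k then k' else 0)"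
    by (intro sum.cong) auto
  also have "\<dots> = k" using k fd_basis(1)[where 'a='w] by simp
  finally show ?thesis
    by (simp add: vmon_def mon_mult pk_nonzero[OF k] Mon_nonzero[OF m] mon_pk[OF k])
qed

lemma IdxI: "k \<in> fd_basis \<Longrightarrow> m \<in> Mon \<Longrightarrow> pk k * m \<in> Idx"
  by (auto simp: Idx_def)

lemma Idx_nonzero: "n \<in> Idx \<Longrightarrow> n \<noteq> 0"
proof -
  assume "n \<in> Idx"
  then obtain k m where "n = pk k * m" "k \<in> fd_basis" "m \<in> Mon" by (auto simp: Idx_def)
  then show ?thesis using pk_nonzero[of k] Mon_nonzero[of m] by simp
qed

lemma Idx_mult:
  assumes "m \<in> Mon" "n \<in> Idx"
  shows "m * n \<in> Idx" "vmon (m * n) u = mon m u *\<^sub>R vmon n u"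
proof -
  obtain k l where n: "n = pk k * l" "k \<in> fd_basis" "l \<in> Mon" using assms(2) by (auto simp: Idx_def)
  have eq: "m * n = pk k * (m * l)" by (simp add: n)
  show "m * n \<in> Idx" unfolding eq by (intro IdxI n Mon_mult assms)
  show "vmon (m * n) u = mon m u *\<^sub>R vmon n u"
  proof -
    have "vmon (m * n) u = (mon m u * mon l u) *\<^sub>R k"
      unfolding eq vmon_eq[OF n(2) Mon_mult[OF assms(1) n(3)]]
      by (simp only: mon_mult[OF Mon_nonzero[OF assms(1)] Mon_nonzero[OF n(3)]])
    moreover have "vmon n u = mon l u *\<^sub>R k" unfolding n(1) by (rule vmon_eq[OF n(2,3)])
    ultimately show ?thesis by simp
  qed
qed

text \<open>The prime marking the component cannot divide a scalar monomial, so divisibility forces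
  equal components and leaves a scalar monomial as quotient. This is what division of vector
  polynomials requires.\<close>

lemma Idx_dvd:
  assumes "n \<in> Idx" "n' \<in> Idx" "n dvd n'"
  shows "\<exists>m\<in>Mon. n' = m * n"
proof -
  obtain k l where n: "n = pk k * l" "k \<in> fd_basis" "l \<in> Mon" using assms(1) by (auto simp: Idx_def)
  obtain k' l' where n': "n' = pk k' * l'" "k' \<in> fd_basis" "l' \<in> Mon" using assms(2) by (auto simp: Idx_def)
  obtain t where t: "n' = n * t" using assms(3) by blast
  have "pk k dvd pk k' * l'" using t n n' by (metis dvd_triv_left mult.assoc)
  then have "pk k dvd pk k'" using prime_dvd_mult_iff[OF pk(2)[OF n(2)]] pk_not_dvd_Mon[OF n(2) n'(3)] by blast
  then have "pk k = pk k'" using primes_dvd_imp_eq pk(2) n(2) n'(2) by blast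
  then have "l' = l * t" using t n n' pk_nonzero[OF n'(2)] by simp
  then have "t \<in> Mon" using n'(3) Mon_factor by simp
  then show ?thesis using t by (auto simp: mult.commute)
qed

lemma Idx_prime_factors: "n \<in> Idx \<Longrightarrow> prime_factors n \<subseteq> pe ` fd_basis \<union> pk ` fd_basis"
  by (auto simp: Idx_def Mon_def prime_factors_product pk_nonzero prime_factorization_prime pk(2))

lemma Dickson_Idx:
  assumes "\<And>i::nat. f i \<in> Idx"
  shows "\<exists>i j. i < j \<and> f i dvd f j"
proof (rule Dickson[of "pe ` fd_basis \<union> pk ` fd_basis"])
  show "finite (pe ` fd_basis \<union> pk ` fd_basis)"
    using fd_basis(1)[where 'a='f] fd_basis(1)[where 'a='w] by simp
qed (use assms Idx_nonzero Idx_prime_factors in blast)+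

subsection \<open>Normal forms\<close>

text \<open>The coefficients vanish off \<open>S\<close>, so supports can be enlarged and united
  without changing the sum. \<open>S\<close> may contain monomials whose coefficient has zeros or is
  identically 0.\<close>

definition srep :: "'a::finite_dim_space set \<Rightarrow> ('a \<times> 'f \<Rightarrow> real) \<Rightarrow> nat set \<Rightarrow> (nat \<Rightarrow> 'a \<Rightarrow> real) \<Rightarrow> bool" where
  "srep W q S C \<longleftrightarrow> finite S \<and> S \<subseteq> Mon \<and> (\<forall>m. smooth_on W (C m)) \<and> (\<forall>m x. m \<notin> S \<longrightarrow> C m x = 0) \<and>
    (\<forall>x\<in>W. \<forall>u. q (x, u) = (\<Sum>m\<in>S. C m x * mon m u))"

definition vrep :: "'a::finite_dim_space set \<Rightarrow> ('a \<times> 'f \<Rightarrow> 'w) \<Rightarrow> nat set \<Rightarrow> (nat \<Rightarrow> 'a \<Rightarrow> real) \<Rightarrow> bool" where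
  "vrep W f S C \<longleftrightarrow> finite S \<and> S \<subseteq> Idx \<and> (\<forall>m. smooth_on W (C m)) \<and> (\<forall>m x. m \<notin> S \<longrightarrow> C m x = 0) \<and>
    (\<forall>x\<in>W. \<forall>u. f (x, u) = (\<Sum>m\<in>S. C m x *\<^sub>R vmon m u))"

lemma sum_extend_zero:
  fixes g :: "nat \<Rightarrow> 'x::real_vector"
  shows "finite S' \<Longrightarrow> S \<subseteq> S' \<Longrightarrow> (\<And>m. m \<notin> S \<Longrightarrow> c m = 0) \<Longrightarrow> (\<Sum>m\<in>S. c m *\<^sub>R g m) = (\<Sum>m\<in>S'. c m *\<^sub>R g m)"
  by (rule sum.mono_neutral_left) auto

lemma srep_add:
  assumes W: "open W" and f: "srep W f S C" and g: "srep W g T D"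
  shows "srep W (\<lambda>z. f z + g z) (S \<union> T) (\<lambda>m x. C m x + D m x)"
proof -
  have "(\<Sum>m\<in>S. C m x * mon m u) + (\<Sum>m\<in>T. D m x * mon m u) = (\<Sum>m\<in>S \<union> T. (C m x + D m x) * mon m u)" for x u
    using sum_extend_zero[of "S \<union> T" S "\<lambda>m. C m x" "\<lambda>m. mon m u"] sum_extend_zero[of "S \<union> T" T "\<lambda>m. D m x" "\<lambda>m. mon m u"] f g
    by (simp add: srep_def distrib_right sum.distrib)
  then show ?thesis using f g W by (auto simp: srep_def intro: smooth_on_add)
qed

lemma vrep_add:
  assumes W: "open W" and f: "vrep W f S C" and g: "vrep W g T D"
  shows "vrep W (\<lambda>z. f z + g z) (S \<union> T) (\<lambda>m x. C m x + D m x)"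
proof -
  have "(\<Sum>m\<in>S. C m x *\<^sub>R vmon m u) + (\<Sum>m\<in>T. D m x *\<^sub>R vmon m u) = (\<Sum>m\<in>S \<union> T. (C m x + D m x) *\<^sub>R vmon m u)" for x u
    using sum_extend_zero[of "S \<union> T" S "\<lambda>m. C m x" "\<lambda>m. vmon m u"] sum_extend_zero[of "S \<union> T" T "\<lambda>m. D m x" "\<lambda>m. vmon m u"] f g
    by (simp add: vrep_def scaleR_add_left sum.distrib)
  then show ?thesis using f g W by (auto simp: vrep_def intro: smooth_on_add)
qed

lemma mem_image_times: "(m::nat) dvd n \<Longrightarrow> n div m \<in> S \<Longrightarrow> n \<in> (*) m ` S"
  by (rule image_eqI[of _ _ "n div m"]) auto

lemma smooth_on_if_const:
  "(b \<Longrightarrow> smooth_on W f) \<Longrightarrow> (\<not> b \<Longrightarrow> smooth_on W g) \<Longrightarrow> smooth_on W (\<lambda>x. if b then f x else g x)"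
  by (cases b) auto

lemma sum_shift:
  fixes g :: "nat \<Rightarrow> 'x::comm_monoid_add"
  assumes "m \<noteq> 0"
  shows "(\<Sum>n\<in>(*) m ` S. g (n div m)) = (\<Sum>n\<in>S. g n)"
  using assms by (subst sum.reindex) (auto simp: inj_on_def)

lemma srep_mult_mon:
  assumes W: "open W" and f: "srep W f S C" and m: "m \<in> Mon" and c: "smooth_on W c"
  shows "srep W (\<lambda>z. c (fst z) * mon m (snd z) * f z) ((*) m ` S) (\<lambda>n x. if m dvd n then c x * C (n div m) x else 0)"
proof -
  have m0: "m \<noteq> 0" by (rule Mon_nonzero[OF m])
  have "(\<Sum>n\<in>(*) m ` S. (if m dvd n then c x * C (n div m) x else 0) * mon n u) = c x * mon m u * (\<Sum>n\<in>S. C n x * mon n u)" for x u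
  proof -
    have "(\<Sum>n\<in>(*) m ` S. (if m dvd n then c x * C (n div m) x else 0) * mon n u)
        = (\<Sum>n\<in>(*) m ` S. (\<lambda>n. c x * C n x * mon (m * n) u) (n div m))"
      using m0 by (intro sum.cong) auto
    also have "\<dots> = (\<Sum>n\<in>S. c x * C n x * mon (m * n) u)" by (rule sum_shift[OF m0])
    also have "\<dots> = (\<Sum>n\<in>S. c x * mon m u * (C n x * mon n u))"
      using f m0 Mon_nonzero by (intro sum.cong) (auto simp: srep_def mon_mult subset_iff)
    finally show ?thesis by (simp add: sum_distrib_left)
  qed
  moreover have "smooth_on W (\<lambda>x. if m dvd n then c x * C (n div m) x else 0)" for n
    using f W c by (cases "m dvd n") (auto simp: srep_def intro: smooth_on_mult smooth_on_const)
  moreover have "(if m dvd n then c x * C (n div m) x else 0) = 0" if "n \<notin> (*) m ` S" for n x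
  proof -
    have "C k x = 0" if "k \<notin> S" for k using f that by (simp add: srep_def)
    then show ?thesis using mem_image_times[of m n S] that by (cases "m dvd n") auto
  qed
  ultimately show ?thesis using f m unfolding srep_def by (auto intro!: Mon_mult)
qed

lemma vrep_mult_mon:
  assumes W: "open W" and f: "vrep W f S C" and m: "m \<in> Mon" and c: "smooth_on W c"
  shows "vrep W (\<lambda>z. (c (fst z) * mon m (snd z)) *\<^sub>R f z) ((*) m ` S) (\<lambda>n x. if m dvd n then c x * C (n div m) x else 0)"
proof -
  have m0: "m \<noteq> 0" by (rule Mon_nonzero[OF m])
  have "(\<Sum>n\<in>(*) m ` S. (if m dvd n then c x * C (n div m) x else 0) *\<^sub>R vmon n u) = (c x * mon m u) *\<^sub>R (\<Sum>n\<in>S. C n x *\<^sub>R vmon n u)" for x u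
  proof -
    have "(\<Sum>n\<in>(*) m ` S. (if m dvd n then c x * C (n div m) x else 0) *\<^sub>R vmon n u)
        = (\<Sum>n\<in>(*) m ` S. (\<lambda>n. (c x * C n x) *\<^sub>R vmon (m * n) u) (n div m))"
      using m0 by (intro sum.cong) auto
    also have "\<dots> = (\<Sum>n\<in>S. (c x * C n x) *\<^sub>R vmon (m * n) u)" by (rule sum_shift[OF m0])
    also have "\<dots> = (\<Sum>n\<in>S. (c x * mon m u) *\<^sub>R (C n x *\<^sub>R vmon n u))"
      using f by (intro sum.cong) (auto simp: vrep_def Idx_mult(2)[OF m] subset_iff)
    finally show ?thesis by (simp add: scaleR_sum_right)
  qed
  moreover have "smooth_on W (\<lambda>x. if m dvd n then c x * C (n div m) x else 0)" for n
    using f W c by (cases "m dvd n") (auto simp: vrep_def intro: smooth_on_mult smooth_on_const)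
  moreover have "(if m dvd n then c x * C (n div m) x else 0) = 0" if "n \<notin> (*) m ` S" for n x
  proof -
    have "C k x = 0" if "k \<notin> S" for k using f that by (simp add: vrep_def)
    then show ?thesis using mem_image_times[of m n S] that by (cases "m dvd n") auto
  qed
  ultimately show ?thesis using f m unfolding vrep_def by (auto intro!: Idx_mult(1))
qed

lemma srep_cong: "srep W f S C \<Longrightarrow> (\<And>z. z \<in> W \<times> UNIV \<Longrightarrow> f z = g z) \<Longrightarrow> srep W g S C"
  by (auto simp: srep_def)

lemma vrep_cong: "vrep W f S C \<Longrightarrow> (\<And>z. z \<in> W \<times> UNIV \<Longrightarrow> f z = g z) \<Longrightarrow> vrep W g S C"
  by (auto simp: vrep_def)

lemma srep_zero: "open W \<Longrightarrow> srep W (\<lambda>z. 0) {} (\<lambda>m x. 0)"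
  by (simp add: srep_def smooth_on_const)

lemma vrep_zero: "open W \<Longrightarrow> vrep W (\<lambda>z. 0) {} (\<lambda>m x. 0)"
  by (simp add: vrep_def smooth_on_const)

lemma srep_sum:
  assumes "open W" "\<And>i. i \<in> I \<Longrightarrow> \<exists>S C. srep W (f i) S C"
  shows "\<exists>S C. srep W (\<lambda>z. \<Sum>i\<in>I. f i z) S C"
  using assms(2)
proof (induction I rule: infinite_finite_induct)
  case (insert i I)
  obtain S C where S: "srep W (f i) S C" using insert.prems by blast
  obtain T D where T: "srep W (\<lambda>z. \<Sum>i\<in>I. f i z) T D" using insert.IH insert.prems by blast
  show ?case using srep_add[OF assms(1) S T] insert.hyps by auto
qed (use srep_zero[OF assms(1)] in auto)

lemma vrep_sum:
  assumes "open W" "\<And>i. i \<in> I \<Longrightarrow> \<exists>S C. vrep W (f i) S C"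
  shows "\<exists>S C. vrep W (\<lambda>z. \<Sum>i\<in>I. f i z) S C"
  using assms(2)
proof (induction I rule: infinite_finite_induct)
  case (insert i I)
  obtain S C where S: "vrep W (f i) S C" using insert.prems by blast
  obtain T D where T: "vrep W (\<lambda>z. \<Sum>i\<in>I. f i z) T D" using insert.IH insert.prems by blast
  show ?case using vrep_add[OF assms(1) S T] insert.hyps by auto
qed (use vrep_zero[OF assms(1)] in auto)

lemma srep_mon: "open W \<Longrightarrow> m \<in> Mon \<Longrightarrow> smooth_on W c \<Longrightarrow>
    srep W (\<lambda>z. c (fst z) * mon m (snd z)) {m} (\<lambda>n x. if n = m then c x else 0)"
  by (auto simp: srep_def intro!: smooth_on_if_const smooth_on_const)

lemma FP_srep:
  assumes W: "open W" and "FP W q"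
  shows "\<exists>S C. srep W q S C"
  using assms(2)
proof (induction rule: FP.induct)
  case (FP_base C)
  then show ?case using srep_mon[OF W Mon_one FP_base] by (auto simp: mon_one[folded One_nat_def] mon_one)
next
  case (FP_lin l)
  have "\<exists>S C. srep W (\<lambda>z. \<Sum>e\<in>fd_basis. l e * coord e (snd z)) S C"
  proof (rule srep_sum[OF W])
    fix e :: 'f assume e: "e \<in> fd_basis"
    show "\<exists>S C. srep W (\<lambda>z. l e * coord e (snd z)) S C"
      using srep_mon[OF W Mon_pe[OF e] smooth_on_const[OF W, of "l e"]] by (auto simp: mon_pe[OF e])
  qed
  moreover have "(\<Sum>e\<in>fd_basis. l e * coord e v) = l v" for v
    using linear_coord_expand[OF FP_lin, of v] by (simp add: mult.commute)
  ultimately show ?case by simp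
next
  case (FP_add f g)
  then show ?case using srep_add[OF W] by blast
next
  case (FP_mult f g)
  obtain S C where S: "srep W f S C" using FP_mult by blast
  obtain T D where T: "srep W g T D" using FP_mult by blast
  have "\<exists>S' C'. srep W (\<lambda>z. \<Sum>m\<in>S. C m (fst z) * mon m (snd z) * g z) S' C'"
  proof (rule srep_sum[OF W])
    fix m assume "m \<in> S"
    then have "m \<in> Mon" "smooth_on W (C m)" using S by (auto simp: srep_def)
    from srep_mult_mon[OF W T this] show "\<exists>S' C'. srep W (\<lambda>z. C m (fst z) * mon m (snd z) * g z) S' C'" by blast
  qed
  then obtain S' C' where "srep W (\<lambda>z. \<Sum>m\<in>S. C m (fst z) * mon m (snd z) * g z) S' C'" by blast
  then have "srep W (\<lambda>z. f z * g z) S' C'"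
    by (rule srep_cong) (use S in \<open>auto simp: srep_def sum_distrib_right\<close>)
  then show ?case by blast
next
  case (FP_cong f g)
  then show ?case using srep_cong by blast
qed

lemma FP_mon: "open W \<Longrightarrow> FP W (\<lambda>z. mon m (snd z))"
  unfolding mon_def by (intro FP_prod FP_power FP_lin coord_linear)

lemma FPV_vrep:
  assumes W: "open W" and f: "FPV W f"
  shows "\<exists>S C. vrep W f S C"
proof -
  have "\<exists>S C. vrep W (\<lambda>z. \<Sum>k\<in>fd_basis. coord k (f z) *\<^sub>R k) S C"
  proof (rule vrep_sum[OF W])
    fix k :: 'w assume k: "k \<in> fd_basis"
    obtain S C where S: "srep W (\<lambda>z. coord k (f z)) S C" using FP_srep[OF W FPV_coord[OF f]] by blast
    have "\<exists>S' C'. vrep W (\<lambda>z. \<Sum>m\<in>S. (C m (fst z) * mon m (snd z)) *\<^sub>R k) S' C'"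
    proof (rule vrep_sum[OF W])
      fix m assume "m \<in> S"
      then have m: "m \<in> Mon" "smooth_on W (C m)" using S by (auto simp: srep_def)
      have "vrep W (\<lambda>z. (C m (fst z) * mon m (snd z)) *\<^sub>R k) {pk k * m} (\<lambda>n x. if n = pk k * m then C m x else 0)"
        using m W by (auto simp: vrep_def vmon_eq[OF k m(1)] IdxI[OF k] intro!: smooth_on_if_const smooth_on_const)
      then show "\<exists>S' C'. vrep W (\<lambda>z. (C m (fst z) * mon m (snd z)) *\<^sub>R k) S' C'" by blast
    qed
    then obtain S' C' where "vrep W (\<lambda>z. \<Sum>m\<in>S. (C m (fst z) * mon m (snd z)) *\<^sub>R k) S' C'" by blast
    then have "vrep W (\<lambda>z. coord k (f z) *\<^sub>R k) S' C'"
      by (rule vrep_cong) (use S in \<open>auto simp: srep_def scaleR_sum_left\<close>)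
    then show "\<exists>S C. vrep W (\<lambda>z. coord k (f z) *\<^sub>R k) S C" by blast
  qed
  then show ?thesis by (simp add: coord_sum)
qed

lemma vrep_subset: "vrep W f S C \<Longrightarrow> W' \<subseteq> W \<Longrightarrow> vrep W' f S C"
  unfolding vrep_def by (meson smooth_on_subset subsetD)

text \<open>The coefficient of the greatest index must be nonzero at every point of
  \<open>W\<close>, which makes it invertible there. A polynomial whose top coefficient has zeros
  may acquire a lead only after the base is shrunk.\<close>

definition has_lead :: "'a::finite_dim_space set \<Rightarrow> ('a \<times> 'f \<Rightarrow> 'w) \<Rightarrow> nat \<Rightarrow> bool" where
  "has_lead W f n \<longleftrightarrow> (\<exists>S C. vrep W f S C \<and> n \<in> S \<and> (\<forall>n'\<in>S. n' \<le> n) \<and> (\<forall>x\<in>W. C n x \<noteq> 0))"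

lemma has_lead_Idx: "has_lead W f n \<Longrightarrow> n \<in> Idx"
  by (auto simp: has_lead_def vrep_def)

lemma has_lead_subset: "has_lead W f n \<Longrightarrow> W' \<subseteq> W \<Longrightarrow> has_lead W' f n"
  unfolding has_lead_def using vrep_subset by (meson subsetD)

lemma has_lead_mult:
  assumes W: "open W" and l: "has_lead W f n" and m: "m \<in> Mon"
  shows "has_lead W (\<lambda>z. mon m (snd z) *\<^sub>R f z) (m * n)"
proof -
  obtain S C where S: "vrep W f S C" "n \<in> S" "\<And>n'. n' \<in> S \<Longrightarrow> n' \<le> n" "\<And>x. x \<in> W \<Longrightarrow> C n x \<noteq> 0"
    using l unfolding has_lead_def by blast
  have "vrep W (\<lambda>z. mon m (snd z) *\<^sub>R f z) ((*) m ` S) (\<lambda>n x. if m dvd n then 1 * C (n div m) x else 0)"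
    using vrep_mult_mon[OF W S(1) m smooth_on_const[OF W, of 1]] by simp
  then show ?thesis
    unfolding has_lead_def using S(2-4) Mon_nonzero[OF m]
    by (intro exI[of _ "(*) m ` S"] exI[of _ "\<lambda>n x. if m dvd n then 1 * C (n div m) x else 0"]) auto
qed

end

subsection \<open>Generic finite generation\<close>

text \<open>A presheaf of modules of polynomial vector fields over the polynomial rings. The set of leading
  exponents with nowhere vanishing leading coefficient grows under restriction to smaller open
  sets, so by Dickson's lemma it becomes stationary on some open set, where division by
  finitely many elements works.\<close>

locale polynomial_module = monomials pe pk
  for pe :: "'f::finite_dim_space \<Rightarrow> nat" and pk :: "'w::finite_dim_space \<Rightarrow> nat" +
  fixes M :: "'a::finite_dim_space set \<Rightarrow> ('a \<times> 'f \<Rightarrow> 'w) \<Rightarrow> bool"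
  assumes M_open: "M W f \<Longrightarrow> open W"
    and M_FPV: "M W f \<Longrightarrow> FPV W f"
    and M_add: "M W f \<Longrightarrow> M W g \<Longrightarrow> M W (\<lambda>z. f z + g z)"
    and M_scale: "FP W q \<Longrightarrow> M W f \<Longrightarrow> M W (\<lambda>z. q z *\<^sub>R f z)"
    and M_subset: "M W f \<Longrightarrow> open W' \<Longrightarrow> W' \<subseteq> W \<Longrightarrow> M W' f"
begin

definition Lset :: "'a set \<Rightarrow> nat set" where
  "Lset W = {n. \<exists>f. M W f \<and> has_lead W f n}"

lemma Lset_Idx: "Lset W \<subseteq> Idx"
  using has_lead_Idx by (auto simp: Lset_def)

lemma Lset_mono: "open W' \<Longrightarrow> W' \<subseteq> W \<Longrightarrow> Lset W \<subseteq> Lset W'"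
  unfolding Lset_def using M_subset has_lead_subset by blast

lemma Lset_dvd:
  assumes "n \<in> Lset W" "n' \<in> Idx" "n dvd n'"
  shows "n' \<in> Lset W"
proof -
  obtain f where f: "M W f" "has_lead W f n" using assms(1) by (auto simp: Lset_def)
  obtain m where m: "m \<in> Mon" "n' = m * n" using Idx_dvd[OF has_lead_Idx[OF f(2)] assms(2,3)] by blast
  have W: "open W" by (rule M_open[OF f(1)])
  show ?thesis
    unfolding Lset_def m(2) using M_scale[OF FP_mon[OF W] f(1)] has_lead_mult[OF W f(2) m(1)] by blast
qed

text \<open>If every admissible set had a smaller one with a new leading exponent, a descending
  sequence of sets with new exponents \<open>n i\<close> would result. Dickson's lemma gives
  \<open>n i dvd n j\<close> with \<open>i < j\<close>, and multiples of leading exponents are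
  leading exponents, so \<open>n j\<close> was not new. Nonempty sets are demanded because over the
  empty set the condition on leading coefficients is void.\<close>

lemma Lset_stationary:
  assumes V: "open V" "V \<noteq> {}"
  shows "\<exists>W. open W \<and> W \<noteq> {} \<and> W \<subseteq> V \<and> (\<forall>W'. open W' \<and> W' \<noteq> {} \<and> W' \<subseteq> W \<longrightarrow> Lset W' = Lset W)"
proof -
  define stat where "stat = (\<lambda>W. \<forall>W'. open W' \<and> W' \<noteq> {} \<and> W' \<subseteq> W \<longrightarrow> Lset W' = Lset W)"
  define adm where "adm = (\<lambda>W. open W \<and> W \<noteq> {} \<and> W \<subseteq> V)"
  define less where "less = (\<lambda>W W'. W' \<subseteq> W \<and> (\<exists>n. n \<in> Lset W' \<and> n \<notin> Lset W))"
  have "\<exists>W. adm W \<and> stat W"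
  proof (rule ccontr)
  assume neg: "\<not> (\<exists>W. adm W \<and> stat W)"
  have step: "\<exists>W'. adm W' \<and> less W W'" if W: "adm W" for W
  proof -
    have "\<not> stat W" using neg W by blast
    then obtain W' where W': "open W'" "W' \<noteq> {}" "W' \<subseteq> W" "Lset W' \<noteq> Lset W" unfolding stat_def by metis
    have "Lset W \<subseteq> Lset W'" by (rule Lset_mono[OF W'(1,3)])
    then obtain n where "n \<in> Lset W'" "n \<notin> Lset W" using W'(4) by blast
    then have "less W W'" using W'(3) unfolding less_def by blast
    moreover have "adm W'" using W W' unfolding adm_def by blast
    ultimately show ?thesis by blast
  qed
  have ex: "\<exists>W. adm W" using V unfolding adm_def by blast
  have "\<exists>f. \<forall>i::nat. adm (f i) \<and> less (f i) (f (Suc i))"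
    by (rule dependent_nat_choice[of "\<lambda>_. adm" "\<lambda>_. less"]) (use ex step in blast)+
  then obtain F where F': "\<And>i::nat. adm (F i)" "\<And>i. less (F i) (F (Suc i))" by blast
  then have F: "\<And>i::nat. open (F i)" "\<And>i. F (Suc i) \<subseteq> F i" "\<And>i. \<exists>n. n \<in> Lset (F (Suc i)) \<and> n \<notin> Lset (F i)"
    by (simp_all add: adm_def less_def)
  obtain n where n: "\<And>i. n i \<in> Lset (F (Suc i))" "\<And>i. n i \<notin> Lset (F i)" using F(3) by metis
  obtain i j where ij: "i < j" "n i dvd n j" using Dickson_Idx[of n] n(1) Lset_Idx by blast
  have "F j \<subseteq> F (Suc i)" using lift_Suc_antimono_le[of F "Suc i" j] F(2) ij(1) by simp
  then have "n i \<in> Lset (F j)" using Lset_mono[OF F(1)] n(1) by blast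
  then have "n j \<in> Lset (F j)" using Lset_dvd[OF _ _ ij(2)] n(1) Lset_Idx by blast
  then show False using n(2) by blast
  qed
  then show ?thesis unfolding adm_def stat_def by blast
qed

text \<open>The elements minimal for divisibility form an antichain, which Dickson's lemma makes
  finite; every element has a minimal divisor by descent in the natural numbers.\<close>

lemma Lset_finite_basis:
  "\<exists>B. finite B \<and> B \<subseteq> Lset W \<and> (\<forall>n\<in>Lset W. \<exists>b\<in>B. b dvd n)"
proof -
  define B where "B = {n \<in> Lset W. \<forall>m\<in>Lset W. m dvd n \<longrightarrow> m = n}"
  have "finite B"
  proof (rule ccontr)
    assume "infinite B"
    then obtain f :: "nat \<Rightarrow> nat" where f: "inj f" "range f \<subseteq> B" using infinite_countable_subset by blast
    then have "\<And>i. f i \<in> Idx" using Lset_Idx by (auto simp: B_def)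
    then obtain i j where ij: "i < j" "f i dvd f j" using Dickson_Idx by blast
    have "f i \<in> B" "f j \<in> B" using f(2) by auto
    then have "f i = f j" using ij(2) by (auto simp: B_def)
    then show False using injD[OF f(1)] ij(1) by blast
  qed
  moreover have "\<exists>b\<in>B. b dvd n" if "n \<in> Lset W" for n
    using that
  proof (induction n rule: less_induct)
    case (less n)
    show ?case
    proof (cases "n \<in> B")
      case False
      then obtain m where m: "m \<in> Lset W" "m dvd n" "m \<noteq> n" using less.prems by (auto simp: B_def)
      have "n \<noteq> 0" using less.prems Lset_Idx Idx_nonzero by blast
      then have "m < n" using m dvd_imp_le[of m n] by auto
      from less.IH[OF this m(1)] show ?thesis using m(2) dvd_trans by blast
    next
      case True
      then show ?thesis by (intro bexI[of _ n] dvd_refl)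
    qed
  qed
  moreover have "B \<subseteq> Lset W" by (auto simp: B_def)
  ultimately show ?thesis by blast
qed

definition generated_by :: "'a set \<Rightarrow> nat set \<Rightarrow> (nat \<Rightarrow> 'a \<times> 'f \<Rightarrow> 'w) \<Rightarrow> ('a \<times> 'f \<Rightarrow> 'w) \<Rightarrow> bool" where
  "generated_by W I g f \<longleftrightarrow> (\<exists>q. (\<forall>i\<in>I. FP W (q i)) \<and> (\<forall>z\<in>W \<times> UNIV. f z = (\<Sum>i\<in>I. q i z *\<^sub>R g i z)))"

text \<open>Division with remainder, by induction on a bound for the occurring exponents. The top
  coefficient of \<open>f\<close> may have zeros in \<open>W'\<close>, so its exponent need not be
  leading there. Stationarity of \<open>Lset\<close> still makes it divisible by the exponent of
  some generator, whose leading coefficient is invertible on all of \<open>W\<close>.\<close>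

theorem generically_finitely_generated:
  assumes V: "open V" "V \<noteq> {}"
  shows "\<exists>W I g. open W \<and> W \<noteq> {} \<and> W \<subseteq> V \<and> finite I \<and> (\<forall>i\<in>I. M W (g i)) \<and>
    (\<forall>W' f. W' \<subseteq> W \<longrightarrow> M W' f \<longrightarrow> generated_by W' I g f)"
proof -
  obtain W where W': "open W \<and> W \<noteq> {} \<and> W \<subseteq> V \<and> (\<forall>W'. open W' \<and> W' \<noteq> {} \<and> W' \<subseteq> W \<longrightarrow> Lset W' = Lset W)"
    using Lset_stationary[OF V] by (rule exE)
  then have W: "open W" "W \<noteq> {}" "W \<subseteq> V"
    "\<And>W'. open W' \<Longrightarrow> W' \<noteq> {} \<Longrightarrow> W' \<subseteq> W \<Longrightarrow> Lset W' = Lset W" by blast+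
  obtain I where I': "finite I \<and> I \<subseteq> Lset W \<and> (\<forall>n\<in>Lset W. \<exists>b\<in>I. b dvd n)"
    using Lset_finite_basis by (rule exE)
  then have I: "finite I" "I \<subseteq> Lset W" "\<And>n. n \<in> Lset W \<Longrightarrow> \<exists>b\<in>I. b dvd n" by simp_all
  have "\<forall>n\<in>I. \<exists>f. M W f \<and> has_lead W f n" using I(2) by (auto simp: Lset_def)
  then obtain g where g: "\<And>n. n \<in> I \<Longrightarrow> M W (g n)" "\<And>n. n \<in> I \<Longrightarrow> has_lead W (g n) n" by metis
  have main: "generated_by W' I g f"
    if W': "open W'" "W' \<subseteq> W" and f: "M W' f" "vrep W' f S C" "\<And>n. n \<in> S \<Longrightarrow> n < N" for N W' f S C
    using f
  proof (induction N arbitrary: f S C)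
    case 0
    then have "S = {}" by auto
    then have "\<forall>z\<in>W' \<times> UNIV. f z = (\<Sum>i\<in>I. 0 *\<^sub>R g i z)" using 0(2) by (auto simp: vrep_def)
    then show ?case
      unfolding generated_by_def by (intro exI[of _ "\<lambda>i z. 0"] conjI ballI FP_const W'(1)) auto
  next
    case (Suc N)
    note r = Suc.prems(2)[unfolded vrep_def]
    show ?case
    proof (cases "N \<in> S \<and> (\<exists>x\<in>W'. C N x \<noteq> 0)")
      case False
      have "vrep W' f (S - {N}) (\<lambda>n x. if n = N then 0 else C n x)"
        unfolding vrep_def
      proof (intro conjI allI impI ballI)
        show "smooth_on W' (\<lambda>x. if m = N then 0 else C m x)" for m
          using r W'(1) by (cases "m = N") (auto intro: smooth_on_const)
        fix x u assume x: "x \<in> W'"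
        have "(\<Sum>m\<in>S. C m x *\<^sub>R vmon m u) = (\<Sum>m\<in>S - {N}. (if m = N then 0 else C m x) *\<^sub>R vmon m u)"
          by (rule sum.mono_neutral_cong_right) (use r False x in auto)
        then show "f (x, u) = (\<Sum>m\<in>S - {N}. (if m = N then 0 else C m x) *\<^sub>R vmon m u)" using r x by simp
      qed (use r in auto)
      then show ?thesis
        by (rule Suc.IH[OF Suc.prems(1)]) (use Suc.prems(3) less_Suc_eq in blast)
    next
      case True
      then obtain x0 where x0: "x0 \<in> W'" "C N x0 \<noteq> 0" and NS: "N \<in> S" by blast
      \<comment> \<open>Over this smaller set \<open>N\<close> is a leading exponent, and by
        stationarity it then belongs to \<open>Lset W\<close>. The division below takes place over
        all of \<open>W'\<close> again.\<close>
      define W2 where "W2 = W' \<inter> C N -` (- {0})"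
      have CN: "smooth_on W' (C N)" using r by blast
      have W2: "open W2" "W2 \<noteq> {}" "W2 \<subseteq> W'"
        using continuous_open_preimage[OF smooth_on_imp_continuous[OF CN] W'(1), of "- {0}"] x0
        by (auto simp: W2_def)
      have "has_lead W2 f N"
        unfolding has_lead_def using vrep_subset[OF Suc.prems(2) W2(3)] NS Suc.prems(3)
        by (intro exI[of _ S] exI[of _ C]) (auto simp: W2_def less_Suc_eq_le)
      then have "N \<in> Lset W2" unfolding Lset_def using M_subset[OF Suc.prems(1) W2(1,3)] by blast
      then have NL: "N \<in> Lset W" using W(4)[OF W2(1,2)] W2(3) W'(2) by blast
      obtain n where n: "n \<in> I" "n dvd N" using I(3)[OF NL] by blast
      obtain T D where T: "vrep W (g n) T D" "n \<in> T" "\<And>n'. n' \<in> T \<Longrightarrow> n' \<le> n" "\<And>x. x \<in> W \<Longrightarrow> D n x \<noteq> 0"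
        using g(2)[OF n(1)] unfolding has_lead_def by blast
      obtain m where m: "m \<in> Mon" "N = m * n" using Idx_dvd[of n N] n NL I(2) Lset_Idx by blast
      have m0: "m \<noteq> 0" by (rule Mon_nonzero[OF m(1)])
      \<comment> \<open>The denominator has no zeros on \<open>W\<close>, so the quotient is smooth
        also where \<open>C N\<close> vanishes; the sign makes the two top terms cancel.\<close>
      define c where "c = (\<lambda>x. - (C N x / D n x))"
      have cs: "smooth_on W' c"
        unfolding c_def
        by (intro smooth_on_minus smooth_on_divide W'(1) CN smooth_on_subset[of W "D n", OF _ W'(2)])
          (use T W'(2) in \<open>auto simp: vrep_def\<close>)
      define E where "E = (\<lambda>k x. if m dvd k then c x * D (k div m) x else 0)"
      define h where "h = (\<lambda>z. f z + (c (fst z) * mon m (snd z)) *\<^sub>R g n z)"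
      have "vrep W' (\<lambda>z. (c (fst z) * mon m (snd z)) *\<^sub>R g n z) ((*) m ` T) E"
        unfolding E_def by (rule vrep_mult_mon[OF W'(1) vrep_subset[OF T(1) W'(2)] m(1) cs])
      from vrep_add[OF W'(1) Suc.prems(2) this]
      have hr: "vrep W' h (S \<union> (*) m ` T) (\<lambda>k x. C k x + E k x)" unfolding h_def .
      note hr' = hr[unfolded vrep_def]
      have EN: "C N x + E N x = 0" if "x \<in> W'" for x
        using m m0 T(4)[of x] that W'(2) by (auto simp: E_def c_def)
      have hv: "vrep W' h ((S \<union> (*) m ` T) - {N}) (\<lambda>k x. if k = N then 0 else C k x + E k x)"
        unfolding vrep_def
      proof (intro conjI allI impI ballI)
        show "smooth_on W' (\<lambda>x. if k = N then 0 else C k x + E k x)" for k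
          using hr' W'(1) by (cases "k = N") (auto intro: smooth_on_const)
        fix x u assume x: "x \<in> W'"
        have "(\<Sum>k\<in>S \<union> (*) m ` T. (C k x + E k x) *\<^sub>R vmon k u)
            = (\<Sum>k\<in>(S \<union> (*) m ` T) - {N}. (if k = N then 0 else C k x + E k x) *\<^sub>R vmon k u)"
          by (rule sum.mono_neutral_cong_right) (use hr' EN[OF x] in auto)
        then show "h (x, u) = (\<Sum>k\<in>(S \<union> (*) m ` T) - {N}. (if k = N then 0 else C k x + E k x) *\<^sub>R vmon k u)"
          using hr' x by simp
      qed (use hr' in auto)
      have qFP: "FP W' (\<lambda>z. c (fst z) * mon m (snd z))" by (intro FP_mult FP_base cs FP_mon W'(1))
      have "M W' h"
        unfolding h_def by (intro M_add Suc.prems(1) M_scale qFP M_subset[OF g(1)[OF n(1)] W'])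
      moreover have "k < N" if "k \<in> (S \<union> (*) m ` T) - {N}" for k
      proof -
        have "k \<le> N" using that Suc.prems(3) T(3) m by (auto simp: less_Suc_eq_le)
        then show ?thesis using that by auto
      qed
      ultimately have "generated_by W' I g h" by (rule Suc.IH[OF _ hv])
      then obtain q where q: "\<And>i. i \<in> I \<Longrightarrow> FP W' (q i)" "\<And>z. z \<in> W' \<times> UNIV \<Longrightarrow> h z = (\<Sum>i\<in>I. q i z *\<^sub>R g i z)"
        unfolding generated_by_def by blast
      define q' where "q' = (\<lambda>i z. if i = n then q n z + - (c (fst z) * mon m (snd z)) else q i z)"
      have "FP W' (q' i)" if "i \<in> I" for i
        unfolding q'_def using q(1)[OF that] FP_add[OF q(1)[OF n(1)] FP_minus[OF W'(1) qFP]] by (cases "i = n") auto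
      moreover have "f z = (\<Sum>i\<in>I. q' i z *\<^sub>R g i z)" if z: "z \<in> W' \<times> UNIV" for z
      proof -
        have "(\<Sum>i\<in>I. q' i z *\<^sub>R g i z) = q' n z *\<^sub>R g n z + (\<Sum>i\<in>I - {n}. q' i z *\<^sub>R g i z)"
          by (rule sum.remove[OF I(1) n(1)])
        also have "(\<Sum>i\<in>I - {n}. q' i z *\<^sub>R g i z) = (\<Sum>i\<in>I - {n}. q i z *\<^sub>R g i z)"
          by (rule sum.cong) (auto simp: q'_def)
        also have "q' n z *\<^sub>R g n z + \<dots> = (\<Sum>i\<in>I. q i z *\<^sub>R g i z) - (c (fst z) * mon m (snd z)) *\<^sub>R g n z"
          unfolding sum.remove[OF I(1) n(1)] by (simp add: q'_def scaleR_diff_left)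
        also have "\<dots> = f z" unfolding q(2)[OF z, symmetric] by (simp add: h_def)
        finally show ?thesis by simp
      qed
      ultimately show ?thesis unfolding generated_by_def by blast
    qed
  qed
  have gen: "generated_by W' I g f" if W': "W' \<subseteq> W" and f: "M W' f" for W' f
  proof -
    have o: "open W'" by (rule M_open[OF f])
    obtain S C where S: "vrep W' f S C" using FPV_vrep[OF o M_FPV[OF f]] by (elim exE)
    then have "finite S" by (simp add: vrep_def)
    then obtain N where N: "\<And>n. n \<in> S \<Longrightarrow> n < N" using finite_nat_set_iff_bounded by auto
    show ?thesis by (rule main[OF o W' f S N])
  qed
  show ?thesis
    by (intro exI[of _ W] exI[of _ I] exI[of _ g] conjI allI impI ballI W(1-3) I(1) g(1) gen)
qed

end

section \<open>From polynomial generators to the generated distribution, and the conclusion\<close>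

subsection \<open>Evaluation of the generated distribution\<close>

context smooth_manifold
begin

text \<open>A property of germs at \<open>x\<close>. The coefficient \<open>h\<close> is built in
  because \<open>lie_subalgebra\<close> demands closure under real multiples only; with
  \<open>h\<close> carried along, multiplication by smooth functions and brackets preserve the
  property.\<close>

definition extendable :: "('x, 'v) vfield set \<Rightarrow> ('x, 'v) chart \<Rightarrow> 'v \<Rightarrow> ('v \<Rightarrow> 'v) \<Rightarrow> bool" where
  "extendable \<Delta> c x f \<longleftrightarrow> (\<forall>B h. open B \<and> x \<in> B \<and> smooth_on B h \<longrightarrow>
     (\<exists>Y\<in>\<Delta>. \<exists>B'. open B' \<and> x \<in> B' \<and> B' \<subseteq> B \<and> (\<forall>y\<in>B'. in_chart Y c y = h y *\<^sub>R f y)))"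

lemma extendableD:
  "extendable \<Delta> c x f \<Longrightarrow> open B \<Longrightarrow> x \<in> B \<Longrightarrow> smooth_on B h \<Longrightarrow>
    \<exists>Y B'. Y \<in> \<Delta> \<and> open B' \<and> x \<in> B' \<and> B' \<subseteq> B \<and> (\<forall>y\<in>B'. in_chart Y c y = h y *\<^sub>R f y)"
  unfolding extendable_def by blast

lemma extendableI:
  assumes "open N" "x \<in> N"
    and "\<And>B h. open B \<Longrightarrow> x \<in> B \<Longrightarrow> B \<subseteq> N \<Longrightarrow> smooth_on B h \<Longrightarrow>
      \<exists>Y\<in>\<Delta>. \<exists>B'. open B' \<and> x \<in> B' \<and> B' \<subseteq> B \<and> (\<forall>y\<in>B'. in_chart Y c y = h y *\<^sub>R f y)"
  shows "extendable \<Delta> c x f"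
  unfolding extendable_def
proof (intro allI impI)
  fix B and h :: "'v \<Rightarrow> real" assume B: "open B \<and> x \<in> B \<and> smooth_on B h"
  have "\<exists>Y\<in>\<Delta>. \<exists>B'. open B' \<and> x \<in> B' \<and> B' \<subseteq> B \<inter> N \<and> (\<forall>y\<in>B'. in_chart Y c y = h y *\<^sub>R f y)"
    by (rule assms(3)) (use B assms(1,2) smooth_on_subset[of B h "B \<inter> N"] in auto)
  then show "\<exists>Y\<in>\<Delta>. \<exists>B'. open B' \<and> x \<in> B' \<and> B' \<subseteq> B \<and> (\<forall>y\<in>B'. in_chart Y c y = h y *\<^sub>R f y)"
    by blast
qed

lemma extendable_add:
  assumes L: "lie_subalgebra A \<Delta>" and f: "extendable \<Delta> c x f" and g: "extendable \<Delta> c x g"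
  shows "extendable \<Delta> c x (\<lambda>y. f y + g y)"
proof (rule extendableI[OF open_UNIV UNIV_I])
  fix B and h :: "'v \<Rightarrow> real" assume B: "open B" "x \<in> B" "smooth_on B h"
  obtain Y1 B1 where 1: "Y1 \<in> \<Delta>" "open B1" "x \<in> B1" "B1 \<subseteq> B" "\<forall>y\<in>B1. in_chart Y1 c y = h y *\<^sub>R f y"
    using extendableD[OF f B] by (elim exE conjE)
  obtain Y2 B2 where 2: "Y2 \<in> \<Delta>" "open B2" "x \<in> B2" "B2 \<subseteq> B" "\<forall>y\<in>B2. in_chart Y2 c y = h y *\<^sub>R g y"
    using extendableD[OF g B] by (elim exE conjE)
  have "(\<lambda>p c. Y1 p c + Y2 p c) \<in> \<Delta>" using L 1(1) 2(1) unfolding lie_subalgebra_def by blast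
  moreover have "in_chart (\<lambda>p c. Y1 p c + Y2 p c) c y = h y *\<^sub>R (f y + g y)" if "y \<in> B1 \<inter> B2" for y
    using that 1(5) 2(5) by (simp add: in_chart_def scaleR_add_right)
  ultimately show "\<exists>Y\<in>\<Delta>. \<exists>B'. open B' \<and> x \<in> B' \<and> B' \<subseteq> B \<and> (\<forall>y\<in>B'. in_chart Y c y = h y *\<^sub>R (f y + g y))"
    using 1(2-4) 2(2,3) by (intro bexI[of _ "\<lambda>p c. Y1 p c + Y2 p c"] exI[of _ "B1 \<inter> B2"] conjI ballI) auto
qed

lemma extendable_scale:
  assumes N: "open N" "x \<in> N" and q: "smooth_on N q" and f: "extendable \<Delta> c x f"
  shows "extendable \<Delta> c x (\<lambda>y. q y *\<^sub>R f y)"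
proof (rule extendableI[OF N])
  fix B and h :: "'v \<Rightarrow> real" assume B: "open B" "x \<in> B" "B \<subseteq> N" "smooth_on B h"
  have "smooth_on B (\<lambda>y. h y * q y)" by (intro smooth_on_mult B smooth_on_subset[OF q])
  from extendableD[OF f B(1,2) this]
  show "\<exists>Y\<in>\<Delta>. \<exists>B'. open B' \<and> x \<in> B' \<and> B' \<subseteq> B \<and> (\<forall>y\<in>B'. in_chart Y c y = h y *\<^sub>R q y *\<^sub>R f y)"
    by (simp add: Bex_def)
qed

lemma in_chart_lie_bracket:
  assumes "c \<in> A" "y \<in> snd c ` fst c"
  shows "in_chart (lie_bracket A X Y) c y = brk (in_chart X c) (in_chart Y c) y"
proof -
  obtain q where "q \<in> fst c" "y = snd c q" using assms(2) by blast
  then show ?thesis using assms(1) by (simp add: in_chart_at lie_bracket_at)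
qed

text \<open>The Leibniz rule \<open>h [f, g] = [h f, g] + (dh g) f\<close>.\<close>

lemma extendable_brk:
  assumes L: "lie_subalgebra A \<Delta>" and c: "c \<in> A" and N: "open N" "x \<in> N" "N \<subseteq> snd c ` fst c"
    and sm: "smooth_on N f" "smooth_on N g" and f: "extendable \<Delta> c x f" and g: "extendable \<Delta> c x g"
  shows "extendable \<Delta> c x (brk f g)"
proof (rule extendableI[OF N(1,2)])
  fix B and h :: "'v \<Rightarrow> real" assume B: "open B" "x \<in> B" "B \<subseteq> N" "smooth_on B h"
  obtain Y1 B1 where 1: "Y1 \<in> \<Delta>" "open B1" "x \<in> B1" "B1 \<subseteq> B" "\<forall>y\<in>B1. in_chart Y1 c y = h y *\<^sub>R f y"
    using extendableD[OF f B(1,2,4)] by (elim exE conjE)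
  obtain Y2 B2 where 2: "Y2 \<in> \<Delta>" "open B2" "x \<in> B2" "B2 \<subseteq> B" "\<forall>y\<in>B2. in_chart Y2 c y = 1 *\<^sub>R g y"
    using extendableD[OF g B(1,2) smooth_on_const[OF B(1), of 1]] by (elim exE conjE)
  have "smooth_on B (\<lambda>y. dd h y (g y))"
    by (intro smooth_on_dd_apply[where g="\<lambda>x. x" and W=B] smooth_on_ident B smooth_on_subset[OF sm(2)]) auto
  from extendableD[OF f B(1,2) this]
  obtain Y3 B3 where 3: "Y3 \<in> \<Delta>" "open B3" "x \<in> B3" "B3 \<subseteq> B" "\<forall>y\<in>B3. in_chart Y3 c y = dd h y (g y) *\<^sub>R f y"
    by (elim exE conjE)
  let ?Y = "\<lambda>p c. lie_bracket A Y1 Y2 p c + Y3 p c"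
  have "lie_bracket A Y1 Y2 \<in> \<Delta>" using L 1(1) 2(1) unfolding lie_subalgebra_def by blast
  then have "?Y \<in> \<Delta>" using L 3(1) unfolding lie_subalgebra_def by blast
  moreover have "in_chart ?Y c y = h y *\<^sub>R brk f g y" if y: "y \<in> B1 \<inter> B2 \<inter> B3" for y
  proof -
    have yB: "y \<in> B" using y 1(4) by blast
    have yc: "y \<in> snd c ` fst c" using yB B(3) N(3) by blast
    have "brk (in_chart Y1 c) (in_chart Y2 c) y = brk (\<lambda>z. h z *\<^sub>R f z) g y"
      by (rule brk_local[of "B1 \<inter> B2"]) (use 1 2 y in auto)
    also have "\<dots> = dd g y (h y *\<^sub>R f y) - dd (\<lambda>z. h z *\<^sub>R f z) y (g y)" by (simp add: brk_def)
    also have "dd (\<lambda>z. h z *\<^sub>R f z) y (g y) = h y *\<^sub>R dd f y (g y) + dd h y (g y) *\<^sub>R f y"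
      by (intro dd_scaleR smooth_on_differentiable[OF B(1,4) yB] smooth_on_differentiable[OF N(1) sm(1)])
        (use yB B(3) in auto)
    also have "dd g y (h y *\<^sub>R f y) = h y *\<^sub>R dd g y (f y)"
      using yB B(3) by (intro linear_scale smooth_on_dd_linear[OF N(1) sm(2)]) auto
    finally have "brk (in_chart Y1 c) (in_chart Y2 c) y = h y *\<^sub>R brk f g y - dd h y (g y) *\<^sub>R f y"
      by (simp add: brk_def scaleR_diff_right)
    moreover have "in_chart ?Y c y = in_chart (lie_bracket A Y1 Y2) c y + in_chart Y3 c y"
      by (simp add: in_chart_def)
    ultimately show ?thesis using in_chart_lie_bracket[OF c yc] 3(5) y by simp
  qed
  ultimately show "\<exists>Y\<in>\<Delta>. \<exists>B'. open B' \<and> x \<in> B' \<and> B' \<subseteq> B \<and> (\<forall>y\<in>B'. in_chart Y c y = h y *\<^sub>R brk f g y)"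
    using 1(2-4) 2(2,3) 3(2,3) by (intro bexI[of _ ?Y] exI[of _ "B1 \<inter> B2 \<inter> B3"] conjI ballI) auto
qed

lemma extendable_tangent:
  assumes P: "plane_field A d P" and W: "open W" "p \<in> W" and X: "smooth_vfield_on A W X" "\<And>q. q \<in> W \<Longrightarrow> X q \<in> P q"
    and c: "c \<in> A" "p \<in> fst c"
  shows "extendable (generated_distribution A P) c (snd c p) (in_chart X c)"
proof (rule extendableI[OF open_UNIV UNIV_I])
  fix B and h :: "'v \<Rightarrow> real" assume B: "open B" "snd c p \<in> B" "smooth_on B h"
  have "\<exists>Y\<in>tangent_vfields A P. \<exists>B'. open B' \<and> snd c p \<in> B' \<and> B' \<subseteq> B \<inter> snd c ` (fst c \<inter> W) \<and>
      (\<forall>y\<in>B'. in_chart Y c y = h y *\<^sub>R in_chart X c y)"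
    by (rule tangent_vfield_localize[OF P W X(1) _ c B]) (rule X(2))
  then obtain Y B' where "Y \<in> tangent_vfields A P" "open B'" "snd c p \<in> B'" "B' \<subseteq> B \<inter> snd c ` (fst c \<inter> W)"
    "\<forall>y\<in>B'. in_chart Y c y = h y *\<^sub>R in_chart X c y" by (elim bexE exE conjE)
  then show "\<exists>Y\<in>generated_distribution A P. \<exists>B'. open B' \<and> snd c p \<in> B' \<and> B' \<subseteq> B \<and>
      (\<forall>y\<in>B'. in_chart Y c y = h y *\<^sub>R in_chart X c y)"
    using tangent_vfields_generated[of P] by (intro bexI[of _ Y] exI[of _ B'] conjI) auto
qed

text \<open>Membership in the module is required only locally on \<open>W\<close>, since the
  coefficients will come from local dual frames. Closure under brackets is the Leibniz rule combined
  with the relations between the generators.\<close>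

lemma locally_in_module_subalgebra:
  fixes g :: "'i \<Rightarrow> 'v \<Rightarrow> 'v"
  assumes c: "c \<in> A" and W: "open W" "W \<subseteq> fst c" and I: "finite I"
    and g: "\<And>i. i \<in> I \<Longrightarrow> smooth_on (snd c ` W) (g i)"
    and inv: "\<And>i j. i \<in> I \<Longrightarrow> j \<in> I \<Longrightarrow> in_mod (snd c ` W) I g (brk (g i) (g j))"
  shows "lie_subalgebra A {X. smooth_vfield_on A UNIV X \<and>
    (\<forall>x\<in>snd c ` W. \<exists>B. open B \<and> x \<in> B \<and> B \<subseteq> snd c ` W \<and> in_mod B I g (in_chart X c))}"
    (is "lie_subalgebra A ?L")
proof -
  have D: "open (snd c ` W)" by (rule chart_image_open[OF c W])
  have zero: "(\<lambda>p c. 0) \<in> ?L"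
    using smooth_vfield_zero D in_mod_zero[OF D] by (auto simp: in_chart_def)
  have add: "(\<lambda>p c. X p c + Y p c) \<in> ?L" if X: "X \<in> ?L" and Y: "Y \<in> ?L" for X Y
  proof -
    have "\<exists>B. open B \<and> x \<in> B \<and> B \<subseteq> snd c ` W \<and> in_mod B I g (in_chart (\<lambda>p c. X p c + Y p c) c)" if x: "x \<in> snd c ` W" for x
    proof -
      obtain B1 where 1: "open B1" "x \<in> B1" "B1 \<subseteq> snd c ` W" "in_mod B1 I g (in_chart X c)" using X x by blast
      obtain B2 where 2: "open B2" "x \<in> B2" "in_mod B2 I g (in_chart Y c)" using Y x by blast
      have "in_mod (B1 \<inter> B2) I g (\<lambda>y. in_chart X c y + in_chart Y c y)"
        by (intro in_mod_add in_mod_subset[OF 1(4)] in_mod_subset[OF 2(3)]) (use 1 2 in auto)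
      then show ?thesis using 1 2 by (intro exI[of _ "B1 \<inter> B2"]) (auto simp: in_chart_def)
    qed
    then show ?thesis using smooth_vfield_add X Y by blast
  qed
  have scale: "(\<lambda>p c. r *\<^sub>R X p c) \<in> ?L" if X: "X \<in> ?L" for r X
  proof -
    have "\<exists>B. open B \<and> x \<in> B \<and> B \<subseteq> snd c ` W \<and> in_mod B I g (in_chart (\<lambda>p c. r *\<^sub>R X p c) c)" if x: "x \<in> snd c ` W" for x
    proof -
      obtain B1 where 1: "open B1" "x \<in> B1" "B1 \<subseteq> snd c ` W" "in_mod B1 I g (in_chart X c)" using X x by blast
      have "in_mod B1 I g (\<lambda>y. r *\<^sub>R in_chart X c y)"
        by (rule in_mod_scale[OF 1(1) smooth_on_const[OF 1(1)] 1(4)])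
      then show ?thesis using 1 by (intro exI[of _ B1]) (auto simp: in_chart_def)
    qed
    then show ?thesis using smooth_vfield_scale X by blast
  qed
  have bracket: "lie_bracket A X Y \<in> ?L" if X: "X \<in> ?L" and Y: "Y \<in> ?L" for X Y
  proof -
    have "\<exists>B. open B \<and> x \<in> B \<and> B \<subseteq> snd c ` W \<and> in_mod B I g (in_chart (lie_bracket A X Y) c)" if x: "x \<in> snd c ` W" for x
    proof -
      obtain B1 where 1: "open B1" "x \<in> B1" "B1 \<subseteq> snd c ` W" "in_mod B1 I g (in_chart X c)" using X x by blast
      obtain B2 where 2: "open B2" "x \<in> B2" "in_mod B2 I g (in_chart Y c)" using Y x by blast
      let ?B = "B1 \<inter> B2"
      have sub: "?B \<subseteq> snd c ` W" using 1 by blast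
      have "in_mod ?B I g (brk (in_chart X c) (in_chart Y c))"
      proof (rule in_mod_brk[OF _ _ I])
        show "open ?B" using 1 2 by blast
        show "smooth_on ?B (g i)" if "i \<in> I" for i by (rule smooth_on_subset[OF g[OF that] sub])
        show "in_mod ?B I g (brk (g i) (g j))" if "i \<in> I" "j \<in> I" for i j by (rule in_mod_subset[OF inv[OF that] sub])
        show "in_mod ?B I g (in_chart X c)" "in_mod ?B I g (in_chart Y c)"
          using in_mod_subset[OF 1(4)] in_mod_subset[OF 2(3)] by auto
      qed
      then have "in_mod ?B I g (in_chart (lie_bracket A X Y) c)"
        by (rule in_mod_cong[rotated]) (use sub W(2) in \<open>auto intro!: in_chart_lie_bracket[OF c, symmetric]\<close>)
      then show ?thesis using 1 2 by (intro exI[of _ ?B]) auto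
    qed
    then show ?thesis using lie_bracket_smooth X Y by blast
  qed
  have sm: "smooth_vfield_on A UNIV X" if "X \<in> ?L" for X using that by blast
  show ?thesis unfolding lie_subalgebra_def by (intro conjI ballI allI zero add scale bracket sm)
qed

text \<open>One inclusion holds because the generators are germs of members of the distribution. For
  the other, the dual of the frame \<open>Z\<close> gives every field tangent to \<open>P\<close>
  smooth coefficients in \<open>Z\<close>, and \<open>Z\<close> lies in the module. So the Lie
  algebra of fields locally in the module contains all fields tangent to \<open>P\<close>, hence the
  whole distribution.\<close>

lemma evaluation_generated_span:
  fixes g :: "'i \<Rightarrow> 'v \<Rightarrow> 'v"
  assumes P: "plane_field A d P" and c: "c \<in> A" and W: "open W" "W \<subseteq> fst c" and I: "finite I"
    and g: "\<And>i. i \<in> I \<Longrightarrow> smooth_on (snd c ` W) (g i)"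
    and inv: "\<And>i j. i \<in> I \<Longrightarrow> j \<in> I \<Longrightarrow> in_mod (snd c ` W) I g (brk (g i) (g j))"
    and ext: "\<And>i x. i \<in> I \<Longrightarrow> x \<in> snd c ` W \<Longrightarrow> extendable (generated_distribution A P) c x (g i)"
    and frame: "\<And>p. p \<in> W \<Longrightarrow> \<exists>B Z. open B \<and> snd c p \<in> B \<and> B \<subseteq> snd c ` W \<and>
      (\<forall>k<d. smooth_on B (Z k) \<and> in_mod B I g (Z k) \<and> (\<forall>q\<in>W. snd c q \<in> B \<longrightarrow> Z k (snd c q) \<in> (\<lambda>v. v c) ` P q)) \<and>
      (\<forall>a. (\<Sum>k<d. a k *\<^sub>R Z k (snd c p)) = 0 \<longrightarrow> (\<forall>k<d. a k = (0::real)))"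
    and q: "q \<in> W"
  shows "evaluation (generated_distribution A P) q = {v \<in> tangent_space A q. v c \<in> span ((\<lambda>i. g i (snd c q)) ` I)}"
proof
  let ?G = "generated_distribution A P"
  have qc: "q \<in> fst c" using q W by blast
  let ?K = "{Z q c | Z. Z \<in> ?G}"
  note L = lie_subalgebra_generated[of P, unfolded lie_subalgebra_def]
  have "subspace ?K"
  proof (rule subspaceI)
    show "0 \<in> ?K" using L by (intro CollectI exI[of _ "\<lambda>p c. 0"]) auto
  next
    fix x y assume "x \<in> ?K" "y \<in> ?K"
    then obtain X Y where XY: "X \<in> ?G" "Y \<in> ?G" "x = X q c" "y = Y q c" by blast
    then have "(\<lambda>p c. X p c + Y p c) \<in> ?G" using L by blast
    then show "x + y \<in> ?K" using XY by (intro CollectI exI[of _ "\<lambda>p c. X p c + Y p c"]) auto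
  next
    fix r x assume "x \<in> ?K"
    then obtain X where X: "X \<in> ?G" "x = X q c" by blast
    then have "(\<lambda>p c. r *\<^sub>R X p c) \<in> ?G" using L by blast
    then show "r *\<^sub>R x \<in> ?K" using X by (intro CollectI exI[of _ "\<lambda>p c. r *\<^sub>R X p c"]) auto
  qed
  moreover have "g i (snd c q) \<in> ?K" if i: "i \<in> I" for i
  proof -
    obtain Y B' where Y: "Y \<in> ?G" "open B'" "snd c q \<in> B'" "B' \<subseteq> UNIV" "\<forall>y\<in>B'. in_chart Y c y = 1 *\<^sub>R g i y"
      using extendableD[OF ext[OF i imageI[OF q]] open_UNIV UNIV_I smooth_on_const[OF open_UNIV, of 1]]
      by (elim exE conjE)
    then have "Y q c = g i (snd c q)" using in_chart_at[OF c qc, of Y] by simp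
    then show ?thesis using Y(1) by (metis (mono_tags, lifting) mem_Collect_eq)
  qed
  ultimately have sp: "span ((\<lambda>i. g i (snd c q)) ` I) \<subseteq> ?K" by (intro span_minimal) auto
  show "{v \<in> tangent_space A q. v c \<in> span ((\<lambda>i. g i (snd c q)) ` I)} \<subseteq> evaluation ?G q"
  proof
    fix v assume v: "v \<in> {v \<in> tangent_space A q. v c \<in> span ((\<lambda>i. g i (snd c q)) ` I)}"
    then obtain Z where Z: "Z \<in> ?G" "v c = Z q c" using sp by blast
    have "Z q \<in> tangent_space A q" by (rule smooth_vfield_tangent[OF generated_smooth[OF Z(1)] UNIV_I])
    then have "v = Z q" using v by (intro tangent_eqI[of v q "Z q" c] c qc Z(2)) auto
    then show "v \<in> evaluation ?G q" using Z(1) unfolding evaluation_def by blast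
  qed
  let ?L = "{X. smooth_vfield_on A UNIV X \<and>
    (\<forall>x\<in>snd c ` W. \<exists>B. open B \<and> x \<in> B \<and> B \<subseteq> snd c ` W \<and> in_mod B I g (in_chart X c))}"
  have "tangent_vfields A P \<subseteq> ?L"
  proof
    fix X assume X: "X \<in> tangent_vfields A P"
    have Xs: "smooth_vfield_on A UNIV X" and XP: "\<And>p. X p \<in> P p" using X unfolding tangent_vfields_def by auto
    have "\<exists>B. open B \<and> snd c p \<in> B \<and> B \<subseteq> snd c ` W \<and> in_mod B I g (in_chart X c)" if p: "p \<in> W" for p
    proof -
      obtain B Z where B: "open B" "snd c p \<in> B" "B \<subseteq> snd c ` W"
        and Z: "\<forall>k<d. smooth_on B (Z k) \<and> in_mod B I g (Z k) \<and> (\<forall>q\<in>W. snd c q \<in> B \<longrightarrow> Z k (snd c q) \<in> (\<lambda>v. v c) ` P q)"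
        and ind: "\<forall>a. (\<Sum>k<d. a k *\<^sub>R Z k (snd c p)) = 0 \<longrightarrow> (\<forall>k<d. a k = (0::real))"
        using frame[OF p] by (elim exE conjE)
      have "\<exists>W' \<mu>. open W' \<and> snd c p \<in> W' \<and> W' \<subseteq> B \<and>
          (\<forall>i<d. \<forall>x\<in>W'. linear (\<mu> i x :: 'v \<Rightarrow> real)) \<and> (\<forall>i<d. \<forall>v. smooth_on W' (\<lambda>x. \<mu> i x v)) \<and>
          (\<forall>i<d. \<forall>j<d. \<forall>x\<in>W'. \<mu> i x (Z j x) = (if i = j then 1 else 0))"
        by (rule dual_frame[OF B(1,2)]) (use Z ind in auto)
      then obtain W' and \<mu> :: "nat \<Rightarrow> 'v \<Rightarrow> 'v \<Rightarrow> real" where W': "open W'" "snd c p \<in> W'" "W' \<subseteq> B"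
        and \<mu>: "\<forall>i<d. \<forall>x\<in>W'. linear (\<mu> i x)" "\<forall>i<d. \<forall>v. smooth_on W' (\<lambda>x. \<mu> i x v)"
          "\<forall>i<d. \<forall>j<d. \<forall>x\<in>W'. \<mu> i x (Z j x) = (if i = j then 1 else 0)"
        by (elim exE conjE)
      have sub: "W' \<subseteq> snd c ` fst c" using W'(3) B(3) W(2) by blast
      have "in_mod W' {..<d} Z (in_chart X c)"
      proof (rule in_modI)
        fix i assume i: "i \<in> {..<d}"
        show "smooth_on W' (\<lambda>x. \<mu> i x (in_chart X c x))"
          by (rule dual_frame_coefficients_smooth[OF W'(1) _ _
            smooth_on_subset[OF smooth_vfield_UNIV_in_chart[OF Xs c] sub]]) (use \<mu>(1,2) i in auto)
      next
        fix x assume x: "x \<in> W'"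
        then obtain r where r: "r \<in> W" "x = snd c r" using W'(3) B(3) by blast
        then have rc: "r \<in> fst c" using W(2) by blast
        show "in_chart X c x = (\<Sum>i<d. \<mu> i x (in_chart X c x) *\<^sub>R Z i x)"
        proof (rule dual_frame_expand)
          show "subspace ((\<lambda>v. v c) ` P r)" "dim ((\<lambda>v. v c) ` P r) = d"
            using plane_field_facts(5)[OF P c rc] by auto
          show "in_chart X c x \<in> (\<lambda>v. v c) ` P r" using XP[of r] by (simp add: r(2) in_chart_at[OF c rc])
          show "Z i x \<in> (\<lambda>v. v c) ` P r" if "i < d" for i using Z that r x W'(3) by blast
        qed (use \<mu> x in auto)
      qed
      then have "in_mod W' I g (in_chart X c)"
        by (rule in_mod_trans[OF W'(1), rotated]) (use Z in_mod_subset[OF _ W'(3)] in blast)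
      then show ?thesis using W' B by blast
    qed
    then show "X \<in> ?L" using Xs by auto
  qed
  from generated_subset[OF locally_in_module_subalgebra[OF c W I g inv] this] have GL: "?G \<subseteq> ?L" .
  show "evaluation ?G q \<subseteq> {v \<in> tangent_space A q. v c \<in> span ((\<lambda>i. g i (snd c q)) ` I)}"
  proof
    fix v assume "v \<in> evaluation ?G q"
    then obtain X where X: "X \<in> ?G" "v = X q" unfolding evaluation_def by blast
    then obtain B where B: "snd c q \<in> B" "in_mod B I g (in_chart X c)" using GL q by blast
    from in_mod_span[OF B(2,1)] have "X q c \<in> span ((\<lambda>i. g i (snd c q)) ` I)" by (simp add: in_chart_at[OF c qc])
    then show "v \<in> {v \<in> tangent_space A q. v c \<in> span ((\<lambda>i. g i (snd c q)) ` I)}"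
      using smooth_vfield_tangent[OF generated_smooth[OF X(1)] UNIV_I] X(2) by simp
  qed
qed

text \<open>A restricted chart is another member of the atlas, so a tangent vector has a separate
  component in it. The transition map is the identity near the point, and the components
  agree.\<close>

lemma tangent_restrict:
  assumes c: "c \<in> A" and W: "open W" "W \<subseteq> fst c" "p \<in> W" and v: "v \<in> tangent_space A p"
  shows "v (W, snd c) = v c"
proof -
  have c': "(W, snd c) \<in> A" by (rule chart_restrict_in_atlas[OF c W(1,2)])
  have pc: "p \<in> fst c" using W by blast
  have "dd (trans c (W, snd c)) (snd c p) = dd (\<lambda>x. x) (snd c p)"
    by (rule dd_local[OF chart(2)[OF c]]) (use pc chart_inv_right[OF c] in \<open>auto simp: trans_def\<close>)
  also have "\<dots> = (\<lambda>x. x)" by (rule dd_eqI[OF has_derivative_ident])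
  finally show ?thesis using tangent_change[OF v c c' pc] W(3) by simp
qed

end

subsection \<open>Fiberwise algebraic plane fields\<close>

locale vector_bundle =
  fixes AB :: "('b::{second_countable_topology, t2_space}, 'a::finite_dim_space) chart set"
    and AN :: "('e::{second_countable_topology, t2_space}, 'a \<times> 'f::finite_dim_space) chart set"
    and \<pi> :: "'e \<Rightarrow> 'b" and padd :: "'e \<Rightarrow> 'e \<Rightarrow> 'e" and pscale :: "real \<Rightarrow> 'e \<Rightarrow> 'e"
  assumes smooth_bundle: "smooth_vector_bundle AB AN \<pi> padd pscale"
begin

sublocale B: smooth_manifold AB
  using smooth_bundle by unfold_locales (simp add: smooth_vector_bundle_def)

sublocale N: smooth_manifold AN
  using smooth_bundle by unfold_locales (simp add: smooth_vector_bundle_def)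

abbreviation triv where "triv \<equiv> local_trivialization AB AN \<pi> padd pscale"

abbreviation triv_chart :: "'b set \<Rightarrow> ('b \<Rightarrow> 'a) \<Rightarrow> ('e \<Rightarrow> 'f) \<Rightarrow> ('e, 'a \<times> 'f) chart" where
  "triv_chart V \<phi> \<tau> \<equiv> (\<pi> -` V, bundle_chart \<phi> \<pi> \<tau>)"

lemma triv_exists: "\<exists>V \<phi> \<tau>. b \<in> V \<and> triv V \<phi> \<tau>"
  using smooth_bundle unfolding smooth_vector_bundle_def by blast

lemma triv_facts:
  assumes "triv V \<phi> \<tau>"
  shows "(V, \<phi>) \<in> AB" "triv_chart V \<phi> \<tau> \<in> AN" "bundle_chart \<phi> \<pi> \<tau> ` (\<pi> -` V) = \<phi> ` V \<times> UNIV" "open V" "inj_on \<phi> V"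
proof -
  show V: "(V, \<phi>) \<in> AB" and "triv_chart V \<phi> \<tau> \<in> AN" "bundle_chart \<phi> \<pi> \<tau> ` (\<pi> -` V) = \<phi> ` V \<times> UNIV"
    using assms unfolding local_trivialization_def by blast+
  show "open V" using B.chart(1)[OF V] by simp
  show "inj_on \<phi> V" using B.chart_inv_left[OF V] by (intro inj_on_inverseI[of V "chart_inv (V, \<phi>)"]) simp
qed

lemma triv_image:
  assumes t: "triv V \<phi> \<tau>" and V': "V' \<subseteq> V"
  shows "bundle_chart \<phi> \<pi> \<tau> ` (\<pi> -` V') = \<phi> ` V' \<times> UNIV"
proof
  show "bundle_chart \<phi> \<pi> \<tau> ` (\<pi> -` V') \<subseteq> \<phi> ` V' \<times> UNIV" by (auto simp: bundle_chart_def)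
  show "\<phi> ` V' \<times> UNIV \<subseteq> bundle_chart \<phi> \<pi> \<tau> ` (\<pi> -` V')"
  proof
    fix z assume z: "z \<in> \<phi> ` V' \<times> (UNIV :: 'f set)"
    then obtain b where b: "b \<in> V'" "fst z = \<phi> b" by auto
    have "z \<in> \<phi> ` V \<times> (UNIV :: 'f set)" using z V' by auto
    then obtain p where p: "p \<in> \<pi> -` V" "z = bundle_chart \<phi> \<pi> \<tau> p" using triv_facts(3)[OF t] by blast
    have "\<phi> (\<pi> p) = \<phi> b" using p(2) b(2) by (simp add: bundle_chart_def)
    then have "\<pi> p = b" using inj_onD[OF triv_facts(5)[OF t]] p(1) b(1) V' by auto
    then show "z \<in> bundle_chart \<phi> \<pi> \<tau> ` (\<pi> -` V')" using p(2) b(1) by blast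
  qed
qed

text \<open>Continuity of the projection is not among the bundle axioms; it is read off from the
  bundle charts.\<close>

lemma open_vimage_projection:
  assumes "open U"
  shows "open (\<pi> -` U)"
proof (subst open_subopen, rule ballI)
  fix p assume p: "p \<in> \<pi> -` U"
  obtain V \<phi> \<tau> where V: "\<pi> p \<in> V" and t: "triv V \<phi> \<tau>" using triv_exists[of "\<pi> p"] by (elim exE conjE)
  note f = triv_facts[OF t]
  have o: "open (\<phi> ` (V \<inter> U))"
    using B.chart_image_open[OF f(1), of "V \<inter> U"] f(4) assms by auto
  have eq: "{q \<in> \<pi> -` V. bundle_chart \<phi> \<pi> \<tau> q \<in> \<phi> ` (V \<inter> U) \<times> UNIV} = \<pi> -` (V \<inter> U)"
    using inj_onD[OF f(5)] by (fastforce simp: bundle_chart_def)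
  have "open (\<pi> -` (V \<inter> U))"
    unfolding eq[symmetric] using N.chart_preimage_open[OF f(2) open_times_UNIV[OF o]] by simp
  then show "\<exists>T. open T \<and> p \<in> T \<and> T \<subseteq> \<pi> -` U" using p V by (intro exI[of _ "\<pi> -` (V \<inter> U)"]) auto
qed

lemma triv_restrict:
  assumes t: "triv V \<phi> \<tau>" and V': "open V'" "V' \<subseteq> V"
  shows "triv V' \<phi> \<tau>"
    and "y \<in> \<phi> ` V' \<times> UNIV \<Longrightarrow> chart_inv (triv_chart V' \<phi> \<tau>) y = chart_inv (triv_chart V \<phi> \<tau>) y"
proof -
  note f = triv_facts[OF t]
  have "(V', \<phi>) \<in> AB" using B.chart_restrict_in_atlas(1)[OF f(1) V'(1)] V'(2) by simp
  moreover have o: "open (\<pi> -` V')" "\<pi> -` V' \<subseteq> fst (triv_chart V \<phi> \<tau>)"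
    using open_vimage_projection[OF V'(1)] V'(2) by auto
  have "triv_chart V' \<phi> \<tau> \<in> AN" using N.chart_restrict_in_atlas(1)[OF f(2) o] by simp
  moreover note triv_image[OF t V'(2)]
  ultimately show "triv V' \<phi> \<tau>" using t V'(2) unfolding local_trivialization_def by (simp add: subset_iff)
  show "y \<in> \<phi> ` V' \<times> UNIV \<Longrightarrow> chart_inv (triv_chart V' \<phi> \<tau>) y = chart_inv (triv_chart V \<phi> \<tau>) y"
    using N.chart_restrict_in_atlas(2)[OF f(2) o, of y] triv_image[OF t V'(2)] by simp
qed

text \<open>The definition speaks of the charts of small trivialisations only. A restricted
  trivialisation has the same components as the given one, so the polynomial form is obtained in the
  fixed chart, near each point of the base.\<close>

lemma algebraic_in_chart:
  assumes X: "fiberwise_algebraic_vfield_on AB AN \<pi> padd pscale Va X" and t: "triv V \<phi> \<tau>" and V: "V \<subseteq> Va"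
    and x: "x \<in> \<phi> ` V"
  shows "\<exists>W. open W \<and> x \<in> W \<and> W \<subseteq> \<phi> ` V \<and> FPV W (in_chart X (triv_chart V \<phi> \<tau>))"
proof -
  obtain b where b: "b \<in> V" "x = \<phi> b" using x by blast
  then have "b \<in> Va" using V by blast
  then obtain V0 where V0: "open V0" "b \<in> V0" "V0 \<subseteq> Va"
    and poly: "\<And>V' \<phi> \<tau> l. triv V' \<phi> \<tau> \<Longrightarrow> V' \<subseteq> V0 \<Longrightarrow> linear l \<Longrightarrow>
      fiber_polynomial (\<phi> ` V') (\<lambda>z. l (in_chart X (triv_chart V' \<phi> \<tau>) z))"
    using X unfolding fiberwise_algebraic_vfield_on_def by meson
  have Xs: "smooth_vfield_on AN (\<pi> -` Va) X" using X unfolding fiberwise_algebraic_vfield_on_def by blast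
  let ?V = "V \<inter> V0"
  note f = triv_facts[OF t]
  have V': "open ?V" "?V \<subseteq> V" using f(4) V0 by auto
  note t' = triv_restrict(1)[OF t V']
  have o: "open (\<phi> ` ?V)" using B.chart_image_open[OF f(1) V'(1)] by simp
  have "FPV (\<phi> ` ?V) (in_chart X (triv_chart ?V \<phi> \<tau>))"
    unfolding FPV_def using fiber_polynomial_FP[OF o poly[OF t']] by blast
  then have "FPV (\<phi> ` ?V) (in_chart X (triv_chart V \<phi> \<tau>))"
  proof (rule FPV_cong)
    fix z assume z: "z \<in> \<phi> ` ?V \<times> (UNIV :: 'f set)"
    then obtain q where q: "q \<in> \<pi> -` ?V" "z = bundle_chart \<phi> \<pi> \<tau> q" using triv_image[OF t V'(2)] by blast
    have "chart_inv (triv_chart V \<phi> \<tau>) z = q" using N.chart_inv_left[OF f(2), of q] q by simp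
    moreover have "X q (triv_chart ?V \<phi> \<tau>) = X q (triv_chart V \<phi> \<tau>)"
      using N.tangent_restrict[OF f(2) open_vimage_projection[OF V'(1)], of q "X q"]
        N.smooth_vfield_tangent[OF Xs, of q] q(1) V by auto
    ultimately show "in_chart X (triv_chart ?V \<phi> \<tau>) z = in_chart X (triv_chart V \<phi> \<tau>) z"
      unfolding in_chart_def using triv_restrict(2)[OF t V' z] by simp
  qed
  then show ?thesis using o b V0(2) by (intro exI[of _ "\<phi> ` ?V"]) auto
qed

end

text \<open>The presheaf to which division is applied, with \<open>F\<close> the chart expressions
  of the algebraic tangent fields over \<open>D\<close>. The base set \<open>W\<close> varies
  because an expression is known to be polynomial only over a neighbourhood of each point.\<close>

inductive bracket_module ::
  "'a::finite_dim_space set \<Rightarrow> ('a \<times> 'f::finite_dim_space \<Rightarrow> 'a \<times> 'f) set \<Rightarrow> 'a set \<Rightarrow> ('a \<times> 'f \<Rightarrow> 'a \<times> 'f) \<Rightarrow> bool"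
  for D F where
  bm_base: "X \<in> F \<Longrightarrow> open W \<Longrightarrow> W \<subseteq> D \<Longrightarrow> FPV W X \<Longrightarrow> bracket_module D F W X"
| bm_add: "bracket_module D F W f \<Longrightarrow> bracket_module D F W g \<Longrightarrow> bracket_module D F W (\<lambda>z. f z + g z)"
| bm_scale: "FP W q \<Longrightarrow> bracket_module D F W f \<Longrightarrow> bracket_module D F W (\<lambda>z. q z *\<^sub>R f z)"
| bm_brk: "bracket_module D F W f \<Longrightarrow> bracket_module D F W g \<Longrightarrow> bracket_module D F W (brk f g)"
| bm_subset: "bracket_module D F W f \<Longrightarrow> open W' \<Longrightarrow> W' \<subseteq> W \<Longrightarrow> bracket_module D F W' f"

lemma bracket_module_FPV: "bracket_module D F W f \<Longrightarrow> open W \<and> W \<subseteq> D \<and> FPV W f"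
proof (induction rule: bracket_module.induct)
  case (bm_brk W f g)
  then show ?case by (simp add: FPV_brk)
next
  case (bm_subset W f W')
  then show ?case using FPV_subset by blast
qed (auto intro: FPV_add FPV_scale)

lemma bracket_module_polynomial: "monomials pe pk \<Longrightarrow> polynomial_module pe pk (bracket_module D F)"
  by (intro polynomial_module.intro polynomial_module_axioms.intro)
    (use bracket_module_FPV in \<open>auto intro: bm_add bm_scale bm_subset\<close>)

context vector_bundle
begin

text \<open>Each rule that builds the module is matched by a closure property of
  \<open>extendable\<close>, and the generators start the induction because they are tangent to the
  plane field.\<close>

lemma bracket_module_extendable:
  assumes P: "plane_field AN d P" and t: "triv V \<phi> \<tau>" and c: "c = triv_chart V \<phi> \<tau>"
    and F: "\<And>f. f \<in> F \<Longrightarrow> \<exists>X. f = in_chart X c \<and> smooth_vfield_on AN (\<pi> -` V) X \<and> (\<forall>q\<in>\<pi> -` V. X q \<in> P q)"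
    and f: "bracket_module (\<phi> ` V) F W f" and x: "x \<in> W \<times> UNIV"
  shows "N.extendable (generated_distribution AN P) c x f"
  using f x
proof (induction arbitrary: x rule: bracket_module.induct)
  case (bm_base f W)
  obtain X where X: "f = in_chart X c" "smooth_vfield_on AN (\<pi> -` V) X" "\<And>q. q \<in> \<pi> -` V \<Longrightarrow> X q \<in> P q"
    using F[OF bm_base(1)] by blast
  have "x \<in> \<phi> ` V \<times> UNIV" using bm_base by auto
  then obtain p where p: "p \<in> \<pi> -` V" "x = bundle_chart \<phi> \<pi> \<tau> p" using triv_facts(3)[OF t] by blast
  have "N.extendable (generated_distribution AN P) c (snd c p) (in_chart X c)"
    by (rule N.extendable_tangent[OF P open_vimage_projection[OF triv_facts(4)[OF t]] p(1) X(2,3)])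
      (use c triv_facts(2)[OF t] p in auto)
  then show ?case using X(1) p(2) c by simp
next
  case (bm_add W f g)
  then show ?case using N.extendable_add[OF N.lie_subalgebra_generated] by blast
next
  case (bm_scale W q f)
  have o: "open W" using bracket_module_FPV[OF bm_scale(2)] by blast
  show ?case
    by (rule N.extendable_scale[OF open_times_UNIV[OF o] bm_scale.prems FP_smooth[OF o bm_scale(1)] bm_scale.IH[OF bm_scale.prems]])
next
  case (bm_brk W f g)
  have o: "open W" "W \<subseteq> \<phi> ` V" "FPV W f" "FPV W g" using bracket_module_FPV bm_brk.hyps by blast+
  show ?case
  proof (rule N.extendable_brk[OF N.lie_subalgebra_generated _ open_times_UNIV[OF o(1)] bm_brk.prems])
    show "c \<in> AN" using c triv_facts(2)[OF t] by simp
    show "W \<times> UNIV \<subseteq> snd c ` fst c" using o(2) c triv_facts(3)[OF t] by auto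
  qed (intro FPV_smooth o bm_brk.IH bm_brk.prems)+
next
  case (bm_subset W f W')
  then show ?case by blast
qed

text \<open>A basis is selected from the values at the single point \<open>q\<close>, so the fields
  chosen depend on \<open>q\<close>. Their independence near \<open>q\<close> is recovered by
  \<open>dual_frame\<close>.\<close>

lemma algebraic_frame:
  assumes P: "plane_field AN d P" and Pq: "P q = tspan {X q | X. X \<in> \<XX>}" and c: "c \<in> AN" "q \<in> fst c"
  shows "\<exists>X. (\<forall>k<d. X k \<in> \<XX>) \<and> (\<forall>a. (\<Sum>k<d. a k *\<^sub>R X k q c) = 0 \<longrightarrow> (\<forall>k<d. a k = (0::real)))"
proof -
  let ?E = "(\<lambda>v. v c) ` {X q | X. X \<in> \<XX>}"
  have "dim (span ?E) = d"
    using N.plane_field_facts(5)[OF P c] unfolding Pq tspan_image by blast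
  then have d: "dim ?E = d" by (simp add: dim_span)
  obtain B where B: "B \<subseteq> ?E" "independent B" "?E \<subseteq> span B" "card B = dim ?E"
    using basis_exists[of ?E] by blast
  have fin: "finite B" by (rule fd.finiteI_independent[OF B(2)])
  obtain e where e: "bij_betw e {..<d} B"
    using ex_bij_betw_nat_finite[OF fin] B(4) d by (auto simp: lessThan_atLeast0)
  have "\<exists>X. X \<in> \<XX> \<and> e k = X q c" if "k < d" for k
  proof -
    have "e k \<in> ?E" using bij_betwE[OF e] that B(1) by blast
    then show ?thesis by blast
  qed
  then obtain X where X: "\<And>k. k < d \<Longrightarrow> X k \<in> \<XX> \<and> e k = X k q c" by metis
  have "a k = 0" if s: "(\<Sum>k<d. a k *\<^sub>R X k q c) = 0" and k: "k < d" for a :: "nat \<Rightarrow> real" and k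
  proof -
    define a' where "a' = (\<lambda>b. a (inv_into {..<d} e b))"
    have "(\<Sum>b\<in>B. a' b *\<^sub>R b) = (\<Sum>k<d. a' (e k) *\<^sub>R e k)" by (rule sum.reindex_bij_betw[OF e, symmetric])
    also have "\<dots> = (\<Sum>k<d. a k *\<^sub>R X k q c)"
      by (rule sum.cong) (use X bij_betw_inv_into_left[OF e] in \<open>auto simp: a'_def\<close>)
    finally have z: "(\<Sum>b\<in>B. a' b *\<^sub>R b) = 0" using s by simp
    have "e k \<in> B" using bij_betwE[OF e] k by blast
    from independentD[OF B(2) fin subset_refl z this] have "a' (e k) = 0" .
    then show ?thesis using bij_betw_inv_into_left[OF e] k by (simp add: a'_def)
  qed
  then show ?thesis using X by blast
qed

theorem generically_integrable:
  assumes P: "fiberwise_algebraic_plane_field AB AN \<pi> padd pscale d P" and Q: "open Q" "Q \<noteq> {}"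
  shows "\<exists>U. open U \<and> U \<noteq> {} \<and> U \<subseteq> Q \<and> integrable_distribution_on AN (\<pi> -` U) (generated_distribution AN P)"
proof -
  have pf: "plane_field AN d P" using P unfolding fiberwise_algebraic_plane_field_def by blast
  obtain b where b: "b \<in> Q" using Q(2) by blast
  obtain Va where Va: "open Va" "b \<in> Va" and span: "\<And>p. p \<in> \<pi> -` Va \<Longrightarrow> P p = tspan {X p | X.
      fiberwise_algebraic_vfield_on AB AN \<pi> padd pscale Va X \<and> (\<forall>q\<in>\<pi> -` Va. X q \<in> P q)}"
    using P unfolding fiberwise_algebraic_plane_field_def by meson
  define \<XX> where "\<XX> = {X. fiberwise_algebraic_vfield_on AB AN \<pi> padd pscale Va X \<and> (\<forall>q\<in>\<pi> -` Va. X q \<in> P q)}"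
  have span: "P p = tspan {X p | X. X \<in> \<XX>}" if "p \<in> \<pi> -` Va" for p
    using span[OF that] unfolding \<XX>_def by simp
  obtain V1 \<phi> \<tau> where V1: "b \<in> V1" "triv V1 \<phi> \<tau>" using triv_exists[of b] by (elim exE conjE)
  define V where "V = V1 \<inter> Va \<inter> Q"
  have V: "open V" "V \<subseteq> V1" "b \<in> V" "V \<subseteq> Va" "V \<subseteq> Q"
    using triv_facts(4)[OF V1(2)] Va Q V1 b by (auto simp: V_def)
  have t: "triv V \<phi> \<tau>" by (rule triv_restrict(1)[OF V1(2) V(1,2)])
  note tf = triv_facts[OF t]
  define c where "c = triv_chart V \<phi> \<tau>"
  have c: "c \<in> AN" "fst c = \<pi> -` V" "snd c = bundle_chart \<phi> \<pi> \<tau>" using tf(2) by (simp_all add: c_def)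
  let ?D = "\<phi> ` V" and ?F = "(\<lambda>X. in_chart X c) ` \<XX>" and ?G = "generated_distribution AN P"
  have D: "open ?D" "?D \<noteq> {}" using B.chart_image_open[OF tf(1), of V] V(1,3) by auto
  obtain pe :: "'f \<Rightarrow> nat" and pk :: "'a \<times> 'f \<Rightarrow> nat" where mon: "monomials pe pk"
    using monomials_exist[where 'f='f and 'w="'a \<times> 'f"] by (elim exE)
  interpret polynomial_module pe pk "bracket_module ?D ?F"
    by (rule bracket_module_polynomial[OF mon])
  obtain W I g where W: "open W" "W \<noteq> {}" "W \<subseteq> ?D" and I: "finite I"
    and g: "\<forall>i\<in>I. bracket_module ?D ?F W (g i)"
    and gen: "\<forall>W' f. W' \<subseteq> W \<longrightarrow> bracket_module ?D ?F W' f \<longrightarrow> generated_by W' I g f"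
    using generically_finitely_generated[OF D] by (elim exE conjE)
  have gen_mod: "in_mod (W' \<times> UNIV) I g f" if W': "open W'" "W' \<subseteq> W" and f: "bracket_module ?D ?F W' f" for W' f
  proof -
    have "generated_by W' I g f" using gen W'(2) f by blast
    then obtain q where q: "\<forall>i\<in>I. FP W' (q i)" "\<forall>z\<in>W' \<times> UNIV. f z = (\<Sum>i\<in>I. q i z *\<^sub>R g i z)"
      unfolding generated_by_def by (elim exE conjE)
    show ?thesis by (rule in_modI[of I _ q]) (use q FP_smooth[OF W'(1)] in auto)
  qed
  define U where "U = {p \<in> V. \<phi> p \<in> W}"
  have U: "open U" using B.chart_preimage_open[OF tf(1) W(1)] by (simp add: U_def)
  have "U \<noteq> {}" "U \<subseteq> V" "\<phi> ` U = W" using W(2,3) by (auto simp: U_def)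
  let ?U = "\<pi> -` U"
  have oU: "open ?U" "?U \<subseteq> fst c" using open_vimage_projection[OF U] \<open>U \<subseteq> V\<close> c(2) by auto
  have img: "snd c ` ?U = W \<times> UNIV" using triv_image[OF t \<open>U \<subseteq> V\<close>] \<open>\<phi> ` U = W\<close> c(3) by simp
  have gs: "smooth_on (snd c ` ?U) (g i)" if "i \<in> I" for i
    unfolding img using bracket_module_FPV g that FPV_smooth[OF W(1)] by blast
  have inv: "in_mod (snd c ` ?U) I g (brk (g i) (g j))" if "i \<in> I" "j \<in> I" for i j
    unfolding img using g that by (intro gen_mod[OF W(1) subset_refl] bm_brk) auto
  have ext: "N.extendable ?G c x (g i)" if i: "i \<in> I" and x: "x \<in> snd c ` ?U" for i x
  proof (rule bracket_module_extendable[OF pf t c_def])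
    show "bracket_module ?D ?F W (g i)" using g i by blast
    show "x \<in> W \<times> UNIV" using x img by simp
    show "\<exists>X. f = in_chart X c \<and> smooth_vfield_on AN (\<pi> -` V) X \<and> (\<forall>q\<in>\<pi> -` V. X q \<in> P q)" if f: "f \<in> ?F" for f
    proof -
      obtain X where X: "X \<in> \<XX>" "f = in_chart X c" using f by blast
      then have "smooth_vfield_on AN (\<pi> -` Va) X" "\<forall>q\<in>\<pi> -` Va. X q \<in> P q"
        unfolding \<XX>_def fiberwise_algebraic_vfield_on_def by auto
      then show ?thesis using X(2) V(4) N.smooth_vfield_subset[of "\<pi> -` Va" X "\<pi> -` V"] by (intro exI[of _ X]) auto
    qed
  qed
  have frame: "\<exists>B Z. open B \<and> snd c p \<in> B \<and> B \<subseteq> snd c ` ?U \<and>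
      (\<forall>k<d. smooth_on B (Z k) \<and> in_mod B I g (Z k) \<and> (\<forall>q\<in>?U. snd c q \<in> B \<longrightarrow> Z k (snd c q) \<in> (\<lambda>v. v c) ` P q)) \<and>
      (\<forall>a. (\<Sum>k<d. a k *\<^sub>R Z k (snd c p)) = 0 \<longrightarrow> (\<forall>k<d. a k = (0::real)))" if p: "p \<in> ?U" for p
  proof -
    have pc: "p \<in> fst c" using p oU by blast
    have "P p = tspan {X p | X. X \<in> \<XX>}" using span[of p] p \<open>U \<subseteq> V\<close> V(4) by auto
    from algebraic_frame[OF pf this c(1) pc] obtain X where X: "\<forall>k<d. X k \<in> \<XX>"
      "\<forall>a. (\<Sum>k<d. a k *\<^sub>R X k p c) = 0 \<longrightarrow> (\<forall>k<d. a k = (0::real))" by (elim exE conjE)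
    let ?Z = "\<lambda>k. in_chart (X k) c"
    have \<phi>p: "\<phi> (\<pi> p) \<in> W" using p by (simp add: U_def)
    have "\<exists>W'. open W' \<and> \<phi> (\<pi> p) \<in> W' \<and> W' \<subseteq> ?D \<and> FPV W' (?Z k)" if "k < d" for k
      unfolding c_def by (rule algebraic_in_chart[OF _ t V(4)]) (use X(1) that \<phi>p W(3) in \<open>auto simp: \<XX>_def\<close>)
    then obtain Wk where Wk: "\<And>k. k < d \<Longrightarrow> open (Wk k) \<and> \<phi> (\<pi> p) \<in> Wk k \<and> Wk k \<subseteq> ?D \<and> FPV (Wk k) (?Z k)" by metis
    \<comment> \<open>Over \<open>W'\<close> all \<open>d\<close> frame fields are polynomial at
      once, so they belong to the module there and are combinations of the generators
      \<open>g i\<close>.\<close>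
    define W' where "W' = W \<inter> (\<Inter>k<d. Wk k)"
    have W': "open W'" "W' \<subseteq> W" "\<phi> (\<pi> p) \<in> W'" using W(1) Wk \<phi>p by (auto simp: W'_def)
    have Zp: "FPV W' (?Z k)" if "k < d" for k
      using FPV_subset[of "Wk k" "?Z k" W'] Wk[OF that] that by (auto simp: W'_def)
    have "bracket_module ?D ?F W' (?Z k)" if "k < d" for k
      using bm_base[OF _ W'(1) _ Zp[OF that], of ?F ?D] X(1) that W'(2) W(3) by blast
    then have "in_mod (W' \<times> UNIV) I g (?Z k)" if "k < d" for k using gen_mod[OF W'(1,2)] that by blast
    moreover have "smooth_on (W' \<times> UNIV) (?Z k)" if "k < d" for k by (rule FPV_smooth[OF W'(1) Zp[OF that]])
    moreover have "?Z k (snd c q) \<in> (\<lambda>v. v c) ` P q" if "k < d" and q: "q \<in> ?U" for k q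
    proof -
      have "q \<in> fst c" using q oU by blast
      moreover have "X k q \<in> P q" using X(1) that \<open>U \<subseteq> V\<close> V(4) unfolding \<XX>_def by blast
      ultimately show ?thesis by (simp add: N.in_chart_at[OF c(1)])
    qed
    moreover have "\<forall>a. (\<Sum>k<d. a k *\<^sub>R ?Z k (snd c p)) = 0 \<longrightarrow> (\<forall>k<d. a k = (0::real))"
      using X(2) by (simp add: N.in_chart_at[OF c(1) pc])
    moreover have "snd c p \<in> W' \<times> UNIV" using W'(3) by (simp add: c(3) bundle_chart_def)
    ultimately show ?thesis
      using open_times_UNIV[OF W'(1)] W'(2) unfolding img
      by (intro exI[of _ "W' \<times> UNIV"] exI[of _ ?Z] conjI) auto
  qed
  have "integrable_distribution_on AN ?U ?G"
    unfolding integrable_distribution_on_def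
  proof
    fix p assume p: "p \<in> ?U"
    show "\<exists>S. S \<subseteq> ?U \<and> p \<in> S \<and> distribution_leaf AN ?G S"
      by (intro N.distribution_leaf_exists[OF c(1) oU p I, of g] gs inv
          N.evaluation_generated_span[OF pf c(1) oU I, of g] ext frame)
  qed
  then show ?thesis using U \<open>U \<noteq> {}\<close> \<open>U \<subseteq> V\<close> V(5) by blast
qed

end

theorem mainTheorem1:
  fixes AB :: "('b::{second_countable_topology, t2_space}, 'a::finite_dim_space) chart set"
    and AN :: "('e::{second_countable_topology, t2_space}, 'a \<times> 'f::finite_dim_space) chart set"
    and \<pi> :: "'e \<Rightarrow> 'b"
    and padd :: "'e \<Rightarrow> 'e \<Rightarrow> 'e"
    and pscale :: "real \<Rightarrow> 'e \<Rightarrow> 'e"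
    and d :: nat
    and P :: "'e \<Rightarrow> ('e, 'a \<times> 'f) tvec set"
  assumes "smooth_vector_bundle AB AN \<pi> padd pscale"
    and "fiberwise_algebraic_plane_field AB AN \<pi> padd pscale d P"
  shows "\<exists>U. open U \<and> closure U = UNIV \<and>
           integrable_distribution_on AN (\<pi> -` U) (generated_distribution AN P) \<and>
           integrability_domain AN d P \<inter> \<pi> -` U =
             infinitesimal_integrability_domain AN P \<inter> \<pi> -` U"
proof -
  interpret vector_bundle AB AN \<pi> padd pscale
    by unfold_locales (rule assms(1))
  let ?G = "generated_distribution AN P"
  have pf: "plane_field AN d P" using assms(2) unfolding fiberwise_algebraic_plane_field_def by blast
  \<comment> \<open>The largest candidate: integrability asks for a leaf through each point
    separately, so it passes to unions of open sets.\<close>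
  define U where "U = \<Union> {U. open U \<and> integrable_distribution_on AN (\<pi> -` U) ?G}"
  have "open U" unfolding U_def by blast
  moreover have "closure U = UNIV"
  proof (rule ccontr)
    assume "closure U \<noteq> UNIV"
    \<comment> \<open>Over a nonempty open set missed by the union, generic integrability would
      supply a further nonempty piece that belongs to the union.\<close>
    then have "open (- closure U)" "- closure U \<noteq> {}" by auto
    from generically_integrable[OF assms(2) this] obtain U' where
      "open U'" "U' \<noteq> {}" "U' \<subseteq> - closure U" "integrable_distribution_on AN (\<pi> -` U') ?G"
      by (elim exE conjE)
    moreover from this have "U' \<subseteq> U" unfolding U_def by blast
    ultimately show False using closure_subset[of U] by blast
  qed
  moreover have int: "integrable_distribution_on AN (\<pi> -` U) ?G"
    unfolding integrable_distribution_on_def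
  proof
    fix p assume "p \<in> \<pi> -` U"
    then obtain U' where U': "\<pi> p \<in> U'" "open U'" "integrable_distribution_on AN (\<pi> -` U') ?G"
      unfolding U_def by blast
    then have "\<exists>S. S \<subseteq> \<pi> -` U' \<and> p \<in> S \<and> distribution_leaf AN ?G S"
      unfolding integrable_distribution_on_def by blast
    moreover have "\<pi> -` U' \<subseteq> \<pi> -` U" using U'(2,3) unfolding U_def by blast
    ultimately show "\<exists>S. S \<subseteq> \<pi> -` U \<and> p \<in> S \<and> distribution_leaf AN ?G S" by blast
  qed
  moreover have "p \<in> integrability_domain AN d P"
    if p: "p \<in> infinitesimal_integrability_domain AN P" "p \<in> \<pi> -` U" for p
  proof -
    obtain S where "p \<in> S" "distribution_leaf AN ?G S"
      using int p(2) unfolding integrable_distribution_on_def by blast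
    then show ?thesis using N.distribution_leaf_plane_leaf[OF pf] p(1) by blast
  qed
  then have "integrability_domain AN d P \<inter> \<pi> -` U = infinitesimal_integrability_domain AN P \<inter> \<pi> -` U"
    using N.integrability_domain_subset[OF pf] by blast
  ultimately show ?thesis by (intro exI[of _ U] conjI)
qed

end
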